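(* Let $m\ge1$. (a) If $\emptyset\ne I\subsetneq M_-$, then $\mathcal L(\widehat{(\mathcal C_{\star I})})\in\mathcal L_-$, the eigenvalues of $\sigma$ on $\mathcal L(\widehat{(\mathcal C_{\star I})})/\mathrm{BW}_{2m}$ are exactly the elements of $\bigcup_{k\in I}\Theta_k$, and $\log_2\det\mathcal L(\widehat{(\mathcal C_{\star I})})=2^{2m-1}-4\sum_{k\in I}\binom{2m}{k}$. If $m-1\notin I$, then $\min\mathcal L(\widehat{(\mathcal C_{\star I})})=\min(\mathrm{BW}_{2m})=2^m$. (b) If $\emptyset\ne J\subsetneq M_+$ with $m\in J$, then $\mathcal L(\widehat{(\mathcal C_{\star J})})\in\mathcal L_+$, the eigenvalues of $\sigma$ on $\mathcal L(\widehat{(\mathcal C_{\star J})})/2\mathrm{BW}_{2m}^{\#}$ are exactly the elements of $\bigcup_{k\in J}\Theta_k$, and $\log_2\det\mathcal L(\widehat{(\mathcal C_{\star J})})=2^{2m-1}+4\sum_{k\in M_+\setminus J}\binom{2m}{k}$. (c) If $\emptyset\ne J\subsetneq M_+$ with $m\notin J$, then $2\mathcal L(\widehat{(\mathcal C_{\star J})})\in\mathcal L_+$, the eigenvalues of $\sigma$ on $2\mathcal L(\widehat{(\mathcal C_{\star J})})/2\mathrm{BW}_{2m}^{\#}$ are exactly the elements of $\bigcup_{k\in J}\Theta_k$, and $\log_2\det\big(2\mathcal L(\widehat{(\mathcal C_{\star J})})\big)=2^{2m-1}+4\sum_{k\in M_+\setminus J,\,k\ne m}\binom{2m}{k}+2\binom{2m}{m}$.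 If moreover $m-2\notin J$, then $\min\big(2\mathcal L(\widehat{(\mathcal C_{\star J})})\big)=\min(2\mathrm{BW}_{2m}^{\#})=2^{m+1}$.
   Context: Fix $m\ge1$, $n=4^m-1$. $\mathcal V=\mathbb F_{4^m}$ as $\mathbb F_2$-space, $\zeta$ a primitive element, $\sigma$ multiplication by $\zeta$. Orthogonal basis $(b_v)_{v\in\mathcal V}$ of $\mathbb R^{4^m}$, $(b_v,b_v)=2^{-m}$, $\Omega=\bigoplus\mathbb Zb_v$; $\sigma$ acts by $b_v\mapsto b_{\sigma(v)}$. Fix an $\mathbb F_2$-basis $v_1,\dots,v_{2m}$ of $\mathcal V$, $\mathcal T_r$ = subspaces spanned by exactly $r$ of the $v_i$. $\mathrm{BW}_{2m}=\langle 2^{\lfloor(2m-r+1)/2\rfloor}\sum_{v\in U}b_v:U\in\mathcal T_r,0\le r\le2m\rangle_{\mathbb Z}$ (Barnes–Wall lattice), $\mathrm{BW}^{\#}_{2m}$ its dual; $\det$ is the Gram determinant, $\min(L)=\min\{(x,x):0\ne x\in L\}$. Eigenvalues of $\sigma$ on an $\mathbb F_2$-quotient of $\sigma$-invariant lattices are roots in $\overline{\mathbb F}_2$ of its characteristic polynomial. $\mathcal L_+$: $\sigma$-invariant $\Gamma$ with $2\mathrm{BW}^{\#}_{2m}\subseteq\Gamma\subseteq\mathrm{BW}_{2m}$ on whose quotient by $2\mathrm{BW}^\#_{2m}$ the eigenvalue 1 of $\sigma$ has multiplicity $0$ or $2$; $\mathcal L_-$: $\sigma$-invariant $\Lambda$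 with $\mathrm{BW}_{2m}\subseteq\Lambda\subseteq\mathrm{BW}^\#_{2m}$. For $0\le u\le n$ write $u=\sum_{i=0}^{2m-1}u_i2^i$, $\mathrm{wt}_2(u)=\sum u_i$, $O(u)=\#\{i<m:u_{2i+1}=1\}$, $E(u)=\#\{i<m:u_{2i}=1\}$; $M_+=\{0\le k\le m:m-k\text{ even}\}$, $M_-=\{0\le k\le m:m-k\text{ odd}\}$, $M_r=M_+$ for $r$ even and $M_-$ for $r$ odd; $\Theta_k=\{\zeta^u:0\le u\le n,|O(u)-E(u)|=m-k\}$, $\Theta^{(r)}_k=\{\zeta^u\in\Theta_k:\mathrm{wt}_2(u)=2m-r\}$, $Z_{r-1}=\{\zeta^u:0<u\le n,\mathrm{wt}_2(u)\le2m-r\}$. Identify $c\in\mathbb F_2^{\mathcal V\setminus\{0\}}$ with $(c(\zeta^i))_{0\le i<n}$; the cyclic code with zero set $Z$ is $\{c:\sum_ic(\zeta^i)z^i=0\ \forall z\in Z\}$, extended to $\mathbb F_2^{\mathcal V}$ by $c(0)=\sum_{v\ne0}c(v)$. For $0\le r<2m$, $I\subseteq M_r$: $\mathcal C(r,I,2m)$ = extended code of the cyclic code with zero set $Z_{r-1}\setminus\bigcup_{k\in I}\Theta^{(r)}_k$; $\mathcal C(2m,I,2m)$ = even-weight code if $m\notin I$, $\mathbb F_2^{\mathcal V}$ otherwise. Chains: $(\mathcal C_{\star I})$: $\mathcal C(1,I,2m)\subseteq\mathcal C(3,I,2m)\subseteq\cdots\subseteq\mathcal C(2m-1,I,2m)$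 for $I\subseteq M_-$; $(\mathcal C_{\star J})$: $\mathcal C(0,J,2m)\subseteq\mathcal C(2,J,2m)\subseteq\cdots\subseteq\mathcal C(2m-2,J,2m)$ if $m\in J\subseteq M_+$, and $\mathcal C(2,J,2m)\subseteq\cdots\subseteq\mathcal C(2m,J,2m)$ if $m\notin J\subseteq M_+$. For such a chain $\mathcal C_0\subseteq\dots\subseteq\mathcal C_{m-1}$, let $g_j$ be the monic generator polynomial (dividing $X^n-1$) of the cyclic code obtained by deleting coordinate $0$ from $\mathcal C_j$ (words $c\leftrightarrow\sum_ic(\zeta^i)X^i$), $G_j$ the unique monic divisor of $X^n-1$ in $(\mathbb Z/2^m\mathbb Z)[X]$ with $G_j\equiv g_j\pmod 2$; the lift $\widehat{(\mathcal C_\star)}\subseteq(\mathbb Z/2^m\mathbb Z)^{\mathcal V}$ is the extended code ($c(0)=-\sum_{v\ne0}c(v)$) of the ideal $(2^jG_j:0\le j<m)$ of $(\mathbb Z/2^m\mathbb Z)[X]/(X^n-1)$, and $\mathcal L(\widehat{(\mathcal C_\star)})=\{\sum a_vb_v\in\Omega:(a_v+2^m\mathbb Z)_v\in\widehat{(\mathcal C_\star)}\}$. *)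

theory Defs
  imports
    "HOL-Analysis.Analysis"
    "HOL-Library.Z2"
    "HOL-Algebra.Algebraic_Closure_Type"
    "Jordan_Normal_Form.Char_Poly"
    "Berlekamp_Zassenhaus.Finite_Field"
begin

text \<open>
  The field with \<open>4 ^ m\<close> elements is a type \<open>'f\<close> of sort \<open>{field, finite}\<close> with
  \<open>CARD('f) = 4 ^ m\<close>; the Euclidean space of dimension \<open>4 ^ m\<close> is \<open>'f euclid\<close>; the prime field
  is \<^typ>\<open>bit\<close>; and the ring of integers modulo \<open>2 ^ m\<close> is \<open>'r mod_ring\<close> for a type \<open>'r\<close> with
  \<open>CARD('r) = 2 ^ m\<close>.
\<close>

text \<open>This is \<open>real ^ 'n\<close>, written so that the index may carry a larger sort.\<close>

type_synonym 'n euclid = "(real, 'n) Finite_Cartesian_Product.vec"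

section \<open>The field as a vector space over its prime field\<close>

text \<open>The inclusion of the prime field; it is a ring homomorphism whenever \<open>2 = 0\<close> in the target.
  For a real target it picks the representatives 0 and 1.\<close>

definition f2_emb :: "bit \<Rightarrow> 'a::zero_neq_one" where
  "f2_emb c = (if c = 0 then 0 else 1)"

definition f2_scale :: "bit \<Rightarrow> 'f::field \<Rightarrow> 'f" where
  "f2_scale c x = f2_emb c * x"

lemma two_eq_0_if_card_4_pow:
  assumes "CARD('f::{field,finite}) = 4 ^ m"
  shows "(2::'f) = 0"
proof -
  have "CHAR('f) dvd CARD('f)"
    by (rule CHAR_dvd_CARD)
  then have "of_nat (4 ^ m) = (0::'f)"
    unfolding assms by (rule of_nat_eq_0_iff_char_dvd[THEN iffD2])
  then have "(4::'f) ^ m = 0"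
    by (metis of_nat_numeral of_nat_power)
  then have "(4::'f) = 0"
    by (rule power_eq_0_iff[THEN iffD1, THEN conjunct1])
  moreover have "(4::'f) = 2 * 2"
    by simp
  ultimately show ?thesis
    by (metis mult_eq_0_iff)
qed

lemma module_f2_scale:
  assumes "CARD('f::{field,finite}) = 4 ^ m"
  shows "Modules.module (f2_scale :: bit \<Rightarrow> 'f \<Rightarrow> 'f)"
proof
  fix a b :: bit and x y :: 'f
  have 2: "x + x = 0"
    using two_eq_0_if_card_4_pow[OF assms] by (metis mult_2 mult_zero_left)
  show "f2_scale a (x + y) = f2_scale a x + f2_scale a y"
    by (simp add: f2_scale_def algebra_simps)
  show "f2_scale (a + b) x = f2_scale a x + f2_scale b x"
    using 2 by (cases a; cases b) (simp_all add: f2_scale_def f2_emb_def)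
  show "f2_scale a (f2_scale b x) = f2_scale (a * b) x"
    by (simp add: f2_scale_def f2_emb_def)
  show "f2_scale 1 x = x"
    by (simp add: f2_scale_def f2_emb_def)
qed

definition f2_basis :: "nat \<Rightarrow> (nat \<Rightarrow> 'f::field) \<Rightarrow> bool" where
  "f2_basis d B \<longleftrightarrow> inj_on B {1..d} \<and> \<not> Modules.module.dependent f2_scale (B ` {1..d}) \<and>
     Modules.module.span f2_scale (B ` {1..d}) = UNIV"

definition primitive_element :: "'f::field \<Rightarrow> bool" where
  "primitive_element \<zeta> \<longleftrightarrow> \<zeta> \<noteq> 0 \<and> (\<forall>x. x \<noteq> 0 \<longrightarrow> (\<exists>i::nat. x = \<zeta> ^ i))"

section \<open>Lattices\<close>

definition int_scale :: "int \<Rightarrow> 'a::real_vector \<Rightarrow> 'a" where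
  "int_scale k x = of_int k *\<^sub>R x"

lemma module_int_scale: "Modules.module int_scale"
  by unfold_locales (simp_all add: int_scale_def algebra_simps)

definition dual_lattice :: "'a::real_inner set \<Rightarrow> 'a set" where
  "dual_lattice L = {x \<in> Real_Vector_Spaces.span L. \<forall>y\<in>L. x \<bullet> y \<in> \<int>}"

text \<open>Bases and determinants are only needed for lattices of full rank.\<close>

definition lattice_basis :: "('n::finite \<Rightarrow> 'n euclid) \<Rightarrow> 'n euclid set \<Rightarrow> bool" where
  "lattice_basis C L \<longleftrightarrow> inj C \<and> Real_Vector_Spaces.independent (range C) \<and>
     Modules.module.span int_scale (range C) = L"

definition lattice_det :: "'n::finite euclid set \<Rightarrow> real" where
  "lattice_det L = (THE d. \<exists>C. lattice_basis C L \<and> d = Determinants.det (\<chi> i j. C i \<bullet> C j))"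

definition lattice_min :: "'a::real_inner set \<Rightarrow> real" where
  "lattice_min L = (LEAST t. \<exists>x\<in>L. x \<noteq> 0 \<and> t = x \<bullet> x)"

definition coordinate_subspaces :: "nat \<Rightarrow> (nat \<Rightarrow> 'f::field) \<Rightarrow> nat \<Rightarrow> 'f set set" where
  "coordinate_subspaces m B r =
     {Modules.module.span f2_scale (B ` S) | S. S \<subseteq> {1..2 * m} \<and> card S = r}"

definition barnes_wall :: "nat \<Rightarrow> (nat \<Rightarrow> 'f::{field,finite}) \<Rightarrow> ('f \<Rightarrow> 'f euclid) \<Rightarrow> 'f euclid set" where
  "barnes_wall m B b = Modules.module.span int_scale
     {2 ^ ((2 * m - r + 1) div 2) *\<^sub>R (\<Sum>v\<in>U. b v) | r U.
        r \<le> 2 * m \<and> U \<in> coordinate_subspaces m B r}"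

section \<open>Eigenvalues on elementary abelian quotients\<close>

text \<open>\<open>xs\<close> lists representatives of a basis of the \<^typ>\<open>bit\<close>-vector space \<open>\<Gamma> / \<Delta>\<close>.\<close>

definition quotient_basis :: "'a::real_vector set \<Rightarrow> 'a set \<Rightarrow> 'a list \<Rightarrow> bool" where
  "quotient_basis \<Gamma> \<Delta> xs \<longleftrightarrow>
     \<Delta> \<subseteq> \<Gamma> \<and> (\<forall>x\<in>\<Gamma>. 2 *\<^sub>R x \<in> \<Delta>) \<and> set xs \<subseteq> \<Gamma> \<and>
     (\<forall>x\<in>\<Gamma>. \<exists>!c. c \<in> carrier_vec (length xs) \<and>
        x - (\<Sum>i<length xs. f2_emb (vec_index c i) *\<^sub>R xs ! i) \<in> \<Delta>)"

definition quotient_matrix ::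
  "('a::real_vector \<Rightarrow> 'a) \<Rightarrow> 'a set \<Rightarrow> 'a list \<Rightarrow> bit mat \<Rightarrow> bool" where
  "quotient_matrix \<sigma> \<Delta> xs A \<longleftrightarrow> A \<in> carrier_mat (length xs) (length xs) \<and>
     (\<forall>j<length xs. \<sigma> (xs ! j) - (\<Sum>i<length xs. f2_emb (A $$ (i, j)) *\<^sub>R xs ! i) \<in> \<Delta>)"

definition quotient_char_poly :: "('a::real_vector \<Rightarrow> 'a) \<Rightarrow> 'a set \<Rightarrow> 'a set \<Rightarrow> bit poly" where
  "quotient_char_poly \<sigma> \<Gamma> \<Delta> =
     (THE p. \<exists>xs A. quotient_basis \<Gamma> \<Delta> xs \<and> quotient_matrix \<sigma> \<Delta> xs A \<and> p = char_poly A)"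

text \<open>Roots are taken in \<open>'f alg_closure\<close>: as \<open>'f\<close> is finite of characteristic 2, this is an
  algebraic closure of \<^typ>\<open>bit\<close>, and it contains \<open>'f\<close> through \<^const>\<open>to_ac\<close>.\<close>

definition quotient_eigenvalues ::
  "('f::{field,finite} euclid \<Rightarrow> 'f euclid) \<Rightarrow> 'f euclid set \<Rightarrow> 'f euclid set \<Rightarrow> 'f alg_closure set" where
  "quotient_eigenvalues \<sigma> \<Gamma> \<Delta> = {x. poly (map_poly f2_emb (quotient_char_poly \<sigma> \<Gamma> \<Delta>)) x = 0}"

definition eigenvalue_multiplicity ::
  "('f::{field,finite} euclid \<Rightarrow> 'f euclid) \<Rightarrow> 'f euclid set \<Rightarrow> 'f euclid set \<Rightarrow> 'f alg_closure \<Rightarrow> nat" where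
  "eigenvalue_multiplicity \<sigma> \<Gamma> \<Delta> x = Polynomial.order x (map_poly f2_emb (quotient_char_poly \<sigma> \<Gamma> \<Delta>))"

text \<open>In the following two definitions the argument \<open>W\<close> stands for the Barnes--Wall lattice.\<close>

definition L_plus ::
  "('f::{field,finite} euclid \<Rightarrow> 'f euclid) \<Rightarrow> 'f euclid set \<Rightarrow> 'f euclid set set" where
  "L_plus \<sigma> W = {\<Gamma>. Modules.module.subspace int_scale \<Gamma> \<and> \<sigma> ` \<Gamma> \<subseteq> \<Gamma> \<and>
     (*\<^sub>R) 2 ` dual_lattice W \<subseteq> \<Gamma> \<and> \<Gamma> \<subseteq> W \<and>
     eigenvalue_multiplicity \<sigma> \<Gamma> ((*\<^sub>R) 2 ` dual_lattice W) 1 \<in> {0, 2}}"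

definition L_minus ::
  "('f::{field,finite} euclid \<Rightarrow> 'f euclid) \<Rightarrow> 'f euclid set \<Rightarrow> 'f euclid set set" where
  "L_minus \<sigma> W = {\<Lambda>. Modules.module.subspace int_scale \<Lambda> \<and> \<sigma> ` \<Lambda> \<subseteq> \<Lambda> \<and>
     W \<subseteq> \<Lambda> \<and> \<Lambda> \<subseteq> dual_lattice W}"

section \<open>Exponent sets\<close>

definition wt2 :: "nat \<Rightarrow> nat \<Rightarrow> nat" where
  "wt2 m u = (\<Sum>i<2 * m. of_bool (bit u i))"

definition odd_ones :: "nat \<Rightarrow> nat \<Rightarrow> nat" where
  "odd_ones m u = card {i. i < m \<and> bit u (2 * i + 1)}"

definition even_ones :: "nat \<Rightarrow> nat \<Rightarrow> nat" where
  "even_ones m u = card {i. i < m \<and> bit u (2 * i)}"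

definition M_plus :: "nat \<Rightarrow> nat set" where
  "M_plus m = {k. k \<le> m \<and> even (m - k)}"

definition M_minus :: "nat \<Rightarrow> nat set" where
  "M_minus m = {k. k \<le> m \<and> odd (m - k)}"

definition Theta :: "nat \<Rightarrow> 'f::field \<Rightarrow> nat \<Rightarrow> 'f set" where
  "Theta m \<zeta> k = {\<zeta> ^ u | u. u \<le> 4 ^ m - 1 \<and>
     \<bar>int (odd_ones m u) - int (even_ones m u)\<bar> = int m - int k}"

text \<open>The exponents 0 and \<open>4 ^ m - 1\<close> denote the same element but have different weights, so the
  weight condition has to be imposed on the exponent.\<close>

definition Theta_wt :: "nat \<Rightarrow> 'f::field \<Rightarrow> nat \<Rightarrow> nat \<Rightarrow> 'f set" where
  "Theta_wt m \<zeta> r k = {\<zeta> ^ u | u. u \<le> 4 ^ m - 1 \<and>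
     \<bar>int (odd_ones m u) - int (even_ones m u)\<bar> = int m - int k \<and> wt2 m u = 2 * m - r}"

text \<open>\<open>Z_pred m \<zeta> r\<close> is the set with subscript \<open>r - 1\<close>; the shift keeps \<open>r = 0\<close> meaningful.\<close>

definition Z_pred :: "nat \<Rightarrow> 'f::field \<Rightarrow> nat \<Rightarrow> 'f set" where
  "Z_pred m \<zeta> r = {\<zeta> ^ u | u. 0 < u \<and> u \<le> 4 ^ m - 1 \<and> wt2 m u \<le> 2 * m - r}"

section \<open>Cyclic codes and their lifts\<close>

text \<open>Words indexed by the nonzero elements of \<open>'f\<close> are represented by functions on all of \<open>'f\<close>
  whose value at 0 is disregarded; \<open>extended_code\<close> prescribes that value. Correspondingly,
  \<open>word_poly\<close> depends only on the word obtained by deleting the coordinate 0.\<close>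

definition word_poly :: "nat \<Rightarrow> 'f::field \<Rightarrow> ('f \<Rightarrow> 'a::comm_ring_1) \<Rightarrow> 'a poly" where
  "word_poly m \<zeta> c = (\<Sum>i<4 ^ m - 1. Polynomial.monom (c (\<zeta> ^ i)) i)"

definition cyclic_code :: "nat \<Rightarrow> 'f::field \<Rightarrow> 'f set \<Rightarrow> ('f \<Rightarrow> bit) set" where
  "cyclic_code m \<zeta> Z = {c. \<forall>z\<in>Z. (\<Sum>i<4 ^ m - 1. f2_emb (c (\<zeta> ^ i)) * z ^ i) = 0}"

text \<open>Over \<^typ>\<open>bit\<close> the sign is immaterial.\<close>

definition extended_code :: "('f::{field,finite} \<Rightarrow> 'a::comm_ring_1) set \<Rightarrow> ('f \<Rightarrow> 'a) set" where
  "extended_code C = {c \<in> C. c 0 = - (\<Sum>v | v \<noteq> 0. c v)}"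

definition bw_code :: "nat \<Rightarrow> 'f::{field,finite} \<Rightarrow> nat \<Rightarrow> nat set \<Rightarrow> ('f \<Rightarrow> bit) set" where
  "bw_code m \<zeta> r I =
     (if r < 2 * m then extended_code (cyclic_code m \<zeta> (Z_pred m \<zeta> r - (\<Union>k\<in>I. Theta_wt m \<zeta> r k)))
      else if m \<notin> I then {c. even (card {v. c v \<noteq> 0})}
      else UNIV)"

definition chain_minus :: "nat \<Rightarrow> 'f::{field,finite} \<Rightarrow> nat set \<Rightarrow> nat \<Rightarrow> ('f \<Rightarrow> bit) set" where
  "chain_minus m \<zeta> I j = bw_code m \<zeta> (2 * j + 1) I"

definition chain_plus :: "nat \<Rightarrow> 'f::{field,finite} \<Rightarrow> nat set \<Rightarrow> nat \<Rightarrow> ('f \<Rightarrow> bit) set" where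
  "chain_plus m \<zeta> J j = (if m \<in> J then bw_code m \<zeta> (2 * j) J else bw_code m \<zeta> (2 * j + 2) J)"

definition X_n_minus_1 :: "nat \<Rightarrow> 'a::comm_ring_1 poly" where
  "X_n_minus_1 m = Polynomial.monom 1 (4 ^ m - 1) - 1"

text \<open>Residue classes modulo \<open>X ^ n - 1\<close> are represented by polynomials of degree less than \<open>n\<close>.\<close>

definition generator_poly :: "nat \<Rightarrow> 'f::field \<Rightarrow> ('f \<Rightarrow> bit) set \<Rightarrow> bit poly" where
  "generator_poly m \<zeta> C = (THE g. Polynomial.lead_coeff g = 1 \<and> g dvd X_n_minus_1 m \<and>
     word_poly m \<zeta> ` C = {p. Polynomial.degree p < 4 ^ m - 1 \<and> g dvd p})"

text \<open>For even \<open>CARD('r)\<close>, \<open>reduce_mod_2\<close> is the canonical ring homomorphism.\<close>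

definition reduce_mod_2 :: "'r::nontriv mod_ring \<Rightarrow> bit" where
  "reduce_mod_2 x = of_int (to_int_mod_ring x)"

definition lifted_poly :: "nat \<Rightarrow> bit poly \<Rightarrow> 'r::nontriv mod_ring poly" where
  "lifted_poly m g =
     (THE G. Polynomial.lead_coeff G = 1 \<and> G dvd X_n_minus_1 m \<and> map_poly reduce_mod_2 G = g)"

text \<open>In a commutative ring, the ideal generated by a set is its span with respect to
  multiplication. An ideal of a quotient ring is given by its preimage, which is why
  \<open>X ^ n - 1\<close> is among the generators.\<close>

lemma module_mult: "Modules.module ((*) :: 'a::comm_ring_1 \<Rightarrow> 'a \<Rightarrow> 'a)"
  by standard (simp_all add: algebra_simps)

definition lifted_code ::
  "nat \<Rightarrow> 'f::{field,finite} \<Rightarrow> (nat \<Rightarrow> ('f \<Rightarrow> bit) set) \<Rightarrow> ('f \<Rightarrow> 'r::nontriv mod_ring) set" where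
  "lifted_code m \<zeta> C = extended_code {c. word_poly m \<zeta> c \<in> Modules.module.span (*)
     (insert (X_n_minus_1 m)
       {Polynomial.smult (2 ^ j) (lifted_poly m (generator_poly m \<zeta> (C j))) | j. j < m})}"

definition code_lattice ::
  "('f::finite \<Rightarrow> 'f euclid) \<Rightarrow> ('f \<Rightarrow> 'r::nontriv mod_ring) set \<Rightarrow> 'f euclid set" where
  "code_lattice b C = {(\<Sum>v\<in>UNIV. of_int (a v) *\<^sub>R b v) | a. (\<lambda>v. of_int (a v)) \<in> C}"

end

theory Submission imports Defs
begin

text \<open>
  Write lattice vectors as functions \<open>a\<close> from the field to the integers. The shift by \<open>\<zeta>\<close> makes them
  a module over \<open>\<int>[X]\<close>, and as \<open>n = 4 ^ m - 1\<close> is odd, every set \<open>N\<close> of exponents that is closed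
  under doubling modulo \<open>n\<close> has an idempotent \<open>e\<^sub>N\<close> modulo \<open>2 ^ m\<close>. By Hensel lifting, the
  lattice of the lift of a chain of codes with exponent sets \<open>N\<^sub>0 \<supseteq> N\<^sub>1 \<supseteq> \<dots>\<close> consists of the \<open>a\<close> with
  \<open>2 ^ m\<close> dividing \<open>\<Sum> a\<close> and \<open>2 ^ (j + 1)\<close> dividing \<open>e\<^sub>N a\<close> for \<open>N = N\<^sub>j\<close>.

  The Barnes--Wall lattice and its dual are of this form too. In terms of monomials in the coordinates
  with respect to the given basis they are defined by divisibility of the coefficients; the two
  descriptions are compared by means of a 2-adic refinement of the degree filtration of Reed--Muller
  codes, which the idempotents respect.

  The quotient of two such lattices is cyclic with generator \<open>\<Sum> 2 ^ j e\<^sub>j\<^sup>2 \<delta>\<^sub>1\<close>, where \<open>e\<^sub>j\<close> belongs to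
  the exponents in which the lattices differ at level \<open>j\<close>, so \<open>\<sigma>\<close> acts on it by a companion
  matrix with the roots \<open>\<zeta> ^ u\<close> for these \<open>u\<close>. This yields the eigenvalues and the index. Minima are
  bounded by the BCH bound applied to the odd part of a vector.
\<close>

section \<open>Functions as polynomials in the coordinates\<close>

text \<open>Two obstacles shape the argument. The coordinate subspaces that generate the
  Barnes--Wall lattice are not permuted by \<sigma>; and a linear form modulo 2, taken with values 0
  and 1, is not a linear polynomial over the integers: its monomials of degree e have coefficients
  divisible by 2^(e-1). Measuring degree 2-adically, a factor 2 paying for one degree, absorbs
  exactly these coefficients and gives a filtration stable under linear substitutions. The lattices
  of the lifts, the Barnes--Wall lattice and its dual all contain 2^m \<Omega>, so congruences
  modulo 2^m suffice for them. Twice the dual does not contain it; there the coordinate sum counts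
  modulo 2^(m+1), and the idempotents in the generator of the quotient are squared to control that
  sum. The eigenvalue 1 belongs to both exponents 0 and n. Idempotents are used for 0 < u < n only;
  the trivial part is governed by the coordinate at 0 and the coordinate sum. In case (b) it
  contributes two fixed basis vectors, the constant 1 and 2^m at 0, hence the multiplicity
  2.\<close>

locale f2_coordinates =
  fixes m :: nat and B :: "nat \<Rightarrow> 'f::{field,finite}"
  assumes card_f: "CARD('f) = 4 ^ m" and B: "f2_basis (2 * m) B"
begin

definition idx :: "nat set" where "idx = {1..2 * m}"

lemma finite_idx [simp]: "finite idx" and card_idx [simp]: "card idx = 2 * m"
  by (simp_all add: idx_def)

definition pt :: "nat set \<Rightarrow> 'f" where "pt S = (\<Sum>i\<in>S. B i)"

definition supp :: "'f \<Rightarrow> nat set" where "supp v = inv_into (Pow idx) pt v"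

definition mon :: "nat set \<Rightarrow> 'f \<Rightarrow> 'a::comm_ring_1" where
  "mon S v = of_bool (S \<subseteq> supp v)"

text \<open>The coefficient at the monomial \<open>mon S\<close>, by inclusion-exclusion.\<close>

definition mob :: "('f \<Rightarrow> 'a::comm_ring_1) \<Rightarrow> nat set \<Rightarrow> 'a" where
  "mob f S = (\<Sum>T\<in>Pow S. (-1) ^ card (S - T) * f (pt T))"

text \<open>Functions of 2-adic degree at most \<open>d\<close>. In characteristic 2 the divisibility condition says
  that all coefficients of monomials of degree more than \<open>d\<close> vanish, so this is a Reed--Muller
  code; over the integers a monomial of degree \<open>d + e\<close> is admitted at the price of a factor
  \<open>2 ^ e\<close>.\<close>

definition deg_le :: "nat \<Rightarrow> ('f \<Rightarrow> 'a::comm_ring_1) set" where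
  "deg_le d = {f. \<forall>S\<subseteq>idx. 2 ^ (card S - d) dvd mob f S}"

section \<open>Points of the field as sets of coordinate indices\<close>

lemma two_eq_0: "(2::'f) = 0"
  using two_eq_0_if_card_4_pow[OF card_f] .

lemma add_self [simp]: "(x::'f) + x = 0"
  by (metis mult_2 mult_zero_left two_eq_0)

lemma minus_self [simp]: "- (x::'f) = x"
  by (metis add_self minus_unique)

lemma span_f2_scale_image:
  assumes "S \<subseteq> idx"
  shows "Modules.module.span f2_scale (B ` S) = pt ` Pow S"
proof -
  interpret f2: Modules.module "f2_scale :: bit \<Rightarrow> 'f \<Rightarrow> 'f"
    by (rule module_f2_scale[OF card_f])
  have inj: "inj_on B S"
    using B assms by (auto simp: f2_basis_def idx_def intro: inj_on_subset)
  have fin: "finite S"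
    using assms finite_subset[OF _ finite_idx] by blast
  show ?thesis
  proof (intro equalityI subsetI)
    fix v assume "v \<in> f2.span (B ` S)"
    then obtain u where "v = (\<Sum>w\<in>B ` S. f2_scale (u w) w)"
      using fin by (auto simp: f2.span_finite)
    also have "\<dots> = (\<Sum>i\<in>S. f2_scale (u (B i)) (B i))"
      by (simp add: sum.reindex inj o_def)
    also have "\<dots> = (\<Sum>i\<in>S. if u (B i) \<noteq> 0 then B i else 0)"
      by (rule sum.cong) (auto simp: f2_scale_def f2_emb_def)
    also have "\<dots> = pt {i\<in>S. u (B i) \<noteq> 0}"
      by (simp add: pt_def sum.If_cases fin Int_def)
    finally show "v \<in> pt ` Pow S"
      by auto
  next
    fix v assume "v \<in> pt ` Pow S"
    then show "v \<in> f2.span (B ` S)"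
      by (auto simp: pt_def intro!: f2.span_sum intro: f2.span_base)
  qed
qed

text \<open>Subset sums cover the field because \<open>B\<close> spans it, and there are as many
  subsets as elements; injectivity comes from counting.\<close>

lemma bij_pt: "bij_betw pt (Pow idx) UNIV"
proof -
  have "pt ` Pow idx = UNIV"
    using span_f2_scale_image[of idx] B by (simp add: f2_basis_def idx_def)
  moreover have "card (Pow idx) = card (UNIV :: 'f set)"
    by (simp add: card_f card_Pow power_mult)
  ultimately show ?thesis
    by (auto simp: bij_betw_def intro: eq_card_imp_inj_on)
qed

lemma supp_pt [simp]: "S \<subseteq> idx \<Longrightarrow> supp (pt S) = S"
  using bij_pt by (auto simp: supp_def bij_betw_def inv_into_f_f)

lemma pt_supp [simp]: "pt (supp v) = v"
  using bij_pt unfolding supp_def bij_betw_def by (metis UNIV_I f_inv_into_f)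

lemma supp_subset: "supp v \<subseteq> idx"
  using bij_pt unfolding supp_def bij_betw_def by (metis UNIV_I inv_into_into PowD)

lemma finite_supp [simp]: "finite (supp v)"
  using supp_subset finite_subset[OF _ finite_idx] by blast

lemma pt_empty [simp]: "pt {} = 0"
  by (simp add: pt_def)

lemma sum_over_pt: "(\<Sum>v\<in>UNIV. f v) = (\<Sum>S\<in>Pow idx. f (pt S))"
  using sum.reindex_bij_betw[OF bij_pt] by (metis (no_types))

lemma pt_sym_diff:
  assumes "finite S" "finite T"
  shows "pt S + pt T = pt (sym_diff S T)"
proof -
  have "pt S = pt (S - T) + pt (S \<inter> T)"
    unfolding pt_def using assms by (metis Diff_Diff_Int Diff_subset add.commute sum.subset_diff inf_le1)
  moreover have "pt T = pt (T - S) + pt (S \<inter> T)"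
    unfolding pt_def using assms
    by (metis Diff_Diff_Int Diff_subset Int_commute add.commute sum.subset_diff)
  ultimately have "pt S + pt T = pt (S - T) + pt (T - S) + (pt (S \<inter> T) + pt (S \<inter> T))"
    by (simp only: ac_simps)
  also have "\<dots> = pt (sym_diff S T)"
    unfolding add_self pt_def using assms by (subst sum.union_disjoint) auto
  finally show ?thesis .
qed

text \<open>Membership of an index in the support is thus additive modulo 2, which makes
  \<open>mon {i}\<close> a linear functional with values 0 and 1.\<close>

lemma supp_add: "supp (v + w) = sym_diff (supp v) (supp w)"
proof -
  have "v + w = pt (sym_diff (supp v) (supp w))"
    using pt_sym_diff[of "supp v" "supp w"] by simp
  then show ?thesis
    using supp_subset[of v] supp_subset[of w] supp_pt by (metis Diff_subset Un_least order_trans)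
qed

section \<open>Moebius inversion and expansion in monomials\<close>

lemma mob_unique:
  fixes f :: "'f \<Rightarrow> 'a::comm_ring_1"
  assumes c: "\<And>S. S \<subseteq> idx \<Longrightarrow> f (pt S) = (\<Sum>T\<in>Pow S. c T)" and S: "S \<subseteq> idx"
  shows "mob f S = c S"
proof -
  have fin: "finite S" using S finite_subset[OF _ finite_idx] by blast
  have "c S = (\<Sum>T\<in>Pow S. (-1) ^ (card S - card T) * sum c (Pow T))"
    by (rule inclusion_exclusion_mobius) (auto simp: fin)
  also have "\<dots> = mob f S"
    unfolding mob_def
    by (rule sum.cong) (use S c fin in \<open>auto simp: card_Diff_subset finite_subset\<close>)
  finally show ?thesis by simp
qed

lemma sum_mob:
  fixes f :: "'f \<Rightarrow> 'a::comm_ring_1"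
  assumes S: "S \<subseteq> idx"
  shows "f (pt S) = (\<Sum>T\<in>Pow S. mob f T)"
proof -
  have fin: "finite S" using S finite_subset[OF _ finite_idx] by blast
  define g where "g T = (\<Sum>U\<in>Pow T. (-1) ^ card U * f (pt U))" for T
  have "f (pt S) = (\<Sum>T\<in>Pow S. (-1) ^ card T * g T)"
    by (rule inclusion_exclusion_symmetric[where f = "\<lambda>U. f (pt U)"]) (auto simp: g_def fin)
  also have "\<dots> = (\<Sum>T\<in>Pow S. mob f T)"
  proof (rule sum.cong)
    fix T assume "T \<in> Pow S"
    then have T: "finite T" using fin finite_subset by blast
    show "(-1) ^ card T * g T = mob f T"
      unfolding g_def mob_def sum_distrib_left
    proof (rule sum.cong)
      fix U assume "U \<in> Pow T"
      then have "card T = card (T - U) + card U"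
        using T by (simp add: card_Diff_subset card_mono finite_subset)
      then show "(-1) ^ card T * ((-1) ^ card U * f (pt U)) = (-1) ^ card (T - U) * f (pt U)"
        by (simp add: power_add flip: mult.assoc) (simp add: mult.assoc flip: power_mult_distrib)
    qed simp
  qed simp
  finally show ?thesis .
qed

lemma function_eq_sum_mon: "f v = (\<Sum>S\<in>Pow idx. mob f S * mon S v)"
proof -
  have "f v = (\<Sum>S\<in>Pow (supp v). mob f S)"
    using sum_mob[of "supp v" f] supp_subset by simp
  also have "\<dots> = (\<Sum>S\<in>Pow idx. if S \<subseteq> supp v then mob f S else 0)"
    using supp_subset[of v] by (intro sum.mono_neutral_cong_left) auto
  also have "\<dots> = (\<Sum>S\<in>Pow idx. mob f S * mon S v)"
    by (rule sum.cong) (auto simp: mon_def)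
  finally show ?thesis .
qed

lemma mob_mon:
  assumes "S \<subseteq> idx" "T \<subseteq> idx"
  shows "mob (mon T) S = (of_bool (S = T) :: 'a::comm_ring_1)"
proof (rule mob_unique[OF _ assms(1)])
  fix S assume S: "S \<subseteq> idx"
  then have "finite S" using finite_subset[OF _ finite_idx] by blast
  then show "mon T (pt S) = (\<Sum>U\<in>Pow S. of_bool (U = T) :: 'a)"
    using S by (simp add: mon_def sum.If_cases of_bool_def)
qed

lemma mob_zero [simp]: "mob (\<lambda>v. 0) S = 0"
  by (simp add: mob_def)

lemma mob_add: "mob (\<lambda>v. f v + g v) S = mob f S + mob g S"
  by (simp add: mob_def algebra_simps sum.distrib)

lemma mob_diff: "mob (\<lambda>v. f v - g v) S = mob f S - mob g S"
  by (simp add: mob_def algebra_simps sum_subtractf)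

lemma mob_smult: "mob (\<lambda>v. c * f v) S = c * mob f S"
  by (simp add: mob_def algebra_simps sum_distrib_left)

lemma mob_of_int: "mob (\<lambda>v. of_int (f v)) S = of_int (mob f S)"
  by (simp add: mob_def)

section \<open>The filtration by 2-adic degree\<close>

lemma deg_le_mono: "d \<le> e \<Longrightarrow> deg_le d \<subseteq> deg_le e"
proof
  fix f :: "'f \<Rightarrow> 'a" assume "d \<le> e" "f \<in> deg_le d"
  show "f \<in> deg_le e"
    unfolding deg_le_def mem_Collect_eq
  proof (intro allI impI)
    fix S assume "S \<subseteq> idx"
    then have "2 ^ (card S - d) dvd mob f S"
      using \<open>f \<in> deg_le d\<close> by (simp add: deg_le_def)
    moreover have "(2::'a) ^ (card S - e) dvd 2 ^ (card S - d)"
      using \<open>d \<le> e\<close> by (intro le_imp_power_dvd) simp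
    ultimately show "2 ^ (card S - e) dvd mob f S"
      by (rule dvd_trans[rotated])
  qed
qed

lemma deg_le_full: "d \<ge> 2 * m \<Longrightarrow> f \<in> deg_le d"
proof -
  assume d: "d \<ge> 2 * m"
  have "card S - d = 0" if "S \<subseteq> idx" for S
    using card_mono[OF _ that] d by simp
  then show ?thesis by (auto simp: deg_le_def)
qed

lemma deg_le_zero [simp]: "(\<lambda>v. 0) \<in> deg_le d"
  by (simp add: deg_le_def)

lemma deg_le_add: "f \<in> deg_le d \<Longrightarrow> g \<in> deg_le d \<Longrightarrow> (\<lambda>v. f v + g v) \<in> deg_le d"
  by (simp add: deg_le_def mob_add)

lemma deg_le_diff: "f \<in> deg_le d \<Longrightarrow> g \<in> deg_le d \<Longrightarrow> (\<lambda>v. f v - g v) \<in> deg_le d"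
  by (simp add: deg_le_def mob_diff)

lemma deg_le_smult: "f \<in> deg_le d \<Longrightarrow> (\<lambda>v. c * f v) \<in> deg_le d"
  by (simp add: deg_le_def mob_smult)

lemma deg_le_sum: "(\<And>i. i \<in> A \<Longrightarrow> f i \<in> deg_le d) \<Longrightarrow> (\<lambda>v. \<Sum>i\<in>A. f i v) \<in> deg_le d"
  by (induction A rule: infinite_finite_induct) (simp_all add: deg_le_add)

text \<open>The exchange rate of the filtration: one factor 2 for one degree.\<close>

lemma deg_le_smult_shift: "f \<in> deg_le e \<Longrightarrow> 2 ^ (e - d) dvd c \<Longrightarrow> (\<lambda>v. c * f v) \<in> deg_le d"
  unfolding deg_le_def mem_Collect_eq mob_smult
proof (intro allI impI)
  fix S assume a: "\<forall>S\<subseteq>idx. 2 ^ (card S - e) dvd mob f S" "2 ^ (e - d) dvd c" "S \<subseteq> idx"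
  have "2 ^ (e - d) * 2 ^ (card S - e) dvd c * mob f S"
    using a by (simp add: mult_dvd_mono)
  moreover have "(2::'a) ^ (card S - d) dvd 2 ^ (e - d) * 2 ^ (card S - e)"
    by (simp flip: power_add add: le_imp_power_dvd)
  ultimately show "2 ^ (card S - d) dvd c * mob f S"
    by (rule dvd_trans[rotated])
qed

lemma mon_in_deg_le: "S \<subseteq> idx \<Longrightarrow> mon S \<in> deg_le (card S)"
  by (auto simp: deg_le_def mob_mon)

lemma const_in_deg_le: "(\<lambda>v. c) \<in> deg_le d"
proof -
  have "mon {} \<in> (deg_le 0 :: ('f \<Rightarrow> 'a) set)"
    using mon_in_deg_le[of "{}"] by simp
  moreover have "mon {} = (\<lambda>v. 1::'a)"
    by (simp add: mon_def fun_eq_iff)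
  ultimately have "(\<lambda>v. c * 1) \<in> (deg_le 0 :: ('f \<Rightarrow> 'a) set)"
    using deg_le_smult[of "\<lambda>v. 1" 0 c] by (simp del: mult_1_right)
  then have "(\<lambda>v. c) \<in> deg_le 0"
    by (simp only: mult_1_right)
  then show ?thesis
    using deg_le_mono[of 0 d, where 'a = 'a] by blast
qed

lemma mon_mult: "mon S v * mon T v = mon (S \<union> T) v"
  by (simp add: mon_def)

text \<open>A product of monomials is the monomial of the union, whose size exceeds
  \<open>d + e\<close> by at most the sum of the two excesses; the coefficients of \<open>f\<close>
  and \<open>g\<close> pay for these.\<close>

lemma deg_le_mult:
  assumes f: "f \<in> deg_le d" and g: "g \<in> deg_le e"
  shows "(\<lambda>v. f v * g v) \<in> deg_le (d + e)"
proof -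
  have "f v * g v = (\<Sum>S\<in>Pow idx. \<Sum>T\<in>Pow idx. (mob f S * mob g T) * mon (S \<union> T) v)" for v
    by (subst function_eq_sum_mon[of f], subst function_eq_sum_mon[of g])
      (simp add: sum_product mult_ac flip: mon_mult)
  moreover have "(\<lambda>v. (mob f S * mob g T) * mon (S \<union> T) v) \<in> deg_le (d + e)"
    if S: "S \<subseteq> idx" and T: "T \<subseteq> idx" for S T
  proof (rule deg_le_smult_shift[OF mon_in_deg_le])
    show "S \<union> T \<subseteq> idx" using S T by simp
    have "card (S \<union> T) \<le> card S + card T"
      by (rule card_Un_le)
    then have "(2::'a) ^ (card (S \<union> T) - (d + e)) dvd 2 ^ (card S - d) * 2 ^ (card T - e)"
      by (auto simp flip: power_add intro: le_imp_power_dvd)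
    also have "\<dots> dvd mob f S * mob g T"
      using f g S T by (intro mult_dvd_mono) (auto simp: deg_le_def)
    finally show "2 ^ (card (S \<union> T) - (d + e)) dvd mob f S * mob g T" .
  qed
  ultimately show ?thesis
    by (simp only:) (intro deg_le_sum, auto)
qed

lemma deg_le_prod:
  assumes "finite A" "\<And>i. i \<in> A \<Longrightarrow> f i \<in> deg_le (e i)"
  shows "(\<lambda>v. \<Prod>i\<in>A. f i v) \<in> deg_le (\<Sum>i\<in>A. e i)"
  using assms
  by (induction A rule: finite_induct) (simp_all add: const_in_deg_le deg_le_mult)

text \<open>Cancelling a 2 is possible over the integers and costs one degree. The repeated halvings
  in \<open>act_idem_dvd\<close> are accounted for in this way.\<close>

lemma deg_le_double:
  fixes f :: "'f \<Rightarrow> int"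
  assumes "(\<lambda>v. 2 * f v) \<in> deg_le d"
  shows "f \<in> deg_le (Suc d)"
  unfolding deg_le_def mem_Collect_eq
proof (intro allI impI)
  fix S assume "S \<subseteq> idx"
  then have *: "2 ^ (card S - d) dvd 2 * mob f S"
    using assms by (auto simp: deg_le_def mob_smult)
  show "2 ^ (card S - Suc d) dvd mob f S"
  proof (cases "card S \<le> d")
    case False
    then have "card S - d = Suc (card S - Suc d)" by simp
    then show ?thesis using * by simp
  qed simp
qed

lemma mon_eq_prod: "S \<subseteq> idx \<Longrightarrow> mon S v = (\<Prod>i\<in>S. mon {i} v)"
proof -
  assume "S \<subseteq> idx"
  then have "finite S" using finite_subset[OF _ finite_idx] by blast
  then show ?thesis
  proof (induction S rule: finite_induct)
    case (insert i S)
    then show ?case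
      by (simp flip: insert.IH add: mon_mult)
  qed (simp add: mon_def)
qed

lemma one_minus_mon_in_deg_le: "i \<in> idx \<Longrightarrow> (\<lambda>v. 1 - mon {i} v) \<in> deg_le 1"
  using mon_in_deg_le[of "{i}"] by (intro deg_le_diff const_in_deg_le) auto

text \<open>The factor 2 pays for the degree of \<open>mon {i}\<close>, so products of any number of
  these functions stay in degree 0.\<close>

lemma one_minus_two_mon_in_deg_le: "i \<in> idx \<Longrightarrow> (\<lambda>v. 1 - 2 * mon {i} v) \<in> deg_le 0"
  using mon_in_deg_le[of "{i}"] by (intro deg_le_diff const_in_deg_le deg_le_smult_shift) auto

text \<open>A linear functional \<open>l\<close> with values 0 and 1 has \<open>1 - 2 * l = (- 1) ^ l\<close>, a product of
  functions \<open>1 - 2 * x\<close> with coordinates \<open>x\<close>.\<close>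

lemma linear_functional_in_deg_le:
  fixes l :: "'f \<Rightarrow> int"
  assumes l: "\<And>v. l v \<in> {0, 1}" and add: "\<And>v w. even (l (v + w) - (l v + l w))"
  shows "l \<in> deg_le 1"
proof -
  define J where "J = {i \<in> idx. l (B i) = 1}"
  have l0: "l 0 = 0"
    using add[of 0 0] l[of 0] by auto
  have *: "1 - 2 * l (pt S) = (\<Prod>i\<in>S. 1 - 2 * l (B i))" if "S \<subseteq> idx" for S
  proof -
    have "finite S" using that finite_subset[OF _ finite_idx] by blast
    then show ?thesis
    proof (induction S rule: finite_induct)
      case (insert i S)
      have "pt (insert i S) = B i + pt S"
        using insert by (simp add: pt_def)
      then have "1 - 2 * l (pt (insert i S)) = (1 - 2 * l (B i)) * (1 - 2 * l (pt S))"
        using l[of "B i"] l[of "pt S"] l[of "B i + pt S"] add[of "B i" "pt S"] by auto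
      then show ?case using insert by simp
    qed (simp add: l0)
  qed
  have "1 - 2 * l v = (\<Prod>i\<in>J. 1 - 2 * mon {i} v)" for v
  proof -
    have "1 - 2 * l v = (\<Prod>i\<in>supp v. 1 - 2 * l (B i))"
      using *[of "supp v"] supp_subset by simp
    also have "\<dots> = (\<Prod>i\<in>supp v \<inter> J. - 1)"
      using l supp_subset[of v] by (intro prod.mono_neutral_cong_right) (auto simp: J_def)
    also have "\<dots> = (\<Prod>i\<in>J. 1 - 2 * mon {i} v)"
      by (rule prod.mono_neutral_cong_left) (auto simp: J_def mon_def)
    finally show ?thesis .
  qed
  moreover have "(\<lambda>v. \<Prod>i\<in>J. 1 - 2 * mon {i} v :: int) \<in> deg_le (\<Sum>i\<in>J. 0)"
    by (rule deg_le_prod) (simp_all only: J_def mem_Collect_eq one_minus_two_mon_in_deg_le, auto)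
  ultimately have "(\<lambda>v. 1 - 2 * l v) \<in> deg_le 0"
    by simp
  \<comment> \<open>Subtraction from 1 leaves \<open>2 * l\<close> in degree 0; halving it raises
    the degree to 1.\<close>
  from deg_le_diff[OF const_in_deg_le[of 1] this] have "(\<lambda>v. 2 * l v) \<in> deg_le 0"
    by simp
  then show ?thesis
    using deg_le_double by force
qed

lemma additive_eq_sum_mon:
  fixes h :: "'f \<Rightarrow> 'a::comm_ring_1"
  assumes "\<And>v w. h (v + w) = h v + h w"
  shows "h v = (\<Sum>i\<in>idx. h (B i) * mon {i} v)"
proof -
  have h0: "h 0 = 0" using assms[of 0 0] by simp
  have *: "h (pt S) = (\<Sum>i\<in>S. h (B i))" if "S \<subseteq> idx" for S
  proof -
    have "finite S" using that finite_subset[OF _ finite_idx] by blast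
    then show ?thesis
      by (induction S rule: finite_induct) (simp_all add: h0 pt_def assms)
  qed
  have "h v = (\<Sum>i\<in>supp v. h (B i))"
    using *[of "supp v"] supp_subset by simp
  also have "\<dots> = (\<Sum>i\<in>idx. h (B i) * mon {i} v)"
    using supp_subset[of v] by (intro sum.mono_neutral_cong_left) (auto simp: mon_def)
  finally show ?thesis .
qed

text \<open>Unlike a functional with integer values 0 and 1, an additive map is a genuine linear
  polynomial in the coordinates. It is applied to powers of Frobenius.\<close>

lemma additive_in_deg_le:
  fixes h :: "'f \<Rightarrow> 'a::comm_ring_1"
  assumes "\<And>v w. h (v + w) = h v + h w"
  shows "h \<in> deg_le 1"
proof -
  have "(\<lambda>v. \<Sum>i\<in>idx. h (B i) * mon {i} v) \<in> deg_le 1"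
    using mon_in_deg_le[of "{_}"] by (intro deg_le_sum deg_le_smult) auto
  then show ?thesis
    unfolding additive_eq_sum_mon[of h, OF assms, symmetric] .
qed

text \<open>The coordinates of \<open>h v\<close> are functionals of degree 1, and
  \<open>f (h v)\<close> is a combination of products of them. For multiplication by powers of
  \<zeta> this makes the filtration stable under \<sigma>.\<close>

lemma deg_le_linear_substitution:
  fixes f :: "'f \<Rightarrow> int"
  assumes f: "f \<in> deg_le d" and h: "\<And>v w. h (v + w) = h v + h w"
  shows "(\<lambda>v. f (h v)) \<in> deg_le d"
proof -
  have x: "(\<lambda>v. mon {i} (h v) :: int) \<in> deg_le 1" for i
    by (rule linear_functional_in_deg_le) (auto simp: mon_def h supp_add)
  have "f (h v) = (\<Sum>S\<in>Pow idx. mob f S * (\<Prod>i\<in>S. mon {i} (h v)))" for v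
    by (subst function_eq_sum_mon) (auto intro!: sum.cong simp: mon_eq_prod)
  moreover have "(\<lambda>v. mob f S * (\<Prod>i\<in>S. mon {i} (h v))) \<in> deg_le d" if "S \<in> Pow idx" for S
  proof (rule deg_le_smult_shift)
    show "(\<lambda>v. \<Prod>i\<in>S. mon {i} (h v) :: int) \<in> deg_le (card S)"
      using deg_le_prod[of S "\<lambda>i v. mon {i} (h v) :: int" "\<lambda>_. 1"] x that finite_subset[of S idx]
      by simp
    show "2 ^ (card S - d) dvd mob f S"
      using f that by (auto simp: deg_le_def)
  qed
  ultimately show ?thesis
    by (simp only:) (intro deg_le_sum, auto)
qed

lemma sum_mon: "S \<subseteq> idx \<Longrightarrow> (\<Sum>v\<in>UNIV. mon S v) = (2 ^ (2 * m - card S) :: 'a::comm_ring_1)"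
proof -
  assume S: "S \<subseteq> idx"
  have "(\<Sum>v\<in>UNIV. mon S v) = (\<Sum>T\<in>Pow idx. of_bool (S \<subseteq> T) :: 'a)"
    unfolding sum_over_pt by (rule sum.cong) (auto simp: mon_def)
  also have "\<dots> = of_nat (card {T. S \<subseteq> T \<and> T \<subseteq> idx})"
    by (simp add: of_bool_def sum.If_cases Int_def conj_commute)
  also have "card {T. S \<subseteq> T \<and> T \<subseteq> idx} = card (Pow (idx - S))"
    by (rule bij_betw_same_card[of "\<lambda>T. T - S"], rule bij_betwI[where g = "\<lambda>T. T \<union> S"]) (use S in auto)
  also have "\<dots> = 2 ^ (2 * m - card S)"
    using S finite_subset[OF S] by (simp add: card_Pow card_Diff_subset)
  finally show ?thesis by simp
qed

text \<open>A monomial of degree c has the sum 2^(2m-c), and coefficients beyond degree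
  \<open>d\<close> make up for the missing factors. In characteristic 2 this says that functions of
  degree below \<open>2 * m\<close> sum to 0, the orthogonality of Reed--Muller codes.\<close>

lemma sum_deg_le:
  assumes f: "f \<in> deg_le d"
  shows "2 ^ (2 * m - d) dvd (\<Sum>v\<in>UNIV. f v)"
proof -
  have "(\<Sum>v\<in>UNIV. f v) = (\<Sum>v\<in>UNIV. \<Sum>S\<in>Pow idx. mob f S * mon S v)"
    by (rule sum.cong[OF refl function_eq_sum_mon])
  also have "\<dots> = (\<Sum>S\<in>Pow idx. mob f S * (\<Sum>v\<in>UNIV. mon S v))"
    by (subst sum.swap) (simp add: sum_distrib_left)
  also have "\<dots> = (\<Sum>S\<in>Pow idx. mob f S * 2 ^ (2 * m - card S))"
    by (rule sum.cong) (auto simp: sum_mon)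
  also have "2 ^ (2 * m - d) dvd \<dots>"
  proof (rule dvd_sum)
    fix S assume S: "S \<in> Pow idx"
    then have "card S \<le> 2 * m" using card_mono[of idx S] by simp
    then have "(2::'a) ^ (2 * m - d) dvd 2 ^ (card S - d) * 2 ^ (2 * m - card S)"
      by (auto simp flip: power_add intro: le_imp_power_dvd)
    also have "\<dots> dvd mob f S * 2 ^ (2 * m - card S)"
      using S f by (intro mult_dvd_mono) (auto simp: deg_le_def)
    finally show "2 ^ (2 * m - d) dvd mob f S * 2 ^ (2 * m - card S)" .
  qed
  finally show ?thesis .
qed

end

section \<open>Cyclic convolution and idempotents\<close>

lemma sum_square_char_2:
  fixes g :: "'b \<Rightarrow> 'a::comm_ring_1"
  assumes "(2::'a) = 0"
  shows "(\<Sum>i\<in>A. g i) ^ 2 = (\<Sum>i\<in>A. g i ^ 2)"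
  using assms by (induction A rule: infinite_finite_induct) (simp_all add: power2_sum)

locale bw_field = f2_coordinates m B
  for m :: nat and B :: "nat \<Rightarrow> 'f::{field,finite}" +
  fixes \<zeta> :: 'f
  assumes m: "m \<ge> 1" and zeta: "primitive_element \<zeta>"
begin

section \<open>The multiplicative group generated by \<zeta>\<close>

definition n :: nat where "n = 4 ^ m - 1"

lemma n_ge_3: "n \<ge> 3"
proof -
  have "(4::nat) ^ 1 \<le> 4 ^ m" using m by (intro power_increasing) auto
  then show ?thesis by (simp add: n_def)
qed

lemma Suc_n: "Suc n = 4 ^ m"
  using n_ge_3 by (simp add: n_def)

lemma zeta_nonzero [simp]: "\<zeta> \<noteq> 0"
  using zeta by (simp add: primitive_element_def)

lemma card_nonzero: "card (UNIV - {0::'f}) = n"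
  by (simp add: card_Diff_subset card_f n_def)

lemma zeta_order: "\<zeta> ^ n = 1" and inj_zeta: "inj_on (\<lambda>i. \<zeta> ^ i) {..<n}"
  and image_zeta: "(\<lambda>i. \<zeta> ^ i) ` {..<n} = UNIV - {0}"
proof -
  have "\<not> inj (\<lambda>i::nat. \<zeta> ^ i)"
    using finite_imageD infinite_UNIV_nat by (metis finite_code)
  then obtain i j :: nat where ij: "\<zeta> ^ i = \<zeta> ^ j" "i < j"
    by (auto simp: inj_def) (metis linorder_neqE_nat)
  then have "\<zeta> ^ i * \<zeta> ^ (j - i) = \<zeta> ^ i * 1"
    by (metis less_imp_le le_add_diff_inverse mult_1_right power_add)
  then have ex: "\<zeta> ^ (j - i) = 1 \<and> 0 < j - i"
    using ij by simp
  define d where "d = (LEAST d. \<zeta> ^ d = 1 \<and> 0 < d)"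
  have d: "\<zeta> ^ d = 1" "0 < d"
    using LeastI[of "\<lambda>d. \<zeta> ^ d = 1 \<and> 0 < d", OF ex] by (simp_all add: d_def)
  have least: "d \<le> e" if "\<zeta> ^ e = 1" "0 < e" for e
    unfolding d_def using that by (intro Least_le) simp
  have inj: "inj_on (\<lambda>i. \<zeta> ^ i) {..<d}"
  proof (rule linorder_inj_onI)
    fix i j assume a: "i < j" "i \<in> {..<d}" "j \<in> {..<d}"
    show "\<zeta> ^ i \<noteq> \<zeta> ^ j"
    proof
      assume "\<zeta> ^ i = \<zeta> ^ j"
      then have "\<zeta> ^ i * \<zeta> ^ (j - i) = \<zeta> ^ i * 1"
        using a by (metis less_imp_le le_add_diff_inverse mult_1_right power_add)
      then have "d \<le> j - i"
        using a by (intro least) auto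
      then show False using a by auto
    qed
  qed auto
  have "\<zeta> ^ i = \<zeta> ^ (i mod d)" for i
    using d(1) by (metis mult_div_mod_eq power_add power_mult power_one mult_1)
  then have "x \<in> (\<lambda>i. \<zeta> ^ i) ` {..<d}" if "x \<noteq> 0" for x
    using zeta that d(2) unfolding primitive_element_def
    by (metis imageI lessThan_iff mod_less_divisor)
  then have img: "(\<lambda>i. \<zeta> ^ i) ` {..<d} = UNIV - {0}"
    by auto
  then have "d = n"
    using card_image[OF inj] card_nonzero by simp
  then show "\<zeta> ^ n = 1" "inj_on (\<lambda>i. \<zeta> ^ i) {..<n}" "(\<lambda>i. \<zeta> ^ i) ` {..<n} = UNIV - {0}"
    using d inj img by auto
qed

lemma zeta_mod: "\<zeta> ^ (i mod n) = \<zeta> ^ i"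
  by (metis mult_div_mod_eq power_add power_mult power_one mult_1 zeta_order)

lemma nonzero_power_n: "v \<noteq> 0 \<Longrightarrow> v ^ n = (1::'f)"
proof -
  assume "v \<noteq> 0"
  then obtain i where "v = \<zeta> ^ i" using image_zeta by blast
  then show ?thesis
    by (metis power_mult mult.commute power_one zeta_order)
qed

text \<open>Because of this, Fourier inversion needs no normalizing factor.\<close>

lemma of_nat_n: "of_nat n = (1::'f)"
proof -
  have "of_nat (Suc n) = (4::'f) ^ m"
    unfolding Suc_n by simp
  also have "(4::'f) = 2 * 2" by simp
  finally have "of_nat n + 1 = (0::'f)"
    unfolding two_eq_0 using m by (simp add: add.commute)
  then show ?thesis
    by (metis add.inverse_unique add.commute minus_self)
qed

lemma of_int_eq_0_iff_even: "of_int k = (0::'f) \<longleftrightarrow> even k"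
proof (cases "even k")
  case True
  then show ?thesis using two_eq_0 by (auto elim!: evenE)
next
  case False
  then show ?thesis using two_eq_0 by (auto elim!: oddE)
qed

lemma sum_root_powers:
  assumes "x \<noteq> 0"
  shows "(\<Sum>i<n. x ^ i) = (of_bool (x = 1) :: 'f)"
proof (cases "x = 1")
  case False
  then show ?thesis
    using geometric_sum[of x n] nonzero_power_n[OF assms] by simp
qed (simp add: of_nat_n)

section \<open>The action of integer polynomials by cyclic shifts\<close>

definition shift :: "('f \<Rightarrow> 'a) \<Rightarrow> 'f \<Rightarrow> 'a" where "shift f v = f (v / \<zeta>)"

text \<open>The variable acts as \<open>shift\<close>, which is \<sigma> in coordinates: the new
  coefficient of \<open>b v\<close> is the old one of \<open>b (v / \<zeta>)\<close>.\<close>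

definition act :: "int poly \<Rightarrow> ('f \<Rightarrow> int) \<Rightarrow> 'f \<Rightarrow> int" where
  "act p f v = (\<Sum>i\<le>Polynomial.degree p. Polynomial.coeff p i * f (v / \<zeta> ^ i))"

lemma act_bound:
  assumes "Polynomial.degree p \<le> N"
  shows "act p f v = (\<Sum>i\<le>N. Polynomial.coeff p i * f (v / \<zeta> ^ i))"
  unfolding act_def using assms
  by (intro sum.mono_neutral_left) (auto simp: coeff_eq_0)

lemma act_0 [simp]: "act 0 f v = 0"
  by (simp add: act_def)

lemma act_1 [simp]: "act 1 f v = f v"
  by (simp add: act_def)

lemma act_monom: "act (Polynomial.monom c i) f v = c * f (v / \<zeta> ^ i)"
proof -
  have "act (Polynomial.monom c i) f v =
      (\<Sum>j\<le>i. Polynomial.coeff (Polynomial.monom c i) j * f (v / \<zeta> ^ j))"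
    by (rule act_bound) (rule degree_monom_le)
  also have "\<dots> = (\<Sum>j\<le>i. if j = i then c * f (v / \<zeta> ^ i) else 0)"
    by (rule sum.cong) auto
  finally show ?thesis by simp
qed

lemma act_add: "act (p + q) f v = act p f v + act q f v"
proof -
  define N where "N = max (Polynomial.degree p) (Polynomial.degree q)"
  have "Polynomial.degree (p + q) \<le> N" "Polynomial.degree p \<le> N" "Polynomial.degree q \<le> N"
    by (auto simp: N_def intro: degree_add_le)
  then show ?thesis
    by (simp add: act_bound[of _ N] sum.distrib algebra_simps)
qed

lemma act_smult: "act (Polynomial.smult c p) f v = c * act p f v"
  by (simp add: act_bound[OF degree_smult_le] act_def sum_distrib_left mult_ac)

lemma act_diff: "act (p - q) f v = act p f v - act q f v"
  using act_add[of p "Polynomial.smult (-1) q" f v] act_smult[of "-1" q f v] by simp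

lemma act_minus: "act (- p) f v = - act p f v"
  using act_smult[of "-1" p f v] by simp

lemma act_sum: "act (\<Sum>i\<in>A. p i) f v = (\<Sum>i\<in>A. act (p i) f v)"
  by (induction A rule: infinite_finite_induct) (simp_all add: act_add)

lemma act_pCons: "act (pCons c p) f v = c * f v + act p (shift f) v"
proof -
  have "act (pCons c p) f v =
      (\<Sum>i\<le>Suc (Polynomial.degree p). Polynomial.coeff (pCons c p) i * f (v / \<zeta> ^ i))"
    by (rule act_bound) (rule degree_pCons_le)
  also have "\<dots> = c * f v + act p (shift f) v"
    by (subst sum.atMost_Suc_shift) (simp add: act_def shift_def mult.commute)
  finally show ?thesis .
qed

lemma act_shift: "act p (shift f) v = act p f (v / \<zeta>)"
  by (simp add: act_def shift_def mult.commute)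

lemma act_mult: "act (p * q) f v = act p (act q f) v"
proof (induction p arbitrary: f v)
  case (pCons c p)
  have "shift (act q f) = act q (shift f)"
    by (simp add: fun_eq_iff act_shift) (simp add: shift_def)
  then show ?case
    by (simp add: mult_pCons_left act_add act_smult act_pCons pCons)
qed simp

lemma act_add_right: "act p (\<lambda>v. f v + g v) v = act p f v + act p g v"
  by (simp add: act_def sum.distrib algebra_simps)

lemma act_diff_right: "act p (\<lambda>v. f v - g v) v = act p f v - act p g v"
  by (simp add: act_def sum_subtractf algebra_simps)

lemma act_smult_right: "act p (\<lambda>v. c * f v) v = c * act p f v"
  by (simp add: act_def sum_distrib_left mult_ac)

lemma act_zero_right [simp]: "act p (\<lambda>v. 0) v = 0"
  by (simp add: act_def)

lemma act_sum_right: "act p (\<lambda>v. \<Sum>i\<in>A. f i v) v = (\<Sum>i\<in>A. act p (f i) v)"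
  by (induction A rule: infinite_finite_induct) (simp_all add: act_add_right)

lemma act_dvd: "(\<And>v. d dvd f v) \<Longrightarrow> d dvd act p f v"
  by (simp add: act_def dvd_sum)

text \<open>The point 0 is fixed by the shift and ignored by the Fourier transform below, so the
  coordinate at 0 is treated separately throughout.\<close>

lemma act_at_0: "act p f 0 = poly p 1 * f 0"
  by (simp add: act_def poly_altdef sum_distrib_right)

text \<open>These are the ideals generated by \<open>2 ^ k\<close> and \<open>X ^ n - 1\<close>.\<close>

definition ann :: "nat \<Rightarrow> int poly set" where
  "ann k = {p. \<forall>f v. 2 ^ k dvd act p f v}"

lemma ann_0 [simp]: "p \<in> ann 0"
  by (simp add: ann_def)

lemma zero_in_ann [simp]: "0 \<in> ann k"
  by (simp add: ann_def)

lemma ann_add: "p \<in> ann k \<Longrightarrow> q \<in> ann k \<Longrightarrow> p + q \<in> ann k"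
  by (simp add: ann_def act_add)

lemma ann_diff: "p \<in> ann k \<Longrightarrow> q \<in> ann k \<Longrightarrow> p - q \<in> ann k"
  by (simp add: ann_def act_diff)

lemma ann_minus: "p \<in> ann k \<Longrightarrow> - p \<in> ann k"
  by (simp add: ann_def act_minus)

lemma ann_minus_commute: "p - q \<in> ann k \<Longrightarrow> q - p \<in> ann k"
  using ann_minus[of "p - q" k] by simp

lemma ann_mono: "k \<le> l \<Longrightarrow> p \<in> ann l \<Longrightarrow> p \<in> ann k"
  unfolding ann_def by (auto intro: dvd_trans[OF le_imp_power_dvd])

lemma ann_mult_ann:
  assumes "p \<in> ann k" "q \<in> ann l"
  shows "p * q \<in> ann (k + l)"
  unfolding ann_def mem_Collect_eq
proof (intro allI)
  fix f v
  have "\<exists>g. \<forall>w. act q f w = 2 ^ l * g w"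
    using assms(2) unfolding ann_def dvd_def by (auto intro: choice)
  then obtain g where "act q f = (\<lambda>w. 2 ^ l * g w)"
    by auto
  then have "act (p * q) f v = 2 ^ l * act p g v"
    by (simp add: act_mult act_smult_right)
  then show "2 ^ (k + l) dvd act (p * q) f v"
    using assms(1) by (simp add: ann_def power_add mult.commute)
qed

lemma ann_mult_right: "p \<in> ann k \<Longrightarrow> p * q \<in> ann k"
  using ann_mult_ann[of p k q 0] by simp

lemma ann_mult_left: "q \<in> ann k \<Longrightarrow> p * q \<in> ann k"
  using ann_mult_ann[of p 0 q k] by simp

lemma act_two_power_mult: "act (2 ^ k * p) f v = 2 ^ k * act p f v"
proof (induction k)
  case (Suc k)
  have "2 ^ Suc k * p = 2 ^ k * p + 2 ^ k * p"
    by (simp add: algebra_simps)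
  then show ?case
    by (simp only: act_add Suc) simp
qed simp

lemma ann_of_two_power: "2 ^ k * p \<in> ann k"
  by (simp add: ann_def act_two_power_mult)

lemma X_n_minus_1_in_ann: "X_n_minus_1 m \<in> ann k"
  unfolding X_n_minus_1_def n_def[symmetric] by (simp add: ann_def act_diff act_monom zeta_order)

text \<open>Powers of the variable move the unit vector at 1 through \<open>n\<close> distinct unit
  vectors, so its image lists the coefficients of \<open>p\<close>.\<close>

lemma ann_coeff:
  assumes p: "p \<in> ann k" and deg: "Polynomial.degree p < n"
  shows "2 ^ k dvd Polynomial.coeff p i"
proof (cases "i < n")
  case True
  have "act p (\<lambda>v. of_bool (v = 1)) (\<zeta> ^ i) =
      (\<Sum>j\<le>n - 1. Polynomial.coeff p j * of_bool (\<zeta> ^ i / \<zeta> ^ j = 1))"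
    using deg by (intro act_bound) simp
  also have "\<dots> = (\<Sum>j\<le>n - 1. if j = i then Polynomial.coeff p i else 0)"
  proof (rule sum.cong)
    fix j assume "j \<in> {..n - 1}"
    then have "j < n" using n_ge_3 by auto
    have "\<zeta> ^ i / \<zeta> ^ j = 1 \<longleftrightarrow> \<zeta> ^ i = \<zeta> ^ j" by simp
    also have "\<dots> \<longleftrightarrow> i = j"
      using inj_zeta True \<open>j < n\<close> by (auto simp: inj_on_def)
    finally show "Polynomial.coeff p j * of_bool (\<zeta> ^ i / \<zeta> ^ j = 1) =
        (if j = i then Polynomial.coeff p i else 0)" by auto
  qed simp
  also have "\<dots> = Polynomial.coeff p i"
    using True by simp
  finally show ?thesis
    using p unfolding ann_def by (metis (mono_tags, lifting) mem_Collect_eq)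
next
  case False
  then show ?thesis using deg by (simp add: coeff_eq_0)
qed

section \<open>The Fourier transform modulo 2\<close>

definition ft :: "('f \<Rightarrow> int) \<Rightarrow> nat \<Rightarrow> 'f" where
  "ft f u = (\<Sum>v\<in>UNIV - {0}. of_int (f v) * v ^ u)"

definition evp :: "int poly \<Rightarrow> 'f \<Rightarrow> 'f" where
  "evp p x = poly (map_poly of_int p) x"

lemma evp_0 [simp]: "evp 0 x = 0" and evp_1 [simp]: "evp 1 x = 1"
  by (simp_all add: evp_def)

lemma evp_pCons: "evp (pCons c p) x = of_int c + x * evp p x"
  by (cases "pCons c p = 0") (auto simp: evp_def map_poly_pCons)

lemma evp_eq_sum: "evp p x = (\<Sum>i\<le>Polynomial.degree p. of_int (Polynomial.coeff p i) * x ^ i)"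
proof (induction p)
  case (pCons c p)
  then show ?case
    by (cases "p = 0") (simp_all add: evp_pCons sum.atMost_Suc_shift sum_distrib_left mult_ac del: sum.atMost_Suc)
qed simp

lemma evp_add: "evp (p + q) x = evp p x + evp q x"
  by (simp add: evp_def of_int_poly_hom.hom_add)

lemma evp_diff: "evp (p - q) x = evp p x - evp q x"
  by (simp add: evp_def of_int_poly_hom.hom_minus)

lemma evp_mult: "evp (p * q) x = evp p x * evp q x"
  by (simp add: evp_def of_int_poly_hom.hom_mult)

lemma evp_power: "evp (p ^ k) x = evp p x ^ k"
  by (induction k) (simp_all add: evp_mult)

lemma evp_monom: "evp (Polynomial.monom c i) x = of_int c * x ^ i"
  by (simp add: evp_def map_poly_monom poly_monom)

lemma evp_sum: "evp (\<Sum>i\<in>A. p i) x = (\<Sum>i\<in>A. evp (p i) x)"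
  by (induction A rule: infinite_finite_induct) (simp_all add: evp_add)

lemma evp_at_1: "evp p 1 = of_int (poly p 1)"
  by (simp add: evp_eq_sum poly_altdef)

lemma ft_add: "ft (\<lambda>v. f v + g v) u = ft f u + ft g u"
  by (simp add: ft_def algebra_simps sum.distrib)

lemma ft_smult: "ft (\<lambda>v. c * f v) u = of_int c * ft f u"
  by (simp add: ft_def algebra_simps sum_distrib_left)

lemma ft_shift: "ft (shift f) u = \<zeta> ^ u * ft f u"
proof -
  have "ft (shift f) u = (\<Sum>w\<in>UNIV - {0}. of_int (f w) * (w * \<zeta>) ^ u)"
    unfolding ft_def shift_def
    by (rule sum.reindex_bij_witness[of _ "\<lambda>w. w * \<zeta>" "\<lambda>v. v / \<zeta>"]) auto
  then show ?thesis
    by (simp add: ft_def sum_distrib_left power_mult_distrib mult_ac)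
qed

lemma ft_act: "ft (act p f) u = evp p (\<zeta> ^ u) * ft f u"
proof (induction p arbitrary: f)
  case 0
  then show ?case by (simp add: ft_def)
next
  case (pCons c p)
  have "act (pCons c p) f = (\<lambda>v. c * f v + act p (shift f) v)"
    by (simp add: fun_eq_iff act_pCons)
  then show ?case
    by (simp add: ft_add ft_smult ft_shift pCons evp_pCons algebra_simps)
qed

text \<open>Orthogonality of the powers of \<open>w / v\<close>. The exponent \<open>n - u\<close>
  expresses the inverse of \<open>v ^ u\<close> by a natural number.\<close>

lemma ft_inversion:
  assumes v: "v \<noteq> 0"
  shows "of_int (f v) = (\<Sum>u<n. ft f u * v ^ (n - u))"
proof -
  have "(\<Sum>u<n. ft f u * v ^ (n - u)) =
      (\<Sum>u<n. \<Sum>w\<in>UNIV - {0}. of_int (f w) * (w / v) ^ u)"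
    unfolding ft_def sum_distrib_right
  proof (intro sum.cong refl)
    fix u w assume u: "u \<in> {..<n}"
    have "v ^ (n - u) * v ^ u = 1"
      using u nonzero_power_n[OF v] by (simp flip: power_add)
    then have "v ^ (n - u) = 1 / v ^ u"
      using v by (simp add: field_simps)
    then show "of_int (f w) * w ^ u * v ^ (n - u) = of_int (f w) * (w / v) ^ u"
      by (simp add: power_divide)
  qed
  also have "\<dots> = (\<Sum>w\<in>UNIV - {0}. of_int (f w) * (\<Sum>u<n. (w / v) ^ u))"
    by (subst sum.swap) (simp add: sum_distrib_left)
  also have "\<dots> = (\<Sum>w\<in>UNIV - {0}. if w = v then of_int (f v) else 0)"
    using v by (intro sum.cong) (auto simp: sum_root_powers)
  also have "\<dots> = of_int (f v)"
    using v by simp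
  finally show ?thesis by simp
qed

lemma even_if_ft_eq_0:
  assumes "\<And>u. u < n \<Longrightarrow> ft f u = 0" "v \<noteq> 0"
  shows "even (f v)"
  using ft_inversion[OF assms(2), of f] assms(1) by (simp flip: of_int_eq_0_iff_even)

definition delta :: "'f \<Rightarrow> 'f \<Rightarrow> int" where "delta w v = of_bool (v = w)"

lemma ft_delta_1: "ft (delta 1) u = 1"
proof -
  have "ft (delta 1) u = (\<Sum>v\<in>UNIV - {0::'f}. if v = 1 then 1 else 0)"
    unfolding ft_def delta_def by (rule sum.cong) auto
  then show ?thesis by simp
qed

text \<open>The unit vector at 1 has constant transform 1 and so detects every value of
  \<open>p\<close>. Conversely, a vanishing transform makes a function even away from 0, and at 0
  the root 1 does it.\<close>

lemma ann_1_iff: "p \<in> ann 1 \<longleftrightarrow> (\<forall>u<n. evp p (\<zeta> ^ u) = 0)"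
proof
  assume p: "p \<in> ann 1"
  then have "even (act p (delta 1) v)" for v
    by (simp add: ann_def)
  then have "ft (act p (delta 1)) u = 0" for u
    by (simp add: ft_def flip: of_int_eq_0_iff_even)
  then show "\<forall>u<n. evp p (\<zeta> ^ u) = 0"
    by (simp add: ft_act ft_delta_1)
next
  assume *: "\<forall>u<n. evp p (\<zeta> ^ u) = 0"
  have "even (act p f v)" for f v
  proof (cases "v = 0")
    case True
    have "of_int (poly p 1) = (0::'f)"
      using * n_ge_3 unfolding evp_at_1[symmetric] by (metis less_le_trans power_0 zero_less_numeral)
    then show ?thesis
      using True by (simp add: act_at_0 of_int_eq_0_iff_even)
  next
    case False
    then show ?thesis
      using * by (intro even_if_ft_eq_0) (simp add: ft_act)
  qed
  then show "p \<in> ann 1"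
    by (simp add: ann_def)
qed

text \<open>Squaring improves a congruence modulo 2^k, k > 0, to one modulo 2^(k+1), and idempotents
  agree with their squares. Identities between idempotents therefore need checking only at the roots
  of unity in characteristic 2.\<close>

lemma idempotent_unique:
  assumes p: "p\<^sup>2 - p \<in> ann N" and q: "q\<^sup>2 - q \<in> ann N" and pq: "p - q \<in> ann 1"
  shows "p - q \<in> ann N"
proof -
  have "k \<le> N \<Longrightarrow> p - q \<in> ann k" for k
  proof (induction k)
    case (Suc k)
    then have k: "p - q \<in> ann k" by simp
    show ?case
    proof (cases "k = 0")
      case False
      have "(p - q) * (p - q) \<in> ann (Suc k)"
        using ann_mult_ann[OF k k] by (rule ann_mono[rotated]) (use False in simp)
      moreover have "2 * q * (p - q) \<in> ann (Suc k)"
        using ann_mult_ann[OF ann_mult_right[OF ann_of_two_power[of 1 1]] k, of q] by simp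
      ultimately have "(p - q) * (p - q) + 2 * q * (p - q) \<in> ann (Suc k)"
        by (rule ann_add)
      also have "(p - q) * (p - q) + 2 * q * (p - q) = p\<^sup>2 - q\<^sup>2"
        by (simp add: algebra_simps power2_eq_square)
      finally have "p\<^sup>2 - q\<^sup>2 \<in> ann (Suc k)" .
      from ann_add[OF ann_diff[OF this ann_mono[OF Suc.prems p]] ann_mono[OF Suc.prems q]]
      show ?thesis by simp
    qed (use pq in simp)
  qed simp
  then show ?thesis by simp
qed

text \<open>These sets are the unions of 2-cyclotomic cosets, the exponent sets stable under
  Frobenius.\<close>

definition closed :: "nat set \<Rightarrow> bool" where
  "closed T \<longleftrightarrow> T \<subseteq> {..<n} \<and> (\<forall>u\<in>T. 2 * u mod n \<in> T)"

text \<open>The inverse Fourier transform of the indicator of \<open>T\<close>.\<close>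

definition idem_coeff :: "nat set \<Rightarrow> nat \<Rightarrow> 'f" where
  "idem_coeff T i = (\<Sum>u\<in>T. inverse (\<zeta> ^ u) ^ i)"

text \<open>The idempotent modulo \<open>2 ^ m\<close> that projects onto the eigenvalues \<open>\<zeta> ^ u\<close> with \<open>u \<in> T\<close>.\<close>

definition idem :: "nat set \<Rightarrow> int poly" where
  "idem T = (\<Sum>i<n. Polynomial.monom (of_bool (idem_coeff T i \<noteq> 0)) i) ^ (2 ^ m)"

lemma odd_n: "odd n"
proof -
  have "even (4 ^ m :: nat)" using m by simp
  then show ?thesis by (simp flip: Suc_n)
qed

lemma doubling_inj: "inj_on (\<lambda>u. 2 * u mod n) {..<n}"
proof (rule inj_onI)
  fix u w assume uw: "u \<in> {..<n}" "w \<in> {..<n}" "2 * u mod n = 2 * w mod n"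
  have "coprime 2 n" using odd_n by simp
  then have "u mod n = w mod n"
    using uw(3) by (metis cong_def cong_mult_lcancel_nat)
  then show "u = w" using uw by simp
qed

text \<open>Squaring permutes the summands, so the sum equals its own square and lies in the prime
  field.\<close>

lemma idem_coeff_cases:
  assumes T: "closed T"
  shows "idem_coeff T i = of_bool (idem_coeff T i \<noteq> 0)"
proof -
  have fin: "finite T" and inj: "inj_on (\<lambda>u. 2 * u mod n) T"
    using T doubling_inj by (auto simp: closed_def intro: finite_subset inj_on_subset)
  have "(\<lambda>u. 2 * u mod n) ` T = T"
    using T fin inj by (intro endo_inj_surj) (auto simp: closed_def)
  then have "idem_coeff T i = (\<Sum>u\<in>T. inverse (\<zeta> ^ (2 * u mod n)) ^ i)"
    unfolding idem_coeff_def using inj by (metis (no_types, lifting) sum.reindex_cong)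
  also have "\<dots> = (\<Sum>u\<in>T. (inverse (\<zeta> ^ u) ^ i) ^ 2)"
    by (rule sum.cong) (simp_all add: zeta_mod power_mult[symmetric] mult_ac flip: power_inverse)
  also have "\<dots> = (idem_coeff T i) ^ 2"
    unfolding idem_coeff_def by (rule sum_square_char_2[OF two_eq_0, symmetric])
  finally have "idem_coeff T i * (idem_coeff T i - 1) = 0"
    by (simp add: power2_eq_square algebra_simps)
  then show ?thesis by auto
qed

lemma evp_idem:
  assumes T: "closed T" and u: "u < n"
  shows "evp (idem T) (\<zeta> ^ u) = of_bool (u \<in> T)"
proof -
  have T': "T \<subseteq> {..<n}" using T by (simp add: closed_def)
  have fin: "finite T" using T' finite_subset by blast
  have "evp (\<Sum>i<n. Polynomial.monom (of_bool (idem_coeff T i \<noteq> 0)) i) (\<zeta> ^ u) =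
      (\<Sum>i<n. idem_coeff T i * (\<zeta> ^ u) ^ i)"
    unfolding evp_sum
  proof (rule sum.cong[OF refl])
    fix i
    show "evp (Polynomial.monom (of_bool (idem_coeff T i \<noteq> 0)) i) (\<zeta> ^ u) =
        idem_coeff T i * (\<zeta> ^ u) ^ i"
      by (subst (2) idem_coeff_cases[OF T]) (simp add: evp_monom)
  qed
  also have "\<dots> = (\<Sum>w\<in>T. \<Sum>i<n. (\<zeta> ^ u / \<zeta> ^ w) ^ i)"
    unfolding idem_coeff_def sum_distrib_right
    by (subst sum.swap) (simp add: divide_inverse power_mult_distrib mult.commute)
  also have "\<dots> = (\<Sum>w\<in>T. if w = u then 1 else 0)"
  proof (rule sum.cong[OF refl])
    fix w assume "w \<in> T"
    then have "\<zeta> ^ u / \<zeta> ^ w = 1 \<longleftrightarrow> w = u"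
      using T' u inj_zeta by (auto simp: inj_on_def)
    then show "(\<Sum>i<n. (\<zeta> ^ u / \<zeta> ^ w) ^ i) = (if w = u then 1 else 0)"
      by (subst sum_root_powers) auto
  qed
  also have "\<dots> = of_bool (u \<in> T)"
    using fin by simp
  finally show ?thesis
    by (simp add: idem_def evp_power)
qed

text \<open>Each squaring gains a factor 2, by
  \<open>(p^2)^2 - p^2 = (p^2 - p)^2 + 2 * p * (p^2 - p)\<close>. This is the reason for the
  exponent \<open>2 ^ m\<close> in \<open>idem\<close>.\<close>

lemma idem_idempotent: 
  assumes T: "closed T"
  shows "(idem T)\<^sup>2 - idem T \<in> ann m"
proof -
  define e :: "int poly" where
    "e = (\<Sum>i<n. Polynomial.monom (of_bool (idem_coeff T i \<noteq> 0)) i)"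
  have E: "idem T = e ^ (2 ^ m)" by (simp add: idem_def e_def)
  have e: "evp e (\<zeta> ^ u) \<in> {0, 1}" if "u < n" for u
  proof -
    have "evp e (\<zeta> ^ u) ^ (2 ^ m) \<in> {0, 1}"
      using evp_idem[OF T that] by (simp add: E evp_power)
    moreover have "x ^ (2 ^ k) \<in> {0, 1} \<Longrightarrow> x \<in> {0, 1}" for x :: 'f and k
    proof (induction k arbitrary: x)
      case (Suc k)
      then have "x\<^sup>2 \<in> {0, 1}" using Suc.IH[of "x\<^sup>2"] by (simp flip: power_mult)
      then show ?case by (auto simp: power2_eq_1_iff)
    qed simp
    ultimately show ?thesis by blast
  qed
  have "(e ^ (2 ^ k))\<^sup>2 - e ^ (2 ^ k) \<in> ann (Suc k)" for k
  proof (induction k)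
    case 0
    have "e\<^sup>2 - e \<in> ann 1"
      unfolding ann_1_iff
    proof (intro allI impI)
      fix u assume "u < n"
      then have "evp e (\<zeta> ^ u) = 0 \<or> evp e (\<zeta> ^ u) = 1" using e by blast
      then show "evp (e\<^sup>2 - e) (\<zeta> ^ u) = 0" by (auto simp: evp_diff evp_power)
    qed
    then show ?case by simp
  next
    case (Suc k)
    define p where "p = e ^ (2 ^ k)"
    have p: "p\<^sup>2 - p \<in> ann (Suc k)" using Suc by (simp add: p_def)
    have "(p\<^sup>2 - p) * (p\<^sup>2 - p) \<in> ann (Suc (Suc k))"
      using ann_mult_ann[OF p p] by (rule ann_mono[rotated]) simp
    moreover have "2 * p * (p\<^sup>2 - p) \<in> ann (Suc (Suc k))"
      using ann_mult_ann[OF ann_mult_right[OF ann_of_two_power[of 1 1]] p, of p] by simp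
    ultimately have "(p\<^sup>2 - p) * (p\<^sup>2 - p) + 2 * p * (p\<^sup>2 - p) \<in> ann (Suc (Suc k))"
      by (rule ann_add)
    also have "(p\<^sup>2 - p) * (p\<^sup>2 - p) + 2 * p * (p\<^sup>2 - p) = (p\<^sup>2)\<^sup>2 - p\<^sup>2"
      by (simp add: algebra_simps power2_eq_square)
    also have "p\<^sup>2 = e ^ (2 ^ Suc k)"
      by (simp add: p_def mult.commute flip: power_mult)
    finally show ?case .
  qed
  then show ?thesis
    unfolding E by (rule ann_mono[rotated]) simp
qed

lemma idem_empty: "idem {} = 0"
  by (simp add: idem_def idem_coeff_def)

lemma closed_Int: "closed S \<Longrightarrow> closed T \<Longrightarrow> closed (S \<inter> T)"
  by (auto simp: closed_def)

lemma closed_Un: "closed S \<Longrightarrow> closed T \<Longrightarrow> closed (S \<union> T)"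
  by (auto simp: closed_def)

lemma idem_mult:
  assumes S: "closed S" and T: "closed T"
  shows "idem S * idem T - idem (S \<inter> T) \<in> ann m"
proof (rule idempotent_unique)
  have "(idem S)\<^sup>2 * ((idem T)\<^sup>2 - idem T) + ((idem S)\<^sup>2 - idem S) * idem T \<in> ann m"
    by (intro ann_add ann_mult_left ann_mult_right idem_idempotent S T)
  then show "(idem S * idem T)\<^sup>2 - idem S * idem T \<in> ann m"
    by (simp add: algebra_simps power2_eq_square)
  show "(idem (S \<inter> T))\<^sup>2 - idem (S \<inter> T) \<in> ann m"
    by (intro idem_idempotent closed_Int S T)
  show "idem S * idem T - idem (S \<inter> T) \<in> ann 1"
    unfolding ann_1_iff by (auto simp: evp_diff evp_mult evp_idem closed_Int S T)
qed

lemma idem_add: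
  assumes S: "closed S" and T: "closed T" and ST: "S \<inter> T = {}"
  shows "idem S + idem T - idem (S \<union> T) \<in> ann m"
proof (rule idempotent_unique)
  have "idem S * idem T \<in> ann m"
    using idem_mult[OF S T] ST by (simp add: idem_empty)
  then have "((idem S)\<^sup>2 - idem S) + ((idem T)\<^sup>2 - idem T) + 2 * (idem S * idem T) \<in> ann m"
    by (intro ann_add idem_idempotent S T ann_mult_left[where p = 2])
  then show "(idem S + idem T)\<^sup>2 - (idem S + idem T) \<in> ann m"
    by (simp add: algebra_simps power2_eq_square)
  show "(idem (S \<union> T))\<^sup>2 - idem (S \<union> T) \<in> ann m"
    by (intro idem_idempotent closed_Un S T)
  show "idem S + idem T - idem (S \<union> T) \<in> ann 1"
    unfolding ann_1_iff using ST by (auto simp: evp_diff evp_add evp_idem closed_Un S T)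
qed

lemma closed_nontrivial: "closed {0<..<n}"
proof -
  have "2 * u mod n \<noteq> 0" if "0 < u" "u < n" for u
  proof
    assume "2 * u mod n = 0"
    then have "(\<lambda>u. 2 * u mod n) u = (\<lambda>u. 2 * u mod n) 0" by simp
    then show False using inj_onD[OF doubling_inj, of u 0] that by simp
  qed
  then show ?thesis using n_ge_3 by (auto simp: closed_def)
qed

text \<open>As \<open>n\<close> is \<open>- 1\<close> modulo \<open>4 ^ m\<close>, the projection onto the eigenvalue 1 is minus the sum of
  all powers.\<close>

lemma idem_nontrivial: "1 + (\<Sum>i<n. Polynomial.monom 1 i) - idem {0<..<n} \<in> ann m"
proof -
  define s :: "int poly" where "s = (\<Sum>i<n. Polynomial.monom 1 i)"
  have act_s: "act s f v = (\<Sum>i<n. f (v / \<zeta> ^ i))" for f v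
    by (simp add: s_def act_sum act_monom)
  have s_shift: "act s f (v / \<zeta>) = act s f v" for f v
  proof -
    have "act s f (v / \<zeta>) + f v = (\<Sum>i<Suc n. f (v / \<zeta> ^ i))"
      unfolding act_s by (subst sum.lessThan_Suc_shift) (simp add: mult.commute)
    also have "\<dots> = act s f v + f v"
      by (simp add: act_s zeta_order)
    finally show ?thesis by simp
  qed
  have s_shift': "act s f (v / \<zeta> ^ i) = act s f v" for f v i
  proof (induction i)
    case (Suc i)
    then show ?case
      using s_shift[of f "v / \<zeta> ^ i"] by (simp add: mult.commute)
  qed simp
  have "act s (act s f) v = int n * act s f v" for f v
    by (subst act_s) (simp add: s_shift')
  moreover have "int n = 2 ^ m * 2 ^ m - 1"
    by (simp add: n_def of_nat_diff flip: power_mult_distrib)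
  ultimately have "act (s\<^sup>2 + s) f v = 2 ^ m * (2 ^ m * act s f v)" for f v
    by (simp add: act_add act_mult power2_eq_square algebra_simps)
  then have s: "s\<^sup>2 + s \<in> ann m"
    by (simp add: ann_def)
  have "(1 + s) - idem {0<..<n} \<in> ann m"
  proof (rule idempotent_unique)
    show "(1 + s)\<^sup>2 - (1 + s) \<in> ann m"
      using s by (simp add: algebra_simps power2_eq_square)
    show "(idem {0<..<n})\<^sup>2 - idem {0<..<n} \<in> ann m"
      by (rule idem_idempotent[OF closed_nontrivial])
    have "evp s (\<zeta> ^ u) = of_bool (u = 0)" if "u < n" for u
    proof -
      have "\<zeta> ^ u = 1 \<longleftrightarrow> u = 0"
        using inj_onD[OF inj_zeta, of u 0] that n_ge_3 by auto
      then show ?thesis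
        by (simp add: s_def evp_sum evp_monom sum_root_powers)
    qed
    then show "1 + s - idem {0<..<n} \<in> ann 1"
      unfolding ann_1_iff by (auto simp: evp_diff evp_add evp_idem closed_nontrivial)
  qed
  then show ?thesis by (simp add: s_def)
qed

end

section \<open>Idempotents and degrees\<close>

lemma sum_odd_even: "(\<Sum>i<2 * m. f i) = (\<Sum>i<m. f (2 * i)) + (\<Sum>i<m. f (2 * i + 1))"
  for f :: "nat \<Rightarrow> 'a::comm_monoid_add"
  by (induction m) (simp_all add: ac_simps)

lemma wt2_eq_odd_even: "wt2 m u = odd_ones m u + even_ones m u"
proof -
  have "(\<Sum>i<m. of_bool (P i)) = card {i. i < m \<and> P i}" for P
    by (simp add: of_bool_def sum.If_cases Int_def)
  then show ?thesis
    unfolding wt2_def sum_odd_even odd_ones_def even_ones_def by simp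
qed

lemma sum_bits:
  assumes "u < 2 ^ k"
  shows "(\<Sum>i | i < k \<and> bit u i. 2 ^ i) = (u::nat)"
proof -
  have "u = take_bit k u"
    using assms by (simp add: take_bit_nat_eq_self)
  also have "\<dots> = (\<Sum>i<k. if bit u i then 2 ^ i else 0)"
    unfolding take_bit_sum atLeast0LessThan
    by (rule sum.cong) (auto simp: push_bit_eq_mult)
  also have "\<dots> = (\<Sum>i | i < k \<and> bit u i. 2 ^ i)"
    by (simp add: sum.If_cases Int_def)
  finally show ?thesis by simp
qed

text \<open>Serves \<open>even_ones_doubling\<close>: the even digits after doubling are the odd
  digits before, rotated by one place.\<close>

lemma card_cyclic_shift:
  "card {i. i < Suc k \<and> (if i = 0 then P k else P (i - 1))} = card {i. i < Suc k \<and> P i}"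
proof -
  have card: "card {i. i < Suc k \<and> Q i} = (\<Sum>i<Suc k. of_bool (Q i))" for Q
    by (simp add: of_bool_def sum.If_cases Int_def del: sum.lessThan_Suc)
  have "card {i. i < Suc k \<and> (if i = 0 then P k else P (i - 1))} =
      (\<Sum>i<Suc k. of_bool (if i = 0 then P k else P (i - 1)))"
    by (rule card)
  also have "\<dots> = of_bool (P k) + (\<Sum>i<k. of_bool (P i))"
    by (subst sum.lessThan_Suc_shift) simp
  also have "\<dots> = (\<Sum>i<Suc k. of_bool (P i))"
    by simp
  also have "\<dots> = card {i. i < Suc k \<and> P i}"
    by (rule card[symmetric])
  finally show ?thesis .
qed

context bw_field
begin

section \<open>Digit weights under doubling modulo \<open>n\<close>\<close>

abbreviation wt :: "nat \<Rightarrow> nat" where "wt u \<equiv> wt2 m u"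

definition odd_even_diff :: "nat \<Rightarrow> int" where
  "odd_even_diff u = \<bar>int (odd_ones m u) - int (even_ones m u)\<bar>"

text \<open>As \<open>4 ^ m\<close> is 1 modulo \<open>n\<close>, the digit shifted out at the top
  re-enters at the bottom: doubling rotates the \<open>2 * m\<close> digits. The bound
  \<open>u < n\<close> matters, since \<open>n\<close> itself, with all digits 1, would be sent to
  0.\<close>

lemma doubling_mod:
  assumes u: "0 < u" "u < n"
  shows "2 * u mod n = 2 * (u mod 2 ^ (2 * m - 1)) + of_bool (bit u (2 * m - 1))"
proof -
  define h :: nat where "h = 2 ^ (2 * m - 1)"
  have "(4::nat) ^ m = 2 ^ Suc (2 * m - 1)"
    using m by (simp add: power_mult)
  then have h: "4 ^ m = 2 * h"
    by (simp add: h_def)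
  then have n: "n = 2 * h - 1" by (simp add: n_def)
  show ?thesis
  proof (cases "u < h")
    case True
    then have "\<not> bit u (2 * m - 1)"
      unfolding bit_iff_odd h_def[symmetric] by simp
    then show ?thesis
      using True u n unfolding h_def[symmetric] by simp
  next
    case False
    then have "u div h = 1"
      using u n by (intro div_nat_eqI) auto
    then have "bit u (2 * m - 1)" and mod: "u mod h = u - h"
      using False u n unfolding bit_iff_odd h_def[symmetric] by (auto simp: modulo_nat_def)
    have "2 * u mod n = (2 * u - n) mod n"
      using False u n by (intro le_mod_geq) auto
    also have "\<dots> = 2 * u - n"
      using False u n by (intro mod_less) auto
    also have "\<dots> = 2 * (u - h) + 1"
      using False u n by auto
    finally show ?thesis
      using mod \<open>bit u (2 * m - 1)\<close> unfolding h_def[symmetric] by simp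
  qed
qed

lemma bit_doubling:
  assumes u: "0 < u" "u < n"
  shows "bit (2 * u mod n) 0 = bit u (2 * m - 1)"
    and "Suc i < 2 * m \<Longrightarrow> bit (2 * u mod n) (Suc i) = bit u i"
  unfolding doubling_mod[OF u]
  by (simp_all add: bit_0 bit_Suc) (auto simp: bit_take_bit_iff simp flip: take_bit_eq_mod)

lemma even_ones_doubling:
  assumes u: "0 < u" "u < n"
  shows "even_ones m (2 * u mod n) = odd_ones m u"
proof -
  obtain k where k: "m = Suc k" using m by (cases m) auto
  have "bit (2 * u mod n) (2 * i) = (if i = 0 then bit u (2 * k + 1) else bit u (2 * (i - 1) + 1))"
    if "i < m" for i
  proof (cases i)
    case 0
    then show ?thesis using bit_doubling(1)[OF u] by (simp add: k)
  next
    case (Suc l)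
    then show ?thesis using bit_doubling(2)[OF u, of "2 * l + 1"] that by simp
  qed
  then have "even_ones m (2 * u mod n) =
      card {i. i < Suc k \<and> (if i = 0 then bit u (2 * k + 1) else bit u (2 * (i - 1) + 1))}"
    unfolding even_ones_def k by (intro arg_cong[of _ _ card] Collect_cong) blast
  also have "\<dots> = odd_ones m u"
    unfolding odd_ones_def k by (rule card_cyclic_shift[where P = "\<lambda>i. bit u (2 * i + 1)"])
  finally show ?thesis .
qed

lemma odd_ones_doubling:
  assumes u: "0 < u" "u < n"
  shows "odd_ones m (2 * u mod n) = even_ones m u"
  unfolding odd_ones_def even_ones_def
  using bit_doubling(2)[OF u] by (intro arg_cong[of _ _ card]) auto

text \<open>Rotation by one place exchanges odd and even positions; it preserves the weight and the
  absolute value of the difference, hence any condition \<open>Q\<close> on these two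
  numbers.\<close>

lemma closed_weights: "closed {u \<in> {0<..<n}. Q (wt u) (odd_even_diff u)}"
proof -
  have "Q (wt (2 * u mod n)) (odd_even_diff (2 * u mod n))"
    if "0 < u" "u < n" "Q (wt u) (odd_even_diff u)" for u
    using that
    by (simp add: wt2_eq_odd_even odd_even_diff_def even_ones_doubling odd_ones_doubling
        add.commute abs_minus_commute)
  moreover have "2 * u mod n \<in> {0<..<n}" if "u \<in> {0<..<n}" for u
    using closed_nontrivial that by (auto simp: closed_def)
  ultimately show ?thesis
    unfolding closed_def by auto
qed

section \<open>Degrees of power functions and of images of idempotents\<close>

lemma power_sum_in_deg_le:
  assumes "finite A"
  shows "(\<lambda>v::'f. v ^ (\<Sum>i\<in>A. 2 ^ i)) \<in> deg_le (card A)"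
proof -
  have "(v + w) ^ (2 ^ i) = v ^ (2 ^ i) + w ^ (2 ^ i)" for v w :: 'f and i
  proof (induction i)
    case (Suc i)
    have "(v + w) ^ (2 ^ Suc i) = ((v + w) ^ (2 ^ i))\<^sup>2"
      by (simp add: mult.commute flip: power_mult)
    also have "\<dots> = (v ^ (2 ^ i))\<^sup>2 + (w ^ (2 ^ i))\<^sup>2"
      unfolding Suc power2_sum two_eq_0 by simp
    finally show ?case
      by (simp add: mult.commute flip: power_mult)
  qed simp
  then have "(\<lambda>v::'f. v ^ (2 ^ i)) \<in> deg_le 1" for i
    by (intro additive_in_deg_le)
  then have "(\<lambda>v::'f. \<Prod>i\<in>A. v ^ (2 ^ i)) \<in> deg_le (\<Sum>i\<in>A. 1)"
    using assms by (intro deg_le_prod)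
  then show ?thesis
    by (simp add: power_sum)
qed

lemma bits_n: "(\<Sum>i<2 * m. 2 ^ i) = n"
  using sum_power2[of "2 * m"] by (simp add: n_def power_mult flip: atLeast0LessThan)

lemma wt_eq_card: "wt u = card {i. i < 2 * m \<and> bit u i}"
  by (simp add: wt2_def of_bool_def sum.If_cases Int_def)

lemma wt_le: "wt u \<le> 2 * m"
  unfolding wt_eq_card using card_mono[of "{..<2 * m}" "{i. i < 2 * m \<and> bit u i}"] by auto

text \<open>Each \<open>v ^ (2 ^ i)\<close> is additive and so of degree 1; \<open>v ^ u\<close> is
  the product of these over the digits 1 of \<open>u\<close>, and \<open>n - u\<close> has the
  complementary digits.\<close>

lemma power_in_deg_le:
  assumes "u \<le> n"
  shows "(\<lambda>v::'f. v ^ u) \<in> deg_le (wt u)" and "(\<lambda>v::'f. v ^ (n - u)) \<in> deg_le (2 * m - wt u)"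
proof -
  have "u < 2 ^ (2 * m)"
    using assms Suc_n by (simp add: power_mult)
  note bits = sum_bits[OF this]
  show "(\<lambda>v::'f. v ^ u) \<in> deg_le (wt u)"
    using power_sum_in_deg_le[of "{i. i < 2 * m \<and> bit u i}"] by (simp add: bits wt_eq_card)
  have "(\<Sum>i | i < 2 * m \<and> bit u i. 2 ^ i) + (\<Sum>i | i < 2 * m \<and> \<not> bit u i. 2 ^ i) = n"
    unfolding bits_n[symmetric] by (subst sum.union_disjoint[symmetric]) (auto intro: sum.cong)
  then have eq: "(\<Sum>i | i < 2 * m \<and> \<not> bit u i. 2 ^ i) = n - u"
    unfolding bits by simp
  have "card {i. i < 2 * m \<and> bit u i} + card {i. i < 2 * m \<and> \<not> bit u i} = card {..<2 * m}"
    by (subst card_Un_disjoint[symmetric]) (auto simp del: card_lessThan intro!: arg_cong[of _ "{..<2 * m}" card])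
  then have "card {i. i < 2 * m \<and> \<not> bit u i} = 2 * m - wt u"
    by (simp add: wt_eq_card)
  then show "(\<lambda>v::'f. v ^ (n - u)) \<in> deg_le (2 * m - wt u)"
    using power_sum_in_deg_le[of "{i. i < 2 * m \<and> \<not> bit u i}"] by (simp add: eq)
qed

lemma act_in_deg_le:
  assumes "f \<in> deg_le d"
  shows "act p f \<in> deg_le d"
proof -
  have "(\<lambda>v. f (v / \<zeta> ^ i)) \<in> deg_le d" for i
    using assms by (rule deg_le_linear_substitution) (simp add: add_divide_distrib)
  then have "(\<lambda>v. \<Sum>i\<le>Polynomial.degree p. Polynomial.coeff p i * f (v / \<zeta> ^ i)) \<in> deg_le d"
    by (intro deg_le_sum deg_le_smult)
  then show ?thesis
    by (simp add: act_def[abs_def])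
qed

lemma act_ann: "p - q \<in> ann k \<Longrightarrow> 2 ^ k dvd act p f v - act q f v"
  by (simp add: ann_def flip: act_diff)

lemma ft_act_idem: "closed T \<Longrightarrow> u < n \<Longrightarrow> ft (act (idem T) f) u = of_bool (u \<in> T) * ft f u"
  by (simp add: ft_act evp_idem)

lemma even_act_idem_at_0:
  assumes T: "closed T" "0 \<notin> T"
  shows "even (act (idem T) f 0)"
proof -
  have "evp (idem T) (\<zeta> ^ 0) = of_bool (0 \<in> T)"
    using n_ge_3 by (intro evp_idem T) simp
  then have "even (poly (idem T) 1)"
    using T(2) by (simp add: evp_at_1 flip: of_int_eq_0_iff_even)
  then show ?thesis
    by (simp add: act_at_0)
qed

text \<open>By inversion the image modulo 2 is a combination of the powers
  \<open>v ^ (n - u)\<close> with \<open>u \<in> T\<close>, all of degree at most \<open>d\<close>.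
  So the integer coefficients in higher degrees are even, and half of that part is
  \<open>y\<close>.\<close>

lemma act_idem_mod_2:
  assumes T: "closed T" "T \<subseteq> {0<..<n}" and wt: "\<And>u. u \<in> T \<Longrightarrow> 2 * m \<le> wt u + d"
  shows "\<exists>p\<in>deg_le d. \<exists>y. \<forall>v. act (idem T) f v = p v + 2 * y v"
proof -
  define g where "g = act (idem T) f"
  have "of_int (g v) = (\<Sum>u\<in>T. ft f u * v ^ (n - u))" for v
  proof (cases "v = 0")
    case True
    \<comment> \<open>Inversion does not cover the point 0; there both sides vanish, the exponents
      \<open>n - u\<close> being positive.\<close>
    have "even (g 0)"
      unfolding g_def using T by (intro even_act_idem_at_0) auto
    then have "of_int (g 0) = (0::'f)"
      by (simp add: of_int_eq_0_iff_even)
    moreover have "(\<Sum>u\<in>T. ft f u * 0 ^ (n - u)) = 0"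
      using T by (intro sum.neutral) auto
    ultimately show ?thesis
      using True by simp
  next
    case False
    have "of_int (g v) = (\<Sum>u<n. of_bool (u \<in> T) * ft f u * v ^ (n - u))"
      unfolding ft_inversion[OF False] g_def
      by (rule sum.cong) (use T in \<open>auto simp: ft_act_idem\<close>)
    also have "\<dots> = (\<Sum>u\<in>T. ft f u * v ^ (n - u))"
      using T by (intro sum.mono_neutral_cong_right) auto
    finally show ?thesis .
  qed
  moreover have "(\<lambda>v. \<Sum>u\<in>T. ft f u * v ^ (n - u)) \<in> deg_le d"
  proof (intro deg_le_sum deg_le_smult)
    fix u assume u: "u \<in> T"
    then have "2 * m - wt u \<le> d" "u \<le> n" using wt[OF u] T by auto
    then show "(\<lambda>v::'f. v ^ (n - u)) \<in> deg_le d"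
      using power_in_deg_le(2)[of u] deg_le_mono by blast
  qed
  ultimately have g: "(\<lambda>v. of_int (g v) :: 'f) \<in> deg_le d"
    by simp
  have ev: "even (mob g S)" if "S \<subseteq> idx" "d < card S" for S
  proof -
    have "(2::'f) ^ (card S - d) dvd of_int (mob g S)"
      using g that(1) by (simp add: deg_le_def mob_of_int)
    then have "of_int (mob g S) = (0::'f)"
      using that(2) by (simp add: two_eq_0 zero_power)
    then show ?thesis
      by (simp add: of_int_eq_0_iff_even)
  qed
  define p where "p v = (\<Sum>S | S \<subseteq> idx \<and> card S \<le> d. mob g S * mon S v)" for v
  define y where "y v = (\<Sum>S | S \<subseteq> idx \<and> d < card S. mob g S div 2 * mon S v)" for v
  have "p \<in> deg_le d"
    unfolding p_def using mon_in_deg_le deg_le_mono by (intro deg_le_sum deg_le_smult) blast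
  moreover have "g v = p v + 2 * y v" for v
  proof -
    have "2 * y v = (\<Sum>S | S \<subseteq> idx \<and> d < card S. mob g S * mon S v)"
      unfolding y_def sum_distrib_left by (rule sum.cong) (use ev in \<open>auto simp flip: mult.assoc\<close>)
    moreover have "Pow idx = {S. S \<subseteq> idx \<and> card S \<le> d} \<union> {S. S \<subseteq> idx \<and> d < card S}"
      by auto
    ultimately show ?thesis
      unfolding p_def by (subst function_eq_sum_mon) (simp add: sum.union_disjoint disjoint_iff)
  qed
  ultimately show ?thesis
    unfolding g_def by blast
qed

text \<open>Successive approximation: an idempotent whose image modulo 2 consists of functions of degree
  at most \<open>d\<close> maps all functions to functions of 2-adic degree at most \<open>d\<close>, because the latter
  form a submodule.\<close>

lemma act_idem_decompose:
  assumes T: "closed T" "T \<subseteq> {0<..<n}" and wt: "\<And>u. u \<in> T \<Longrightarrow> 2 * m \<le> wt u + d"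
    and k: "k \<le> m"
  shows "\<exists>p\<in>deg_le d. \<exists>y. \<forall>v. act (idem T) f v = p v + 2 ^ k * y v"
  using k
proof (induction k arbitrary: f)
  case 0
  show ?case by (rule bexI[of _ "\<lambda>v. 0"], rule exI[of _ "act (idem T) f"]) simp_all
next
  case (Suc k)
  obtain p y where p: "p \<in> deg_le d" and py: "act (idem T) f = (\<lambda>v. p v + 2 * y v)"
    using act_idem_mod_2[OF T wt] by (metis ext)
  obtain q z where q: "q \<in> deg_le d" and qz: "act (idem T) y = (\<lambda>v. q v + 2 ^ k * z v)"
    using Suc by (metis Suc_leD ext)
  \<comment> \<open>The idempotent is applied once more, to \<open>p + 2 * y\<close>: the error
    \<open>2 * y\<close> is improved by the induction hypothesis for \<open>y\<close>.\<close>
  define r where "r v = act (idem T) p v + 2 * q v" for v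
  have "r \<in> deg_le d"
    unfolding r_def by (intro deg_le_add act_in_deg_le p deg_le_smult q)
  moreover have "2 ^ Suc k dvd act (idem T) f v - r v" for v
  proof -
    have "(2::int) ^ Suc k dvd 2 ^ m" using Suc.prems by (rule le_imp_power_dvd)
    moreover have "2 ^ m dvd act (idem T * idem T) f v - act (idem T) f v"
      using act_ann[OF idem_idempotent[OF T(1)]] by (simp add: power2_eq_square)
    ultimately have "2 ^ Suc k dvd act (idem T * idem T) f v - act (idem T) f v"
      by (rule dvd_trans)
    moreover have "act (idem T * idem T) f v = r v + 2 ^ Suc k * z v"
      unfolding act_mult py act_add_right act_smult_right qz r_def by (simp add: algebra_simps)
    ultimately have "2 ^ Suc k dvd r v + 2 ^ Suc k * z v - act (idem T) f v"
      by simp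
    from dvd_diff[OF dvd_triv_left[of "2 ^ Suc k" "z v"] this] show ?thesis
      by simp
  qed
  then have "\<exists>x. act (idem T) f v = r v + 2 ^ Suc k * x" for v
    by (metis add.commute diff_add_cancel dvd_def)
  then obtain x where "\<forall>v. act (idem T) f v = r v + 2 ^ Suc k * x v"
    by metis
  ultimately show ?case by blast
qed

text \<open>Multiplication by \<open>v ^ u\<close> leaves \<open>f\<close> in degree
  \<open>d + wt u < 2 * m\<close>, so the sum over the field, which is the transform at
  \<open>u\<close>, vanishes.\<close>

lemma even_act_idem:
  assumes T: "closed T" "T \<subseteq> {0<..<n}" and wt: "\<And>u. u \<in> T \<Longrightarrow> wt u + d < 2 * m"
    and f: "f \<in> deg_le d"
  shows "even (act (idem T) f v)"
proof (cases "v = 0")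
  case True
  then show ?thesis
    using T(2) even_act_idem_at_0[OF T(1), of f] by force
next
  case False
  show ?thesis
  proof (rule even_if_ft_eq_0[OF _ False])
    fix u assume u: "u < n"
    show "ft (act (idem T) f) u = 0"
    proof (cases "u \<in> T")
      case True
      have fF: "(\<lambda>v. of_int (f v) :: 'f) \<in> deg_le d"
        unfolding deg_le_def mem_Collect_eq mob_of_int
      proof (intro allI impI)
        fix S assume "S \<subseteq> idx"
        then obtain c where "mob f S = 2 ^ (card S - d) * c"
          using f unfolding deg_le_def dvd_def by blast
        then show "(2::'f) ^ (card S - d) dvd of_int (mob f S)"
          by simp
      qed
      have "(\<lambda>v. of_int (f v) * v ^ u) \<in> (deg_le (d + wt u) :: ('f \<Rightarrow> 'f) set)"
        using u by (intro deg_le_mult fF power_in_deg_le) simp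
      then have "(2::'f) ^ (2 * m - (d + wt u)) dvd (\<Sum>v\<in>UNIV. of_int (f v) * v ^ u)"
        by (rule sum_deg_le)
      moreover have "2 * m - (d + wt u) > 0"
        using wt[OF True] by simp
      ultimately have "(\<Sum>v\<in>UNIV. of_int (f v) * v ^ u) = 0"
        by (simp add: two_eq_0 zero_power)
      \<comment> \<open>The summand at 0 may be included because \<open>u\<close> is
        positive.\<close>
      moreover have "ft f u = (\<Sum>v\<in>UNIV. of_int (f v) * v ^ u)"
        unfolding ft_def using True T by (intro sum.mono_neutral_left) (auto simp: zero_power)
      ultimately show ?thesis
        by (simp add: ft_act)
    qed (use u T in \<open>simp add: ft_act_idem\<close>)
  qed
qed

text \<open>As long as the degree is below \<open>w\<close>, applying the idempotent gives an even
  function; halving it gains a factor 2 and raises the degree by one. Reapplying the idempotent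
  changes nothing modulo \<open>2 ^ m\<close>.\<close>

lemma act_idem_dvd:
  assumes T: "closed T" "T \<subseteq> {0<..<n}" and wt: "\<And>u. u \<in> T \<Longrightarrow> wt u + w \<le> 2 * m"
    and f: "f \<in> deg_le d" and k: "d + k \<le> w"
  shows "\<exists>y\<in>deg_le (d + k). \<forall>v. 2 ^ m dvd act (idem T) f v - 2 ^ k * y v"
  using k
proof (induction k)
  case 0
  show ?case
    using act_in_deg_le[OF f] by (intro bexI[of _ "act (idem T) f"]) auto
next
  case (Suc k)
  then obtain y where y: "y \<in> deg_le (d + k)"
    and fy: "\<And>v. 2 ^ m dvd act (idem T) f v - 2 ^ k * y v" by auto
  define z where "z v = act (idem T) y v div 2" for v
  have "even (act (idem T) y v)" for v
  proof (rule even_act_idem[OF T _ y])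
    fix u assume "u \<in> T"
    then show "wt u + (d + k) < 2 * m" using wt Suc.prems by fastforce
  qed
  then have z: "act (idem T) y v = 2 * z v" for v
    by (simp add: z_def)
  have "(\<lambda>v. 2 * z v) \<in> deg_le (d + k)"
    using act_in_deg_le[OF y, of "idem T"] by (simp add: z[symmetric])
  then have "z \<in> deg_le (d + Suc k)"
    using deg_le_double by force
  moreover have "2 ^ m dvd act (idem T) f v - 2 ^ Suc k * z v" for v
  proof -
    have "2 ^ m dvd act (idem T) (\<lambda>v. act (idem T) f v - 2 ^ k * y v) v"
      by (rule act_dvd[OF fy])
    then have 1: "2 ^ m dvd act (idem T) (act (idem T) f) v - 2 ^ Suc k * z v"
      unfolding act_diff_right act_smult_right z by (simp add: mult_ac)
    have 2: "2 ^ m dvd act (idem T) (act (idem T) f) v - act (idem T) f v"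
      using act_ann[OF idem_idempotent[OF T(1)]] by (simp add: power2_eq_square act_mult)
    from dvd_diff[OF 1 2] show ?thesis
      by simp
  qed
  ultimately show ?case by blast
qed

text \<open>For \<open>s = 1\<close> these are the coordinate vectors of the Barnes--Wall lattice, for \<open>s = 0\<close> those of
  its dual.\<close>

definition Lam :: "nat \<Rightarrow> ('f \<Rightarrow> int) set" where
  "Lam s = {a. \<forall>S\<subseteq>idx. 2 ^ ((card S + s) div 2) dvd mob a S}"

text \<open>The lattice of the lift of the chain of codes whose \<open>j\<close>-th zero set has the exponents \<open>N j\<close>.\<close>

definition crit :: "(nat \<Rightarrow> nat set) \<Rightarrow> ('f \<Rightarrow> int) set" where
  "crit N = {a. 2 ^ m dvd (\<Sum>v\<in>UNIV. a v) \<and> (\<forall>j<m. \<forall>v. 2 ^ Suc j dvd act (idem (N j)) a v)}"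

text \<open>For \<open>w > 0\<close> these are the exponents between 0 and \<open>n\<close> of the
  zeros of the Reed--Muller code of degree \<open>w - 1\<close>.\<close>

definition low_wt :: "nat \<Rightarrow> nat set" where
  "low_wt w = {u \<in> {0<..<n}. wt u + w \<le> 2 * m}"

section \<open>The Barnes--Wall lattice and its dual in terms of idempotents\<close>

lemma closed_low_wt: "closed (low_wt w)"
  unfolding low_wt_def by (rule closed_weights[where Q = "\<lambda>a b. a + w \<le> 2 * m"])

lemma Lam_add: "a \<in> Lam s \<Longrightarrow> b \<in> Lam s \<Longrightarrow> (\<lambda>v. a v + b v) \<in> Lam s"
  by (simp add: Lam_def mob_add)

text \<open>From degree \<open>d\<close> to \<open>card S\<close> the function gains
  \<open>card S - d\<close> factors 2, at least the increase of the halved exponent.\<close>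

lemma Lam_deg_le:
  assumes "f \<in> deg_le d" "2 ^ ((d + s) div 2) dvd c"
  shows "(\<lambda>v. c * f v) \<in> Lam s"
  unfolding Lam_def mem_Collect_eq mob_smult
proof (intro allI impI)
  fix S assume S: "S \<subseteq> idx"
  have "2 ^ ((d + s) div 2) * 2 ^ (card S - d) dvd c * mob f S"
    using assms S by (intro mult_dvd_mono) (auto simp: deg_le_def)
  moreover have "(2::int) ^ ((card S + s) div 2) dvd 2 ^ ((d + s) div 2) * 2 ^ (card S - d)"
    unfolding power_add[symmetric] by (intro le_imp_power_dvd) linarith
  ultimately show "2 ^ ((card S + s) div 2) dvd c * mob f S"
    by (rule dvd_trans[rotated])
qed

text \<open>For \<open>s \<le> 1\<close> the exponents in \<open>Lam s\<close> are at most
  \<open>m\<close>, because \<open>card S\<close> is at most \<open>2 * m\<close>.\<close>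

lemma Lam_dvd:
  assumes "\<And>v. 2 ^ m dvd a v" "s \<le> 1"
  shows "a \<in> Lam s"
proof -
  obtain b where "a = (\<lambda>v. 2 ^ m * b v)"
    using assms(1) unfolding dvd_def by metis
  moreover have "(\<lambda>v. 2 ^ m * b v) \<in> Lam s"
    using assms(2) by (intro Lam_deg_le[OF deg_le_full[of "2 * m" b]]) (auto intro: le_imp_power_dvd)
  ultimately show ?thesis by simp
qed

lemma Lam_cong:
  assumes "a \<in> Lam s" "\<And>v. 2 ^ m dvd b v - a v" "s \<le> 1"
  shows "b \<in> Lam s"
  using Lam_add[OF assms(1) Lam_dvd[of "\<lambda>v. b v - a v", OF assms(2,3)]] by simp

text \<open>Let w be \<open>2 * j + 2 - s\<close>. The idempotent makes a monomial of degree c < w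
  divisible by 2^(w-c), and its coefficient brings 2^((c+s) div 2); together these are at least
  \<open>Suc j\<close> factors.\<close>

lemma Lam_subset_crit: "Lam s \<subseteq> crit (\<lambda>j. low_wt (2 * j + 2 - s))"
proof
  fix a assume a: "a \<in> Lam s"
  have sum: "2 ^ m dvd (\<Sum>v\<in>UNIV. a v)"
  proof -
    have "(\<Sum>v\<in>UNIV. a v) = (\<Sum>v\<in>UNIV. \<Sum>S\<in>Pow idx. mob a S * mon S v)"
      by (rule sum.cong[OF refl function_eq_sum_mon])
    also have "\<dots> = (\<Sum>S\<in>Pow idx. mob a S * (\<Sum>v\<in>UNIV. mon S v))"
      by (subst sum.swap) (simp add: sum_distrib_left)
    also have "2 ^ m dvd \<dots>"
    proof (rule dvd_sum)
      fix S assume S: "S \<in> Pow idx"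
      then have "card S \<le> 2 * m" using card_mono[of idx S] by simp
      then have "(2::int) ^ m dvd 2 ^ ((card S + s) div 2) * 2 ^ (2 * m - card S)"
        unfolding power_add[symmetric] by (intro le_imp_power_dvd) linarith
      also have "\<dots> dvd mob a S * (\<Sum>v\<in>UNIV. mon S v)"
        using S a by (intro mult_dvd_mono) (auto simp: Lam_def sum_mon)
      finally show "2 ^ m dvd mob a S * (\<Sum>v\<in>UNIV. mon S v)" .
    qed
    finally show ?thesis .
  qed
  have "2 ^ Suc j dvd act (idem (low_wt (2 * j + 2 - s))) a v" if j: "j < m" for j v
  proof -
    define w where "w = 2 * j + 2 - s"
    have "act (idem (low_wt w)) a v =
        act (idem (low_wt w)) (\<lambda>v. \<Sum>S\<in>Pow idx. mob a S * mon S v) v"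
      by (simp flip: function_eq_sum_mon)
    also have "\<dots> = (\<Sum>S\<in>Pow idx. mob a S * act (idem (low_wt w)) (mon S) v)"
      by (simp add: act_smult_right act_sum_right)
    also have "2 ^ Suc j dvd \<dots>"
    proof (rule dvd_sum)
      fix S assume "S \<in> Pow idx"
      then have S: "S \<subseteq> idx" by simp
      have aS: "2 ^ ((card S + s) div 2) dvd mob a S"
        using a S by (simp add: Lam_def)
      \<comment> \<open>The gain is capped at \<open>m\<close>, as the divisibility under the
        idempotent is known modulo \<open>2 ^ m\<close> only.\<close>
      define e where "e = (if w \<le> card S then 0 else min m (w - card S))"
      have "2 ^ e dvd act (idem (low_wt w)) (mon S) v"
      proof (cases "w \<le> card S")
        case False
        have "\<exists>y\<in>deg_le (card S + (w - card S)). \<forall>v. 2 ^ m dvd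
            act (idem (low_wt w)) (mon S) v - 2 ^ (w - card S) * y v"
          using S False by (intro act_idem_dvd[where w = w] closed_low_wt mon_in_deg_le)
            (auto simp: low_wt_def)
        then obtain y :: "'f \<Rightarrow> int" where
          "2 ^ m dvd act (idem (low_wt w)) (mon S) v - 2 ^ (w - card S) * y v" by blast
        then have "2 ^ e dvd act (idem (low_wt w)) (mon S) v - 2 ^ (w - card S) * y v"
          by (rule dvd_trans[rotated]) (simp add: e_def le_imp_power_dvd)
        moreover have "2 ^ e dvd 2 ^ (w - card S) * y v"
          by (intro dvd_mult2 le_imp_power_dvd) (simp add: e_def)
        ultimately show ?thesis
          by (metis dvd_add diff_add_cancel)
      qed (simp add: e_def)
      then have "2 ^ ((card S + s) div 2) * 2 ^ e dvd mob a S * act (idem (low_wt w)) (mon S) v"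
        using aS by (rule mult_dvd_mono[rotated])
      moreover have "(2::int) ^ Suc j dvd 2 ^ ((card S + s) div 2) * 2 ^ e"
        unfolding power_add[symmetric] e_def w_def using j
        by (intro le_imp_power_dvd) (auto simp: min_def)
      ultimately show "2 ^ Suc j dvd mob a S * act (idem (low_wt w)) (mon S) v"
        by (rule dvd_trans[rotated])
    qed
    finally show ?thesis unfolding w_def .
  qed
  then show "a \<in> crit (\<lambda>j. low_wt (2 * j + 2 - s))"
    using sum by (simp add: crit_def)
qed

text \<open>The projection to the nontrivial part is \<open>a\<close> plus the sum of its
  \<open>n\<close> shifts. That sum is the total minus \<open>a 0\<close> away from 0 and
  \<open>n * a 0\<close> at 0, in both cases \<open>- a 0\<close> modulo
  \<open>2 ^ m\<close>.\<close>

lemma function_mod: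
  assumes a: "2 ^ m dvd (\<Sum>v\<in>UNIV. a v)"
  shows "2 ^ m dvd a v - (a 0 + act (idem {0<..<n}) a v)"
proof -
  have *: "2 ^ m dvd (\<Sum>i<n. a (v / \<zeta> ^ i)) + a 0"
  proof (cases "v = 0")
    case True
    have "(\<Sum>i<n. a (v / \<zeta> ^ i)) + a 0 = int (Suc n) * a 0"
      using True by (simp add: algebra_simps)
    also have "int (Suc n) = 2 ^ m * 2 ^ m"
      unfolding Suc_n by (simp flip: power_mult_distrib)
    finally show ?thesis by simp
  next
    case False
    have "bij_betw (\<lambda>i. v / \<zeta> ^ i) {..<n} (UNIV - {0})"
    proof (rule bij_betwI')
      fix i j assume "i \<in> {..<n}" "j \<in> {..<n}"
      then show "(v / \<zeta> ^ i = v / \<zeta> ^ j) = (i = j)"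
        using False inj_zeta by (auto simp: inj_on_def)
    next
      fix x assume "x \<in> UNIV - {0::'f}"
      then have "v / x \<in> (\<lambda>i. \<zeta> ^ i) ` {..<n}"
        unfolding image_zeta using False by simp
      then obtain i where "i < n" "v / x = \<zeta> ^ i" by auto
      moreover from this have "x = v / \<zeta> ^ i"
        using False \<open>x \<in> UNIV - {0}\<close> by (simp add: eq_divide_eq divide_eq_eq mult.commute)
      ultimately show "\<exists>i\<in>{..<n}. x = v / \<zeta> ^ i"
        by blast
    qed (use False in auto)
    then have "(\<Sum>i<n. a (v / \<zeta> ^ i)) = (\<Sum>w\<in>UNIV - {0}. a w)"
      by (rule sum.reindex_bij_betw)
    then have "(\<Sum>i<n. a (v / \<zeta> ^ i)) + a 0 = (\<Sum>v\<in>UNIV. a v)"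
      by (simp add: sum.remove[of UNIV "0::'f"] add.commute)
    then show ?thesis using a by simp
  qed
  have "2 ^ m dvd act (1 + (\<Sum>i<n. Polynomial.monom 1 i)) a v - act (idem {0<..<n}) a v"
    by (rule act_ann[OF idem_nontrivial])
  then have "2 ^ m dvd a v + (\<Sum>i<n. a (v / \<zeta> ^ i)) - act (idem {0<..<n}) a v"
    by (simp add: act_add act_sum act_monom)
  from dvd_diff[OF this *] show ?thesis
    by (simp add: algebra_simps)
qed

lemma act_idem_idem:
  assumes "closed S" "closed T" "S \<subseteq> T"
  shows "2 ^ m dvd act (idem S) (act (idem T) a) v - act (idem S) a v"
proof -
  have "S \<inter> T = S" using assms(3) by auto
  then show ?thesis
    using act_ann[OF idem_mult[OF assms(1,2)]] by (simp add: act_mult)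
qed

text \<open>Descending induction on the level l. The slice \<open>T\<close> holds the weights that
  separate level l from level l + 1; there \<open>a\<close> is 2^l times a function of degree at
  most \<open>2 * l + 1 - s\<close> modulo \<open>2 ^ m\<close>. As
  \<open>(2 * l + 1 - s + s) div 2 = l\<close>, the factor 2^l is what \<open>Lam s\<close> asks
  for: two consecutive degrees share one power of 2.\<close>

lemma crit_subset_Lam:
  assumes s: "s \<le> 1"
  shows "crit (\<lambda>j. low_wt (2 * j + 2 - s)) \<subseteq> Lam s"
proof
  fix a assume a: "a \<in> crit (\<lambda>j. low_wt (2 * j + 2 - s))"
  have crit: "2 ^ i dvd act (idem (low_wt (2 * i - s))) a v" if "i \<le> m" for i v
    using a that by (cases i) (auto simp: crit_def)
  have "act (idem (low_wt (2 * (m - i) - s))) a \<in> Lam s" if "i \<le> m" for i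
    using that
  proof (induction i)
    case 0
    then show ?case
      using crit[of m] s by (intro Lam_dvd) auto
  next
    case (Suc i)
    define l where "l = m - Suc i"
    have l: "l \<le> m" "m - i = Suc l" using Suc.prems by (auto simp: l_def)
    define T where "T = {u \<in> {0<..<n}. wt u + (2 * l - s) \<le> 2 * m \<and> \<not> wt u + (2 * Suc l - s) \<le> 2 * m}"
    have T: "closed T" "T \<subseteq> {0<..<n}" "T \<subseteq> low_wt (2 * l - s)"
      unfolding T_def
      by (rule closed_weights[where Q = "\<lambda>a b. a + (2 * l - s) \<le> 2 * m \<and> \<not> a + (2 * Suc l - s) \<le> 2 * m"])
        (auto simp: low_wt_def)
    have disj: "T \<inter> low_wt (2 * Suc l - s) = {}" and
      un: "T \<union> low_wt (2 * Suc l - s) = low_wt (2 * l - s)"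
      by (auto simp: T_def low_wt_def)
    obtain y where y: "act (idem (low_wt (2 * l - s))) a = (\<lambda>v. 2 ^ l * y v)"
      using crit[OF l(1)] unfolding dvd_def by metis
    have "\<exists>p\<in>deg_le (2 * l + 1 - s). \<exists>z. \<forall>v. act (idem T) y v = p v + 2 ^ m * z v"
    proof (rule act_idem_decompose[OF T(1,2)])
      fix u assume "u \<in> T"
      then have "\<not> wt u + (2 * Suc l - s) \<le> 2 * m" by (simp add: T_def)
      then show "2 * m \<le> wt u + (2 * l + 1 - s)" using s by (cases "s = 0") auto
    qed simp
    then obtain p z where p: "p \<in> deg_le (2 * l + 1 - s)"
      and pz: "\<And>v. act (idem T) y v = p v + 2 ^ m * z v"
      by blast
    have "(\<lambda>v. 2 ^ l * p v) \<in> Lam s"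
      using s by (intro Lam_deg_le[OF p] le_imp_power_dvd) auto
    moreover have "2 ^ m dvd act (idem T) a v - 2 ^ l * p v" for v
    proof -
      have "2 ^ m dvd act (idem T) (act (idem (low_wt (2 * l - s))) a) v - act (idem T) a v"
        by (intro act_idem_idem T closed_low_wt)
      then have "2 ^ m dvd 2 ^ l * p v + 2 ^ l * (2 ^ m * z v) - act (idem T) a v"
        unfolding y act_smult_right pz by (simp add: algebra_simps)
      then have "2 ^ m dvd (2 ^ l * p v + 2 ^ l * (2 ^ m * z v) - act (idem T) a v) - 2 ^ m * (2 ^ l * z v)"
        by (rule dvd_diff) simp
      then have "2 ^ m dvd 2 ^ l * p v - act (idem T) a v"
        by (simp add: algebra_simps)
      then show ?thesis by (simp add: dvd_diff_commute)
    qed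
    ultimately have "act (idem T) a \<in> Lam s"
      using s by (rule Lam_cong)
    then have "(\<lambda>v. act (idem T) a v + act (idem (low_wt (2 * Suc l - s))) a v) \<in> Lam s"
      using Suc l by (intro Lam_add) auto
    moreover have "2 ^ m dvd act (idem (low_wt (2 * l - s))) a v -
        (act (idem T) a v + act (idem (low_wt (2 * Suc l - s))) a v)" for v
      using act_ann[OF ann_minus_commute[OF idem_add[OF T(1) closed_low_wt disj]]]
      by (simp only: un act_add)
    ultimately show ?case
      unfolding l_def[symmetric] using s by (rule Lam_cong)
  qed
  from this[of m] have "act (idem (low_wt 0)) a \<in> Lam s" by simp
  moreover have "low_wt 0 = {0<..<n}"
    using wt_le by (auto simp: low_wt_def)
  moreover have "(\<lambda>v. a 0 * 1) \<in> Lam s"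
    using s by (intro Lam_deg_le[OF const_in_deg_le[of _ 0]]) simp
  ultimately have sum: "(\<lambda>v. a 0 + act (idem {0<..<n}) a v) \<in> Lam s"
    using Lam_add[of "\<lambda>v. a 0 * 1" s "act (idem {0<..<n}) a"] by simp
  have "2 ^ m dvd (\<Sum>v\<in>UNIV. a v)"
    using a by (simp add: crit_def)
  from sum function_mod[OF this] s show "a \<in> Lam s"
    by (rule Lam_cong)
qed

lemma Lam_eq_crit: "s \<le> 1 \<Longrightarrow> Lam s = crit (\<lambda>j. low_wt (2 * j + 2 - s))"
  using Lam_subset_crit crit_subset_Lam by blast

end

section \<open>Lifted codes\<close>

abbreviation red2 :: "int poly \<Rightarrow> bit poly" where "red2 \<equiv> map_poly of_int"

definition lift2 :: "bit poly \<Rightarrow> int poly" where "lift2 = map_poly f2_emb"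

lemma f2_emb_0 [simp]: "f2_emb 0 = 0" and f2_emb_1 [simp]: "f2_emb 1 = 1"
  by (simp_all add: f2_emb_def)

lemma coeff_lift2: "Polynomial.coeff (lift2 p) i = f2_emb (Polynomial.coeff p i)"
  by (simp add: lift2_def coeff_map_poly)

lemma red2_lift2 [simp]: "red2 (lift2 p) = p"
  by (rule poly_eqI) (simp add: coeff_map_poly coeff_lift2 f2_emb_def)

lemma degree_lift2 [simp]: "Polynomial.degree (lift2 p) = Polynomial.degree p"
  unfolding lift2_def by (rule degree_map_poly) (simp add: f2_emb_def)

lemma lift2_0 [simp]: "lift2 0 = 0"
  by (simp add: lift2_def)

lemma of_int_bit_eq_0_iff: "(of_int k :: bit) = 0 \<longleftrightarrow> even k"
  by (cases "even k") (auto elim!: evenE oddE)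

lemma coeff_two_power_mult: "Polynomial.coeff (2 ^ k * p) i = (2 ^ k * Polynomial.coeff p i :: 'a::comm_ring_1)"
proof (induction k)
  case (Suc k)
  have "2 ^ Suc k * p = 2 ^ k * p + 2 ^ k * p" by (simp add: algebra_simps)
  then show ?case by (simp only: coeff_add Suc) (simp add: algebra_simps)
qed simp

lemma two_power_dvd_poly:
  assumes "\<And>i. 2 ^ k dvd Polynomial.coeff p i"
  shows "\<exists>q. p = 2 ^ k * (q :: int poly)"
proof
  show "p = 2 ^ k * map_poly (\<lambda>c. c div 2 ^ k) p"
    by (rule poly_eqI) (use assms in \<open>simp add: coeff_two_power_mult coeff_map_poly\<close>)
qed

lemma red2_eq_0D: "red2 p = 0 \<Longrightarrow> \<exists>q. p = 2 * q"
proof -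
  assume "red2 p = 0"
  then have "Polynomial.coeff (red2 p) i = 0" for i by simp
  then have "2 ^ 1 dvd Polynomial.coeff p i" for i
    by (simp add: coeff_map_poly of_int_bit_eq_0_iff)
  then show ?thesis using two_power_dvd_poly[of 1 p] by simp
qed

lemma red2_hom: "red2 (p + q) = red2 p + red2 q" "red2 (p * q) = red2 p * red2 q"
    "red2 (p - q) = red2 p - red2 q" "red2 1 = 1" "red2 0 = 0" "red2 (2 * p) = 0"
proof -
  show "red2 (p + q) = red2 p + red2 q" "red2 (p * q) = red2 p * red2 q"
    "red2 (p - q) = red2 p - red2 q" "red2 1 = 1" "red2 0 = 0"
    by (simp_all add: of_int_poly_hom.hom_add of_int_poly_hom.hom_mult of_int_poly_hom.hom_minus)
  have "red2 (p + p) = red2 p + red2 p" by (rule of_int_poly_hom.hom_add)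
  also have "\<dots> = 0"
  proof (rule poly_eqI)
    fix i
    have "c + c = 0" for c :: bit by (cases c) simp_all
    then show "Polynomial.coeff (red2 p + red2 p) i = Polynomial.coeff 0 i"
      unfolding coeff_add coeff_0 .
  qed
  finally show "red2 (2 * p) = 0" unfolding mult_2 .
qed

text \<open>Stated for variables, so that they apply by \<open>rule\<close> to the large terms in
  \<open>hensel\<close>.\<close>

lemma hensel_identities:
  fixes a b c d e x :: "'a::comm_ring_1"
  shows "(a - c * d) * (b - c * e) = a * b - c * (a * e + b * d) + c * c * (d * e)"
    and "x + c * a - c * b + d = x + c * (a - b) + d"
    and "x + 2 * c * (2 * a) + 2 * c * (2 * c) * d = x + 2 * (2 * c) * (a + c * d)"
  by (simp_all add: algebra_simps)

text \<open>A monic factor keeps degrees additive even in the presence of zero divisors, so the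
  cofactor has degree 0 and leading coefficient 1.\<close>

lemma monic_dvd_antisym:
  fixes G G' :: "'a::comm_ring_1 poly"
  assumes "Polynomial.lead_coeff G = 1" "Polynomial.lead_coeff G' = 1" "G dvd G'" "G' dvd G"
  shows "G = G'"
proof -
  have *: "Polynomial.degree A + Polynomial.degree K = Polynomial.degree (A * K) \<and>
      Polynomial.lead_coeff K = Polynomial.lead_coeff (A * K)"
    if "Polynomial.lead_coeff A = 1" "A * K \<noteq> 0" for A K :: "'a poly"
  proof -
    have "K \<noteq> 0" using that by auto
    then have "Polynomial.coeff (A * K) (Polynomial.degree A + Polynomial.degree K) \<noteq> 0"
      using that by (simp add: coeff_mult_degree_sum)
    then have "Polynomial.degree A + Polynomial.degree K = Polynomial.degree (A * K)"
      using le_degree degree_mult_le by (metis le_antisym)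
    then show ?thesis
      using that(1) coeff_mult_degree_sum[of A K] by simp
  qed
  obtain K K' where K: "G' = G * K" and K': "G = G' * K'"
    using assms(3,4) by (auto elim!: dvdE)
  have nz: "G \<noteq> 0" "G' \<noteq> 0" using assms(1,2) by auto
  have 1: "Polynomial.degree G + Polynomial.degree K = Polynomial.degree G'"
    "Polynomial.lead_coeff K = 1"
    using *[OF assms(1), of K] nz assms(2) by (simp_all add: K[symmetric])
  have 2: "Polynomial.degree G' + Polynomial.degree K' = Polynomial.degree G"
    using *[OF assms(2), of K'] nz by (simp add: K'[symmetric])
  have "Polynomial.degree K = 0" using 1 2 by simp
  then have "K = 1" using 1(2) by (metis degree_0_id one_pCons)
  then show ?thesis using K by simp
qed

context bw_field
begin

section \<open>Binary cyclic codes and their generators\<close>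

definition evb :: "bit poly \<Rightarrow> 'f \<Rightarrow> 'f" where "evb p x = poly (map_poly f2_emb p) x"

lemma evb_red2: "evb (red2 p) x = evp p x"
proof -
  have "f2_emb (of_int k) = (of_int k :: 'f)" for k
    using of_int_eq_0_iff_even[of k] of_int_eq_0_iff_even[of "k - 1"]
    by (cases "even k") (simp_all add: f2_emb_def of_int_bit_eq_0_iff)
  then have "map_poly f2_emb (red2 p) = (map_poly of_int p :: 'f poly)"
    by (intro poly_eqI) (simp add: coeff_map_poly)
  then show ?thesis by (simp add: evb_def evp_def)
qed

lemma evb_eq_evp: "evb p x = evp (lift2 p) x"
  using evb_red2[of "lift2 p" x] by simp

lemma evb_add: "evb (p + q) x = evb p x + evb q x"
  using evb_red2[of "lift2 p + lift2 q" x] by (simp add: red2_hom evp_add evb_eq_evp)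

lemma evb_diff: "evb (p - q) x = evb p x - evb q x"
  using evb_red2[of "lift2 p - lift2 q" x] by (simp add: red2_hom evp_diff evb_eq_evp)

lemma evb_mult: "evb (p * q) x = evb p x * evb q x"
  using evb_red2[of "lift2 p * lift2 q" x] by (simp add: red2_hom evp_mult evb_eq_evp)

lemma evb_1 [simp]: "evb 1 x = 1"
  using evb_red2[of 1 x] by (simp add: red2_hom)

lemma evb_0 [simp]: "evb 0 x = 0"
  using evb_red2[of 0 x] by (simp add: red2_hom)

lemma X_n_minus_1_eq: "X_n_minus_1 m = Polynomial.monom 1 n - 1"
  by (simp add: X_n_minus_1_def n_def)

lemma degree_X_n_minus_1: "Polynomial.degree (X_n_minus_1 m :: 'a::comm_ring_1 poly) = n"
  and lead_coeff_X_n_minus_1: "Polynomial.lead_coeff (X_n_minus_1 m :: 'a::comm_ring_1 poly) = 1"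
proof -
  have c: "Polynomial.coeff (X_n_minus_1 m :: 'a poly) n = 1"
    using n_ge_3 by (simp add: X_n_minus_1_eq)
  have "Polynomial.degree (X_n_minus_1 m :: 'a poly) \<le> n"
    unfolding X_n_minus_1_eq by (rule degree_diff_le) (simp_all add: degree_monom_le)
  moreover have "n \<le> Polynomial.degree (X_n_minus_1 m :: 'a poly)"
    by (rule le_degree) (simp add: c)
  ultimately show deg: "Polynomial.degree (X_n_minus_1 m :: 'a poly) = n" by simp
  show "Polynomial.lead_coeff (X_n_minus_1 m :: 'a poly) = 1"
    unfolding deg by (rule c)
qed

lemma map_poly_X_n_minus_1: "map_poly of_int (X_n_minus_1 m) = (X_n_minus_1 m :: 'a::comm_ring_1 poly)"
  by (simp add: X_n_minus_1_def of_int_poly_hom.hom_minus map_poly_monom)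

lemma evb_X_n_minus_1: "u < n \<Longrightarrow> evb (X_n_minus_1 m) (\<zeta> ^ u) = 0"
proof -
  have "evb (X_n_minus_1 m) (\<zeta> ^ u) = evp (X_n_minus_1 m) (\<zeta> ^ u)"
    unfolding evb_red2[symmetric] by (simp add: map_poly_X_n_minus_1)
  then show ?thesis
    by (simp add: X_n_minus_1_eq evp_diff evp_monom nonzero_power_n)
qed

text \<open>The remainder has degree below \<open>n\<close> and would have all \<open>n\<close>
  nonzero field elements as roots.\<close>

lemma X_n_minus_1_dvd_if_roots:
  assumes "\<And>u. u < n \<Longrightarrow> evb p (\<zeta> ^ u) = 0"
  shows "X_n_minus_1 m dvd p"
proof -
  define r where "r = p mod X_n_minus_1 m"
  have X0: "X_n_minus_1 m \<noteq> (0 :: bit poly)"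
    using lead_coeff_X_n_minus_1[where 'a = bit] by force
  have "r = p - X_n_minus_1 m * (p div X_n_minus_1 m)"
    by (simp add: r_def minus_mult_div_eq_mod)
  then have roots: "evb r (\<zeta> ^ u) = 0" if "u < n" for u
    using assms[OF that] evb_X_n_minus_1[OF that] by (simp add: evb_diff evb_mult)
  have "r = 0"
  proof (rule ccontr)
    assume r: "r \<noteq> 0"
    then have deg: "Polynomial.degree r < n"
      using degree_mod_less'[OF X0, of p] by (simp add: r_def degree_X_n_minus_1)
    define q where "q = (map_poly f2_emb r :: 'f poly)"
    have "Polynomial.degree q = Polynomial.degree r"
      unfolding q_def by (rule degree_map_poly) (simp add: f2_emb_def)
    moreover have "q \<noteq> 0"
      using r unfolding q_def by (subst map_poly_eq_0_iff) (auto simp: f2_emb_def)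
    moreover have "UNIV - {0} \<subseteq> {x. poly q x = 0}"
      unfolding image_zeta[symmetric] using roots by (auto simp: q_def evb_def)
    then have "n \<le> card {x. poly q x = 0}"
      unfolding card_nonzero[symmetric] by (intro card_mono) auto
    ultimately show False
      using card_poly_roots_bound[of q] deg by simp
  qed
  then show ?thesis by (simp add: r_def mod_eq_0_iff_dvd)
qed

definition vanishing :: "nat set \<Rightarrow> bit poly set" where
  "vanishing Z = {p. \<forall>u\<in>Z. evb p (\<zeta> ^ u) = 0}"

lemma vanishing_principal:
  assumes Z: "Z \<subseteq> {..<n}"
  shows "\<exists>g. Polynomial.lead_coeff g = 1 \<and> (\<forall>p. p \<in> vanishing Z \<longleftrightarrow> g dvd p)"
proof -
  have X: "X_n_minus_1 m \<in> vanishing Z \<and> X_n_minus_1 m \<noteq> (0 :: bit poly)"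
    using Z evb_X_n_minus_1 lead_coeff_X_n_minus_1[where 'a = bit] by (force simp: vanishing_def)
  obtain g where g: "g \<in> vanishing Z" "g \<noteq> 0"
    and min: "\<And>p. p \<in> vanishing Z \<and> p \<noteq> 0 \<Longrightarrow> Polynomial.degree g \<le> Polynomial.degree p"
    using ex_has_least_nat[of "\<lambda>p. p \<in> vanishing Z \<and> p \<noteq> 0", OF X] by blast
  have "p \<in> vanishing Z \<longleftrightarrow> g dvd p" for p
  proof
    assume p: "p \<in> vanishing Z"
    have "p mod g = p - g * (p div g)" by (simp add: minus_mult_div_eq_mod)
    then have "p mod g \<in> vanishing Z"
      using p g by (simp add: vanishing_def evb_diff evb_mult)
    then have "p mod g = 0"
      using min degree_mod_less'[OF g(2), of p] by (meson leD)
    then show "g dvd p" by (simp add: mod_eq_0_iff_dvd)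
  next
    assume "g dvd p"
    then show "p \<in> vanishing Z" using g by (auto simp: vanishing_def evb_mult elim!: dvdE)
  qed
  moreover have "Polynomial.lead_coeff g = 1"
    using g(2) by (metis bit_not_zero_iff leading_coeff_0_iff)
  ultimately show ?thesis by blast
qed

lemma coeff_word_poly: "Polynomial.coeff (word_poly m \<zeta> c) i = (if i < n then c (\<zeta> ^ i) else 0)"
  by (simp add: word_poly_def n_def coeff_sum if_distrib[of "\<lambda>f. f _"] cong: if_cong)

lemma degree_word_poly: "Polynomial.degree (word_poly m \<zeta> c) < n"
  using n_ge_3 by (intro degree_lessI) (auto simp: coeff_word_poly)

lemma evb_word_poly: "evb (word_poly m \<zeta> c) x = (\<Sum>i<n. f2_emb (c (\<zeta> ^ i)) * x ^ i)"
proof -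
  have "lift2 (word_poly m \<zeta> c) = (\<Sum>i<n. Polynomial.monom (f2_emb (c (\<zeta> ^ i))) i)"
    by (rule poly_eqI)
      (simp add: coeff_lift2 coeff_word_poly coeff_sum if_distrib[of "\<lambda>f. f _"] cong: if_cong)
  moreover have "of_int (f2_emb c) = (f2_emb c :: 'f)" for c
    by (simp add: f2_emb_def)
  ultimately show ?thesis
    by (simp add: evb_eq_evp evp_sum evp_monom)
qed

definition zeros :: "nat set \<Rightarrow> 'f set" where "zeros Z = (\<lambda>u. \<zeta> ^ u) ` Z"

text \<open>Extension prescribes only the coordinate at 0, which \<open>word_poly\<close> does not
  see.\<close>

lemma word_poly_image:
  "word_poly m \<zeta> ` extended_code (cyclic_code m \<zeta> (zeros Z)) =
     {p. Polynomial.degree p < n \<and> p \<in> vanishing Z}"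
proof (intro equalityI subsetI)
  fix p assume "p \<in> word_poly m \<zeta> ` extended_code (cyclic_code m \<zeta> (zeros Z))"
  then obtain c where "p = word_poly m \<zeta> c" "c \<in> cyclic_code m \<zeta> (zeros Z)"
    by (auto simp: extended_code_def)
  then show "p \<in> {p. Polynomial.degree p < n \<and> p \<in> vanishing Z}"
    using degree_word_poly
    by (auto simp: vanishing_def evb_word_poly cyclic_code_def zeros_def n_def)
next
  fix p :: "bit poly" assume p: "p \<in> {p. Polynomial.degree p < n \<and> p \<in> vanishing Z}"
  define e where "e v = Polynomial.coeff p (inv_into {..<n} (\<lambda>i. \<zeta> ^ i) v)" for v
  define c where "c v = (if v = 0 then - (\<Sum>v | v \<noteq> 0. e v) else e v)" for v
  have c: "c (\<zeta> ^ i) = Polynomial.coeff p i" if "i < n" for i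
    using that inj_zeta by (simp add: c_def e_def inv_into_f_f)
  have w: "word_poly m \<zeta> c = p"
    by (rule poly_eqI) (use p c in \<open>auto simp: coeff_word_poly coeff_eq_0\<close>)
  have "(\<Sum>i<n. f2_emb (c (\<zeta> ^ i)) * z ^ i) = 0" if "z \<in> zeros Z" for z
    using p that unfolding evb_word_poly[symmetric] w by (auto simp: vanishing_def zeros_def)
  then have "c \<in> cyclic_code m \<zeta> (zeros Z)"
    by (simp add: cyclic_code_def n_def)
  moreover have "c 0 = - (\<Sum>v | v \<noteq> 0. c v)"
    by (simp add: c_def)
  ultimately show "p \<in> word_poly m \<zeta> ` extended_code (cyclic_code m \<zeta> (zeros Z))"
    using w by (auto simp: extended_code_def)
qed

text \<open>The definite description fixes the multiples of degree below \<open>n\<close>. For the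
  zero code the generator is X^n - 1 itself and has no nonzero multiple in that range; there
  divisibility of X^n - 1 decides, hence the case distinction on the degree.\<close>

lemma generator_poly_correct:
  assumes Z: "Z \<subseteq> {..<n}"
  defines "g \<equiv> generator_poly m \<zeta> (extended_code (cyclic_code m \<zeta> (zeros Z)))"
  shows "Polynomial.lead_coeff g = 1 \<and> (\<forall>p. p \<in> vanishing Z \<longleftrightarrow> g dvd p)"
proof -
  obtain g0 where g0: "Polynomial.lead_coeff g0 = 1" "\<And>p. p \<in> vanishing Z \<longleftrightarrow> g0 dvd p"
    using vanishing_principal[OF Z] by blast
  have X: "X_n_minus_1 m \<in> vanishing Z"
    using Z evb_X_n_minus_1 by (force simp: vanishing_def)
  define P where "P g \<longleftrightarrow> Polynomial.lead_coeff g = 1 \<and> g dvd X_n_minus_1 m \<and>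
     word_poly m \<zeta> ` extended_code (cyclic_code m \<zeta> (zeros Z)) =
       {p. Polynomial.degree p < n \<and> g dvd p}" for g
  have P0: "P g0"
    using g0 X by (simp add: P_def word_poly_image)
  have dvd: "g1 dvd g2" if "P g1" "P g2" for g1 g2
  proof (cases "Polynomial.degree g2 < n")
    case True
    then have "g2 \<in> {p. Polynomial.degree p < n \<and> g2 dvd p}" by simp
    then have "g2 \<in> {p. Polynomial.degree p < n \<and> g1 dvd p}"
      using that unfolding P_def by blast
    then show ?thesis by simp
  next
    case False
    obtain k where k: "X_n_minus_1 m = g2 * k"
      using \<open>P g2\<close> by (auto simp: P_def elim!: dvdE)
    have X0: "X_n_minus_1 m \<noteq> (0 :: bit poly)"
      using lead_coeff_X_n_minus_1[where 'a = bit] by force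
    then have "g2 \<noteq> 0" "k \<noteq> 0" using k by auto
    then have "n = Polynomial.degree g2 + Polynomial.degree k"
      unfolding degree_X_n_minus_1[where 'a = bit, symmetric] k by (rule degree_mult_eq)
    then have "Polynomial.degree k = 0" using False by simp
    moreover have "Polynomial.lead_coeff k = 1"
      using \<open>k \<noteq> 0\<close> by (metis bit_not_zero_iff leading_coeff_0_iff)
    ultimately have "k = 1" by (metis degree_0_id one_pCons)
    then show ?thesis using k \<open>P g1\<close> by (simp add: P_def)
  qed
  have "g = g0"
    unfolding g_def generator_poly_def n_def[symmetric]
  proof (rule the_equality)
    show "Polynomial.lead_coeff g0 = 1 \<and> g0 dvd X_n_minus_1 m \<and>
      word_poly m \<zeta> ` extended_code (cyclic_code m \<zeta> (zeros Z)) =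
        {p. Polynomial.degree p < n \<and> g0 dvd p}"
      using P0 by (simp add: P_def)
  next
    fix g1
    assume "Polynomial.lead_coeff g1 = 1 \<and> g1 dvd X_n_minus_1 m \<and>
      word_poly m \<zeta> ` extended_code (cyclic_code m \<zeta> (zeros Z)) =
        {p. Polynomial.degree p < n \<and> g1 dvd p}"
    then have "P g1" by (simp add: P_def)
    then show "g1 = g0"
      using dvd[OF _ P0] dvd[OF P0] by (intro monic_dvd_antisym) (auto simp: P_def P0[unfolded P_def])
  qed
  then show ?thesis using g0 by blast
qed

section \<open>Testing polynomials on the unit vector at 1\<close>

lemma int_poly_division:
  "\<exists>q r. p = X_n_minus_1 m * q + r \<and> Polynomial.degree (r :: int poly) < n"
proof -
  obtain q r where qr: "pseudo_divmod p (X_n_minus_1 m) = (q, r)" by fastforce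
  have X0: "X_n_minus_1 m \<noteq> (0 :: int poly)"
    using lead_coeff_X_n_minus_1[where 'a = int] by force
  have "p = X_n_minus_1 m * q + r" "r = 0 \<or> Polynomial.degree r < n"
    using pseudo_divmod[OF X0 qr, unfolded lead_coeff_X_n_minus_1]
    by (simp_all add: degree_X_n_minus_1)
  then show ?thesis using n_ge_3 by force
qed

lemma ann_decompose:
  assumes "p \<in> ann k"
  shows "\<exists>q r. p = X_n_minus_1 m * q + 2 ^ k * r"
proof -
  obtain q r where qr: "p = X_n_minus_1 m * q + r" "Polynomial.degree r < n"
    using int_poly_division by blast
  have "p - X_n_minus_1 m * q \<in> ann k"
    by (intro ann_diff assms ann_mult_right X_n_minus_1_in_ann)
  then have "r \<in> ann k" using qr by simp
  then obtain s where "r = 2 ^ k * s"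
    using two_power_dvd_poly ann_coeff[OF _ qr(2)] by metis
  then show ?thesis using qr by blast
qed

lemma act_delta_1:
  assumes "Polynomial.degree p < n" "i < n"
  shows "act p (delta 1) (\<zeta> ^ i) = Polynomial.coeff p i"
proof -
  have "act p (delta 1) (\<zeta> ^ i) = (\<Sum>j\<le>n - 1. Polynomial.coeff p j * delta 1 (\<zeta> ^ i / \<zeta> ^ j))"
    using assms by (intro act_bound) simp
  also have "\<dots> = (\<Sum>j\<le>n - 1. if j = i then Polynomial.coeff p i else 0)"
  proof (rule sum.cong)
    fix j assume "j \<in> {..n - 1}"
    then have "j < n" using n_ge_3 by auto
    then have "\<zeta> ^ i / \<zeta> ^ j = 1 \<longleftrightarrow> j = i"
      using inj_zeta assms(2) by (auto simp: inj_on_def)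
    then show "Polynomial.coeff p j * delta 1 (\<zeta> ^ i / \<zeta> ^ j) =
        (if j = i then Polynomial.coeff p i else 0)" by (auto simp: delta_def)
  qed simp
  also have "\<dots> = Polynomial.coeff p i"
    using assms(2) by simp
  finally show ?thesis .
qed

text \<open>Modulo X^n - 1 the functions on the nonzero elements form a free module of rank one,
  generated by the unit vector at 1.\<close>

lemma ann_iff_delta_1: "p \<in> ann k \<longleftrightarrow> (\<forall>v. v \<noteq> 0 \<longrightarrow> 2 ^ k dvd act p (delta 1) v)"
proof
  assume *: "\<forall>v. v \<noteq> 0 \<longrightarrow> 2 ^ k dvd act p (delta 1) v"
  obtain q r where qr: "p = X_n_minus_1 m * q + r" "Polynomial.degree r < n"
    using int_poly_division by blast
  have X: "X_n_minus_1 m * q \<in> ann k" by (intro ann_mult_right X_n_minus_1_in_ann)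
  have "2 ^ k dvd Polynomial.coeff r i" for i
  proof (cases "i < n")
    case True
    have "2 ^ k dvd act p (delta 1) (\<zeta> ^ i) - act (X_n_minus_1 m * q) (delta 1) (\<zeta> ^ i)"
      using * X by (intro dvd_diff) (simp_all add: ann_def)
    then show ?thesis
      using act_delta_1[OF qr(2) True] by (simp add: qr(1) act_add)
  qed (use qr(2) in \<open>simp add: coeff_eq_0\<close>)
  then obtain s where "r = 2 ^ k * s" using two_power_dvd_poly by blast
  then show "p \<in> ann k"
    unfolding qr(1) by (intro ann_add X) (simp add: ann_of_two_power)
qed (simp add: ann_def)

lemma act_word_poly: "v \<noteq> 0 \<Longrightarrow> act (word_poly m \<zeta> a) (delta 1) v = a v"
proof -
  assume "v \<noteq> 0"
  then obtain i where "i < n" "v = \<zeta> ^ i" using image_zeta by (metis (no_types, lifting) DiffI UNIV_I image_iff lessThan_iff singletonD)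
  then show ?thesis
    by (simp add: act_delta_1 degree_word_poly coeff_word_poly)
qed

text \<open>The value c at 1 satisfies c (c - 1) = 0 modulo \<open>2 ^ m\<close>, and since c is
  even, c - 1 is odd. So an idempotent without the exponent 0 kills the coordinate at 0 modulo
  \<open>2 ^ m\<close>.\<close>

lemma two_power_dvd_idem_at_1:
  assumes T: "closed T" "0 \<notin> T"
  shows "2 ^ m dvd poly (idem T) 1"
proof -
  define c where "c = poly (idem T) 1"
  have "2 ^ m dvd act ((idem T)\<^sup>2) (\<lambda>v. 1) 0 - act (idem T) (\<lambda>v. 1) 0"
    by (rule act_ann[OF idem_idempotent[OF T(1)]])
  then have "2 ^ m dvd c * (c - 1)"
    by (simp add: act_at_0 c_def power2_eq_square algebra_simps)
  moreover have "even c"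
    using even_act_idem_at_0[OF T, of "\<lambda>v. 1"] by (simp add: act_at_0 c_def)
  then have "coprime (2 ^ m) (c - 1)" by simp
  ultimately show ?thesis
    using coprime_dvd_mult_left_iff c_def by blast
qed

lemma idem_word_poly_in_ann:
  assumes T: "closed T" "0 \<notin> T" and k: "k \<le> m"
  shows "idem T * word_poly m \<zeta> a \<in> ann k \<longleftrightarrow> (\<forall>v. 2 ^ k dvd act (idem T) a v)"
proof -
  have eq: "act (idem T * word_poly m \<zeta> a) (delta 1) v = act (idem T) a v" if "v \<noteq> 0" for v
    unfolding act_mult act_def[of "idem T"] using that by (intro sum.cong) (simp_all add: act_word_poly)
  have "(2::int) ^ k dvd 2 ^ m" using k by (rule le_imp_power_dvd)
  then have "2 ^ k dvd act (idem T) a 0"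
    using two_power_dvd_idem_at_1[OF T] by (auto simp: act_at_0 intro: dvd_trans)
  then show ?thesis
    unfolding ann_iff_delta_1 using eq by metis
qed

text \<open>The reduction of \<open>1 - idem Z\<close> is a multiple of \<open>g\<close> whose roots
  among the powers of \<zeta> are exactly those from \<open>Z\<close>.\<close>

lemma generator_roots:
  assumes Z: "closed Z" and g: "\<And>p. p \<in> vanishing Z \<longleftrightarrow> g dvd p" and u: "u < n"
  shows "evb g (\<zeta> ^ u) = 0 \<longleftrightarrow> u \<in> Z"
proof
  assume 0: "evb g (\<zeta> ^ u) = 0"
  have "red2 (1 - idem Z) \<in> vanishing Z"
    using Z evp_idem[OF Z] by (auto simp: vanishing_def evb_red2 evp_diff closed_def subset_iff)
  then have "evb (red2 (1 - idem Z)) (\<zeta> ^ u) = 0"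
    using g 0 by (auto simp: evb_mult elim!: dvdE)
  then show "u \<in> Z"
    using u Z by (auto simp: evb_red2 evp_diff evp_idem)
next
  assume "u \<in> Z"
  then show "evb g (\<zeta> ^ u) = 0" using g[of g] by (simp add: vanishing_def)
qed

text \<open>The generator divides \<open>1 - idem Z\<close>, the cofactor divides
  \<open>idem Z\<close>, and these add up to 1.\<close>

lemma bezout:
  assumes Z: "closed Z" and g: "\<And>p. p \<in> vanishing Z \<longleftrightarrow> g dvd p" and gh: "X_n_minus_1 m = g * h"
  shows "\<exists>a b. a * g + b * h = 1"
proof -
  have X0: "X_n_minus_1 m \<noteq> (0 :: bit poly)"
    using lead_coeff_X_n_minus_1[where 'a = bit] by force
  have "red2 (1 - idem Z) \<in> vanishing Z"
    using Z evp_idem[OF Z] by (auto simp: vanishing_def evb_red2 evp_diff closed_def subset_iff)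
  then have 1: "g dvd 1 - red2 (idem Z)"
    using g by (simp add: red2_hom)
  have "X_n_minus_1 m dvd g * red2 (idem Z)"
    by (rule X_n_minus_1_dvd_if_roots) (auto simp: evb_mult evb_red2 evp_idem Z generator_roots[OF Z g])
  then have 2: "h dvd red2 (idem Z)"
    using X0 unfolding gh by simp
  obtain a b where "1 - red2 (idem Z) = g * a" "red2 (idem Z) = h * b"
    using 1 2 by (auto elim!: dvdE)
  then have "a * g + b * h = 1" by (simp add: algebra_simps)
  then show ?thesis by blast
qed

text \<open>Linear Hensel lifting: \<open>g * E + h * D = d\<close> solves for the corrections that
  cancel the error one binary digit further. Reducing \<open>D\<close> modulo \<open>g\<close> keeps
  the first factor monic of the same degree; \<open>E\<close> then has small degree too.\<close>

lemma hensel: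
  assumes g: "Polynomial.lead_coeff g = 1" and h: "Polynomial.lead_coeff h = 1"
    and gh: "X_n_minus_1 m = g * h" and ab: "a * g + b * h = (1 :: bit poly)"
  shows "\<exists>G H K. red2 G = g \<and> red2 H = h \<and> Polynomial.lead_coeff G = 1 \<and>
     Polynomial.lead_coeff H = 1 \<and> Polynomial.degree G = Polynomial.degree g \<and>
     Polynomial.degree H = Polynomial.degree h \<and> G * H = X_n_minus_1 m + 2 ^ Suc k * K"
proof (induction k)
  case 0
  have "red2 (lift2 g * lift2 h - X_n_minus_1 m) = 0"
    by (simp add: red2_hom map_poly_X_n_minus_1 gh)
  then obtain K where "lift2 g * lift2 h = X_n_minus_1 m + 2 * K"
    using red2_eq_0D by (metis add_diff_cancel_left' diff_add_cancel add.commute)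
  then show ?case
    using g h by (intro exI[of _ "lift2 g"] exI[of _ "lift2 h"] exI[of _ K])
      (simp add: coeff_lift2)
next
  case (Suc k)
  then obtain G H K where G: "red2 G = g" "Polynomial.lead_coeff G = 1" "Polynomial.degree G = Polynomial.degree g"
    and H: "red2 H = h" "Polynomial.lead_coeff H = 1" "Polynomial.degree H = Polynomial.degree h"
    and GH: "G * H = X_n_minus_1 m + 2 ^ Suc k * K"
    by blast
  have nz: "g \<noteq> 0" "h \<noteq> 0" "G \<noteq> 0" "H \<noteq> 0" using g h G(2) H(2) by auto
  have n: "n = Polynomial.degree g + Polynomial.degree h"
    unfolding degree_X_n_minus_1[where 'a = bit, symmetric] gh using nz by (simp add: degree_mult_eq)
  \<comment> \<open>\<open>G * H\<close> and X^n - 1 are both monic of degree \<open>n\<close>, so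
    their difference has lower degree.\<close>
  have K: "Polynomial.coeff K i = 0" if "i \<ge> n" for i
  proof -
    have "Polynomial.coeff (G * H) i = Polynomial.coeff (X_n_minus_1 m) i"
    proof (cases "i = n")
      case True
      then show ?thesis
        using coeff_mult_degree_sum[of G H] lead_coeff_X_n_minus_1[where 'a = int] G H n
        by (simp add: degree_X_n_minus_1)
    next
      case False
      then show ?thesis
        using that G H n degree_mult_le[of G H] degree_X_n_minus_1[where 'a = int]
        by (simp add: coeff_eq_0)
    qed
    then have "Polynomial.coeff (2 ^ Suc k * K) i = 0"
      by (simp only: GH coeff_add)
    then show ?thesis
      unfolding coeff_two_power_mult by simp
  qed
  define d where "d = red2 K"
  have d: "Polynomial.coeff d i = 0" if "i \<ge> n" for i
    using K[OF that] by (simp add: d_def coeff_map_poly)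
  define D where "D = (b * d) mod g"
  define E where "E = a * d + h * ((b * d) div g)"
  have gE: "g * E + h * D = d"
  proof -
    have "g * E + h * D = g * a * d + h * (g * ((b * d) div g) + (b * d) mod g)"
      by (simp only: D_def E_def algebra_simps)
    also have "\<dots> = (a * g + b * h) * d"
      unfolding mult_div_mod_eq by (simp only: algebra_simps)
    finally show ?thesis by (simp add: ab)
  qed
  have D: "D = 0 \<or> Polynomial.degree D < Polynomial.degree g"
    using degree_mod_less[OF nz(1)] by (auto simp: D_def)
  \<comment> \<open>Otherwise the leading term of \<open>g * E\<close>, in degree at least
    \<open>n\<close>, would survive in \<open>d\<close>.\<close>
  have E: "E = 0 \<or> Polynomial.degree E < Polynomial.degree h"
  proof (rule ccontr)
    assume "\<not> ?thesis"
    then have E: "E \<noteq> 0" "Polynomial.degree h \<le> Polynomial.degree E" by auto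
    define i where "i = Polynomial.degree g + Polynomial.degree E"
    have i: "i \<ge> n" using E n by (simp add: i_def)
    have "Polynomial.coeff (h * D) i = 0"
    proof (cases "D = 0")
      case False
      then have "Polynomial.degree (h * D) < i"
        using D i n degree_mult_le[of h D] by simp
      then show ?thesis by (rule coeff_eq_0)
    qed simp
    moreover have "Polynomial.coeff (g * E) i = Polynomial.lead_coeff g * Polynomial.lead_coeff E"
      unfolding i_def by (rule coeff_mult_degree_sum)
    ultimately have "Polynomial.lead_coeff g * Polynomial.lead_coeff E = 0"
      using d[OF i] by (simp flip: gE)
    then show False using E nz by simp
  qed
  define G' where "G' = G - 2 ^ Suc k * lift2 D"
  define H' where "H' = H - 2 ^ Suc k * lift2 E"
  have aux: "red2 (A - 2 ^ Suc k * lift2 C) = red2 A \<and>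
      Polynomial.degree (A - 2 ^ Suc k * lift2 C) = Polynomial.degree A \<and>
      Polynomial.lead_coeff (A - 2 ^ Suc k * lift2 C) = 1"
    if "Polynomial.lead_coeff A = 1" "C = 0 \<or> Polynomial.degree C < Polynomial.degree A" for A C
  proof (intro conjI)
    have "red2 (2 * (2 ^ k * lift2 C)) = 0" by (rule red2_hom)
    then show "red2 (A - 2 ^ Suc k * lift2 C) = red2 A"
      by (simp add: red2_hom(3) mult.assoc)
    have z: "Polynomial.coeff (A - 2 ^ Suc k * lift2 C) i = Polynomial.coeff A i"
      if "i \<ge> Polynomial.degree A" for i
    proof -
      have "Polynomial.coeff (lift2 C) i = 0"
        using \<open>C = 0 \<or> Polynomial.degree C < Polynomial.degree A\<close> that by (auto simp: coeff_eq_0)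
      then show ?thesis unfolding coeff_diff coeff_two_power_mult by simp
    qed
    have "Polynomial.degree (A - 2 ^ Suc k * lift2 C) \<le> Polynomial.degree A"
      by (rule degree_le) (use z in \<open>auto simp: coeff_eq_0\<close>)
    moreover have "Polynomial.degree A \<le> Polynomial.degree (A - 2 ^ Suc k * lift2 C)"
      by (rule le_degree) (unfold z[OF le_refl] that(1), simp)
    ultimately show deg: "Polynomial.degree (A - 2 ^ Suc k * lift2 C) = Polynomial.degree A" by simp
    show "Polynomial.lead_coeff (A - 2 ^ Suc k * lift2 C) = 1"
      unfolding deg z[OF le_refl] by (rule that(1))
  qed
  have G': "red2 G' = g" "Polynomial.degree G' = Polynomial.degree g" "Polynomial.lead_coeff G' = 1"
    using aux[OF G(2), of D, folded G'_def] D G by auto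
  have H': "red2 H' = h" "Polynomial.degree H' = Polynomial.degree h" "Polynomial.lead_coeff H' = 1"
    using aux[OF H(2), of E, folded H'_def] E H by auto
  have "red2 (K - (G * lift2 E + H * lift2 D)) = 0"
    using gE by (simp add: red2_hom G H d_def)
  from red2_eq_0D[OF this] obtain M where M: "K - (G * lift2 E + H * lift2 D) = 2 * M" ..
  have "G' * H' = G * H - 2 ^ Suc k * (G * lift2 E + H * lift2 D)
      + 2 ^ Suc k * 2 ^ Suc k * (lift2 D * lift2 E)"
    unfolding G'_def H'_def by (rule hensel_identities(1))
  also have "\<dots> = X_n_minus_1 m + 2 ^ Suc k * (K - (G * lift2 E + H * lift2 D))
      + 2 ^ Suc k * 2 ^ Suc k * (lift2 D * lift2 E)"
    unfolding GH by (rule hensel_identities(2))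
  also have "\<dots> = X_n_minus_1 m + 2 ^ Suc (Suc k) * (M + 2 ^ k * (lift2 D * lift2 E))"
    unfolding M power_Suc by (rule hensel_identities(3))
  finally show ?case
    using G' H' by blast
qed

context
  fixes r :: "'r::nontriv itself"
  assumes card_r: "CARD('r) = 2 ^ m"
begin

section \<open>Lifting generators and ideals to the integers modulo \<open>2 ^ m\<close>\<close>

abbreviation red :: "int poly \<Rightarrow> 'r mod_ring poly" where "red \<equiv> map_poly of_int"

lemma of_int_mod_ring_eq_0_iff: "of_int k = (0 :: 'r mod_ring) \<longleftrightarrow> 2 ^ m dvd k"
proof -
  have "of_int_mod_ring k = (0 :: 'r mod_ring) \<longleftrightarrow> int CARD('r) dvd k"
    by transfer (simp add: dvd_eq_mod_eq_0)
  then show ?thesis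
    by (simp add: of_int_of_int_mod_ring card_r)
qed

lemma of_int_to_int_mod_ring: "of_int (to_int_mod_ring x) = (x :: 'r mod_ring)"
  by (simp add: of_int_of_int_mod_ring)

text \<open>The chosen representative differs from \<open>k\<close> by a multiple of
  \<open>2 ^ m\<close>, which is even as \<open>m \<ge> 1\<close>.\<close>

lemma reduce_mod_2_of_int: "reduce_mod_2 (of_int k :: 'r mod_ring) = of_int k"
proof -
  define l where "l = to_int_mod_ring (of_int k :: 'r mod_ring)"
  have "of_int (l - k) = (0 :: 'r mod_ring)"
    by (simp add: l_def of_int_to_int_mod_ring)
  then have "2 ^ m dvd l - k"
    by (simp only: of_int_mod_ring_eq_0_iff)
  then have "even (l - k)"
    by (rule dvd_trans[rotated]) (use m in simp)
  then have "(of_int l :: bit) = 0 \<longleftrightarrow> (of_int k :: bit) = 0"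
    by (simp only: of_int_bit_eq_0_iff) simp
  then have "(of_int l :: bit) = of_int k"
    by (cases "(of_int l :: bit)"; cases "(of_int k :: bit)") (simp_all only: refl simp_thms zero_neq_one one_neq_zero)
  then show ?thesis
    unfolding reduce_mod_2_def l_def[symmetric] .
qed

lemma red_surj: "\<exists>P. red P = p"
proof
  show "red (map_poly to_int_mod_ring p) = p"
    by (rule poly_eqI) (simp add: coeff_map_poly of_int_to_int_mod_ring of_int_mod_ring_eq_0_iff)
qed

lemma red_hom: "red (p + q) = red p + red q" "red (p * q) = red p * red q"
    "red (p - q) = red p - red q" "red 1 = 1" "red 0 = 0"
  by (simp_all add: of_int_poly_hom.hom_add of_int_poly_hom.hom_mult of_int_poly_hom.hom_minus)

lemma red_two_power: "red (2 ^ k * p) = Polynomial.smult (2 ^ k) (red p)"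
  by (rule poly_eqI) (simp add: coeff_map_poly coeff_two_power_mult)

lemma red_eq_0D: "red p = 0 \<Longrightarrow> \<exists>q. p = 2 ^ m * q"
proof -
  assume "red p = 0"
  then have "Polynomial.coeff (red p) i = 0" for i by simp
  then have "2 ^ m dvd Polynomial.coeff p i" for i
    by (simp add: coeff_map_poly of_int_mod_ring_eq_0_iff)
  then show ?thesis by (rule two_power_dvd_poly)
qed

lemma red_eqD: "red p = red q \<Longrightarrow> p - q \<in> ann m"
  using red_eq_0D[of "p - q"] ann_of_two_power by (auto simp: red_hom)

lemma red_ann: "p \<in> ann m \<Longrightarrow> X_n_minus_1 m dvd red p"
proof -
  assume "p \<in> ann m"
  then obtain q s where "p = X_n_minus_1 m * q + 2 ^ m * s"
    using ann_decompose by blast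
  moreover have "red (2 ^ m * s) = 0"
    by (rule poly_eqI) (simp add: coeff_map_poly coeff_two_power_mult of_int_mod_ring_eq_0_iff
        del: of_int_mult)
  ultimately show ?thesis
    by (simp add: red_hom map_poly_X_n_minus_1)
qed

lemma map_poly_reduce_red: "map_poly reduce_mod_2 (red p) = red2 p"
proof -
  have "reduce_mod_2 (0 :: 'r mod_ring) = 0"
    using reduce_mod_2_of_int[of 0] by simp
  then show ?thesis
    by (intro poly_eqI) (simp add: coeff_map_poly reduce_mod_2_of_int)
qed

definition is_lift :: "bit poly \<Rightarrow> 'r mod_ring poly \<Rightarrow> bool" where
  "is_lift g G \<longleftrightarrow> Polynomial.lead_coeff G = 1 \<and> G dvd X_n_minus_1 m \<and> map_poly reduce_mod_2 G = g"

context
  fixes Z :: "nat set" and g :: "bit poly"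
  assumes Z: "closed Z" and monic: "Polynomial.lead_coeff g = 1"
    and g: "\<And>p. p \<in> vanishing Z \<longleftrightarrow> g dvd p"
begin

lemma cofactor: "\<exists>h a b. X_n_minus_1 m = g * h \<and> Polynomial.lead_coeff h = 1 \<and> a * g + b * h = 1"
proof -
  have "X_n_minus_1 m \<in> vanishing Z"
    using Z evb_X_n_minus_1 by (force simp: vanishing_def closed_def)
  then obtain h where h: "X_n_minus_1 m = g * h"
    using g by (auto elim!: dvdE)
  have "h \<noteq> 0"
    using h lead_coeff_X_n_minus_1[where 'a = bit] by force
  then have "Polynomial.lead_coeff h = 1"
    by (metis bit_not_zero_iff leading_coeff_0_iff)
  then show ?thesis using h bezout[OF Z g h] by blast
qed

lemma lift_exists: "\<exists>G. is_lift g G"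
proof -
  obtain h a b where h: "X_n_minus_1 m = g * h" "Polynomial.lead_coeff h = 1" "a * g + b * h = 1"
    using cofactor by blast
  obtain k where k: "m = Suc k" using m by (cases m) auto
  obtain G H K where G: "red2 G = g" "Polynomial.lead_coeff G = 1"
    and GH: "G * H = X_n_minus_1 m + 2 ^ m * K"
    using hensel[OF monic h(2) h(1) h(3), of k] unfolding k by blast
  have "red (2 ^ m * K) = 0"
    by (rule poly_eqI) (simp add: coeff_map_poly coeff_two_power_mult of_int_mod_ring_eq_0_iff
        del: of_int_mult)
  then have "red G * red H = X_n_minus_1 m"
    by (simp add: red_hom(1) red_hom(2)[symmetric] GH map_poly_X_n_minus_1)
  then have "red G dvd X_n_minus_1 m" by (metis dvd_triv_left)
  moreover have "Polynomial.lead_coeff (red G) = 1"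
  proof -
    have c: "Polynomial.coeff (red G) (Polynomial.degree G) = 1"
      using G(2) by (simp add: coeff_map_poly)
    then have "Polynomial.degree G \<le> Polynomial.degree (red G)"
      by (intro le_degree) simp
    then have "Polynomial.degree (red G) = Polynomial.degree G"
      using degree_map_poly_le[of "of_int :: int \<Rightarrow> 'r mod_ring" G] by (rule le_antisym[rotated])
    then show ?thesis using c by simp
  qed
  ultimately show ?thesis
    unfolding is_lift_def using map_poly_reduce_red[of G] G(1) by blast
qed

text \<open>Modulo \<open>2 ^ m\<close> and X^n - 1, \<open>G\<close> and \<open>1 - idem Z\<close>
  generate the same ideal. Nonzero field elements have \<open>n\<close>-th power 1, so on
  \<open>Z\<close> the cofactor \<open>H\<close>, and off \<open>Z\<close> the polynomial
  \<open>G\<close>, is invertible modulo 2 with inverse its power \<open>n - 1\<close>; this is then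
  bootstrapped to \<open>2 ^ m\<close>.\<close>

lemma lift_properties:
  assumes G: "is_lift g (red G)"
  shows "idem Z * G \<in> ann m" and "\<exists>q. 1 - idem Z - G * q \<in> ann m"
proof -
  obtain h a b where h: "X_n_minus_1 m = g * h" "a * g + b * h = 1"
    using cofactor by blast
  have g2: "red2 G = g"
    using G by (simp add: is_lift_def map_poly_reduce_red)
  have nz: "g \<noteq> 0" using monic by auto
  obtain H where "red G * red H = X_n_minus_1 m"
    using G red_surj unfolding is_lift_def by (metis dvdE)
  then have "red (G * H) = red (X_n_minus_1 m)"
    by (simp add: red_hom map_poly_X_n_minus_1)
  then obtain K where K: "G * H = X_n_minus_1 m + 2 ^ m * K"
    using red_eq_0D[of "G * H - X_n_minus_1 m"] by (auto simp: red_hom(3) diff_eq_eq add.commute)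
  then have GH: "G * H \<in> ann m"
    by (simp add: ann_add X_n_minus_1_in_ann ann_of_two_power)
  have rootG: "evp G (\<zeta> ^ u) = 0 \<longleftrightarrow> u \<in> Z" if "u < n" for u
    using generator_roots[OF Z g that] g2 by (simp flip: evb_red2)
  have rootH: "evp H (\<zeta> ^ u) \<noteq> 0" if "u \<in> Z" for u
  proof -
    have "red2 (G * H) = g * h"
    proof -
      have "red2 (2 ^ m * K) = 0"
        using m red2_hom(6)[of "2 ^ (m - 1) * K"] by (cases m) (simp_all add: mult.assoc)
      then show ?thesis
        by (simp add: K red2_hom(1) map_poly_X_n_minus_1 h(1))
    qed
    then have "red2 H = h"
      using nz g2 by (simp add: red2_hom)
    moreover have "evb (a * g + b * h) (\<zeta> ^ u) = 1"
      by (simp add: h(2))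
    moreover have "evb g (\<zeta> ^ u) = 0"
      using g[of g] that by (simp add: vanishing_def)
    ultimately show ?thesis
      by (auto simp: evb_add evb_mult simp flip: evb_red2)
  qed
  have E: "(idem Z)\<^sup>2 - idem Z \<in> ann m"
    by (rule idem_idempotent[OF Z])
  have "k \<le> m \<Longrightarrow> idem Z * G \<in> ann k" for k
  proof (induction k)
    case (Suc k)
    \<comment> \<open>The factor \<open>1 - H ^ n\<close> gains a power of 2, and the difference it
      makes contains the product \<open>G * H\<close>, which vanishes.\<close>
    have "idem Z * (1 - H ^ n) \<in> ann 1"
      unfolding ann_1_iff using rootH
      by (auto simp: evp_mult evp_idem Z evp_diff evp_power nonzero_power_n)
    then have "idem Z * G * (idem Z * (1 - H ^ n)) \<in> ann (Suc k)"
      using ann_mult_ann[of "idem Z * G" k "idem Z * (1 - H ^ n)" 1] Suc by simp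
    moreover have "(idem Z)\<^sup>2 * H ^ (n - 1) * (G * H) \<in> ann (Suc k)"
      by (intro ann_mult_left[of "G * H"] ann_mono[OF Suc.prems] GH)
    moreover have "((idem Z)\<^sup>2 - idem Z) * G \<in> ann (Suc k)"
      by (intro ann_mult_right ann_mono[OF Suc.prems] E)
    ultimately have "idem Z * G * (idem Z * (1 - H ^ n)) + (idem Z)\<^sup>2 * H ^ (n - 1) * (G * H)
        - ((idem Z)\<^sup>2 - idem Z) * G \<in> ann (Suc k)"
      by (intro ann_add ann_diff)
    moreover have "H ^ n = H ^ (n - 1) * H"
      using n_ge_3 by (simp flip: power_Suc2)
    ultimately show ?case
      by (simp add: algebra_simps power2_eq_square)
  qed simp
  then show "idem Z * G \<in> ann m" by simp
  define F where "F = 1 - idem Z"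
  have F: "F\<^sup>2 - F \<in> ann m"
    using E by (simp add: F_def algebra_simps power2_eq_square)
  \<comment> \<open>Off \<open>Z\<close> the values of \<open>G\<close> are nonzero; the
    \<open>m\<close>-th power of this element is then divisible by \<open>2 ^ m\<close>.\<close>
  have "F * (1 - G ^ n) \<in> ann 1"
    unfolding ann_1_iff
  proof (intro allI impI)
    fix u assume u: "u < n"
    show "evp (F * (1 - G ^ n)) (\<zeta> ^ u) = 0"
      using rootG[OF u] evp_idem[OF Z u]
      by (cases "u \<in> Z") (simp_all add: F_def evp_mult evp_diff evp_power nonzero_power_n)
  qed
  have pow: "(F * (1 - G ^ n)) ^ k \<in> ann k" for k
  proof (induction k)
    case (Suc k)
    then show ?case
      using ann_mult_ann[OF \<open>F * (1 - G ^ n) \<in> ann 1\<close> Suc] by simp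
  qed simp
  have Fpow: "F ^ Suc k - F \<in> ann m" for k
  proof (induction k)
    case (Suc k)
    have "F * (F ^ Suc k - F) + (F\<^sup>2 - F) \<in> ann m"
      by (intro ann_add ann_mult_left Suc F)
    then show ?case by (simp add: algebra_simps power2_eq_square)
  qed simp
  \<comment> \<open>Expanding the power exhibits \<open>F\<close> as a multiple of
    \<open>G\<close>.\<close>
  have "\<exists>q. (1 - G ^ n) ^ k = 1 - G * q" for k
  proof (induction k)
    case 0
    show ?case by (intro exI[of _ 0]) simp
  next
    case (Suc k)
    then obtain q where q: "(1 - G ^ n) ^ k = 1 - G * q" by blast
    have "G ^ n = G * G ^ (n - 1)"
      using n_ge_3 by (simp flip: power_Suc)
    then have "(1 - G ^ n) ^ Suc k = 1 - G * (q + G ^ (n - 1) * (1 - G * q))"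
      unfolding power_Suc q by (simp add: algebra_simps)
    then show ?case by blast
  qed
  then obtain q where q: "(1 - G ^ n) ^ m = 1 - G * q" by blast
  have "F ^ m * (1 - G * q) \<in> ann m"
    using pow[of m] by (simp add: power_mult_distrib q)
  moreover have "F ^ m - F \<in> ann m"
    using Fpow[of "m - 1"] m by simp
  ultimately have "F ^ m * (1 - G * q) - (F ^ m - F) \<in> ann m"
    by (rule ann_diff)
  then have "F - G * (F ^ m * q) \<in> ann m"
    by (simp add: algebra_simps)
  then show "\<exists>q. 1 - idem Z - G * q \<in> ann m"
    unfolding F_def by blast
qed

text \<open>\<open>G2\<close> is the sum of its parts under \<open>idem Z\<close> and
  \<open>1 - idem Z\<close>. The first is 0 modulo X^n - 1, which \<open>G1\<close> divides; the
  second is a multiple of \<open>G1\<close> already.\<close>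

lemma lift_unique:
  assumes "is_lift g G1" "is_lift g G2"
  shows "G1 dvd G2"
proof -
  obtain P1 P2 where P: "red P1 = G1" "red P2 = G2" using red_surj by metis
  obtain q where q: "1 - idem Z - P1 * q \<in> ann m"
    using lift_properties(2)[of P1] assms P by blast
  have "G1 dvd X_n_minus_1 m" using assms by (simp add: is_lift_def)
  then have "G1 dvd red (1 - idem Z - P1 * q)"
    using red_ann[OF q] dvd_trans by blast
  then have "G1 dvd red (1 - idem Z - P1 * q) + G1 * red q" by simp
  then have 1: "G1 dvd red (1 - idem Z)"
    by (simp add: red_hom P)
  have "idem Z * P2 \<in> ann m"
    using lift_properties(1)[of P2] assms P by blast
  then have "G1 dvd red (idem Z * P2)"
    using red_ann \<open>G1 dvd X_n_minus_1 m\<close> dvd_trans by blast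
  moreover have "G1 dvd red (1 - idem Z) * G2"
    using 1 by simp
  ultimately have "G1 dvd red (idem Z * P2) + red (1 - idem Z) * G2"
    by (rule dvd_add)
  also have "red (idem Z * P2) + red (1 - idem Z) * G2 = G2"
    by (simp add: red_hom P algebra_simps)
  finally show ?thesis .
qed

lemma is_lift_lifted_poly: "is_lift g (lifted_poly m g)"
proof -
  obtain G where G: "is_lift g G" using lift_exists by blast
  have "lifted_poly m g = G"
    unfolding lifted_poly_def
  proof (rule the_equality)
    show "Polynomial.lead_coeff G = 1 \<and> G dvd X_n_minus_1 m \<and> map_poly reduce_mod_2 G = g"
      using G by (simp add: is_lift_def)
    fix G' :: "'r mod_ring poly"
    assume "Polynomial.lead_coeff G' = 1 \<and> G' dvd X_n_minus_1 m \<and> map_poly reduce_mod_2 G' = g"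
    then have G': "is_lift g G'" by (simp add: is_lift_def)
    show "G' = G"
      using lift_unique[OF G G'] lift_unique[OF G' G] G G'
      by (intro monic_dvd_antisym) (auto simp: is_lift_def)
  qed
  then show ?thesis using G by simp
qed

end

text \<open>Forward it is enough to test generators: for i \<le> j the idempotent of
  \<open>Z j\<close> factors through that of \<open>Z i\<close> and kills \<open>G i\<close>, and
  for i > j the factor 2^i suffices. Backward \<open>p\<close> is rebuilt from its components,
  starting at the highest level.\<close>

lemma lifted_ideal_iff:
  fixes G :: "nat \<Rightarrow> 'r mod_ring poly"
  assumes Z: "\<And>j. j < m \<Longrightarrow> closed (Z j)"
    and anti: "\<And>i j. i \<le> j \<Longrightarrow> j < m \<Longrightarrow> Z j \<subseteq> Z i"
    and G1: "\<And>j P. j < m \<Longrightarrow> red P = G j \<Longrightarrow> idem (Z j) * P \<in> ann m"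
    and G2: "\<And>j P. j < m \<Longrightarrow> red P = G j \<Longrightarrow> \<exists>q. 1 - idem (Z j) - P * q \<in> ann m"
  shows "red p \<in> Modules.module.span (*) (insert (X_n_minus_1 m) {Polynomial.smult (2 ^ j) (G j) | j. j < m})
     \<longleftrightarrow> (\<forall>j<m. idem (Z j) * p \<in> ann (Suc j))"
    (is "_ \<in> Modules.module.span _ ?gens \<longleftrightarrow> _")
proof -
  interpret R: Modules.module "(*) :: 'r mod_ring poly \<Rightarrow> _"
    by (rule module_mult)
  define Q where "Q p \<longleftrightarrow> (\<forall>j<m. idem (Z j) * p \<in> ann (Suc j))" for p
  have Q_ann: "Q p" if "p \<in> ann m" for p
    unfolding Q_def using that by (auto intro!: ann_mult_left ann_mono[of _ m p])
  define S where "S = {x. \<exists>p. red p = x \<and> Q p}"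
  have "R.subspace S"
  proof (rule R.subspaceI)
    have "red 0 = 0 \<and> Q 0" by (simp add: Q_def)
    then show "0 \<in> S" unfolding S_def mem_Collect_eq by (rule exI[of _ 0])
  next
    fix x y assume "x \<in> S" "y \<in> S"
    then obtain p q where "red p = x" "Q p" "red q = y" "Q q" by (auto simp: S_def)
    then have "red (p + q) = x + y \<and> Q (p + q)"
      by (auto simp: red_hom Q_def ring_distribs intro: ann_add)
    then show "x + y \<in> S" unfolding S_def mem_Collect_eq by (rule exI[of _ "p + q"])
  next
    fix c x assume "x \<in> S"
    then obtain p where p: "red p = x" "Q p" by (auto simp: S_def)
    obtain d where "red d = c" using red_surj by blast
    then have "red (p * d) = c * x \<and> Q (p * d)"
      using p by (auto simp: red_hom Q_def mult.assoc[symmetric] intro: ann_mult_right)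
    then show "c * x \<in> S" unfolding S_def mem_Collect_eq by (rule exI[of _ "p * d"])
  qed
  moreover have "?gens \<subseteq> S"
  proof
    fix x assume "x \<in> ?gens"
    then consider "x = X_n_minus_1 m" | i where "i < m" "x = Polynomial.smult (2 ^ i) (G i)" by blast
    then show "x \<in> S"
    proof cases
      case 1
      have "red (X_n_minus_1 m) = x \<and> Q (X_n_minus_1 m)"
        using 1 by (simp add: map_poly_X_n_minus_1 Q_ann X_n_minus_1_in_ann)
      then show ?thesis unfolding S_def mem_Collect_eq by (rule exI[of _ "X_n_minus_1 m"])
    next
      case 2
      obtain P where P: "red P = G i" using red_surj by blast
      have "idem (Z j) * (2 ^ i * P) \<in> ann (Suc j)" if j: "j < m" for j
      proof (cases "i \<le> j")
        case True
        have "Z j \<inter> Z i = Z j" using anti[OF True j] by auto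
        then have "idem (Z j) * idem (Z i) - idem (Z j) \<in> ann m"
          using idem_mult[OF Z[OF j] Z[OF 2(1)]] by simp
        then have "idem (Z j) * (idem (Z i) * P) - (idem (Z j) * idem (Z i) - idem (Z j)) * P \<in> ann m"
          using ann_diff[OF ann_mult_left[OF G1[OF 2(1) P]] ann_mult_right] by blast
        then have "idem (Z j) * P \<in> ann m"
          by (simp add: algebra_simps)
        then have "2 ^ i * (idem (Z j) * P) \<in> ann m"
          by (rule ann_mult_left)
        then have "2 ^ i * (idem (Z j) * P) \<in> ann (Suc j)"
          using j by (intro ann_mono[of "Suc j" m]) auto
        then show ?thesis by (simp add: mult_ac)
      next
        case False
        then have "2 ^ i * (idem (Z j) * P) \<in> ann (Suc j)"
          using ann_of_two_power[of i] by (intro ann_mono[of "Suc j" i]) auto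
        then show ?thesis by (simp add: mult_ac)
      qed
      then have "red (2 ^ i * P) = x \<and> Q (2 ^ i * P)"
        using 2 by (simp add: red_two_power P Q_def)
      then show ?thesis unfolding S_def mem_Collect_eq by (rule exI[of _ "2 ^ i * P"])
    qed
  qed
  ultimately have sub: "R.span ?gens \<subseteq> S"
    by (simp add: R.span_minimal)
  show ?thesis
  proof
    assume "red p \<in> R.span ?gens"
    then obtain q where q: "red q = red p" "Q q"
      using sub by (auto simp: S_def)
    have "Q (p - q)"
      using red_eqD[of p q] q by (intro Q_ann) simp
    then have "Q (q + (p - q))"
      using q unfolding Q_def by (auto simp only: ring_distribs intro: ann_add)
    then show "\<forall>j<m. idem (Z j) * p \<in> ann (Suc j)"
      by (simp add: Q_def)
  next
    assume p: "\<forall>j<m. idem (Z j) * p \<in> ann (Suc j)"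
    have X: "red a \<in> R.span ?gens" if "a \<in> ann m" for a
    proof -
      obtain k where "red a = X_n_minus_1 m * k" using red_ann[OF \<open>a \<in> ann m\<close>] by (auto elim!: dvdE)
      then have "red a = k * X_n_minus_1 m" by (simp add: mult.commute)
      then show ?thesis by (simp add: R.span_scale R.span_base)
    qed
    have G: "red (2 ^ j * (1 - idem (Z j)) * a) \<in> R.span ?gens" if j: "j < m" for j a
    proof -
      obtain P where P: "red P = G j" using red_surj by blast
      obtain q where q: "1 - idem (Z j) - P * q \<in> ann m" using G2[OF j P] by blast
      have "2 ^ j * (1 - idem (Z j)) * a = 2 ^ j * P * (q * a) + 2 ^ j * a * (1 - idem (Z j) - P * q)"
        by (simp add: algebra_simps)
      then have "red (2 ^ j * (1 - idem (Z j)) * a) =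
          red (q * a) * Polynomial.smult (2 ^ j) (G j) + red (2 ^ j * a * (1 - idem (Z j) - P * q))"
        by (simp only: red_hom(1) red_hom(2)[of "2 ^ j * P" "q * a"] red_two_power P mult.commute[of _ "red (q * a)"])
      moreover have "red (q * a) * Polynomial.smult (2 ^ j) (G j) \<in> R.span ?gens"
        using j by (intro R.span_scale R.span_base) blast
      moreover have "red (2 ^ j * a * (1 - idem (Z j) - P * q)) \<in> R.span ?gens"
        by (intro X ann_mult_left q)
      ultimately show ?thesis by (simp add: R.span_add)
    qed
    \<comment> \<open>\<open>F j * p\<close> is divisible by 2^j; the convention
      \<open>F 0 = 1\<close> makes the last level \<open>p\<close> itself.\<close>
    define F where "F j = (if j = 0 then 1 else idem (Z (j - 1)))" for j
    have F: "F j * p \<in> ann j" if "j \<le> m" for j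
      using p that by (cases j) (auto simp: F_def)
    have "red (F (m - i) * p) \<in> R.span ?gens" if "i \<le> m" for i
      using that
    proof (induction i)
      case 0
      then show ?case using F[of m] by (intro X) simp
    next
      case (Suc i)
      define j where "j = m - Suc i"
      have j: "j < m" "m - i = Suc j" using Suc.prems by (auto simp: j_def)
      have IH: "red (idem (Z j) * p) \<in> R.span ?gens"
        using Suc j by (simp add: F_def)
      obtain a b where ab: "F j * p = X_n_minus_1 m * a + 2 ^ j * b"
        using ann_decompose[OF F[of j]] j by auto
      have FF: "F j * idem (Z j) - idem (Z j) \<in> ann m"
      proof (cases "j = 0")
        case False
        have "Z (j - 1) \<inter> Z j = Z j" using anti[of "j - 1" j] j by auto
        then show ?thesis
          using idem_mult[OF Z Z, of "j - 1" j] j False by (simp add: F_def)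
      qed (simp add: F_def)
      have id: "f * p = e * p + (f * e - e) * p + f * p * (1 - e)"
        "(x * a + c * b) * (1 - e) = x * (a * (1 - e)) + c * (1 - e) * b"
        for f e x c :: "int poly"
        by (simp_all add: algebra_simps)
      \<comment> \<open>Outside \<open>Z j\<close> an element divisible by 2^j is covered by the
        generator of level \<open>j\<close>; inside, the previous level applies.\<close>
      have "F j * p = idem (Z j) * p + (F j * idem (Z j) - idem (Z j)) * p + F j * p * (1 - idem (Z j))"
        by (rule id)
      also have "F j * p * (1 - idem (Z j)) =
          X_n_minus_1 m * (a * (1 - idem (Z j))) + 2 ^ j * (1 - idem (Z j)) * b"
        unfolding ab by (rule id)
      finally have "red (F j * p) = red (idem (Z j) * p) + red ((F j * idem (Z j) - idem (Z j)) * p) +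
          (red (X_n_minus_1 m * (a * (1 - idem (Z j)))) + red (2 ^ j * (1 - idem (Z j)) * b))"
        by (simp only: red_hom(1))
      then show ?case
        unfolding j_def[symmetric]
        by (simp only:) (intro R.span_add IH X G j ann_mult_right FF X_n_minus_1_in_ann)
    qed
    from this[of m] show "red p \<in> R.span ?gens"
      by (simp add: F_def)
  qed
qed

text \<open>The ideal gives the divisibility conditions at nonzero elements; at 0 they hold
  automatically, as idempotents without the exponent 0 kill that coordinate. The extension rule is
  the congruence for the sum.\<close>

lemma lifted_code_iff_crit:
  assumes Z: "\<And>j. j < m \<Longrightarrow> closed (Z j)" "\<And>j. j < m \<Longrightarrow> 0 \<notin> Z j"
    and anti: "\<And>i j. i \<le> j \<Longrightarrow> j < m \<Longrightarrow> Z j \<subseteq> Z i"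
    and C: "\<And>j. j < m \<Longrightarrow> C j = extended_code (cyclic_code m \<zeta> (zeros (Z j)))"
  shows "(\<lambda>v. of_int (a v)) \<in> (lifted_code m \<zeta> C :: ('f \<Rightarrow> 'r mod_ring) set) \<longleftrightarrow> a \<in> crit Z"
proof -
  define G :: "nat \<Rightarrow> 'r mod_ring poly" where "G j = lifted_poly m (generator_poly m \<zeta> (C j))" for j
  have G: "is_lift (generator_poly m \<zeta> (C j)) (G j)" and
    GP: "red P = G j \<Longrightarrow> idem (Z j) * P \<in> ann m \<and> (\<exists>q. 1 - idem (Z j) - P * q \<in> ann m)"
    if j: "j < m" for j P
  proof -
    have sub: "Z j \<subseteq> {..<n}" using Z(1)[OF j] by (simp add: closed_def)
    note g = generator_poly_correct[OF sub, folded C[OF j]]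
    show 1: "is_lift (generator_poly m \<zeta> (C j)) (G j)"
      unfolding G_def by (rule is_lift_lifted_poly[OF Z(1)[OF j]]) (use g in auto)
    show "idem (Z j) * P \<in> ann m \<and> (\<exists>q. 1 - idem (Z j) - P * q \<in> ann m)" if "red P = G j"
    proof -
      have P: "is_lift (generator_poly m \<zeta> (C j)) (red P)"
        using 1 that by simp
      have monic: "Polynomial.lead_coeff (generator_poly m \<zeta> (C j)) = 1"
        and dvd: "p \<in> vanishing (Z j) \<longleftrightarrow> generator_poly m \<zeta> (C j) dvd p" for p
        using g by auto
      show ?thesis
        using lift_properties[OF Z(1)[OF j] monic dvd P] by (rule conjI)
    qed
  qed
  have word: "word_poly m \<zeta> (\<lambda>v. of_int (a v)) = red (word_poly m \<zeta> a)"
    by (rule poly_eqI) (simp add: coeff_word_poly coeff_map_poly)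
  have "(\<lambda>v. of_int (a v)) \<in> (lifted_code m \<zeta> C :: ('f \<Rightarrow> 'r mod_ring) set) \<longleftrightarrow>
      red (word_poly m \<zeta> a) \<in> Modules.module.span (*)
        (insert (X_n_minus_1 m) {Polynomial.smult (2 ^ j) (G j) | j. j < m}) \<and>
      of_int (a 0) = - (\<Sum>v | v \<noteq> 0. of_int (a v) :: 'r mod_ring)"
    unfolding lifted_code_def extended_code_def mem_Collect_eq word G_def ..
  also have "red (word_poly m \<zeta> a) \<in> Modules.module.span (*)
        (insert (X_n_minus_1 m) {Polynomial.smult (2 ^ j) (G j) | j. j < m}) \<longleftrightarrow>
      (\<forall>j<m. idem (Z j) * word_poly m \<zeta> a \<in> ann (Suc j))"
    by (rule lifted_ideal_iff) (use Z anti GP in auto)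
  also have "\<dots> \<longleftrightarrow> (\<forall>j<m. \<forall>v. 2 ^ Suc j dvd act (idem (Z j)) a v)"
    using idem_word_poly_in_ann[OF Z] by (simp add: Suc_le_eq del: power_Suc)
  also have "of_int (a 0) = - (\<Sum>v | v \<noteq> 0. of_int (a v) :: 'r mod_ring) \<longleftrightarrow>
      2 ^ m dvd (\<Sum>v\<in>UNIV. a v)"
  proof -
    have "{v. v \<noteq> 0} = UNIV - {0::'f}" by auto
    then have "(\<Sum>v\<in>UNIV. a v) = a 0 + (\<Sum>v | v \<noteq> 0. a v)"
      by (simp add: sum.remove[of UNIV "0::'f"])
    then have "of_int (\<Sum>v\<in>UNIV. a v) = (of_int (a 0) + (\<Sum>v | v \<noteq> 0. of_int (a v)) :: 'r mod_ring)"
      by simp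
    then show ?thesis
      unfolding of_int_mod_ring_eq_0_iff[of "\<Sum>v\<in>UNIV. a v", symmetric]
      by (metis add_eq_0_iff2)
  qed
  finally show ?thesis
    by (auto simp: crit_def)
qed

end

section \<open>Cyclic quotients\<close>

text \<open>\<open>crit\<close> without the condition on the coordinate sum, which is imposed modulo
  different powers of 2 in \<open>crit\<close> and \<open>even_crit\<close>.\<close>

definition cond :: "(nat \<Rightarrow> nat set) \<Rightarrow> ('f \<Rightarrow> int) \<Rightarrow> bool" where
  "cond N a \<longleftrightarrow> (\<forall>j<m. \<forall>v. 2 ^ Suc j dvd act (idem (N j)) a v)"

lemma cond_add: "cond N a \<Longrightarrow> cond N b \<Longrightarrow> cond N (\<lambda>v. a v + b v)"
  by (simp add: cond_def act_add_right)

lemma cond_diff: "cond N a \<Longrightarrow> cond N b \<Longrightarrow> cond N (\<lambda>v. a v - b v)"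
  by (simp add: cond_def act_diff_right)

lemma cond_smult: "cond N a \<Longrightarrow> cond N (\<lambda>v. c * a v)"
  by (simp add: cond_def act_smult_right)

lemma cond_shift: "cond N a \<Longrightarrow> cond N (shift a)"
  by (simp add: cond_def act_shift)

lemma cond_dvd: "(\<And>v. 2 ^ m dvd a v) \<Longrightarrow> cond N a"
  unfolding cond_def
proof (intro allI impI)
  fix j v assume "\<And>v. 2 ^ m dvd a v" "j < m"
  then have "2 ^ m dvd act (idem (N j)) a v" by (intro act_dvd)
  then show "2 ^ Suc j dvd act (idem (N j)) a v"
    using \<open>j < m\<close> dvd_trans le_imp_power_dvd Suc_leI by metis
qed

text \<open>A smaller idempotent factors through a larger one, so larger sets impose stronger
  conditions.\<close>

lemma cond_mono:
  assumes "\<And>j. j < m \<Longrightarrow> closed (N j)" "\<And>j. j < m \<Longrightarrow> closed (N' j)"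
    and "\<And>j. j < m \<Longrightarrow> N j \<subseteq> N' j" and "cond N' a"
  shows "cond N a"
  unfolding cond_def
proof (intro allI impI)
  fix j v assume j: "j < m"
  have "2 ^ Suc j dvd act (idem (N j)) (act (idem (N' j)) a) v"
    by (rule act_dvd) (use assms(4) j in \<open>simp add: cond_def\<close>)
  moreover have "2 ^ m dvd act (idem (N j)) (act (idem (N' j)) a) v - act (idem (N j)) a v"
    by (intro act_idem_idem assms(1-3) j)
  then have "2 ^ Suc j dvd act (idem (N j)) (act (idem (N' j)) a) v - act (idem (N j)) a v"
    using j by (meson dvd_trans le_imp_power_dvd Suc_leI)
  ultimately show "2 ^ Suc j dvd act (idem (N j)) a v"
    by (metis dvd_diff diff_diff_eq2 add_diff_cancel_left' diff_add_cancel)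
qed

lemma cond_const:
  assumes "\<And>j. j < m \<Longrightarrow> closed (N j)" "\<And>j. j < m \<Longrightarrow> 0 \<notin> N j"
  shows "cond N (\<lambda>v. c)"
  unfolding cond_def
proof (intro allI impI)
  fix j v assume j: "j < m"
  have "act (idem (N j)) (\<lambda>v. c) v = act (idem (N j)) (\<lambda>v. c) 0"
    by (simp add: act_def)
  also have "2 ^ m dvd \<dots>"
    using two_power_dvd_idem_at_1[OF assms[OF j]] by (simp add: act_at_0)
  finally show "2 ^ Suc j dvd act (idem (N j)) (\<lambda>v. c) v"
    using j by (meson dvd_trans le_imp_power_dvd Suc_leI)
qed

lemma two_power_mult_in_ann_iff: "2 ^ j * p \<in> ann (Suc j) \<longleftrightarrow> p \<in> ann 1"
  by (simp add: ann_def act_two_power_mult)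

lemma sum_act: "(\<Sum>v\<in>UNIV - {0}. act p f v) = poly p 1 * (\<Sum>v\<in>UNIV - {0}. f v)"
proof (induction p arbitrary: f)
  case (pCons c p)
  have "(\<Sum>v\<in>UNIV - {0}. shift f v) = (\<Sum>v\<in>UNIV - {0}. f v)"
    unfolding shift_def
    by (rule sum.reindex_bij_witness[of _ "\<lambda>w. w * \<zeta>" "\<lambda>v. v / \<zeta>"]) auto
  then show ?case
    by (simp add: act_pCons sum.distrib pCons sum_distrib_left[symmetric] algebra_simps)
qed simp

end

text \<open>Both \<open>N\<close> and \<open>N'\<close> describe lattices; the quotient of the lattice for \<open>N\<close> by that for
  \<open>N'\<close> has the eigenvalues \<open>\<zeta> ^ u\<close> with \<open>u \<in> T\<close>, and is generated by \<open>w\<close>.\<close>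

locale bw_chain = bw_field m B \<zeta>
  for m :: nat and B :: "nat \<Rightarrow> 'f::{field,finite}" and \<zeta> :: 'f +
  fixes N N' :: "nat \<Rightarrow> nat set"
  assumes closed_N: "j < m \<Longrightarrow> closed (N j)" and closed_N': "j < m \<Longrightarrow> closed (N' j)"
    and N'_subset: "j < m \<Longrightarrow> N' j \<subseteq> {0<..<n}"
    and N_N': "j < m \<Longrightarrow> N j \<subseteq> N' j"
    and N'_N: "i < j \<Longrightarrow> j < m \<Longrightarrow> N' j \<subseteq> N i"
begin

text \<open>The locale assumptions interlace the sets, N' 0 \<supseteq> N 0 \<supseteq> N' 1
  \<supseteq> N 1 and so on; hence these differences are pairwise disjoint.\<close>

definition S :: "nat \<Rightarrow> nat set" where "S j = N' j - N j"

definition T :: "nat set" where "T = (\<Union>j<m. S j)"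

text \<open>Squaring an idempotent changes nothing modulo \<open>2 ^ m\<close>, but makes its value
  at 1 divisible by \<open>2 ^ (2 * m)\<close>. In this way the coordinate sums of multiples of
  \<open>w\<close> vanish modulo \<open>2 ^ Suc m\<close>, see \<open>sum_w\<close>.\<close>

definition omega :: "int poly" where "omega = (\<Sum>j<m. 2 ^ j * (idem (S j) * idem (S j)))"

definition w :: "'f \<Rightarrow> int" where "w = act omega (delta 1)"

text \<open>Doubling is injective and permutes the finite set \<open>C\<close>, so no exponent
  enters \<open>C\<close> from outside.\<close>

lemma closed_Diff:
  assumes "closed A" "closed C"
  shows "closed (A - C)"
proof -
  have A: "A \<subseteq> {..<n}" using assms(1) by (simp add: closed_def)
  have fin: "finite C" and inj: "inj_on (\<lambda>u. 2 * u mod n) C" and C: "C \<subseteq> {..<n}"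
    using assms(2) doubling_inj by (auto simp: closed_def intro: finite_subset inj_on_subset)
  have img: "(\<lambda>u. 2 * u mod n) ` C = C"
    using assms(2) fin inj by (intro endo_inj_surj) (auto simp: closed_def)
  have "2 * u mod n \<notin> C" if "u \<in> A" "u \<notin> C" for u
  proof
    assume "2 * u mod n \<in> C"
    then obtain c where c: "c \<in> C" "2 * u mod n = 2 * c mod n"
      using img by force
    then have "u = c"
      using inj_onD[OF doubling_inj, of u c] A C that(1) by auto
    then show False using c(1) that(2) by simp
  qed
  then show ?thesis using assms by (auto simp: closed_def)
qed

lemma closed_S: "j < m \<Longrightarrow> closed (S j)"
  unfolding S_def by (intro closed_Diff closed_N closed_N')

lemma closed_T: "closed T"
  unfolding T_def closed_def using closed_S by (auto simp: closed_def subset_iff)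

lemma S_subset: "j < m \<Longrightarrow> S j \<subseteq> {0<..<n}"
  using N'_subset by (auto simp: S_def)

lemma T_subset: "T \<subseteq> {0<..<n}"
  using S_subset by (auto simp: T_def)

lemma zero_notin: "j < m \<Longrightarrow> 0 \<notin> N j" "j < m \<Longrightarrow> 0 \<notin> N' j" "j < m \<Longrightarrow> 0 \<notin> S j"
  using N'_subset N_N' by (force simp: S_def)+

lemma idem_mult_disjoint: "closed A \<Longrightarrow> closed C \<Longrightarrow> A \<inter> C = {} \<Longrightarrow> idem A * idem C \<in> ann m"
  using idem_mult[of A C] by (simp add: idem_empty)

text \<open>Summands up to level \<open>j\<close> live on exponents disjoint from
  \<open>N j\<close>; the others carry a factor 2^i with i > j.\<close>

lemma idem_N_omega:
  assumes j: "j < m"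
  shows "idem (N j) * omega \<in> ann (Suc j)"
proof -
  have "idem (N j) * (2 ^ i * (idem (S i) * idem (S i))) \<in> ann (Suc j)" if i: "i < m" for i
  proof (cases "i \<le> j")
    case True
    have "N j \<inter> S i = {}"
      using N'_N[of i j] N_N'[OF j] True j by (cases "i = j") (auto simp: S_def)
    then have "idem (N j) * idem (S i) * (2 ^ i * idem (S i)) \<in> ann m"
      by (intro ann_mult_right idem_mult_disjoint closed_N closed_S i j)
    then have "idem (N j) * idem (S i) * (2 ^ i * idem (S i)) \<in> ann (Suc j)"
      using j by (intro ann_mono[of "Suc j" m]) auto
    then show ?thesis by (simp only: mult_ac)
  next
    case False
    then have "2 ^ i * (idem (N j) * (idem (S i) * idem (S i))) \<in> ann (Suc j)"
      using ann_of_two_power[of i] by (intro ann_mono[of "Suc j" i]) auto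
    then show ?thesis by (simp only: mult_ac)
  qed
  then have "(\<Sum>i\<in>A. idem (N j) * (2 ^ i * (idem (S i) * idem (S i)))) \<in> ann (Suc j)"
    if "A \<subseteq> {..<m}" for A
    using that by (induction A rule: infinite_finite_induct) (auto intro: ann_add)
  then show ?thesis
    unfolding omega_def sum_distrib_left by simp
qed

text \<open>Lower levels are disjoint from \<open>N' j\<close> and higher ones are divisible by
  \<open>2 ^ Suc j\<close>; only the summand of level \<open>j\<close> survives.\<close>

lemma idem_N'_omega:
  assumes j: "j < m"
  shows "idem (N' j) * omega - 2 ^ j * idem (S j) \<in> ann (Suc j)"
proof -
  have term_i: "idem (N' j) * (2 ^ i * (idem (S i) * idem (S i))) \<in> ann (Suc j)"
    if i: "i < m" "i \<noteq> j" for i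
  proof (cases "i \<le> j")
    case True
    have "N' j \<inter> S i = {}"
      using N'_N[of i j] True i j by (auto simp: S_def)
    then have "idem (N' j) * idem (S i) * (2 ^ i * idem (S i)) \<in> ann m"
      by (intro ann_mult_right idem_mult_disjoint closed_N' closed_S i j)
    then have "idem (N' j) * idem (S i) * (2 ^ i * idem (S i)) \<in> ann (Suc j)"
      using j by (intro ann_mono[of "Suc j" m]) auto
    then show ?thesis by (simp only: mult_ac)
  next
    case False
    then have "2 ^ i * (idem (N' j) * (idem (S i) * idem (S i))) \<in> ann (Suc j)"
      using ann_of_two_power[of i] by (intro ann_mono[of "Suc j" i]) auto
    then show ?thesis by (simp only: mult_ac)
  qed
  then have "(\<Sum>i\<in>A. idem (N' j) * (2 ^ i * (idem (S i) * idem (S i)))) \<in> ann (Suc j)"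
    if "A \<subseteq> {..<m} - {j}" for A
    using that by (induction A rule: infinite_finite_induct) (auto intro: ann_add)
  then have rest: "(\<Sum>i\<in>{..<m} - {j}. idem (N' j) * (2 ^ i * (idem (S i) * idem (S i)))) \<in> ann (Suc j)"
    by blast
  have "N' j \<inter> S j = S j" by (auto simp: S_def)
  then have 1: "idem (N' j) * idem (S j) - idem (S j) \<in> ann m"
    using idem_mult[OF closed_N'[OF j] closed_S[OF j]] by simp
  have 2: "idem (S j) * idem (S j) - idem (S j) \<in> ann m"
    using idem_idempotent[OF closed_S[OF j]] by (simp add: power2_eq_square)
  have "2 ^ j * (idem (S j) * (idem (N' j) * idem (S j) - idem (S j)) +
      (idem (S j) * idem (S j) - idem (S j))) \<in> ann m"
    by (intro ann_mult_left ann_add 1 2)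
  then have "2 ^ j * (idem (S j) * (idem (N' j) * idem (S j) - idem (S j)) +
      (idem (S j) * idem (S j) - idem (S j))) \<in> ann (Suc j)"
    using j by (intro ann_mono[of "Suc j" m]) auto
  also have "2 ^ j * (idem (S j) * (idem (N' j) * idem (S j) - idem (S j)) +
      (idem (S j) * idem (S j) - idem (S j))) =
      idem (N' j) * (2 ^ j * (idem (S j) * idem (S j))) - 2 ^ j * idem (S j)"
  proof -
    have "c * (s * (a * s - s) + (s * s - s)) = a * (c * (s * s)) - c * s" for a c s :: "int poly"
      by (simp add: algebra_simps)
    then show ?thesis .
  qed
  finally have "idem (N' j) * (2 ^ j * (idem (S j) * idem (S j))) - 2 ^ j * idem (S j) +
      (\<Sum>i\<in>{..<m} - {j}. idem (N' j) * (2 ^ i * (idem (S i) * idem (S i)))) \<in> ann (Suc j)"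
    using rest by (rule ann_add)
  moreover have "idem (N' j) * omega = idem (N' j) * (2 ^ j * (idem (S j) * idem (S j))) +
      (\<Sum>i\<in>{..<m} - {j}. idem (N' j) * (2 ^ i * (idem (S i) * idem (S i))))"
    unfolding omega_def sum_distrib_left using j by (intro sum.remove) auto
  ultimately show ?thesis by (simp add: algebra_simps)
qed

lemma cond_act_w: "cond N (act p w)"
  unfolding cond_def
proof (intro allI impI)
  fix j v assume j: "j < m"
  have "p * (idem (N j) * omega) \<in> ann (Suc j)"
    by (intro ann_mult_left idem_N_omega j)
  then have "2 ^ Suc j dvd act (p * (idem (N j) * omega)) (delta 1) v"
    by (simp add: ann_def)
  moreover have "p * (idem (N j) * omega) = idem (N j) * p * omega"
    by (simp only: mult_ac)
  ultimately show "2 ^ Suc j dvd act (idem (N j)) (act p w) v"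
    by (simp only: w_def act_mult)
qed

lemma w_at_0 [simp]: "w 0 = 0"
  by (simp add: w_def act_at_0 delta_def)

lemma act_w_at_0 [simp]: "act p w 0 = 0"
  by (simp add: w_def act_at_0 delta_def)

lemma sum_w: "2 ^ Suc m dvd (\<Sum>v\<in>UNIV - {0}. act p w v)"
proof -
  have "2 ^ Suc m dvd poly omega 1"
    unfolding omega_def poly_sum
  proof (rule dvd_sum)
    fix j assume "j \<in> {..<m}"
    then have *: "2 ^ m dvd poly (idem (S j)) 1"
      using closed_S zero_notin(3) by (intro two_power_dvd_idem_at_1) auto
    have "(2::int) ^ Suc m dvd 2 ^ (m + m)"
      using m by (intro le_imp_power_dvd) simp
    also have "\<dots> dvd poly (idem (S j)) 1 * poly (idem (S j)) 1"
      unfolding power_add by (intro mult_dvd_mono *)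
    finally show "2 ^ Suc m dvd poly (2 ^ j * (idem (S j) * idem (S j))) 1"
      unfolding poly_mult by (rule dvd_mult)
  qed
  moreover have "(\<Sum>v\<in>UNIV - {0}. act p w v) = poly p 1 * (poly omega 1 * (\<Sum>v\<in>UNIV - {0}. delta 1 v))"
    by (simp only: sum_act w_def)
  ultimately show ?thesis by simp
qed

text \<open>At level \<open>j\<close> the condition says that
  \<open>2 ^ j * (idem (S j) * p)\<close> vanishes modulo \<open>2 ^ Suc j\<close>, that is,
  \<open>p\<close> vanishes on \<open>S j\<close> in characteristic 2. So the annihilator of
  \<open>w\<close> modulo the sublattice is the ideal of polynomials vanishing on
  \<open>T\<close>.\<close>

lemma cond_N'_act_w_iff: "cond N' (act p w) \<longleftrightarrow> (\<forall>u\<in>T. evp p (\<zeta> ^ u) = 0)"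
proof -
  have "(\<forall>v. 2 ^ Suc j dvd act (idem (N' j)) (act p w) v) \<longleftrightarrow> (\<forall>u\<in>S j. evp p (\<zeta> ^ u) = 0)"
    if j: "j < m" for j
  proof -
    have at0: "2 ^ Suc j dvd act (idem (N' j)) (act p w) 0"
      by (simp add: act_at_0)
    have "(\<forall>v. 2 ^ Suc j dvd act (idem (N' j)) (act p w) v) \<longleftrightarrow>
        (\<forall>v. v \<noteq> 0 \<longrightarrow> 2 ^ Suc j dvd act (idem (N' j) * p * omega) (delta 1) v)"
      using at0 unfolding act_mult w_def by metis
    also have "\<dots> \<longleftrightarrow> idem (N' j) * p * omega \<in> ann (Suc j)"
      by (rule ann_iff_delta_1[symmetric])
    also have "\<dots> \<longleftrightarrow> 2 ^ j * (idem (S j) * p) \<in> ann (Suc j)"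
    proof -
      have d: "p * (idem (N' j) * omega - 2 ^ j * idem (S j)) \<in> ann (Suc j)"
        by (intro ann_mult_left idem_N'_omega j)
      have "p * (a * o' - c * s) = a * p * o' - c * (s * p)" for a o' c s :: "int poly"
        by (simp add: algebra_simps)
      then have d: "idem (N' j) * p * omega - 2 ^ j * (idem (S j) * p) \<in> ann (Suc j)"
        using d by simp
      show ?thesis
        using ann_add[OF d] ann_diff[OF _ d] by fastforce
    qed
    also have "\<dots> \<longleftrightarrow> idem (S j) * p \<in> ann 1"
      by (rule two_power_mult_in_ann_iff)
    also have "\<dots> \<longleftrightarrow> (\<forall>u<n. u \<in> S j \<longrightarrow> evp p (\<zeta> ^ u) = 0)"
      unfolding ann_1_iff by (auto simp: evp_mult evp_idem closed_S j)
    also have "\<dots> \<longleftrightarrow> (\<forall>u\<in>S j. evp p (\<zeta> ^ u) = 0)"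
      using S_subset[OF j] by auto
    finally show ?thesis .
  qed
  then show ?thesis
    unfolding cond_def T_def by blast
qed

lemma act_cong_nonzero:
  assumes "\<And>v. v \<noteq> 0 \<Longrightarrow> f v = g v" "v \<noteq> 0"
  shows "act p f v = act p g v"
  unfolding act_def using assms by (intro sum.cong) auto

text \<open>By interlacing \<open>S j\<close> lies in \<open>N (j - 1)\<close>, so
  \<open>idem (S j)\<close> maps \<open>a\<close> to \<open>2 ^ j * y j\<close>. With these
  quotients as coefficients of \<open>p\<close>, \<open>act p w\<close> reproduces the
  \<open>S j\<close>-part of \<open>a\<close> at level \<open>j\<close>, which is all that separates
  \<open>N' j\<close> from \<open>N j\<close>.\<close>

lemma cond_N_spanned:
  assumes a: "cond N a"
  shows "\<exists>p. cond N' (\<lambda>v. a v - act p w v)"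
proof -
  have "\<exists>y. \<forall>v. 2 ^ m dvd act (idem (S j)) a v - 2 ^ j * y v" if j: "j < m" for j
  proof -
    have "2 ^ j dvd act (idem (S j)) a v" for v
    proof (cases j)
      case (Suc i)
      have "S j \<subseteq> N i" using N'_N[of i j] Suc j by (auto simp: S_def)
      then have *: "2 ^ m dvd act (idem (S j)) (act (idem (N i)) a) v - act (idem (S j)) a v"
        using Suc j by (intro act_idem_idem closed_S closed_N) auto
      have **: "2 ^ j dvd act (idem (S j)) (act (idem (N i)) a) v"
        by (rule act_dvd) (use a Suc j in \<open>simp add: cond_def\<close>)
      have "(2::int) ^ j dvd 2 ^ m" using j by (intro le_imp_power_dvd) simp
      with * have "2 ^ j dvd act (idem (S j)) (act (idem (N i)) a) v - act (idem (S j)) a v"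
        using dvd_trans by blast
      from dvd_diff[OF ** this] show ?thesis by simp
    qed simp
    then have "\<forall>v. \<exists>y. act (idem (S j)) a v = 2 ^ j * y" by (simp add: dvd_def)
    then obtain y where "\<forall>v. act (idem (S j)) a v = 2 ^ j * y v" by metis
    then show ?thesis by (intro exI[of _ y]) simp
  qed
  then obtain y where y: "\<And>j v. j < m \<Longrightarrow> 2 ^ m dvd act (idem (S j)) a v - 2 ^ j * y j v"
    by metis
  define p where "p = (\<Sum>j<m. idem (S j) * word_poly m \<zeta> (y j))"
  have "2 ^ Suc j dvd act (idem (N' j)) (\<lambda>v. a v - act p w v) v" if j: "j < m" for j v
  proof (cases "v = 0")
    case True
    have "(2::int) ^ Suc j dvd 2 ^ m" using j by (intro le_imp_power_dvd) simp
    then show ?thesis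
      using two_power_dvd_idem_at_1[OF closed_N'[OF j] zero_notin(2)[OF j]] True
      by (auto simp: act_at_0 intro: dvd_trans)
  next
    case False
    have pow: "(2::int) ^ Suc j dvd 2 ^ m" using j by (intro le_imp_power_dvd) simp
    let ?P = "word_poly m \<zeta> (y j)"
    have "p * idem (S j) - idem (S j) * idem (S j) * ?P \<in> ann m"
    proof -
      have "(\<Sum>i\<in>A. idem (S i) * word_poly m \<zeta> (y i) * idem (S j)) \<in> ann m" if "A \<subseteq> {..<m} - {j}" for A
        using that
      proof (induction A rule: infinite_finite_induct)
        case (insert i A)
        have "S i \<inter> S j = {}"
        proof (cases "i < j")
          case True
          then show ?thesis using N'_N[OF True j] by (auto simp: S_def)
        next
          case False
          then have "N' i \<subseteq> N j" using insert by (intro N'_N) auto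
          then show ?thesis by (auto simp: S_def)
        qed
        then have "idem (S i) * idem (S j) * word_poly m \<zeta> (y i) \<in> ann m"
          using insert by (intro ann_mult_right idem_mult_disjoint closed_S j) auto
        then have "idem (S i) * word_poly m \<zeta> (y i) * idem (S j) \<in> ann m"
          by (simp only: mult_ac)
        then show ?case using insert by (auto intro: ann_add)
      qed auto
      moreover have "p * idem (S j) = idem (S j) * ?P * idem (S j) +
          (\<Sum>i\<in>{..<m} - {j}. idem (S i) * word_poly m \<zeta> (y i) * idem (S j))"
        unfolding p_def sum_distrib_right using j by (intro sum.remove) auto
      ultimately show ?thesis by (simp add: mult_ac)
    qed
    then have p1: "2 ^ j * (p * idem (S j) - idem (S j) * idem (S j) * ?P) \<in> ann (Suc j)"
      using j by (intro ann_mult_left ann_mono[of "Suc j" m]) auto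
    have p2: "p * (idem (N' j) * omega - 2 ^ j * idem (S j)) \<in> ann (Suc j)"
      by (intro ann_mult_left idem_N'_omega j)
    have p3: "2 ^ j * ((idem (S j) * idem (S j) - idem (S j)) * ?P) \<in> ann (Suc j)"
      using idem_idempotent[OF closed_S[OF j]] j
      by (intro ann_mult_left ann_mult_right ann_mono[of "Suc j" m]) (auto simp: power2_eq_square)
    have "p * (a' * o' - c * s) + c * (p * s - s * s * P) + c * ((s * s - s) * P) = a' * p * o' - c * (s * P)"
      for a' o' c s P :: "int poly"
      by (simp add: algebra_simps)
    from this[of "idem (N' j)" omega "2 ^ j" "idem (S j)" ?P]
    have "idem (N' j) * p * omega - 2 ^ j * (idem (S j) * ?P) \<in> ann (Suc j)"
      using ann_add[OF ann_add[OF p2 p1] p3] by simp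
    then have 1: "2 ^ Suc j dvd act (idem (N' j) * p * omega) (delta 1) v
        - act (2 ^ j * (idem (S j) * ?P)) (delta 1) v"
      by (rule act_ann)
    have "act (2 ^ j * (idem (S j) * ?P)) (delta 1) v = 2 ^ j * act (idem (S j)) (y j) v"
      using act_cong_nonzero[of "act ?P (delta 1)" "y j" v "idem (S j)", OF act_word_poly False]
      by (simp add: act_two_power_mult act_mult[of "idem (S j)"])
    then have 1: "2 ^ Suc j dvd act (idem (N' j)) (act p w) v - 2 ^ j * act (idem (S j)) (y j) v"
      using 1 by (simp only: act_mult w_def)
    have "2 ^ m dvd act (idem (S j)) (\<lambda>v. act (idem (S j)) a v - 2 ^ j * y j v) v"
      using y[OF j] by (rule act_dvd)
    then have 2: "2 ^ m dvd act (idem (S j)) (act (idem (S j)) a) v - 2 ^ j * act (idem (S j)) (y j) v"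
      by (simp only: act_diff_right act_smult_right)
    have 3: "2 ^ m dvd act (idem (S j)) (act (idem (S j)) a) v - act (idem (S j)) a v"
      by (intro act_idem_idem closed_S j order_refl)
    have "N j \<inter> S j = {}" "N j \<union> S j = N' j" using N_N'[OF j] by (auto simp: S_def)
    then have "idem (N j) + idem (S j) - idem (N' j) \<in> ann m"
      using idem_add[OF closed_N[OF j] closed_S[OF j]] by simp
    then have 4: "2 ^ m dvd act (idem (N j)) a v + act (idem (S j)) a v - act (idem (N' j)) a v"
      using act_ann by (metis act_add)
    have 5: "2 ^ Suc j dvd act (idem (N j)) a v"
      using a j by (simp add: cond_def)
    have "2 ^ m dvd act (idem (N j)) a v + 2 ^ j * act (idem (S j)) (y j) v - act (idem (N' j)) a v"
      using dvd_add[OF dvd_diff[OF 3 2] 4] by (simp add: algebra_simps)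
    then have "2 ^ Suc j dvd act (idem (N j)) a v + 2 ^ j * act (idem (S j)) (y j) v - act (idem (N' j)) a v"
      using pow dvd_trans by blast
    from dvd_add[OF this 1] have "2 ^ Suc j dvd act (idem (N j)) a v +
        act (idem (N' j)) (act p w) v - act (idem (N' j)) a v"
      by (simp add: algebra_simps)
    from dvd_diff[OF 5 this] show ?thesis
      by (simp add: act_diff_right)
  qed
  then show ?thesis
    unfolding cond_def by blast
qed

text \<open>Twice a polynomial vanishes at all roots in characteristic 2, so twice a multiple of
  \<open>w\<close> lies in the sublattice.\<close>

lemma cond_N_double:
  assumes "cond N a"
  shows "cond N' (\<lambda>v. 2 * a v)"
proof -
  obtain p where "cond N' (\<lambda>v. a v - act p w v)" using cond_N_spanned[OF assms] by blast
  moreover have "cond N' (act (2 * p) w)"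
    unfolding cond_N'_act_w_iff by (simp only: mult_2 evp_add add_self) simp
  moreover have "act (2 * p) w v = 2 * act p w v" for v
    using act_two_power_mult[of 1] by simp
  ultimately have "cond N' (\<lambda>v. 2 * (a v - act p w v) + act (2 * p) w v)"
    by (intro cond_add cond_smult)
  then show ?thesis
    by (simp add: \<open>\<And>v. act (2 * p) w v = 2 * act p w v\<close>)
qed

text \<open>The generator has \<open>card T\<close> roots and its cofactor
  \<open>n - card T\<close>; as the degrees add up to \<open>n\<close>, both bounds are
  attained.\<close>

lemma T_polynomial:
  obtains g where "Polynomial.lead_coeff g = 1" "Polynomial.degree g = card T"
    "\<And>p. p \<in> vanishing T \<longleftrightarrow> g dvd p"
proof -
  have T: "T \<subseteq> {..<n}" using T_subset by auto
  obtain g where g: "Polynomial.lead_coeff g = 1" "\<And>p. p \<in> vanishing T \<longleftrightarrow> g dvd p"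
    using vanishing_principal[OF T] by blast
  have "X_n_minus_1 m \<in> vanishing T"
    using T evb_X_n_minus_1 by (force simp: vanishing_def)
  then obtain h where h: "X_n_minus_1 m = g * h" using g(2) by (auto elim!: dvdE)
  have X0: "X_n_minus_1 m \<noteq> (0 :: bit poly)"
    using lead_coeff_X_n_minus_1[where 'a = bit] by force
  then have nz: "g \<noteq> 0" "h \<noteq> 0" using h by auto
  have n: "n = Polynomial.degree g + Polynomial.degree h"
    unfolding degree_X_n_minus_1[where 'a = bit, symmetric] h using nz by (simp add: degree_mult_eq)
  have roots: "card A \<le> Polynomial.degree p"
    if "p \<noteq> 0" "A \<subseteq> {..<n}" "\<And>u. u \<in> A \<Longrightarrow> evb p (\<zeta> ^ u) = 0"
    for p and A :: "nat set"
  proof -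
    define q where "q = (map_poly f2_emb p :: 'f poly)"
    have deg: "Polynomial.degree q = Polynomial.degree p"
      unfolding q_def by (rule degree_map_poly) (simp add: f2_emb_def)
    have q0: "q \<noteq> 0"
      using that(1) unfolding q_def by (subst map_poly_eq_0_iff) (auto simp: f2_emb_def)
    have "card A = card ((\<lambda>u. \<zeta> ^ u) ` A)"
      using inj_on_subset[OF inj_zeta that(2)] by (simp add: card_image)
    also have "\<dots> \<le> card {x. poly q x = 0}"
      using that(3) by (intro card_mono) (auto simp: q_def evb_def)
    also have "\<dots> \<le> Polynomial.degree q"
      by (rule card_poly_roots_bound[OF q0])
    finally show ?thesis by (simp add: deg)
  qed
  have "card T \<le> Polynomial.degree g"
    using nz(1) T by (rule roots) (use generator_roots[OF closed_T g(2)] T in auto)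
  moreover have "card ({..<n} - T) \<le> Polynomial.degree h"
  proof (rule roots[OF nz(2)])
    fix u assume u: "u \<in> {..<n} - T"
    then have "evb g (\<zeta> ^ u) \<noteq> 0" using generator_roots[OF closed_T g(2), of u] by auto
    moreover have "evb g (\<zeta> ^ u) * evb h (\<zeta> ^ u) = 0"
      using evb_X_n_minus_1[of u] u by (simp add: h evb_mult)
    ultimately show "evb h (\<zeta> ^ u) = 0" by simp
  qed auto
  moreover have "card ({..<n} - T) = n - card T"
    using T finite_subset[OF T] by (simp add: card_Diff_subset)
  moreover have "card T \<le> n" using card_mono[OF _ T] by simp
  ultimately have "Polynomial.degree g = card T" using n by linarith
  then show thesis using that g by blast
qed

end

section \<open>Eigenvalues and determinants by bases of quotients\<close>

interpretation Z: Modules.module "int_scale :: int \<Rightarrow> 'a::real_vector \<Rightarrow> 'a"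
  by (rule module_int_scale)

definition int_comb :: "'a::real_vector list \<Rightarrow> (nat \<Rightarrow> int) \<Rightarrow> 'a" where
  "int_comb xs c = (\<Sum>i<length xs. of_int (c i) *\<^sub>R xs ! i)"

definition bit_int :: "bit \<Rightarrow> int" where "bit_int = f2_emb"

lemma f2_emb_eq_bit_int: "f2_emb c = (of_int (bit_int c) :: 'a::ring_1)"
  by (simp add: bit_int_def f2_emb_def)

lemma f2_emb_bit [simp]: "f2_emb c = (c :: bit)"
  by (cases c) (simp_all add: f2_emb_def)

lemma of_int_bit_int [simp]: "of_int (bit_int c) = (c :: bit)"
  by (simp only: f2_emb_eq_bit_int[symmetric] f2_emb_bit)

lemma even_bit_int_iff: "even (bit_int c - k) \<longleftrightarrow> c = of_int k"
proof -
  have "(of_int (bit_int c - k) :: bit) = 0 \<longleftrightarrow> c = of_int k"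
    by (simp add: bit_int_def f2_emb_def)
  then show ?thesis by (simp only: of_int_bit_eq_0_iff)
qed

lemma int_comb_bit_int: "int_comb xs (\<lambda>i. bit_int (c i)) = (\<Sum>i<length xs. f2_emb (c i) *\<^sub>R xs ! i)"
  by (simp add: int_comb_def f2_emb_eq_bit_int)

lemma int_comb_diff: "int_comb xs c - int_comb xs d = int_comb xs (\<lambda>i. c i - d i)"
  by (simp add: int_comb_def scaleR_left_diff_distrib sum_subtractf)

lemma int_comb_in_subspace:
  assumes "Z.subspace \<Gamma>" "set xs \<subseteq> \<Gamma>"
  shows "int_comb xs c \<in> \<Gamma>"
  unfolding int_comb_def
proof (rule Z.subspace_sum[OF assms(1)])
  fix i assume "i \<in> {..<length xs}"
  then have "int_scale (c i) (xs ! i) \<in> \<Gamma>"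
    using assms by (intro Z.subspace_scale) auto
  then show "of_int (c i) *\<^sub>R xs ! i \<in> \<Gamma>" by (simp add: int_scale_def)
qed

lemma int_comb_even:
  assumes \<Delta>: "Z.subspace \<Delta>" "\<And>x. x \<in> set xs \<Longrightarrow> 2 *\<^sub>R x \<in> \<Delta>"
    and c: "\<And>i. i < length xs \<Longrightarrow> even (c i)"
  shows "int_comb xs c \<in> \<Delta>"
  unfolding int_comb_def
proof (rule Z.subspace_sum[OF \<Delta>(1)])
  fix i assume i: "i \<in> {..<length xs}"
  then obtain d where d: "c i = d * 2" using c[of i] by (auto elim: evenE)
  have "int_scale d (2 *\<^sub>R xs ! i) \<in> \<Delta>"
    using i \<Delta> by (intro Z.subspace_scale) auto
  then show "of_int (c i) *\<^sub>R xs ! i \<in> \<Delta>" by (simp add: int_scale_def d)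
qed

locale elementary_quotient =
  fixes \<Gamma> \<Delta> :: "'a::real_vector set"
  assumes \<Gamma>: "Z.subspace \<Gamma>" and \<Delta>: "Z.subspace \<Delta>" and sub: "\<Delta> \<subseteq> \<Gamma>"
    and two: "x \<in> \<Gamma> \<Longrightarrow> 2 *\<^sub>R x \<in> \<Delta>"
begin

lemma even_comb: "set xs \<subseteq> \<Gamma> \<Longrightarrow> (\<And>i. i < length xs \<Longrightarrow> even (c i)) \<Longrightarrow> int_comb xs c \<in> \<Delta>"
  using two by (intro int_comb_even \<Delta>) auto

text \<open>Integer coefficients, of which only the parity matters, are easier to work with than
  \<^typ>\<open>bit\<close> coefficients.\<close>

lemma quotient_basis_iff:
  "quotient_basis \<Gamma> \<Delta> xs \<longleftrightarrow> set xs \<subseteq> \<Gamma> \<and> (\<forall>x\<in>\<Gamma>. \<exists>c. x - int_comb xs c \<in> \<Delta>) \<and>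
     (\<forall>c. int_comb xs c \<in> \<Delta> \<longrightarrow> (\<forall>i<length xs. even (c i)))"
proof
  assume qb: "quotient_basis \<Gamma> \<Delta> xs"
  then have xs: "set xs \<subseteq> \<Gamma>" by (simp add: quotient_basis_def)
  have ex: "\<exists>!c. c \<in> carrier_vec (length xs) \<and> x - int_comb xs (\<lambda>i. bit_int (vec_index c i)) \<in> \<Delta>"
    if "x \<in> \<Gamma>" for x
    using qb that unfolding quotient_basis_def int_comb_bit_int by blast
  have "even (c i)" if c: "int_comb xs c \<in> \<Delta>" and i: "i < length xs" for c i
  proof -
    define d where "d = Matrix.vec (length xs) (\<lambda>i. of_int (c i) :: bit)"
    have "int_comb xs (\<lambda>i. c i - bit_int (vec_index d i)) \<in> \<Delta>"
    proof (rule even_comb[OF xs])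
      fix i assume "i < length xs"
      then have "even (bit_int (vec_index d i) - c i)"
        unfolding even_bit_int_iff by (simp add: d_def)
      then show "even (c i - bit_int (vec_index d i))" by simp
    qed
    from Z.subspace_diff[OF \<Delta> this c] have "0 - int_comb xs (\<lambda>i. bit_int (vec_index d i)) \<in> \<Delta>"
      by (simp flip: int_comb_diff)
    moreover have "0 - int_comb xs (\<lambda>i. bit_int (vec_index (0\<^sub>v (length xs)) i)) \<in> \<Delta>"
    proof -
      have "int_comb xs (\<lambda>i. bit_int (vec_index (0\<^sub>v (length xs)) i)) = 0"
        by (simp add: int_comb_def bit_int_def)
      then show ?thesis using Z.subspace_0[OF \<Delta>] by simp
    qed
    ultimately have "d = 0\<^sub>v (length xs)"
      using ex[OF Z.subspace_0[OF \<Gamma>]] d_def by auto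
    then have "vec_index d i = 0" using i by simp
    then have "(of_int (c i) :: bit) = 0" using i by (simp add: d_def)
    then show ?thesis by (simp only: of_int_bit_eq_0_iff)
  qed
  moreover have "\<exists>c. x - int_comb xs c \<in> \<Delta>" if "x \<in> \<Gamma>" for x
    using ex[OF that] by blast
  ultimately show "set xs \<subseteq> \<Gamma> \<and> (\<forall>x\<in>\<Gamma>. \<exists>c. x - int_comb xs c \<in> \<Delta>) \<and>
     (\<forall>c. int_comb xs c \<in> \<Delta> \<longrightarrow> (\<forall>i<length xs. even (c i)))"
    using xs by blast
next
  assume *: "set xs \<subseteq> \<Gamma> \<and> (\<forall>x\<in>\<Gamma>. \<exists>c. x - int_comb xs c \<in> \<Delta>) \<and>
     (\<forall>c. int_comb xs c \<in> \<Delta> \<longrightarrow> (\<forall>i<length xs. even (c i)))"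
  then have xs: "set xs \<subseteq> \<Gamma>" and indep: "\<And>c i. int_comb xs c \<in> \<Delta> \<Longrightarrow> i < length xs \<Longrightarrow> even (c i)"
    by blast+
  have "\<exists>!c. c \<in> carrier_vec (length xs) \<and> x - int_comb xs (\<lambda>i. bit_int (vec_index c i)) \<in> \<Delta>"
    if x: "x \<in> \<Gamma>" for x
  proof -
    obtain c where c: "x - int_comb xs c \<in> \<Delta>" using * x by blast
    define d where "d = Matrix.vec (length xs) (\<lambda>i. of_int (c i) :: bit)"
    have d: "d \<in> carrier_vec (length xs)" by (simp add: d_def)
    have "int_comb xs (\<lambda>i. c i - bit_int (vec_index d i)) \<in> \<Delta>"
    proof (rule even_comb[OF xs])
      fix i assume "i < length xs"
      then have "even (bit_int (vec_index d i) - c i)"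
        unfolding even_bit_int_iff by (simp add: d_def)
      then show "even (c i - bit_int (vec_index d i))" by simp
    qed
    from Z.subspace_add[OF \<Delta> c this]
    have "x - int_comb xs (\<lambda>i. bit_int (vec_index d i)) \<in> \<Delta>"
      by (simp flip: int_comb_diff)
    moreover have "e = d" if e: "e \<in> carrier_vec (length xs)"
      "x - int_comb xs (\<lambda>i. bit_int (vec_index e i)) \<in> \<Delta>" for e
    proof (rule eq_vecI)
      show "dim_vec e = dim_vec d" using e d by simp
      fix i assume "i < dim_vec d"
      then have i: "i < length xs" using d by simp
      from Z.subspace_diff[OF \<Delta> c e(2)]
      have "int_comb xs (\<lambda>i. bit_int (vec_index e i) - c i) \<in> \<Delta>"
        by (simp flip: int_comb_diff)
      then have "even (bit_int (vec_index e i) - c i)" using indep i by blast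
      then show "vec_index e i = vec_index d i" unfolding even_bit_int_iff using i by (simp add: d_def)
    qed
    ultimately show ?thesis using d by blast
  qed
  then show "quotient_basis \<Gamma> \<Delta> xs"
    unfolding quotient_basis_def int_comb_bit_int using xs sub two by blast
qed

lemma int_comb_int_comb:
  assumes xs: "set xs \<subseteq> \<Gamma>" and y: "\<And>j. j < length ys \<Longrightarrow> f (ys ! j) - int_comb xs (\<lambda>i. M i j) \<in> \<Delta>"
  shows "(\<Sum>j<length ys. of_int (d j) *\<^sub>R f (ys ! j)) - int_comb xs (\<lambda>i. \<Sum>j<length ys. M i j * d j) \<in> \<Delta>"
proof -
  have "(\<Sum>j<length ys. int_scale (d j) (f (ys ! j) - int_comb xs (\<lambda>i. M i j))) \<in> \<Delta>"
    using y by (intro Z.subspace_sum[OF \<Delta>] Z.subspace_scale[OF \<Delta>]) auto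
  also have "(\<Sum>j<length ys. int_scale (d j) (f (ys ! j) - int_comb xs (\<lambda>i. M i j))) =
      (\<Sum>j<length ys. of_int (d j) *\<^sub>R f (ys ! j)) -
      (\<Sum>j<length ys. of_int (d j) *\<^sub>R int_comb xs (\<lambda>i. M i j))"
    by (simp add: int_scale_def scaleR_right_diff_distrib sum_subtractf)
  also have "(\<Sum>j<length ys. of_int (d j) *\<^sub>R int_comb xs (\<lambda>i. M i j)) =
      int_comb xs (\<lambda>i. \<Sum>j<length ys. M i j * d j)"
    unfolding int_comb_def scaleR_sum_right
    by (subst sum.swap) (simp add: scaleR_sum_left mult.commute)
  finally show ?thesis .
qed

lemma quotient_matrix_iff:
  assumes xs: "set xs \<subseteq> \<Gamma>"
  shows "quotient_matrix \<sigma> \<Delta> xs A \<longleftrightarrow> A \<in> carrier_mat (length xs) (length xs) \<and>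
     (\<forall>j<length xs. \<sigma> (xs ! j) - int_comb xs (\<lambda>i. bit_int (A $$ (i, j))) \<in> \<Delta>)"
  unfolding quotient_matrix_def int_comb_bit_int ..

lemma card_carrier_vec_bit: "card (carrier_vec k :: bit Matrix.vec set) = 2 ^ k" "finite (carrier_vec k :: bit Matrix.vec set)"
proof -
  have univ: "(UNIV :: bit set) = {0, 1}" by (auto simp: bit_not_zero_iff)
  have b: "bij_betw vec_of_list {xs. set xs \<subseteq> (UNIV :: bit set) \<and> length xs = k} (carrier_vec k)"
  proof (rule bij_betwI[where g = list_of_vec])
    show "vec_of_list \<in> {xs. set xs \<subseteq> (UNIV :: bit set) \<and> length xs = k} \<rightarrow> carrier_vec k"
      by (intro Pi_I carrier_vecI) simp
    show "list_of_vec \<in> carrier_vec k \<rightarrow> {xs. set xs \<subseteq> (UNIV :: bit set) \<and> length xs = k}"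
      by (intro Pi_I) simp
  qed (rule list_vec, rule vec_list)
  then show "card (carrier_vec k :: bit Matrix.vec set) = 2 ^ k"
    using bij_betw_same_card[OF b] card_lists_length_eq[of "UNIV :: bit set" k]
    by (simp add: univ numeral_2_eq_2)
  show "finite (carrier_vec k :: bit Matrix.vec set)"
    using bij_betw_finite[OF b] finite_lists_length_eq[of "UNIV :: bit set" k] by (simp add: univ)
qed

lemma even_sum_bit: "(of_int (\<Sum>i<k. bit_int (A i) * bit_int (C i)) :: bit) = (\<Sum>i<k. A i * C i)"
  by (simp only: of_int_sum of_int_mult of_int_bit_int)

lemma coordinates:
  assumes "quotient_basis \<Gamma> \<Delta> xs" "set ys \<subseteq> \<Gamma>"
  obtains P where "P \<in> carrier_mat (length xs) (length ys)"
    "\<And>j. j < length ys \<Longrightarrow> ys ! j - int_comb xs (\<lambda>i. bit_int (P $$ (i, j))) \<in> \<Delta>"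
proof -
  have "\<exists>c. c \<in> carrier_vec (length xs) \<and> x - int_comb xs (\<lambda>i. bit_int (vec_index c i)) \<in> \<Delta>"
    if "x \<in> \<Gamma>" for x
    using assms(1) that unfolding quotient_basis_def int_comb_bit_int by blast
  then obtain c where c: "\<And>x. x \<in> \<Gamma> \<Longrightarrow> x - int_comb xs (\<lambda>i. bit_int (vec_index (c x) i)) \<in> \<Delta>"
    by metis
  define P where "P = Matrix.mat (length xs) (length ys) (\<lambda>(i, j). vec_index (c (ys ! j)) i)"
  have "ys ! j - int_comb xs (\<lambda>i. bit_int (P $$ (i, j))) \<in> \<Delta>" if j: "j < length ys" for j
  proof -
    have "int_comb xs (\<lambda>i. bit_int (P $$ (i, j))) = int_comb xs (\<lambda>i. bit_int (vec_index (c (ys ! j)) i))"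
      unfolding int_comb_def using j by (intro sum.cong) (auto simp: P_def)
    moreover have "ys ! j \<in> \<Gamma>" using j assms(2) nth_mem by blast
    ultimately show ?thesis using c[of "ys ! j"] by simp
  qed
  then show thesis using that[of P] by (simp add: P_def)
qed

lemma coordinates_unique:
  assumes "quotient_basis \<Gamma> \<Delta> xs" "x - int_comb xs c \<in> \<Delta>" "x - int_comb xs d \<in> \<Delta>" "i < length xs"
  shows "(of_int (c i) :: bit) = of_int (d i)"
proof -
  from Z.subspace_diff[OF \<Delta> assms(3,2)] have "int_comb xs (\<lambda>i. c i - d i) \<in> \<Delta>"
    by (simp flip: int_comb_diff)
  then have "even (c i - d i)"
    using assms(1,4) quotient_basis_iff[of xs] by blast
  then have "(of_int (c i - d i) :: bit) = 0"
    by (simp only: of_int_bit_eq_0_iff)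
  then show ?thesis by (simp only: of_int_diff right_minus_eq)
qed

lemma mult_mat_eqI:
  assumes xs: "quotient_basis \<Gamma> \<Delta> xs" and x: "\<And>j. j < l \<Longrightarrow> f j - int_comb xs (\<lambda>i. bit_int (C $$ (i, j))) \<in> \<Delta>"
    "\<And>j. j < l \<Longrightarrow> f j - int_comb xs (\<lambda>i. \<Sum>h<k. bit_int (A $$ (i, h)) * bit_int (D $$ (h, j))) \<in> \<Delta>"
    and car: "A \<in> carrier_mat (length xs) k" "D \<in> carrier_mat k l" "C \<in> carrier_mat (length xs) l"
  shows "A * D = C"
proof (rule eq_matI)
  fix i j assume "i < dim_row C" "j < dim_col C"
  then have ij: "i < length xs" "j < l" using car by auto
  have "(of_int (bit_int (C $$ (i, j))) :: bit) =
      of_int (\<Sum>h<k. bit_int (A $$ (i, h)) * bit_int (D $$ (h, j)))"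
    by (rule coordinates_unique[OF xs x(1) x(2)]) (use ij in auto)
  also have "\<dots> = (\<Sum>h<k. A $$ (i, h) * D $$ (h, j))"
    by (rule even_sum_bit)
  also have "\<dots> = (A * D) $$ (i, j)"
    using ij car by (simp add: scalar_prod_def atLeast0LessThan)
  finally show "(A * D) $$ (i, j) = C $$ (i, j)"
    by (simp only: of_int_bit_int)
qed (use car in auto)

lemma change_of_basis:
  assumes xs: "quotient_basis \<Gamma> \<Delta> xs" and ys: "quotient_basis \<Gamma> \<Delta> ys"
    and P: "P \<in> carrier_mat (length xs) (length ys)"
      "\<And>j. j < length ys \<Longrightarrow> ys ! j - int_comb xs (\<lambda>i. bit_int (P $$ (i, j))) \<in> \<Delta>"
    and Q: "Q \<in> carrier_mat (length ys) (length xs)"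
      "\<And>j. j < length xs \<Longrightarrow> xs ! j - int_comb ys (\<lambda>i. bit_int (Q $$ (i, j))) \<in> \<Delta>"
  shows "P * Q = 1\<^sub>m (length xs)"
proof (rule mult_mat_eqI[OF xs _ _ P(1) Q(1)])
  have xs': "set xs \<subseteq> \<Gamma>" using xs quotient_basis_iff[of xs] by blast
  fix j assume j: "j < length xs"
  have "int_comb xs (\<lambda>i. bit_int (1\<^sub>m (length xs) $$ (i, j))) = (\<Sum>i<length xs. if i = j then xs ! j else 0)"
    unfolding int_comb_def using j by (intro sum.cong) (auto simp: bit_int_def)
  then show "xs ! j - int_comb xs (\<lambda>i. bit_int (1\<^sub>m (length xs) $$ (i, j))) \<in> \<Delta>"
    using j Z.subspace_0[OF \<Delta>] by simp
  have "int_comb ys (\<lambda>i. bit_int (Q $$ (i, j))) -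
      int_comb xs (\<lambda>i. \<Sum>h<length ys. bit_int (P $$ (i, h)) * bit_int (Q $$ (h, j))) \<in> \<Delta>"
    using int_comb_int_comb[OF xs', of ys "\<lambda>x. x" "\<lambda>i j. bit_int (P $$ (i, j))" "\<lambda>i. bit_int (Q $$ (i, j))"] P(2)
    by (simp add: int_comb_def)
  from Z.subspace_add[OF \<Delta> Q(2)[OF j] this]
  show "xs ! j - int_comb xs (\<lambda>i. \<Sum>h<length ys. bit_int (P $$ (i, h)) * bit_int (Q $$ (h, j))) \<in> \<Delta>"
    by simp
qed simp

text \<open>By counting vectors over \<open>bit\<close>: a matrix with a left inverse acts
  injectively.\<close>

lemma length_le:
  fixes P Q :: "bit mat"
  assumes P: "P \<in> carrier_mat k l" and Q: "Q \<in> carrier_mat l k" and PQ: "P * Q = 1\<^sub>m k"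
  shows "k \<le> l"
proof -
  have "inj_on (\<lambda>v. Q *\<^sub>v v) (carrier_vec k)"
  proof (rule inj_onI)
    fix v w :: "bit Matrix.vec" assume v: "v \<in> carrier_vec k" and w: "w \<in> carrier_vec k" and eq: "Q *\<^sub>v v = Q *\<^sub>v w"
    have "v = (P * Q) *\<^sub>v v" using v by (simp add: PQ)
    also have "\<dots> = P *\<^sub>v (Q *\<^sub>v v)" using P Q v by (rule assoc_mult_mat_vec)
    also have "\<dots> = (P * Q) *\<^sub>v w" unfolding eq using P Q w by (rule assoc_mult_mat_vec[symmetric])
    also have "\<dots> = w" using w by (simp add: PQ)
    finally show "v = w" .
  qed
  moreover have "(\<lambda>v. Q *\<^sub>v v) ` carrier_vec k \<subseteq> carrier_vec l"
    using Q by auto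
  ultimately have "card (carrier_vec k :: bit Matrix.vec set) \<le> card (carrier_vec l :: bit Matrix.vec set)"
    by (rule card_inj_on_le) (rule card_carrier_vec_bit(2))
  then show ?thesis by (simp add: card_carrier_vec_bit)
qed

text \<open>Makes the definite description in \<open>quotient_char_poly\<close> meaningful.
  \<open>A * P\<close> and \<open>P * C\<close> both hold the coordinates of
  \<open>\<sigma> (ys ! j)\<close> in the basis \<open>xs\<close>, so the matrices are
  similar.\<close>

lemma char_poly_unique:
  assumes \<sigma>: "linear \<sigma>" "\<sigma> ` \<Delta> \<subseteq> \<Delta>"
    and xs: "quotient_basis \<Gamma> \<Delta> xs" "quotient_matrix \<sigma> \<Delta> xs A"
    and ys: "quotient_basis \<Gamma> \<Delta> ys" "quotient_matrix \<sigma> \<Delta> ys C"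
  shows "char_poly A = char_poly C"
proof -
  have xs': "set xs \<subseteq> \<Gamma>" and ys': "set ys \<subseteq> \<Gamma>"
    using xs(1) ys(1) quotient_basis_iff by blast+
  obtain P where P: "P \<in> carrier_mat (length xs) (length ys)"
    "\<And>j. j < length ys \<Longrightarrow> ys ! j - int_comb xs (\<lambda>i. bit_int (P $$ (i, j))) \<in> \<Delta>"
    using coordinates[OF xs(1) ys'] by blast
  obtain Q where Q: "Q \<in> carrier_mat (length ys) (length xs)"
    "\<And>j. j < length xs \<Longrightarrow> xs ! j - int_comb ys (\<lambda>i. bit_int (Q $$ (i, j))) \<in> \<Delta>"
    using coordinates[OF ys(1) xs'] by blast
  have PQ: "P * Q = 1\<^sub>m (length xs)" by (rule change_of_basis[OF xs(1) ys(1) P Q])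
  have QP: "Q * P = 1\<^sub>m (length ys)" by (rule change_of_basis[OF ys(1) xs(1) Q P])
  have len: "length ys = length xs"
    using length_le[OF P(1) Q(1) PQ] length_le[OF Q(1) P(1) QP] by simp
  have A: "A \<in> carrier_mat (length xs) (length xs)"
    "\<And>j. j < length xs \<Longrightarrow> \<sigma> (xs ! j) - int_comb xs (\<lambda>i. bit_int (A $$ (i, j))) \<in> \<Delta>"
    using xs(2) quotient_matrix_iff[OF xs'] by blast+
  have C: "C \<in> carrier_mat (length ys) (length ys)"
    "\<And>j. j < length ys \<Longrightarrow> \<sigma> (ys ! j) - int_comb ys (\<lambda>i. bit_int (C $$ (i, j))) \<in> \<Delta>"
    using ys(2) quotient_matrix_iff[OF ys'] by blast+
  have PC: "\<sigma> (ys ! j) - int_comb xs (\<lambda>i. \<Sum>h<length ys. bit_int (P $$ (i, h)) * bit_int (C $$ (h, j))) \<in> \<Delta>"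
    if j: "j < length ys" for j
  proof -
    have "int_comb ys (\<lambda>i. bit_int (C $$ (i, j))) -
        int_comb xs (\<lambda>i. \<Sum>h<length ys. bit_int (P $$ (i, h)) * bit_int (C $$ (h, j))) \<in> \<Delta>"
      using int_comb_int_comb[OF xs', of ys "\<lambda>x. x" "\<lambda>i j. bit_int (P $$ (i, j))" "\<lambda>i. bit_int (C $$ (i, j))"] P(2)
      by (simp add: int_comb_def)
    from Z.subspace_add[OF \<Delta> C(2)[OF j] this] show ?thesis by simp
  qed
  have AP: "\<sigma> (ys ! j) - int_comb xs (\<lambda>i. \<Sum>h<length xs. bit_int (A $$ (i, h)) * bit_int (P $$ (h, j))) \<in> \<Delta>"
    if j: "j < length ys" for j
  proof -
    have "\<sigma> (ys ! j - int_comb xs (\<lambda>i. bit_int (P $$ (i, j)))) \<in> \<Delta>"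
      using \<sigma>(2) P(2)[OF j] by blast
    then have 1: "\<sigma> (ys ! j) - (\<Sum>h<length xs. of_int (bit_int (P $$ (h, j))) *\<^sub>R \<sigma> (xs ! h)) \<in> \<Delta>"
      by (simp add: int_comb_def linear_diff[OF \<sigma>(1)] linear_sum[OF \<sigma>(1)] linear_scale[OF \<sigma>(1)])
    have "(\<Sum>h<length xs. of_int (bit_int (P $$ (h, j))) *\<^sub>R \<sigma> (xs ! h)) -
        int_comb xs (\<lambda>i. \<Sum>h<length xs. bit_int (A $$ (i, h)) * bit_int (P $$ (h, j))) \<in> \<Delta>"
      using A(2) by (intro int_comb_int_comb[OF xs']) auto
    from Z.subspace_add[OF \<Delta> 1 this] show ?thesis by simp
  qed
  define Y where "Y = A * P"
  have Y: "Y \<in> carrier_mat (length xs) (length ys)"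
    using A P by (simp add: Y_def)
  have Yj: "\<sigma> (ys ! j) - int_comb xs (\<lambda>i. bit_int (Y $$ (i, j))) \<in> \<Delta>" if j: "j < length ys" for j
  proof -
    have "int_comb xs (\<lambda>i. bit_int (Y $$ (i, j)) - (\<Sum>h<length xs. bit_int (A $$ (i, h)) * bit_int (P $$ (h, j)))) \<in> \<Delta>"
    proof (rule even_comb[OF xs'])
      fix i assume i: "i < length xs"
      have "Y $$ (i, j) = (\<Sum>h<length xs. A $$ (i, h) * P $$ (h, j))"
        using i j A P by (simp add: Y_def scalar_prod_def atLeast0LessThan)
      then show "even (bit_int (Y $$ (i, j)) - (\<Sum>h<length xs. bit_int (A $$ (i, h)) * bit_int (P $$ (h, j))))"
        unfolding even_bit_int_iff even_sum_bit .
    qed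
    then have "int_comb xs (\<lambda>i. bit_int (Y $$ (i, j))) -
        int_comb xs (\<lambda>i. \<Sum>h<length xs. bit_int (A $$ (i, h)) * bit_int (P $$ (h, j))) \<in> \<Delta>"
      by (simp only: int_comb_diff)
    from Z.subspace_diff[OF \<Delta> AP[OF j] this] show ?thesis by simp
  qed
  have "P * C = Y"
    by (rule mult_mat_eqI[OF xs(1) Yj PC P(1) C(1) Y])
  then have eq: "A * P = P * C" by (simp add: Y_def)
  have "A = A * (P * Q)" using A by (simp add: PQ)
  also have "\<dots> = P * C * Q" using A P Q eq by (metis assoc_mult_mat)
  finally have "A = P * C * Q" .
  then have "similar_mat_wit A C P Q"
    unfolding similar_mat_wit_def Let_def using A P Q C PQ QP len by auto
  then have "similar_mat A C"
    by (auto simp: similar_mat_def)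
  then show ?thesis by (rule char_poly_similar)
qed

lemma quotient_char_poly_eq:
  assumes "linear \<sigma>" "\<sigma> ` \<Delta> \<subseteq> \<Delta>"
    and "quotient_basis \<Gamma> \<Delta> xs" "quotient_matrix \<sigma> \<Delta> xs A"
  shows "quotient_char_poly \<sigma> \<Gamma> \<Delta> = char_poly A"
  unfolding quotient_char_poly_def
  using assms char_poly_unique[OF assms(1,2)] by (intro the_equality) blast+

end

section \<open>Companion matrices and fixed vectors\<close>

lemma comm_ring_hom_f2_emb:
  assumes "(2 :: 'a::comm_ring_1) = 0"
  shows "comm_ring_hom (f2_emb :: bit \<Rightarrow> 'a)"
proof
  have *: "(1 :: 'a) + 1 = 0" using assms by simp
  fix x y :: bit
  show "f2_emb (x + y) = (f2_emb x + f2_emb y :: 'a)"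
    by (cases x; cases y) (simp_all add: f2_emb_def assms)
  show "f2_emb (x * y) = (f2_emb x * f2_emb y :: 'a)"
    by (cases x; cases y) (simp_all add: f2_emb_def)
qed simp_all

text \<open>Multiplication by the variable on polynomials modulo \<open>g\<close>, for monic
  \<open>g\<close>, in the basis of powers.\<close>

definition companion :: "'a::comm_ring_1 poly \<Rightarrow> 'a mat" where
  "companion g = Matrix.mat (Polynomial.degree g) (Polynomial.degree g)
     (\<lambda>(i, j). if Suc j < Polynomial.degree g then of_bool (i = Suc j) else - Polynomial.coeff g i)"

lemma companion_carrier [simp]: "companion g \<in> carrier_mat (Polynomial.degree g) (Polynomial.degree g)"
  by (simp add: companion_def)

text \<open>The powers of a root form an eigenvector of the transposed companion matrix.\<close>

lemma companion_root:
  fixes g :: "'a::field poly"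
  assumes g: "Polynomial.lead_coeff g = 1" and x: "poly g x = 0"
  shows "poly (char_poly (companion g)) x = 0"
proof -
  define k where "k = Polynomial.degree g"
  have k: "k > 0"
  proof (rule ccontr)
    assume "\<not> k > 0"
    then have "g = 1" using g by (metis degree_0_id gr0I k_def one_pCons)
    then show False using x by simp
  qed
  define C where "C = transpose_mat (companion g)"
  have C: "C \<in> carrier_mat k k" by (simp add: C_def k_def)
  define v where "v = Matrix.vec k (\<lambda>i. x ^ i)"
  have v: "v \<in> carrier_vec k" by (simp add: v_def)
  have "C *\<^sub>v v = x \<cdot>\<^sub>v v"
  proof (rule eq_vecI)
    fix j assume "j < dim_vec (x \<cdot>\<^sub>v v)"
    then have j: "j < k" using v by simp
    have "vec_index (C *\<^sub>v v) j = (\<Sum>i<k. companion g $$ (i, j) * x ^ i)"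
      using j by (simp add: C_def v_def scalar_prod_def atLeast0LessThan companion_def k_def)
    also have "\<dots> = x ^ Suc j"
    proof (cases "Suc j < k")
      case True
      have "(\<Sum>i<k. companion g $$ (i, j) * x ^ i) = (\<Sum>i<k. if i = Suc j then x ^ Suc j else 0)"
        using j True by (intro sum.cong) (auto simp: companion_def k_def)
      then show ?thesis using True by simp
    next
      case False
      then have Suc_j: "Suc j = k" using j by simp
      have "(\<Sum>i<k. companion g $$ (i, j) * x ^ i) = - (\<Sum>i<k. Polynomial.coeff g i * x ^ i)"
        unfolding sum_negf[symmetric] using j False by (intro sum.cong) (auto simp: companion_def k_def)
      moreover have "poly g x = (\<Sum>i<k. Polynomial.coeff g i * x ^ i) + x ^ k"
        using g by (simp add: poly_altdef k_def lessThan_Suc_atMost[symmetric])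
      ultimately show ?thesis
        unfolding Suc_j using x by (metis add.commute add_eq_0_iff)
    qed
    finally show "vec_index (C *\<^sub>v v) j = vec_index (x \<cdot>\<^sub>v v) j"
      using j v by (simp add: v_def)
  qed (use C v in auto)
  moreover have "v \<noteq> 0\<^sub>v k"
  proof
    assume "v = 0\<^sub>v k"
    then have "vec_index v 0 = 0" using k by simp
    then show False using k by (simp add: v_def)
  qed
  ultimately have "eigenvalue C x"
    using v C unfolding eigenvalue_def eigenvector_def by auto
  then have "poly (char_poly C) x = 0"
    using eigenvalue_root_char_poly[OF C] by simp
  then show ?thesis
    unfolding C_def using char_poly_transpose_mat[OF companion_carrier] by metis
qed

lemma companion_hom:
  assumes "comm_ring_hom h" "\<And>x. h x = 0 \<Longrightarrow> x = 0"
  shows "map_mat h (companion g) = companion (map_poly h g)"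
proof -
  interpret comm_ring_hom h by (rule assms(1))
  have "Polynomial.degree (map_poly h g) = Polynomial.degree g"
    by (rule degree_map_poly) (metis assms(2) hom_zero leading_coeff_0_iff)
  then show ?thesis
    by (intro eq_matI) (simp_all add: companion_def coeff_map_poly hom_uminus)
qed

text \<open>The characteristic polynomial has degree \<open>card R\<close> and vanishes on
  \<open>R\<close>; this leaves no room for further roots, and it need not be computed.\<close>

lemma char_poly_companion_roots:
  fixes g :: "bit poly"
  assumes two: "(2 :: 'a::field) = 0" and g: "Polynomial.lead_coeff g = 1"
    and R: "finite R" "card R = Polynomial.degree g" "\<And>x. x \<in> R \<Longrightarrow> poly (map_poly f2_emb g) x = (0 :: 'a)"
  shows "{x :: 'a. poly (map_poly f2_emb (char_poly (companion g))) x = 0} = R"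
proof -
  interpret h: comm_ring_hom "f2_emb :: bit \<Rightarrow> 'a" by (rule comm_ring_hom_f2_emb[OF two])
  define p :: "'a poly" where "p = map_poly f2_emb (char_poly (companion g))"
  have inj: "x = 0" if "f2_emb x = (0 :: 'a)" for x
    using that by (simp add: f2_emb_def split: if_splits)
  have p: "p = char_poly (companion (map_poly f2_emb g))"
    using h.char_poly_hom[OF companion_carrier, of g]
      companion_hom[OF h.comm_ring_hom_axioms, of g] inj by (simp add: p_def)
  have deg: "Polynomial.degree (map_poly f2_emb g :: 'a poly) = Polynomial.degree g"
    by (rule degree_map_poly) (simp add: f2_emb_def)
  have lead: "Polynomial.lead_coeff (map_poly f2_emb g :: 'a poly) = 1"
    unfolding deg using g by (simp add: coeff_map_poly)
  have "Polynomial.degree p = Polynomial.degree g \<and> Polynomial.coeff p (Polynomial.degree g) = 1"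
    unfolding p deg[symmetric] by (rule degree_monic_char_poly) simp
  then have pdeg: "Polynomial.degree p = card R" "p \<noteq> 0" using R(2) by auto
  have sub: "R \<subseteq> {x. poly p x = 0}"
    using R(3) companion_root[OF lead] by (auto simp: p)
  have "card {x. poly p x = 0} \<le> card R"
    using card_poly_roots_bound[OF pdeg(2)] by (simp add: pdeg(1))
  then have "R = {x. poly p x = 0}"
    using poly_roots_finite[OF pdeg(2)] sub by (intro card_seteq) auto
  then show ?thesis by (simp add: p_def)
qed

text \<open>The action on a quotient with one additional basis vector that is fixed.\<close>

definition add_fixed :: "'a::comm_ring_1 mat \<Rightarrow> 'a mat" where
  "add_fixed A = four_block_mat (1\<^sub>m 1) (0\<^sub>m 1 (dim_row A)) (0\<^sub>m (dim_row A) 1) A"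

lemma add_fixed_carrier: "A \<in> carrier_mat k k \<Longrightarrow> add_fixed A \<in> carrier_mat (Suc k) (Suc k)"
  by (auto simp: add_fixed_def)

lemma char_poly_add_fixed:
  fixes A :: "'a::idom mat"
  assumes "A \<in> carrier_mat k k"
  shows "char_poly (add_fixed A) = [:- 1, 1:] * char_poly A"
proof -
  have "char_poly (1\<^sub>m 1 :: 'a mat) = [:- 1, 1:]"
    by (subst char_poly_upper_triangular[of _ 1]) (auto simp: diag_mat_def)
  then show ?thesis
    unfolding add_fixed_def
    using assms char_poly_four_block_zeros_col[of "1\<^sub>m 1" "0\<^sub>m 1 k" k A] by auto
qed

lemma int_comb_Cons: "int_comb (x # xs) c = of_int (c 0) *\<^sub>R x + int_comb xs (\<lambda>i. c (Suc i))"
  by (simp add: int_comb_def sum.lessThan_Suc_shift del: sum.lessThan_Suc)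

lemma int_comb_zero [simp]: "int_comb xs (\<lambda>i. 0) = 0"
  by (simp add: int_comb_def)

lemma int_comb_cong: "(\<And>i. i < length xs \<Longrightarrow> c i = d i) \<Longrightarrow> int_comb xs c = int_comb xs d"
  by (simp add: int_comb_def)

lemma quotient_matrix_int_comb:
  "quotient_matrix \<sigma> \<Delta> xs A \<longleftrightarrow> A \<in> carrier_mat (length xs) (length xs) \<and>
     (\<forall>j<length xs. \<sigma> (xs ! j) - int_comb xs (\<lambda>i. bit_int (A $$ (i, j))) \<in> \<Delta>)"
  unfolding quotient_matrix_def int_comb_bit_int ..

lemma quotient_matrix_add_fixed:
  assumes A: "quotient_matrix \<sigma> \<Delta> xs A" and x: "\<sigma> x - x \<in> \<Delta>"
  shows "quotient_matrix \<sigma> \<Delta> (x # xs) (add_fixed A)"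
  unfolding quotient_matrix_int_comb
proof (intro conjI allI impI)
  have A: "A \<in> carrier_mat (length xs) (length xs)"
    "\<And>j. j < length xs \<Longrightarrow> \<sigma> (xs ! j) - int_comb xs (\<lambda>i. bit_int (A $$ (i, j))) \<in> \<Delta>"
    using A by (auto simp: quotient_matrix_int_comb)
  show "add_fixed A \<in> carrier_mat (length (x # xs)) (length (x # xs))"
    using add_fixed_carrier[OF A(1)] by simp
  fix j assume j: "j < length (x # xs)"
  show "\<sigma> ((x # xs) ! j) - int_comb (x # xs) (\<lambda>i. bit_int (add_fixed A $$ (i, j))) \<in> \<Delta>"
  proof (cases j)
    case 0
    have "int_comb xs (\<lambda>i. bit_int (add_fixed A $$ (Suc i, 0))) = int_comb xs (\<lambda>i. 0)"
      using A(1) by (intro int_comb_cong) (simp add: add_fixed_def bit_int_def)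
    then show ?thesis
      using 0 x A(1) by (simp add: int_comb_Cons) (simp add: add_fixed_def bit_int_def)
  next
    case (Suc l)
    then have l: "l < length xs" using j by simp
    have "int_comb xs (\<lambda>i. bit_int (add_fixed A $$ (Suc i, Suc l))) = int_comb xs (\<lambda>i. bit_int (A $$ (i, l)))"
      using A(1) l by (intro int_comb_cong) (simp add: add_fixed_def)
    moreover have "bit_int (add_fixed A $$ (0, Suc l)) = 0"
      using A(1) l by (simp add: add_fixed_def bit_int_def)
    ultimately show ?thesis
      using Suc A(2)[OF l] by (simp add: int_comb_Cons)
  qed
qed

lemma quotient_matrix_companion:
  assumes len: "length xs = Polynomial.degree g" and 0: "0 \<in> \<Delta>"
    and step: "\<And>j. Suc j < length xs \<Longrightarrow> \<sigma> (xs ! j) = xs ! Suc j"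
    and last: "\<And>j. Suc j = length xs \<Longrightarrow> \<sigma> (xs ! j) - int_comb xs (\<lambda>i. bit_int (Polynomial.coeff g i)) \<in> \<Delta>"
  shows "quotient_matrix \<sigma> \<Delta> xs (companion g)"
  unfolding quotient_matrix_int_comb
proof (intro conjI allI impI)
  show "companion g \<in> carrier_mat (length xs) (length xs)" by (simp add: len)
  fix j assume j: "j < length xs"
  show "\<sigma> (xs ! j) - int_comb xs (\<lambda>i. bit_int (companion g $$ (i, j))) \<in> \<Delta>"
  proof (cases "Suc j < length xs")
    case True
    have "int_comb xs (\<lambda>i. bit_int (companion g $$ (i, j))) = (\<Sum>i<length xs. if i = Suc j then xs ! Suc j else 0)"
      unfolding int_comb_def using j True by (intro sum.cong) (auto simp: companion_def len bit_int_def)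
    then show ?thesis using True 0 by (simp add: step)
  next
    case False
    then have Suc_j: "Suc j = length xs" using j by simp
    have "int_comb xs (\<lambda>i. bit_int (companion g $$ (i, j))) = int_comb xs (\<lambda>i. bit_int (Polynomial.coeff g i))"
      using j False by (intro int_comb_cong) (auto simp: companion_def len)
    then show ?thesis using last[OF Suc_j] by simp
  qed
qed

section \<open>Determinants of lattices of full rank\<close>

definition row_matrix :: "('n::finite \<Rightarrow> 'n euclid) \<Rightarrow> (('n euclid), 'n) Finite_Cartesian_Product.vec" where
  "row_matrix C = (\<chi> i. C i)"

lemma det_row_matrix_nz_iff:
  fixes C :: "'n::finite \<Rightarrow> 'n euclid"
  shows "Determinants.det (row_matrix C) \<noteq> 0 \<longleftrightarrow> inj C \<and> Real_Vector_Spaces.independent (range C)"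
proof -
  have row: "Finite_Cartesian_Product.row i (row_matrix C) = C i" for i
    by (simp add: Finite_Cartesian_Product.row_def row_matrix_def Finite_Cartesian_Product.vec_eq_iff)
  have "Determinants.det (row_matrix C) \<noteq> 0 \<longleftrightarrow> (\<exists>D. row_matrix C ** D = Finite_Cartesian_Product.mat 1)"
    using invertible_det_nz invertible_right_inverse by metis
  also have "\<dots> \<longleftrightarrow> (\<forall>c. (\<Sum>i\<in>UNIV. c i *s C i) = 0 \<longrightarrow> (\<forall>i. c i = 0))"
    unfolding matrix_right_invertible_independent_rows row ..
  also have "\<dots> \<longleftrightarrow> inj C \<and> Real_Vector_Spaces.independent (range C)"
  proof
    assume *: "\<forall>c. (\<Sum>i\<in>UNIV. c i *s C i) = 0 \<longrightarrow> (\<forall>i. c i = 0)"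
    have inj: "inj C"
    proof (rule injI, rule ccontr)
      fix x y assume "C x = C y" "x \<noteq> y"
      define c where "c i = (if i = x then 1 else if i = y then -1 else 0 :: real)" for i
      have "(\<Sum>i\<in>UNIV. c i *s C i) = (\<Sum>i\<in>{x, y}. c i *s C i)"
        by (rule sum.mono_neutral_right) (auto simp: c_def)
      also have "\<dots> = 0"
        using \<open>C x = C y\<close> \<open>x \<noteq> y\<close> by (simp add: c_def scalar_mult_eq_scaleR)
      finally have "c x = 0" using * by blast
      then show False by (simp add: c_def)
    qed
    have "Real_Vector_Spaces.independent (range C)"
    proof (rule real_vector.independent_if_scalars_zero)
      fix f x assume s: "(\<Sum>x\<in>range C. f x *\<^sub>R x) = 0" and x: "x \<in> range C"
      have "(\<Sum>i\<in>UNIV. f (C i) *s C i) = 0"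
        using s inj by (simp add: sum.reindex scalar_mult_eq_scaleR)
      then have "\<forall>i. f (C i) = 0" using *[rule_format, of "\<lambda>i. f (C i)"] by blast
      then show "f x = 0" using x by auto
    qed simp
    then show "inj C \<and> Real_Vector_Spaces.independent (range C)" using inj by blast
  next
    assume *: "inj C \<and> Real_Vector_Spaces.independent (range C)"
    show "\<forall>c. (\<Sum>i\<in>UNIV. c i *s C i) = 0 \<longrightarrow> (\<forall>i. c i = 0)"
    proof (intro allI impI)
      fix c i assume s: "(\<Sum>i\<in>UNIV. c i *s C i) = 0"
      have "(\<Sum>x\<in>range C. c (the_inv C x) *\<^sub>R x) = 0"
        using s * by (simp add: sum.reindex scalar_mult_eq_scaleR the_inv_f_f)
      then have "c (the_inv C (C i)) = 0"
        using * by (intro independentD[of "range C" "range C" "\<lambda>x. c (the_inv C x)"]) auto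
      then show "c i = 0" using * by (simp add: the_inv_f_f)
    qed
  qed
  finally show ?thesis .
qed

lemma det_gram:
  fixes C :: "'n::finite \<Rightarrow> 'n euclid"
  shows "Determinants.det (\<chi> i j. C i \<bullet> C j) = (Determinants.det (row_matrix C))\<^sup>2"
proof -
  have "(\<chi> i j. C i \<bullet> C j) = row_matrix C ** Finite_Cartesian_Product.transpose (row_matrix C)"
    by (simp add: Finite_Cartesian_Product.vec_eq_iff matrix_matrix_mult_def Finite_Cartesian_Product.transpose_def
        row_matrix_def inner_vec_def)
  then show ?thesis
    by (simp add: det_mul det_transpose power2_eq_square)
qed

lemma span_int_scale_range:
  fixes C :: "'n::finite \<Rightarrow> 'a::real_vector"
  shows "Z.span (range C) = (range (\<lambda>k. \<Sum>i\<in>UNIV. of_int (k i) *\<^sub>R C i))"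
proof
  have "Z.subspace (range (\<lambda>k. \<Sum>i\<in>UNIV. of_int (k i) *\<^sub>R C i))"
  proof (rule Z.subspaceI)
    show "0 \<in> (range (\<lambda>k. \<Sum>i\<in>UNIV. of_int (k i) *\<^sub>R C i))"
      by (rule range_eqI[of _ _ "\<lambda>i. 0"]) simp
  next
    fix x y assume "x \<in> (range (\<lambda>k. \<Sum>i\<in>UNIV. of_int (k i) *\<^sub>R C i))"
      "y \<in> (range (\<lambda>k. \<Sum>i\<in>UNIV. of_int (k i) *\<^sub>R C i))"
    then obtain k l where "x = (\<Sum>i\<in>UNIV. of_int (k i) *\<^sub>R C i)" "y = (\<Sum>i\<in>UNIV. of_int (l i) *\<^sub>R C i)"
      by blast
    then have "x + y = (\<Sum>i\<in>UNIV. of_int (k i + l i) *\<^sub>R C i)"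
      by (simp add: scaleR_left_distrib sum.distrib)
    then show "x + y \<in> (range (\<lambda>k. \<Sum>i\<in>UNIV. of_int (k i) *\<^sub>R C i))"
      by (intro range_eqI[where x = "\<lambda>i. k i + l i"]) simp
  next
    fix c x assume "x \<in> (range (\<lambda>k. \<Sum>i\<in>UNIV. of_int (k i) *\<^sub>R C i))"
    then obtain k where "x = (\<Sum>i\<in>UNIV. of_int (k i) *\<^sub>R C i)" by blast
    then have "int_scale c x = (\<Sum>i\<in>UNIV. of_int (c * k i) *\<^sub>R C i)"
      by (simp add: int_scale_def scaleR_sum_right)
    then show "int_scale c x \<in> (range (\<lambda>k. \<Sum>i\<in>UNIV. of_int (k i) *\<^sub>R C i))"
      by (intro range_eqI[where x = "\<lambda>i. c * k i"]) simp
  qed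
  moreover have "range C \<subseteq> (range (\<lambda>k. \<Sum>i\<in>UNIV. of_int (k i) *\<^sub>R C i))"
  proof
    fix x assume "x \<in> range C"
    then obtain i where x: "x = C i" by blast
    have "(\<Sum>j\<in>UNIV. of_int (of_bool (j = i)) *\<^sub>R C j) = (\<Sum>j\<in>UNIV. if j = i then C i else 0)"
      by (rule sum.cong) auto
    then have "x = (\<Sum>j\<in>UNIV. of_int (of_bool (j = i)) *\<^sub>R C j)" by (simp add: x)
    then show "x \<in> (range (\<lambda>k. \<Sum>i\<in>UNIV. of_int (k i) *\<^sub>R C i))"
      by (intro range_eqI[where x = "\<lambda>j. of_bool (j = i)"]) simp
  qed
  ultimately show "Z.span (range C) \<subseteq> (range (\<lambda>k. \<Sum>i\<in>UNIV. of_int (k i) *\<^sub>R C i))"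
    by (intro Z.span_minimal)
next
  have "of_int (k i) *\<^sub>R C i \<in> Z.span (range C)" for k i
    using Z.span_scale[OF Z.span_base, of "C i" "range C" "k i"] by (simp add: int_scale_def)
  then show "(range (\<lambda>k. \<Sum>i\<in>UNIV. of_int (k i) *\<^sub>R C i)) \<subseteq> Z.span (range C)"
    by (auto intro: Z.span_sum)
qed

definition has_lattice_det :: "'n::finite euclid set \<Rightarrow> real \<Rightarrow> bool" where
  "has_lattice_det L d \<longleftrightarrow> (\<exists>C. lattice_basis C L \<and> d = (Determinants.det (row_matrix C))\<^sup>2)"

lemma lattice_basis_iff: "lattice_basis C L \<longleftrightarrow> Determinants.det (row_matrix C) \<noteq> 0 \<and> Z.span (range C) = L"
  by (auto simp: lattice_basis_def det_row_matrix_nz_iff)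

text \<open>The change of basis has an integer determinant, nonzero and hence of absolute value at
  least 1. With the roles exchanged this shows that the lattice determinant does not depend on the
  basis.\<close>

lemma abs_det_le:
  assumes C: "lattice_basis C L" and D: "lattice_basis D L"
  shows "\<bar>Determinants.det (row_matrix C)\<bar> \<le> \<bar>Determinants.det (row_matrix D)\<bar>"
proof -
  have "\<exists>k. D i = (\<Sum>j\<in>UNIV. of_int (k j) *\<^sub>R C j)" for i
  proof -
    have "D i \<in> Z.span (range C)"
      using C D Z.span_base[of "D i" "range D"] by (simp add: lattice_basis_iff)
    then show ?thesis unfolding span_int_scale_range by blast
  qed
  then obtain k :: "'a \<Rightarrow> 'a \<Rightarrow> int" where k: "\<And>i. D i = (\<Sum>j\<in>UNIV. of_int (k i j) *\<^sub>R C j)" by metis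
  define K where "K = (\<chi> i j. real_of_int (k i j))"
  have "row_matrix D = K ** row_matrix C"
  proof (rule Finite_Cartesian_Product.vec_eq_iff[THEN iffD2], rule allI)
    fix i
    show "Finite_Cartesian_Product.vec_nth (row_matrix D) i =
        Finite_Cartesian_Product.vec_nth (K ** row_matrix C) i"
      by (simp add: matrix_matrix_mult_def row_matrix_def K_def k Finite_Cartesian_Product.vec_eq_iff sum_component)
  qed
  then have det: "Determinants.det (row_matrix D) = Determinants.det K * Determinants.det (row_matrix C)"
    by (simp add: det_mul)
  have "Determinants.det K \<in> \<int>"
    unfolding Determinants.det_def K_def by (intro Ints_sum Ints_mult Ints_prod) auto
  moreover have "Determinants.det K \<noteq> 0"
    using D by (auto simp: lattice_basis_iff det)
  ultimately have "1 \<le> \<bar>Determinants.det K\<bar>"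
    by (auto elim!: Ints_cases)
  then have "1 * \<bar>Determinants.det (row_matrix C)\<bar> \<le> \<bar>Determinants.det K\<bar> * \<bar>Determinants.det (row_matrix C)\<bar>"
    by (intro mult_right_mono) auto
  then show ?thesis by (simp add: det abs_mult)
qed

lemma lattice_det_eq: "has_lattice_det L d \<Longrightarrow> lattice_det L = d"
proof -
  assume "has_lattice_det L d"
  then obtain C where C: "lattice_basis C L" "d = (Determinants.det (row_matrix C))\<^sup>2"
    by (auto simp: has_lattice_det_def)
  show ?thesis
    unfolding lattice_det_def
  proof (rule the_equality)
    show "\<exists>C. lattice_basis C L \<and> d = Determinants.det (\<chi> i j. C i \<bullet> C j)"
      using C by (auto simp: det_gram)
    fix e assume "\<exists>C. lattice_basis C L \<and> e = Determinants.det (\<chi> i j. C i \<bullet> C j)"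
    then obtain D where D: "lattice_basis D L" "e = (Determinants.det (row_matrix D))\<^sup>2"
      by (auto simp: det_gram)
    have "\<bar>Determinants.det (row_matrix C)\<bar> = \<bar>Determinants.det (row_matrix D)\<bar>"
      using abs_det_le C(1) D(1) by (intro antisym) auto
    then show "e = d" by (metis C(2) D(2) power2_abs)
  qed
qed

text \<open>In a basis of \<open>L\<close> some coefficient of \<open>2 *\<^sub>R x\<close> is odd,
  or \<open>x\<close> would lie in \<open>L\<close>. Only parities matter modulo \<open>L\<close>,
  so the corresponding basis vector can be exchanged for half the sum of all basis vectors with odd
  coefficient, which halves the determinant of the basis and divides the Gram determinant by
  4.\<close>

lemma has_lattice_det_insert:
  assumes L: "has_lattice_det L d" and x: "x \<notin> L" "2 *\<^sub>R x \<in> L"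
  shows "has_lattice_det {y + of_int k *\<^sub>R x | y k. y \<in> L} (d / 4)"
proof -
  obtain C where C: "lattice_basis C L" and d: "d = (Determinants.det (row_matrix C))\<^sup>2"
    using L by (auto simp: has_lattice_det_def)
  have L_eq: "L = Z.span (range C)" and nz: "Determinants.det (row_matrix C) \<noteq> 0"
    using C by (auto simp: lattice_basis_iff)
  have subL: "Z.subspace L" by (simp add: L_eq)
  have CL: "C i \<in> L" for i by (simp add: L_eq Z.span_base)
  obtain a where a: "2 *\<^sub>R x = (\<Sum>i\<in>UNIV. of_int (a i) *\<^sub>R C i)"
    using x(2) unfolding L_eq span_int_scale_range by blast
  have scL: "of_int k *\<^sub>R y \<in> L" if "y \<in> L" for k y
    using Z.subspace_scale[OF subL that, of k] by (simp add: int_scale_def)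
  have "\<exists>i. odd (a i)"
  proof (rule ccontr)
    assume "\<not> ?thesis"
    then have "2 *\<^sub>R x = 2 *\<^sub>R (\<Sum>i\<in>UNIV. of_int (a i div 2) *\<^sub>R C i)"
      unfolding a scaleR_sum_right
    proof (intro sum.cong refl)
      fix i
      have "a i = 2 * (a i div 2)" using \<open>\<not> (\<exists>i. odd (a i))\<close> by auto
      then have "real_of_int (a i) = 2 * real_of_int (a i div 2)"
        by (metis of_int_mult of_int_numeral)
      then show "real_of_int (a i) *\<^sub>R C i = 2 *\<^sub>R real_of_int (a i div 2) *\<^sub>R C i"
        by simp
    qed
    then have "x = (\<Sum>i\<in>UNIV. of_int (a i div 2) *\<^sub>R C i)" by simp
    then have "x \<in> L" unfolding L_eq span_int_scale_range
      by (intro range_eqI[where x = "\<lambda>i. a i div 2"]) simp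
    then show False using x(1) by simp
  qed
  then obtain i0 where i0: "odd (a i0)" by blast
  define s where "s = (\<Sum>i\<in>UNIV - {i0}. of_int (a i mod 2) *\<^sub>R C i)"
  define z where "z = (\<Sum>i\<in>UNIV. of_int (a i div 2) *\<^sub>R C i)"
  \<comment> \<open>Differs from \<open>x\<close> by \<open>z \<in> L\<close>, so it generates the
    same overlattice.\<close>
  define x' where "x' = (1 / 2) *\<^sub>R (C i0 + s)"
  have zL: "z \<in> L" unfolding z_def L_eq span_int_scale_range by (rule rangeI)
  have sL: "s \<in> L" unfolding s_def by (intro Z.subspace_sum[OF subL] scL CL)
  have "2 *\<^sub>R x = 2 *\<^sub>R z + (C i0 + s)"
  proof -
    have "2 *\<^sub>R x = (\<Sum>i\<in>UNIV. 2 *\<^sub>R (of_int (a i div 2) *\<^sub>R C i) + of_int (a i mod 2) *\<^sub>R C i)"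
      unfolding a
    proof (rule sum.cong[OF refl])
      fix i
      have "real_of_int (a i) = 2 * of_int (a i div 2) + of_int (a i mod 2)"
        by (metis mult_div_mod_eq of_int_add of_int_mult of_int_numeral)
      then show "real_of_int (a i) *\<^sub>R C i = 2 *\<^sub>R real_of_int (a i div 2) *\<^sub>R C i + real_of_int (a i mod 2) *\<^sub>R C i"
        by (simp add: scaleR_left_distrib)
    qed
    also have "\<dots> = 2 *\<^sub>R z + (\<Sum>i\<in>UNIV. of_int (a i mod 2) *\<^sub>R C i)"
      by (simp add: sum.distrib z_def scaleR_sum_right)
    also have "(\<Sum>i\<in>UNIV. of_int (a i mod 2) *\<^sub>R C i) = C i0 + s"
      using i0 by (simp add: s_def sum.remove[of UNIV i0] odd_iff_mod_2_eq_one)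
    finally show ?thesis .
  qed
  then have "(1 / 2) *\<^sub>R (2 *\<^sub>R x) = (1 / 2) *\<^sub>R (2 *\<^sub>R z + (C i0 + s))" by simp
  then have xx': "x = z + x'" by (simp add: x'_def scaleR_right_distrib)
  have Ci0: "C i0 = 2 *\<^sub>R x' - s" by (simp add: x'_def)
  define C' where "C' = C(i0 := x')"
  have det: "Determinants.det (row_matrix C') = Determinants.det (row_matrix C) / 2"
  proof -
    have row: "Finite_Cartesian_Product.row i (row_matrix C) = C i" for i
      by (simp add: Finite_Cartesian_Product.row_def row_matrix_def Finite_Cartesian_Product.vec_eq_iff)
    have "row_matrix C' = (\<chi> i. if i = i0 then (1 / 2) *s (C i0 + s) else C i)"
      by (simp add: row_matrix_def C'_def x'_def Finite_Cartesian_Product.vec_eq_iff scalar_mult_eq_scaleR)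
    then have "Determinants.det (row_matrix C') =
        (1 / 2) * Determinants.det (\<chi> i. if i = i0 then C i0 + s else C i)"
      by (simp add: det_row_mul)
    also have "Determinants.det (\<chi> i. if i = i0 then C i0 + s else C i) = Determinants.det (row_matrix C)"
    proof -
      have "s \<in> vec.span {Finite_Cartesian_Product.row j (row_matrix C) |j. j \<noteq> i0}"
        unfolding s_def row scalar_mult_eq_scaleR[symmetric]
        by (intro vec.span_sum vec.span_scale vec.span_base) auto
      from det_row_span[OF this] show ?thesis
        unfolding row .
    qed
    finally show ?thesis by simp
  qed
  let ?M = "{y + of_int k *\<^sub>R x | y k. y \<in> L}"
  have "Z.span (range C') = ?M"
  proof
    have subM: "Z.subspace ?M"
    proof (rule Z.subspaceI)
      show "0 \<in> ?M"
        using Z.subspace_0[OF subL] by (intro CollectI exI[of _ 0]) simp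
    next
      fix u v assume "u \<in> ?M" "v \<in> ?M"
      then obtain y k y' k' where "u = y + of_int k *\<^sub>R x" "v = y' + of_int k' *\<^sub>R x" "y \<in> L" "y' \<in> L"
        by blast
      then have "u + v = (y + y') + of_int (k + k') *\<^sub>R x" "y + y' \<in> L"
        by (auto simp: scaleR_left_distrib intro: Z.subspace_add[OF subL])
      then show "u + v \<in> ?M" by blast
    next
      fix c u assume "u \<in> ?M"
      then obtain y k where "u = y + of_int k *\<^sub>R x" "y \<in> L" by blast
      then have "int_scale c u = of_int c *\<^sub>R y + of_int (c * k) *\<^sub>R x" "of_int c *\<^sub>R y \<in> L"
        by (auto simp: int_scale_def scaleR_right_distrib intro: scL)
      then show "int_scale c u \<in> ?M" by blast
    qed
    have LM: "y \<in> ?M" if "y \<in> L" for y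
      using that by (intro CollectI exI[of _ y] exI[of _ 0]) simp
    have "x' = - z + of_int 1 *\<^sub>R x" by (simp add: xx')
    then have "x' \<in> ?M" using Z.subspace_neg[OF subL zL] by blast
    then have "range C' \<subseteq> ?M" using LM CL by (auto simp: C'_def)
    then show "Z.span (range C') \<subseteq> ?M" by (rule Z.span_minimal[OF _ subM])
    have sub': "Z.subspace (Z.span (range C'))" by simp
    have sc': "of_int k *\<^sub>R y \<in> Z.span (range C')" if "y \<in> Z.span (range C')" for k y
      using Z.span_scale[OF that, of k] by (simp add: int_scale_def)
    have x'_in: "x' \<in> Z.span (range C')" by (rule Z.span_base) (auto simp: C'_def)
    have C_in: "C i \<in> Z.span (range C')" if "i \<noteq> i0" for i
      by (rule Z.span_base) (use that in \<open>auto simp: C'_def intro!: image_eqI[of _ _ i]\<close>)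
    have "s \<in> Z.span (range C')"
      unfolding s_def using C_in by (intro Z.span_sum sc') auto
    moreover have "2 *\<^sub>R x' \<in> Z.span (range C')"
      using sc'[OF x'_in, of 2] by simp
    ultimately have "C i0 \<in> Z.span (range C')"
      unfolding Ci0 by (intro Z.span_diff)
    then have "C i \<in> Z.span (range C')" for i using C_in by (cases "i = i0") auto
    then have "range C \<subseteq> Z.span (range C')" by blast
    then have LS: "L \<subseteq> Z.span (range C')"
      unfolding L_eq by (rule Z.span_minimal[OF _ sub'])
    then have "x \<in> Z.span (range C')"
      unfolding xx' using zL x'_in by (intro Z.span_add) auto
    then show "?M \<subseteq> Z.span (range C')"
      using LS sc' by (auto intro!: Z.span_add)
  qed
  then have "lattice_basis C' ?M"
    using nz by (simp add: lattice_basis_iff det)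
  moreover have "d / 4 = (Determinants.det (row_matrix C'))\<^sup>2"
    by (simp add: det d power_divide)
  ultimately show ?thesis by (auto simp: has_lattice_det_def)
qed

text \<open>The representatives are adjoined one at a time; by independence modulo 2 each of them is
  new and doubles the index.\<close>

lemma has_lattice_det_elementary_quotient:
  fixes \<Gamma> \<Delta> :: "'n::finite euclid set"
  assumes eq: "elementary_quotient \<Gamma> \<Delta>" and xs: "quotient_basis \<Gamma> \<Delta> xs" and d: "has_lattice_det \<Delta> d"
  shows "has_lattice_det \<Gamma> (d / 4 ^ length xs)"
proof -
  interpret elementary_quotient \<Gamma> \<Delta> by (rule eq)
  have xs: "set xs \<subseteq> \<Gamma>" "\<And>x. x \<in> \<Gamma> \<Longrightarrow> \<exists>c. x - int_comb xs c \<in> \<Delta>"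
    "\<And>c i. int_comb xs c \<in> \<Delta> \<Longrightarrow> i < length xs \<Longrightarrow> even (c i)"
    using xs quotient_basis_iff by blast+
  define M where "M h = {y + (\<Sum>i<h. of_int (c i) *\<^sub>R xs ! i) | y c. y \<in> \<Delta>}" for h
  have "h \<le> length xs \<Longrightarrow> has_lattice_det (M h) (d / 4 ^ h)" for h
  proof (induction h)
    case 0
    then show ?case using d by (simp add: M_def)
  next
    case (Suc h)
    have "xs ! h \<notin> M h"
    proof
      assume "xs ! h \<in> M h"
      then obtain y c where y: "y \<in> \<Delta>" "xs ! h = y + (\<Sum>i<h. of_int (c i) *\<^sub>R xs ! i)"
        by (auto simp: M_def)
      define e where "e i = (if i < h then - c i else of_bool (i = h))" for i
      have "int_comb xs e = (\<Sum>i<Suc h. of_int (e i) *\<^sub>R xs ! i)"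
        unfolding int_comb_def using Suc.prems by (intro sum.mono_neutral_right) (auto simp: e_def)
      also have "\<dots> = xs ! h - (\<Sum>i<h. of_int (c i) *\<^sub>R xs ! i)"
        by (simp add: e_def sum_negf)
      also have "\<dots> = y" using y(2) by simp
      finally have "even (e h)" using xs(3)[of e h] y(1) Suc.prems by simp
      then show False by (simp add: e_def)
    qed
    moreover have "2 *\<^sub>R xs ! h \<in> M h"
    proof -
      have "2 *\<^sub>R xs ! h \<in> \<Delta>" using xs(1) Suc.prems by (intro two) auto
      then show ?thesis
        unfolding M_def by (intro CollectI exI[of _ "2 *\<^sub>R xs ! h"] exI[of _ "\<lambda>i. 0"]) simp
    qed
    ultimately have "has_lattice_det {y + of_int k *\<^sub>R xs ! h | y k. y \<in> M h} (d / 4 ^ h / 4)"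
      using Suc by (intro has_lattice_det_insert) auto
    also have "{y + of_int k *\<^sub>R xs ! h | y k. y \<in> M h} = M (Suc h)"
    proof (intro equalityI subsetI)
      fix z assume "z \<in> {y + of_int k *\<^sub>R xs ! h | y k. y \<in> M h}"
      then obtain y c k where y: "y \<in> \<Delta>" "z = y + (\<Sum>i<h. of_int (c i) *\<^sub>R xs ! i) + of_int k *\<^sub>R xs ! h"
        by (auto simp: M_def)
      define e where "e = c(h := k)"
      have "z = y + (\<Sum>i<Suc h. of_int (e i) *\<^sub>R xs ! i)"
        by (simp add: y(2) e_def add.assoc)
      then show "z \<in> M (Suc h)" unfolding M_def using y(1) by blast
    next
      fix z assume "z \<in> M (Suc h)"
      then obtain y c where y: "y \<in> \<Delta>" "z = y + (\<Sum>i<h. of_int (c i) *\<^sub>R xs ! i) + of_int (c h) *\<^sub>R xs ! h"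
        by (auto simp: M_def add.assoc)
      then show "z \<in> {y + of_int k *\<^sub>R xs ! h | y k. y \<in> M h}"
        unfolding M_def by blast
    qed
    finally show ?case by (simp add: mult.commute)
  qed
  from this[of "length xs"] have "has_lattice_det (M (length xs)) (d / 4 ^ length xs)" by simp
  moreover have "M (length xs) = \<Gamma>"
  proof (intro equalityI subsetI)
    fix z assume "z \<in> M (length xs)"
    then obtain y c where "y \<in> \<Delta>" "z = y + int_comb xs c" by (auto simp: M_def int_comb_def)
    then show "z \<in> \<Gamma>"
      using sub int_comb_in_subspace[OF \<Gamma> xs(1)] by (auto intro: Z.subspace_add[OF \<Gamma>])
  next
    fix z assume "z \<in> \<Gamma>"
    then obtain c where c: "z - int_comb xs c \<in> \<Delta>" using xs(2) by blast
    then show "z \<in> M (length xs)"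
      unfolding M_def by (intro CollectI exI[of _ "z - int_comb xs c"] exI[of _ c]) (simp add: int_comb_def)
  qed
  ultimately show ?thesis by simp
qed

section \<open>Lattices in Euclidean space\<close>

text \<open>The norm \<nu> stays a parameter so that a doubled lattice can be treated as the same
  lattice of coordinates for the basis \<open>2 *\<^sub>R b\<close>.\<close>

locale embedded = bw_field m B \<zeta>
  for m :: nat and B :: "nat \<Rightarrow> 'f::{field,finite}" and \<zeta> :: 'f +
  fixes b :: "'f \<Rightarrow> 'f euclid" and \<nu> :: real and \<sigma> :: "'f euclid \<Rightarrow> 'f euclid"
  assumes nu: "\<nu> > 0" and b: "b v \<bullet> b w = (if v = w then \<nu> else 0)"
    and sigma: "linear \<sigma>" "\<sigma> (b v) = b (\<zeta> * v)"
begin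

definition emb :: "('f \<Rightarrow> int) \<Rightarrow> 'f euclid" where
  "emb a = (\<Sum>v\<in>UNIV. of_int (a v) *\<^sub>R b v)"

lemma emb_add: "emb (\<lambda>v. a v + c v) = emb a + emb c"
  by (simp add: emb_def scaleR_left_distrib sum.distrib)

lemma emb_diff: "emb (\<lambda>v. a v - c v) = emb a - emb c"
  by (simp add: emb_def scaleR_left_diff_distrib sum_subtractf)

lemma emb_smult: "emb (\<lambda>v. k * a v) = of_int k *\<^sub>R emb a"
  by (simp add: emb_def scaleR_sum_right)

lemma emb_zero [simp]: "emb (\<lambda>v. 0) = 0"
  by (simp add: emb_def)

lemma emb_sum: "emb (\<lambda>v. \<Sum>i\<in>A. f i v) = (\<Sum>i\<in>A. emb (f i))"
  by (induction A rule: infinite_finite_induct) (simp_all add: emb_add)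

lemma emb_inner_b: "emb a \<bullet> b v = \<nu> * of_int (a v)"
proof -
  have "emb a \<bullet> b v = (\<Sum>w\<in>UNIV. if w = v then \<nu> * of_int (a v) else 0)"
    unfolding emb_def inner_sum_left by (intro sum.cong) (auto simp: b)
  then show ?thesis by simp
qed

lemma inner_emb: "emb a \<bullet> emb c = \<nu> * of_int (\<Sum>v\<in>UNIV. a v * c v)"
proof -
  have "emb a \<bullet> emb c = (\<Sum>v\<in>UNIV. of_int (c v) * (emb a \<bullet> b v))"
    by (simp add: emb_def[of c] inner_sum_right)
  then show ?thesis
    by (simp add: emb_inner_b sum_distrib_left mult_ac)
qed

lemma emb_eq_iff [simp]: "emb a = emb c \<longleftrightarrow> a = c"
proof
  assume "emb a = emb c"
  then have "\<nu> * of_int (a v) = \<nu> * of_int (c v)" for v by (metis emb_inner_b)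
  then show "a = c" using nu by (simp add: fun_eq_iff)
qed simp

lemma emb_in_image_iff [simp]: "emb a \<in> emb ` A \<longleftrightarrow> a \<in> A"
  by auto

lemma sigma_emb: "\<sigma> (emb a) = emb (shift a)"
proof -
  have "\<sigma> (emb a) = (\<Sum>v\<in>UNIV. of_int (a v) *\<^sub>R b (\<zeta> * v))"
    by (simp add: emb_def linear_sum[OF sigma(1)] linear_scale[OF sigma(1)] sigma(2))
  also have "\<dots> = emb (shift a)"
    unfolding emb_def shift_def
    by (rule sum.reindex_bij_witness[of _ "\<lambda>w. w / \<zeta>" "\<lambda>v. \<zeta> * v"]) auto
  finally show ?thesis .
qed

lemma subspace_emb:
  assumes "(\<lambda>v. 0) \<in> A" "\<And>a c. a \<in> A \<Longrightarrow> c \<in> A \<Longrightarrow> (\<lambda>v. a v + c v) \<in> A"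
    "\<And>k a. a \<in> A \<Longrightarrow> (\<lambda>v. k * a v) \<in> A"
  shows "Z.subspace (emb ` A)"
proof (rule Z.subspaceI)
  show "0 \<in> emb ` A" using assms(1) by (metis emb_zero imageI)
  fix x y assume "x \<in> emb ` A" "y \<in> emb ` A"
  then show "x + y \<in> emb ` A" using assms(2) by (auto simp: emb_add[symmetric])
next
  fix k x assume "x \<in> emb ` A"
  then show "int_scale k x \<in> emb ` A" using assms(3) by (auto simp: int_scale_def emb_smult[symmetric])
qed

lemma cond_zero: "cond N (\<lambda>v. 0)"
  by (simp add: cond_def)

lemma crit_eq: "crit N = {a. 2 ^ m dvd (\<Sum>v\<in>UNIV. a v) \<and> cond N a}"
  by (auto simp: crit_def cond_def)

lemma sum_shift: "(\<Sum>v\<in>UNIV. shift a v) = (\<Sum>v\<in>UNIV. a v)" "(\<Sum>v\<in>UNIV - {0}. shift a v) = (\<Sum>v\<in>UNIV - {0}. a v)"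
  unfolding shift_def
  by (rule sum.reindex_bij_witness[of _ "\<lambda>w. w * \<zeta>" "\<lambda>v. v / \<zeta>"]; simp)+

lemma subspace_crit: "Z.subspace (emb ` crit N)"
proof (rule subspace_emb)
  show "(\<lambda>v. 0) \<in> crit N" by (simp add: crit_eq cond_zero)
  show "(\<lambda>v. a v + c v) \<in> crit N" if "a \<in> crit N" "c \<in> crit N" for a c
    using that by (simp add: crit_eq cond_add sum.distrib)
  show "(\<lambda>v. k * a v) \<in> crit N" if "a \<in> crit N" for k a
    using that by (simp add: crit_eq cond_smult sum_distrib_left[symmetric])
qed

lemma sigma_crit: "\<sigma> ` emb ` crit N \<subseteq> emb ` crit N"
  by (auto simp: sigma_emb crit_eq cond_shift sum_shift)

text \<open>For the sets \<open>low_wt (2 * j)\<close> this is twice \<open>Lam 0\<close>, see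
  \<open>even_crit_eq_double\<close>. There is one parity condition for each orbit of \<zeta>, the
  point 0 and its complement.\<close>

definition even_crit :: "(nat \<Rightarrow> nat set) \<Rightarrow> ('f \<Rightarrow> int) set" where
  "even_crit N = {a. even (a 0) \<and> even (\<Sum>v\<in>UNIV - {0}. a v) \<and> 2 ^ Suc m dvd (\<Sum>v\<in>UNIV. a v) \<and> cond N a}"

lemma subspace_even_crit: "Z.subspace (emb ` even_crit N)"
proof (rule subspace_emb)
  show "(\<lambda>v. 0) \<in> even_crit N" by (simp add: even_crit_def cond_zero)
  show "(\<lambda>v. a v + c v) \<in> even_crit N" if "a \<in> even_crit N" "c \<in> even_crit N" for a c
    using that by (simp add: even_crit_def cond_add sum.distrib)
  show "(\<lambda>v. k * a v) \<in> even_crit N" if "a \<in> even_crit N" for k a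
    using that by (simp add: even_crit_def cond_smult sum_distrib_left[symmetric])
qed

lemma sigma_even_crit: "\<sigma> ` emb ` even_crit N \<subseteq> emb ` even_crit N"
  by (auto simp: sigma_emb even_crit_def cond_shift sum_shift) (simp_all add: shift_def)

end

locale embedded_chain = embedded m B \<zeta> b \<nu> \<sigma> + bw_chain m B \<zeta> N N'
  for m :: nat and B :: "nat \<Rightarrow> 'f::{field,finite}" and \<zeta> :: 'f
    and b :: "'f \<Rightarrow> 'f euclid" and \<nu> :: real and \<sigma> :: "'f euclid \<Rightarrow> 'f euclid"
    and N N' :: "nat \<Rightarrow> nat set"
begin

section \<open>Bases of the quotients and the matrix of \<sigma>\<close>

lemma sum_UNIV: "(\<Sum>v\<in>UNIV. a v) = a 0 + (\<Sum>v\<in>UNIV - {0}. a v)" for a :: "'f \<Rightarrow> int"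
  by (simp add: sum.remove[of UNIV "0::'f"])

lemma cond_N'_imp_N: "cond N' a \<Longrightarrow> cond N a"
  using cond_mono[of N N' a] closed_N closed_N' N_N' by blast

definition ws :: "'f euclid list" where
  "ws = map (\<lambda>i. emb (act (Polynomial.monom 1 i) w)) [0..<card T]"

lemma length_ws [simp]: "length ws = card T"
  by (simp add: ws_def)

lemma int_comb_ws: "int_comb ws c = emb (act (\<Sum>i<card T. Polynomial.monom (c i) i) w)"
proof -
  have "act (\<Sum>i<card T. Polynomial.monom (c i) i) w = (\<lambda>v. \<Sum>i<card T. c i * act (Polynomial.monom 1 i) w v)"
    by (simp add: fun_eq_iff act_sum act_monom)
  then show ?thesis
    by (simp add: int_comb_def ws_def emb_sum emb_smult)
qed

lemma degree_sum_monom: "p = (\<Sum>i<k. Polynomial.monom (c i) i) \<Longrightarrow> p = 0 \<or> Polynomial.degree p < k"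
  for c :: "nat \<Rightarrow> 'a::comm_ring_1"
proof -
  assume p: "p = (\<Sum>i<k. Polynomial.monom (c i) i)"
  have coeff: "Polynomial.coeff p i = (if i < k then c i else 0)" for i
    by (simp add: p coeff_sum if_distrib[of "\<lambda>f. f _"] cong: if_cong)
  show ?thesis
  proof (cases "p = 0")
    case False
    then have "Polynomial.coeff p (Polynomial.degree p) \<noteq> 0" by simp
    then have "Polynomial.degree p < k" unfolding coeff by (rule contrapos_np) simp
    then show ?thesis ..
  qed simp
qed

lemma even_if_cond_N':
  assumes "cond N' (act (\<Sum>i<card T. Polynomial.monom (c i) i) w)" "i < card T"
  shows "even (c i)"
proof -
  obtain g where g: "Polynomial.lead_coeff g = 1" "Polynomial.degree g = card T"
    "\<And>p. p \<in> vanishing T \<longleftrightarrow> g dvd p" using T_polynomial by blast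
  define p where "p = red2 (\<Sum>i<card T. Polynomial.monom (c i) i)"
  have p: "p = (\<Sum>i<card T. Polynomial.monom (of_int (c i)) i)"
    unfolding p_def by (rule poly_eqI) (simp add: coeff_map_poly coeff_sum if_distrib[of "\<lambda>f. f _"] cong: if_cong)
  have "p \<in> vanishing T"
    using assms(1) unfolding cond_N'_act_w_iff by (simp add: vanishing_def p_def evb_red2)
  then have "g dvd p" using g(3) by simp
  have "p = 0"
  proof (rule ccontr)
    assume "p \<noteq> 0"
    then have "card T \<le> Polynomial.degree p"
      using dvd_imp_degree_le[OF \<open>g dvd p\<close>] g(2) by simp
    then show False using degree_sum_monom[OF p] \<open>p \<noteq> 0\<close> by simp
  qed
  then have "Polynomial.coeff p i = 0" by simp
  then have "(of_int (c i) :: bit) = 0"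
    using assms(2) by (simp add: p coeff_sum if_distrib[of "\<lambda>f. f _"] cong: if_cong)
  then show ?thesis by (simp only: of_int_bit_eq_0_iff)
qed

lemma poly_eq_sum_monom:
  assumes "Polynomial.degree p < k"
  shows "p = (\<Sum>i<k. Polynomial.monom (Polynomial.coeff p i) i)"
  by (rule poly_eqI) (use assms in \<open>auto simp: coeff_sum if_distrib[of "\<lambda>f. f _"] coeff_eq_0 cong: if_cong\<close>)

text \<open>Division by \<open>g\<close> modulo 2 replaces the multiplier of \<open>w\<close> by one
  of degree below \<open>card T\<close>.\<close>

lemma cond_N_comb:
  assumes "cond N a"
  shows "\<exists>c. cond N' (\<lambda>v. a v - act (\<Sum>i<card T. Polynomial.monom (c i) i) w v)"
proof -
  obtain g where g: "Polynomial.lead_coeff g = 1" "Polynomial.degree g = card T"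
    "\<And>p. p \<in> vanishing T \<longleftrightarrow> g dvd p" using T_polynomial by blast
  have g0: "g \<noteq> 0" using g(1) by auto
  obtain p where p: "cond N' (\<lambda>v. a v - act p w v)" using cond_N_spanned[OF assms] by blast
  define r where "r = lift2 (red2 p mod g)"
  have "g dvd red2 p - red2 p mod g" by (rule dvd_minus_mod)
  then have "red2 p - red2 p mod g \<in> vanishing T" using g(3) by blast
  then have "cond N' (act (p - r) w)"
    unfolding cond_N'_act_w_iff by (simp add: vanishing_def evb_diff evb_red2 evp_diff r_def evb_eq_evp[of "_ mod _"])
  from cond_add[OF p this] have *: "cond N' (\<lambda>v. a v - act r w v)"
    by (simp add: act_diff)
  have "\<exists>c. r = (\<Sum>i<card T. Polynomial.monom (c i) i)"
  proof (cases "r = 0")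
    case True
    then show ?thesis by (intro exI[of _ "\<lambda>i. 0"]) simp
  next
    case False
    then have "red2 p mod g \<noteq> 0" by (auto simp: r_def)
    then have "Polynomial.degree r < card T"
      using degree_mod_less'[OF g0] g(2) by (simp add: r_def)
    then show ?thesis using poly_eq_sum_monom by blast
  qed
  then show ?thesis using * by auto
qed

lemma sigma_ws: "Suc j < card T \<Longrightarrow> \<sigma> (ws ! j) = ws ! Suc j"
proof -
  assume j: "Suc j < card T"
  have "shift (act (Polynomial.monom 1 j) w) = act (Polynomial.monom 1 (Suc j)) w"
    by (simp add: fun_eq_iff shift_def act_monom mult.commute)
  then show ?thesis using j by (simp add: ws_def sigma_emb)
qed

text \<open>Shifting the last basis vector gives the power \<open>card T\<close> of the variable;
  minus the lower terms of \<open>g\<close> this reduces to \<open>g\<close> itself, signs being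
  immaterial modulo 2.\<close>

lemma cond_last:
  assumes g: "Polynomial.lead_coeff g = 1" "Polynomial.degree g = card T" "\<And>p. p \<in> vanishing T \<longleftrightarrow> g dvd p"
    and j: "Suc j = card T"
  shows "\<exists>p. \<sigma> (ws ! j) - int_comb ws (\<lambda>i. bit_int (Polynomial.coeff g i)) = emb (act p w) \<and> cond N' (act p w)"
proof -
  define p where "p = Polynomial.monom 1 (card T) - (\<Sum>i<card T. Polynomial.monom (bit_int (Polynomial.coeff g i)) i)"
  have "shift (act (Polynomial.monom 1 j) w) = act (Polynomial.monom 1 (card T)) w"
    by (simp add: fun_eq_iff shift_def act_monom mult.commute flip: j)
  then have "\<sigma> (ws ! j) = emb (act (Polynomial.monom 1 (card T)) w)"
    using j by (simp add: ws_def sigma_emb)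
  then have 1: "\<sigma> (ws ! j) - int_comb ws (\<lambda>i. bit_int (Polynomial.coeff g i)) = emb (act p w)"
    by (simp add: int_comb_ws p_def act_diff[abs_def] emb_diff)
  have "red2 p = g"
  proof (rule poly_eqI)
    fix i
    have "Polynomial.coeff (red2 p) i = of_int (Polynomial.coeff p i)"
      by (simp add: coeff_map_poly)
    also have "Polynomial.coeff p i = of_bool (i = card T) - (if i < card T then bit_int (Polynomial.coeff g i) else 0)"
      by (simp add: p_def coeff_sum if_distrib[of "\<lambda>f. f _"] cong: if_cong)
    also have "of_int \<dots> = Polynomial.coeff g i"
    proof -
      consider "i < card T" | "i = card T" | "i > card T" by linarith
      then show ?thesis
      proof cases
        case 1
        then have "of_int (of_bool (i = card T) - (if i < card T then bit_int (Polynomial.coeff g i) else 0)) =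
            - (of_int (bit_int (Polynomial.coeff g i)) :: bit)" by simp
        then show ?thesis by (simp only: of_int_bit_int) simp
      qed (use g in \<open>auto simp: coeff_eq_0\<close>)
    qed
    finally show "Polynomial.coeff (red2 p) i = Polynomial.coeff g i" .
  qed
  then have "red2 p \<in> vanishing T" using g(3) by simp
  then have "cond N' (act p w)"
    unfolding cond_N'_act_w_iff by (simp add: vanishing_def evb_red2)
  then show ?thesis using 1 by blast
qed

lemma two_alg_closure: "(2 :: 'f alg_closure) = 0"
proof -
  have "to_ac (2 :: 'f) = 0" unfolding two_eq_0 by simp
  then show ?thesis by simp
qed

lemma poly_f2_emb_to_ac: "poly (map_poly f2_emb p) (to_ac x) = to_ac (evb p x)"
proof -
  have "to_ac (f2_emb c :: 'f) = f2_emb c" for c by (simp add: f2_emb_def)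
  moreover have "Polynomial.degree (map_poly f2_emb p :: 'f poly) = Polynomial.degree p"
    "Polynomial.degree (map_poly f2_emb p :: 'f alg_closure poly) = Polynomial.degree p"
    by (rule degree_map_poly; simp add: f2_emb_def)+
  ultimately show ?thesis
    by (simp add: evb_def poly_altdef coeff_map_poly to_ac_sum)
qed

lemma companion_eigenvalues:
  assumes g: "Polynomial.lead_coeff g = 1" "Polynomial.degree g = card T" "\<And>p. p \<in> vanishing T \<longleftrightarrow> g dvd p"
  shows "{x. poly (map_poly f2_emb (char_poly (companion g))) x = 0} = to_ac ` zeros T"
proof (rule char_poly_companion_roots[OF two_alg_closure g(1)])
  have inj: "inj_on (\<lambda>u. \<zeta> ^ u) T" using T_subset by (intro inj_on_subset[OF inj_zeta]) auto
  show "card (to_ac ` zeros T) = Polynomial.degree g"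
    unfolding zeros_def using inj inj_on_subset[OF inj_to_ac, of "zeros T"]
    by (simp add: card_image zeros_def g(2))
  have "g \<in> vanishing T" using g(3) by simp
  then show "poly (map_poly f2_emb g) x = 0" if x: "x \<in> to_ac ` zeros T" for x
  proof -
    obtain u where u: "u \<in> T" "x = to_ac (\<zeta> ^ u)" using x unfolding zeros_def by blast
    show ?thesis
      unfolding u(2) poly_f2_emb_to_ac using u(1) \<open>g \<in> vanishing T\<close> by (simp add: vanishing_def)
  qed
qed simp

lemma one_notin: "(1 :: 'f) \<notin> zeros T"
proof
  assume "1 \<in> zeros T"
  then obtain u where u: "u \<in> T" "\<zeta> ^ u = \<zeta> ^ 0" by (auto simp: zeros_def)
  then show False
    using T_subset inj_onD[OF inj_zeta u(2)] by auto
qed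

text \<open>As a module over the polynomials modulo 2 the quotient is cyclic with annihilator
  \<open>g\<close>, so \<sigma> acts by the companion matrix. The exponent 0 is not in
  \<open>T\<close>, hence 1 is no eigenvalue.\<close>

theorem quotient_crit:
  defines "\<Gamma> \<equiv> emb ` crit N" and "\<Delta> \<equiv> emb ` crit N'"
  shows "elementary_quotient \<Gamma> \<Delta>" and "\<exists>xs. quotient_basis \<Gamma> \<Delta> xs \<and> length xs = card T"
    and "quotient_eigenvalues \<sigma> \<Gamma> \<Delta> = to_ac ` zeros T"
    and "eigenvalue_multiplicity \<sigma> \<Gamma> \<Delta> 1 = 0"
proof -
  show eq: "elementary_quotient \<Gamma> \<Delta>"
  proof
    show "Z.subspace \<Gamma>" "Z.subspace \<Delta>" by (simp_all add: \<Gamma>_def \<Delta>_def subspace_crit)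
    show "\<Delta> \<subseteq> \<Gamma>" by (auto simp: \<Gamma>_def \<Delta>_def crit_eq cond_N'_imp_N)
    fix x assume "x \<in> \<Gamma>"
    then obtain a where a: "x = emb a" "a \<in> crit N" by (auto simp: \<Gamma>_def)
    then have "(\<lambda>v. 2 * a v) \<in> crit N'"
      by (simp add: crit_eq cond_N_double sum_distrib_left[symmetric])
    then show "2 *\<^sub>R x \<in> \<Delta>"
      unfolding \<Delta>_def a(1) using emb_smult[of 2 a] by (metis imageI of_int_numeral)
  qed
  then interpret elementary_quotient \<Gamma> \<Delta> .
  obtain g where g: "Polynomial.lead_coeff g = 1" "Polynomial.degree g = card T"
    "\<And>p. p \<in> vanishing T \<longleftrightarrow> g dvd p" using T_polynomial by blast
  have sum: "2 ^ m dvd (\<Sum>v\<in>UNIV. act p w v)" for p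
    using sum_w[of p] by (simp add: sum_UNIV) (meson dvd_mult_right)
  have in_\<Gamma>: "act p w \<in> crit N" for p
    by (simp add: crit_eq cond_act_w sum)
  have in_\<Delta>: "act p w \<in> crit N' \<longleftrightarrow> cond N' (act p w)" for p
    by (simp add: crit_eq sum)
  have qb: "quotient_basis \<Gamma> \<Delta> ws"
    unfolding quotient_basis_iff
  proof (intro conjI ballI allI impI)
    show "set ws \<subseteq> \<Gamma>" using in_\<Gamma> by (auto simp: ws_def \<Gamma>_def)
  next
    fix x assume "x \<in> \<Gamma>"
    then obtain a where a: "x = emb a" "a \<in> crit N" by (auto simp: \<Gamma>_def)
    obtain c where c: "cond N' (\<lambda>v. a v - act (\<Sum>i<card T. Polynomial.monom (c i) i) w v)"
      using cond_N_comb a(2) by (auto simp: crit_eq)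
    have "(\<lambda>v. a v - act (\<Sum>i<card T. Polynomial.monom (c i) i) w v) \<in> crit N'"
      using a(2) sum c by (simp add: crit_eq sum_subtractf)
    then show "\<exists>c. x - int_comb ws c \<in> \<Delta>"
      by (intro exI[of _ c]) (simp add: a(1) int_comb_ws \<Delta>_def emb_diff[symmetric])
  next
    fix c i assume "int_comb ws c \<in> \<Delta>" "i < length ws"
    then show "even (c i)"
      using even_if_cond_N' by (simp add: int_comb_ws \<Delta>_def in_\<Delta>)
  qed
  then show "\<exists>xs. quotient_basis \<Gamma> \<Delta> xs \<and> length xs = card T"
    by (intro exI[of _ ws]) simp
  have qm: "quotient_matrix \<sigma> \<Delta> ws (companion g)"
  proof (rule quotient_matrix_companion)
    show "length ws = Polynomial.degree g" by (simp add: g(2))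
    show "0 \<in> \<Delta>" using Z.subspace_0[OF \<Delta>] .
    show "\<sigma> (ws ! j) = ws ! Suc j" if "Suc j < length ws" for j
      using that sigma_ws by simp
    show "\<sigma> (ws ! j) - int_comb ws (\<lambda>i. bit_int (Polynomial.coeff g i)) \<in> \<Delta>" if "Suc j = length ws" for j
      using cond_last[OF g, of j] that by (auto simp: \<Delta>_def in_\<Delta>)
  qed
  have cp: "quotient_char_poly \<sigma> \<Gamma> \<Delta> = char_poly (companion g)"
    using sigma_crit by (intro quotient_char_poly_eq[OF sigma(1) _ qb qm]) (simp add: \<Delta>_def)
  show eig: "quotient_eigenvalues \<sigma> \<Gamma> \<Delta> = to_ac ` zeros T"
    unfolding quotient_eigenvalues_def cp by (rule companion_eigenvalues[OF g])
  have "poly (map_poly f2_emb (quotient_char_poly \<sigma> \<Gamma> \<Delta>)) (1 :: 'f alg_closure) \<noteq> 0"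
    using eig one_notin unfolding quotient_eigenvalues_def by (metis (mono_tags, lifting) imageE mem_Collect_eq to_ac_eq_1_iff')
  then show "eigenvalue_multiplicity \<sigma> \<Gamma> \<Delta> 1 = 0"
    unfolding eigenvalue_multiplicity_def by (rule order_0I)
qed

text \<open>The cyclic part is joined by two fixed vectors: the constant 1, detected by the parity
  at 0, and \<open>2 ^ m\<close> at 0, detected by the coordinate sum modulo
  \<open>2 ^ Suc m\<close>. They account for the multiplicity 2 of the eigenvalue 1.\<close>

theorem quotient_even_crit:
  defines "\<Gamma> \<equiv> emb ` crit N" and "\<Delta> \<equiv> emb ` even_crit N'"
  shows "elementary_quotient \<Gamma> \<Delta>" and "\<exists>xs. quotient_basis \<Gamma> \<Delta> xs \<and> length xs = card T + 2"
    and "quotient_eigenvalues \<sigma> \<Gamma> \<Delta> = insert 1 (to_ac ` zeros T)"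
    and "eigenvalue_multiplicity \<sigma> \<Gamma> \<Delta> 1 = 2"
proof -
  show eq: "elementary_quotient \<Gamma> \<Delta>"
  proof
    show "Z.subspace \<Gamma>" "Z.subspace \<Delta>" by (simp_all add: \<Gamma>_def \<Delta>_def subspace_crit subspace_even_crit)
    show "\<Delta> \<subseteq> \<Gamma>"
      by (auto simp: \<Gamma>_def \<Delta>_def crit_eq even_crit_def cond_N'_imp_N intro: dvd_mult_right)
    fix x assume "x \<in> \<Gamma>"
    then obtain a where a: "x = emb a" "a \<in> crit N" by (auto simp: \<Gamma>_def)
    then have "(\<lambda>v. 2 * a v) \<in> even_crit N'"
      by (simp add: crit_eq even_crit_def cond_N_double sum_distrib_left[symmetric])
    then show "2 *\<^sub>R x \<in> \<Delta>"
      unfolding \<Delta>_def a(1) using emb_smult[of 2 a] by (metis imageI of_int_numeral)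
  qed
  then interpret elementary_quotient \<Gamma> \<Delta> .
  obtain g where g: "Polynomial.lead_coeff g = 1" "Polynomial.degree g = card T"
    "\<And>p. p \<in> vanishing T \<longleftrightarrow> g dvd p" using T_polynomial by blast
  have sum: "2 ^ Suc m dvd (\<Sum>v\<in>UNIV. act p w v)" "2 ^ m dvd (\<Sum>v\<in>UNIV. act p w v)"
    "even (\<Sum>v\<in>UNIV - {0}. act p w v)" for p
    using sum_w[of p] by (simp_all add: sum_UNIV) (meson dvd_mult_right dvd_mult_left)+
  have in_\<Gamma>: "act p w \<in> crit N" for p
    by (simp add: crit_eq cond_act_w sum)
  have in_\<Delta>: "act p w \<in> even_crit N' \<longleftrightarrow> cond N' (act p w)" for p
    using sum by (simp add: even_crit_def)
  define one :: "'f \<Rightarrow> int" where "one = (\<lambda>v. 1)"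
  define pm :: "'f \<Rightarrow> int" where "pm = (\<lambda>v. 2 ^ m * delta 0 v)"
  have even_pow: "even (2 ^ m :: int)" using m by simp
  have card_UNIV: "int (card (UNIV :: 'f set)) = 2 ^ m * 2 ^ m"
    by (simp add: card_f flip: power_mult_distrib)
  have four: "2 ^ Suc m dvd (2 ^ m * 2 ^ m :: int)"
    using even_pow by (simp add: mult.commute[of 2] mult_dvd_mono)
  have sum_one: "(\<Sum>v\<in>UNIV. one v) = 2 ^ m * 2 ^ m" "(\<Sum>v\<in>UNIV - {0}. one v) = 2 ^ m * 2 ^ m - 1"
    using sum_UNIV[of one] by (simp_all add: one_def card_UNIV)
  have sum_pm: "(\<Sum>v\<in>UNIV. pm v) = 2 ^ m" "(\<Sum>v\<in>UNIV - {0}. pm v) = 0"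
    by (simp_all add: sum_UNIV pm_def delta_def)
  have cond_one: "cond M (\<lambda>v. c)" if "M = N \<or> M = N'" for M c
    using that closed_N closed_N' zero_notin by (intro cond_const) auto
  have cond_pm: "cond M pm" for M
    by (rule cond_dvd) (simp add: pm_def)
  define xs where "xs = emb one # emb pm # ws"
  have comb: "int_comb xs c = emb (\<lambda>v. c 0 * one v + c 1 * pm v +
      act (\<Sum>i<card T. Polynomial.monom (c (i + 2)) i) w v)" for c
    by (simp add: xs_def int_comb_Cons int_comb_ws emb_add emb_smult)
  have qb: "quotient_basis \<Gamma> \<Delta> xs"
    unfolding quotient_basis_iff
  proof (intro conjI ballI allI impI)
    have "one \<in> crit N" "pm \<in> crit N"
      using cond_one[of N 1] cond_pm sum_one sum_pm by (simp_all add: crit_eq one_def)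
    then show "set xs \<subseteq> \<Gamma>" using in_\<Gamma> by (auto simp: xs_def ws_def \<Gamma>_def)
  next
    fix x assume "x \<in> \<Gamma>"
    then obtain a where a: "x = emb a" "a \<in> crit N" by (auto simp: \<Gamma>_def)
    obtain c where c: "cond N' (\<lambda>v. a v - act (\<Sum>i<card T. Polynomial.monom (c i) i) w v)"
      using cond_N_comb a(2) by (auto simp: crit_eq)
    define y where "y = act (\<Sum>i<card T. Polynomial.monom (c i) i) w"
    have y0: "y 0 = 0" by (simp add: y_def)
    obtain s where s: "(\<Sum>v\<in>UNIV. a v) = 2 ^ m * s" using a(2) by (auto simp: crit_eq)
    \<comment> \<open>The coefficient of \<open>one\<close> corrects the parity at 0. That of
      \<open>pm\<close> cancels the coordinate sum of \<open>a\<close>; what \<open>one\<close> adds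
      to it, a multiple of \<open>4 ^ m\<close>, is divisible by \<open>2 ^ Suc m\<close> since
      \<open>m \<ge> 1\<close>.\<close>
    define d where "d i = (if i = 0 then a 0 else if i = 1 then s else c (i - 2))" for i :: nat
    define z where "z v = a v - (a 0 * one v + s * pm v + y v)" for v
    have zsum: "(\<Sum>v\<in>UNIV. z v) = - (a 0 * (2 ^ m * 2 ^ m)) - (\<Sum>v\<in>UNIV. y v)"
      unfolding z_def sum_subtractf sum.distrib sum_distrib_left[symmetric] sum_one sum_pm s by simp
    have z1: "2 ^ Suc m dvd (\<Sum>v\<in>UNIV. z v)"
      unfolding zsum y_def using four sum(1) by (intro dvd_diff) (auto intro: dvd_mult)
    have z2: "even (z 0)"
      using even_pow y0 by (simp add: z_def one_def pm_def delta_def)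
    have "even (\<Sum>v\<in>UNIV. z v)" by (rule dvd_trans[OF _ z1]) simp
    then have z3: "even (\<Sum>v\<in>UNIV - {0}. z v)" using z2 by (simp add: sum_UNIV)
    have "cond N' (\<lambda>v. a 0 + s * pm v)"
      by (intro cond_add cond_smult cond_pm cond_one) auto
    from cond_diff[OF c this] have "cond N' (\<lambda>v. (a v - y v) - (a 0 + s * pm v))"
      unfolding y_def .
    then have "cond N' z" by (simp add: z_def[abs_def] one_def algebra_simps)
    then have "z \<in> even_crit N'" using z1 z2 z3 by (simp add: even_crit_def)
    moreover have "x - int_comb xs d = emb z"
      unfolding comb a(1) emb_diff[symmetric] by (simp add: d_def z_def[abs_def] y_def)
    ultimately show "\<exists>c. x - int_comb xs c \<in> \<Delta>"
      by (intro exI[of _ d]) (simp add: \<Delta>_def)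
  next
    fix c i assume "int_comb xs c \<in> \<Delta>" and i: "i < length xs"
    then have mem: "(\<lambda>v. c 0 * one v + c 1 * pm v + act (\<Sum>i<card T. Polynomial.monom (c (i + 2)) i) w v) \<in> even_crit N'"
      (is "?z \<in> _") by (simp add: comb \<Delta>_def del: One_nat_def)
    have c0: "even (c 0)"
      using mem even_pow by (simp add: even_crit_def one_def pm_def delta_def)
    have "2 ^ Suc m dvd (\<Sum>v\<in>UNIV. ?z v)"
      using mem by (simp only: even_crit_def mem_Collect_eq)
    then have "2 ^ Suc m dvd c 0 * (2 ^ m * 2 ^ m) + c 1 * 2 ^ m +
        (\<Sum>v\<in>UNIV. act (\<Sum>i<card T. Polynomial.monom (c (i + 2)) i) w v)"
      by (simp only: sum.distrib sum_distrib_left[symmetric] sum_one sum_pm)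
    then have "2 ^ Suc m dvd c 0 * (2 ^ m * 2 ^ m) + c 1 * 2 ^ m"
      by (simp only: dvd_add_left_iff[OF sum(1)])
    then have "2 ^ Suc m dvd c 1 * 2 ^ m"
      by (simp only: dvd_add_right_iff[OF dvd_mult[OF four]])
    then have c1: "even (c 1)" by simp
    have "cond N' ?z"
      using mem unfolding even_crit_def by blast
    moreover have "cond N' (\<lambda>v. c 0 + c 1 * pm v)"
      by (intro cond_add cond_smult cond_pm cond_one) auto
    ultimately have "cond N' (\<lambda>v. ?z v - (c 0 + c 1 * pm v))"
      by (rule cond_diff)
    then have "cond N' (act (\<Sum>i<card T. Polynomial.monom (c (i + 2)) i) w)"
      by (simp add: one_def)
    then have "even (c (i + 2))" if "i < card T" for i
      using even_if_cond_N'[of "\<lambda>i. c (i + 2)"] that by simp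
    moreover have "i = 0 \<or> i = 1 \<or> (\<exists>j. i = j + 2)"
      by presburger
    ultimately show "even (c i)"
      using c0 c1 i by (auto simp: xs_def)
  qed
  then show "\<exists>xs. quotient_basis \<Gamma> \<Delta> xs \<and> length xs = card T + 2"
    by (intro exI[of _ xs]) (simp add: xs_def)
  have "quotient_matrix \<sigma> \<Delta> ws (companion g)"
  proof (rule quotient_matrix_companion)
    show "length ws = Polynomial.degree g" by (simp add: g(2))
    show "0 \<in> \<Delta>" using Z.subspace_0[OF \<Delta>] .
    show "\<sigma> (ws ! j) = ws ! Suc j" if "Suc j < length ws" for j
      using that sigma_ws by simp
    show "\<sigma> (ws ! j) - int_comb ws (\<lambda>i. bit_int (Polynomial.coeff g i)) \<in> \<Delta>" if "Suc j = length ws" for j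
      using cond_last[OF g, of j] that by (auto simp: \<Delta>_def in_\<Delta>)
  qed
  moreover have "shift one = one" "shift pm = pm"
    by (simp_all add: fun_eq_iff shift_def one_def pm_def delta_def)
  then have "\<sigma> (emb one) - emb one \<in> \<Delta>" "\<sigma> (emb pm) - emb pm \<in> \<Delta>"
    using Z.subspace_0[OF \<Delta>] by (simp_all add: sigma_emb)
  ultimately have qm: "quotient_matrix \<sigma> \<Delta> xs (add_fixed (add_fixed (companion g)))"
    unfolding xs_def by (intro quotient_matrix_add_fixed)
  have cp: "quotient_char_poly \<sigma> \<Gamma> \<Delta> = [:- 1, 1:] ^ 2 * char_poly (companion g)"
  proof -
    have "quotient_char_poly \<sigma> \<Gamma> \<Delta> = char_poly (add_fixed (add_fixed (companion g)))"
      using sigma_even_crit by (intro quotient_char_poly_eq[OF sigma(1) _ qb qm]) (simp add: \<Delta>_def)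
    also have "\<dots> = [:- 1, 1:] ^ 2 * char_poly (companion g)"
      unfolding char_poly_add_fixed[OF add_fixed_carrier[OF companion_carrier]]
        char_poly_add_fixed[OF companion_carrier] by (simp only: power2_eq_square mult.assoc)
    finally show ?thesis .
  qed
  define q :: "'f alg_closure poly" where "q = map_poly f2_emb (char_poly (companion g))"
  interpret h: comm_ring_hom "f2_emb :: bit \<Rightarrow> 'f alg_closure"
    by (rule comm_ring_hom_f2_emb[OF two_alg_closure])
  interpret hp: map_poly_comm_ring_hom "f2_emb :: bit \<Rightarrow> 'f alg_closure" ..
  have map: "map_poly f2_emb (quotient_char_poly \<sigma> \<Gamma> \<Delta>) = [:- 1, 1:] ^ 2 * q"
  proof -
    have "(1 :: 'f alg_closure) + 1 = 0" using two_alg_closure by simp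
    then have neg: "(- 1 :: 'f alg_closure) = 1" by (rule minus_unique)
    have "map_poly f2_emb [:- 1, 1:] = ([:1, 1:] :: 'f alg_closure poly)"
      by (simp add: map_poly_pCons)
    then have "map_poly f2_emb [:- 1, 1:] = ([:- 1, 1:] :: 'f alg_closure poly)"
      unfolding neg .
    then show ?thesis
      unfolding cp q_def hp.hom_mult hp.hom_power by (simp only:)
  qed
  have roots: "{x. poly q x = 0} = to_ac ` zeros T"
    unfolding q_def by (rule companion_eigenvalues[OF g])
  have q1: "poly q 1 \<noteq> 0"
    using roots one_notin by (metis (mono_tags, lifting) imageE mem_Collect_eq to_ac_eq_1_iff')
  show "quotient_eigenvalues \<sigma> \<Gamma> \<Delta> = insert 1 (to_ac ` zeros T)"
    unfolding quotient_eigenvalues_def map roots[symmetric] by auto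
  have q0: "q \<noteq> 0" using q1 by auto
  show "eigenvalue_multiplicity \<sigma> \<Gamma> \<Delta> 1 = 2"
    unfolding eigenvalue_multiplicity_def map using q0 q1
    by (subst order_mult) (simp_all add: order_power_n_n order_0I)
qed

end

context embedded
begin

section \<open>Lattices given by divisibility of monomial coefficients\<close>

definition mob_dvd :: "(nat set \<Rightarrow> nat) \<Rightarrow> ('f \<Rightarrow> int) set" where
  "mob_dvd \<phi> = {a. \<forall>S\<subseteq>idx. 2 ^ \<phi> S dvd mob a S}"

lemma Lam_eq_mob_dvd: "Lam s = mob_dvd (\<lambda>S. (card S + s) div 2)"
  by (simp add: Lam_def mob_dvd_def)

lemma subspace_mob_dvd: "Z.subspace (emb ` mob_dvd \<phi>)"
  by (rule subspace_emb) (simp_all add: mob_dvd_def mob_add mob_smult)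

lemma det_row_matrix_b: "(Determinants.det (row_matrix b))\<^sup>2 = \<nu> ^ 4 ^ m"
proof -
  have "(Determinants.det (row_matrix b))\<^sup>2 = Determinants.det (\<chi> i j. b i \<bullet> b j)"
    by (simp add: det_gram)
  also have "\<dots> = (\<Prod>i\<in>(UNIV :: 'f set). \<nu>)"
    by (subst det_diagonal) (simp_all add: b)
  finally show ?thesis by (simp add: card_f)
qed

lemma lattice_basis_b: "lattice_basis b (range emb)"
proof -
  have "Determinants.det (row_matrix b) \<noteq> 0"
    using det_row_matrix_b nu by (metis less_irrefl power_eq_0_iff zero_less_power zero_neq_numeral zero_power2)
  moreover have "Z.span (range b) = range emb"
    unfolding span_int_scale_range emb_def ..
  ultimately show ?thesis by (simp add: lattice_basis_iff)
qed

lemma has_lattice_det_range_emb: "has_lattice_det (range emb) (\<nu> ^ 4 ^ m)"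
  unfolding has_lattice_det_def using lattice_basis_b det_row_matrix_b by auto

lemma span_b: "Real_Vector_Spaces.span (range b) = UNIV"
proof -
  have b': "inj b" "Real_Vector_Spaces.independent (range b)"
    using lattice_basis_b by (simp_all add: lattice_basis_def)
  have "Real_Vector_Spaces.dim (range b) = card (range b)"
    by (rule real_vector.dim_eq_card_independent[OF b'(2)])
  also have "\<dots> = DIM('f euclid)"
    using b'(1) by (simp add: card_image)
  finally show ?thesis
    using dim_eq_full by blast
qed

lemma expand_b: "x = (\<Sum>v\<in>UNIV. ((x \<bullet> b v) / \<nu>) *\<^sub>R b v)"
proof -
  define y where "y = x - (\<Sum>v\<in>UNIV. ((x \<bullet> b v) / \<nu>) *\<^sub>R b v)"
  have "b w \<bullet> y = 0" for w
  proof -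
    have "(\<Sum>v\<in>UNIV. (x \<bullet> b v) / \<nu> * (b w \<bullet> b v)) = (\<Sum>v\<in>UNIV. if v = w then x \<bullet> b w else 0)"
      by (intro sum.cong) (use nu in \<open>auto simp: b\<close>)
    then show ?thesis
      by (simp add: y_def inner_diff_right inner_sum_right inner_commute)
  qed
  then have "range b \<subseteq> {z. y \<bullet> z = 0}"
    by (auto simp: inner_commute)
  then have "Real_Vector_Spaces.span (range b) \<subseteq> {z. y \<bullet> z = 0}"
    by (rule real_vector.span_minimal) (rule subspace_hyperplane)
  then have "y \<bullet> y = 0" unfolding span_b by blast
  then have "y = 0" by simp
  then show ?thesis by (simp add: y_def)
qed

end

lemma (in embedded) embedded_scale:
  assumes "c \<noteq> 0"
  shows "embedded m B \<zeta> (\<lambda>v. c *\<^sub>R b v) (c\<^sup>2 * \<nu>) \<sigma>"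
proof unfold_locales
  show "0 < c\<^sup>2 * \<nu>" using assms nu by simp
  show "(c *\<^sub>R b v) \<bullet> (c *\<^sub>R b w) = (if v = w then c\<^sup>2 * \<nu> else 0)" for v w
    by (simp add: b power2_eq_square)
  show "\<sigma> (c *\<^sub>R b v) = c *\<^sub>R b (\<zeta> * v)" for v
    by (simp add: linear_scale[OF sigma(1)] sigma(2))
qed (simp_all add: linear_add[OF sigma(1)] linear_scale[OF sigma(1)])

context embedded
begin

lemma emb_scale:
  assumes "c \<noteq> 0"
  shows "embedded.emb (\<lambda>v. c *\<^sub>R b v) a = c *\<^sub>R emb a"
proof -
  interpret E: embedded m B \<zeta> "\<lambda>v. c *\<^sub>R b v" "c\<^sup>2 * \<nu>" \<sigma>
    by (rule embedded_scale[OF assms])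
  show ?thesis
    by (simp add: E.emb_def emb_def scaleR_sum_right mult.commute)
qed

lemma has_lattice_det_two_power: "has_lattice_det (emb ` {\<lambda>v. 2 ^ M * a v | a. True}) (\<nu> ^ 4 ^ m * 4 ^ (M * 4 ^ m))"
proof -
  have nz: "(2 ^ M :: real) \<noteq> 0" by simp
  interpret E: embedded m B \<zeta> "\<lambda>v. 2 ^ M *\<^sub>R b v" "(2 ^ M)\<^sup>2 * \<nu>" \<sigma>
    by (rule embedded_scale[OF nz])
  have "E.emb a = emb (\<lambda>v. 2 ^ M * a v)" for a
    using emb_scale[OF nz, of a] emb_smult[of "2 ^ M" a] by simp
  then have "range E.emb = emb ` {\<lambda>v. 2 ^ M * a v | a. True}"
    by auto
  moreover have "((2 ^ M)\<^sup>2 * \<nu>) ^ 4 ^ m = \<nu> ^ 4 ^ m * 4 ^ (M * 4 ^ m)"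
  proof -
    have "((2 :: real) ^ M)\<^sup>2 = 4 ^ M"
      by (simp add: power2_eq_square flip: power_mult_distrib)
    then show ?thesis
      by (simp add: power_mult_distrib flip: power_mult)
  qed
  ultimately show ?thesis
    using E.has_lattice_det_range_emb by simp
qed

lemma mob_dvd_const: 
  assumes "\<And>S. S \<subseteq> idx \<Longrightarrow> \<phi> S = M"
  shows "mob_dvd \<phi> = {\<lambda>v. 2 ^ M * a v | a. True}"
proof (intro equalityI subsetI)
  fix a assume a: "a \<in> mob_dvd \<phi>"
  have "2 ^ M dvd a v" for v
    unfolding function_eq_sum_mon[of a v] using a assms by (intro dvd_sum dvd_mult2) (auto simp: mob_dvd_def)
  then have "a = (\<lambda>v. 2 ^ M * (a v div 2 ^ M))" by simp
  then show "a \<in> {\<lambda>v. 2 ^ M * a v | a. True}"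
    by (intro CollectI exI[of _ "\<lambda>v. a v div 2 ^ M"] conjI TrueI)
next
  fix a :: "'f \<Rightarrow> int" assume "a \<in> {\<lambda>v. 2 ^ M * a v | a. True}"
  then show "a \<in> mob_dvd \<phi>" using assms by (auto simp: mob_dvd_def mob_smult)
qed

text \<open>For the constant exponent \<open>M\<close> the lattice is \<open>2 ^ M\<close> times
  \<Omega>. Lowering the exponent at one \<open>S\<close> by one adjoins
  \<open>2 ^ \<phi> S * mon S\<close>, an extension of index 2; the induction runs over the total
  distance from \<open>M\<close>.\<close>

lemma has_lattice_det_mob_dvd:
  assumes "\<And>S. S \<subseteq> idx \<Longrightarrow> \<phi> S \<le> M"
  shows "has_lattice_det (emb ` mob_dvd \<phi>) (\<nu> ^ 4 ^ m * 4 ^ (\<Sum>S\<in>Pow idx. \<phi> S))"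
  using assms
proof (induction "\<Sum>S\<in>Pow idx. M - \<phi> S" arbitrary: \<phi> rule: less_induct)
  case (less \<phi>)
  show ?case
  proof (cases "\<exists>S\<subseteq>idx. \<phi> S < M")
    case False
    then have \<phi>: "\<phi> S = M" if "S \<subseteq> idx" for S
      using less.prems that by (meson le_antisym not_le)
    have "card (Pow idx) = 4 ^ m"
      by (simp add: card_Pow power_mult)
    then have "(\<Sum>S\<in>Pow idx. \<phi> S) = M * 4 ^ m"
      using \<phi> by (simp add: mult.commute)
    then show ?thesis
      using has_lattice_det_two_power[of M] mob_dvd_const[OF \<phi>] by simp
  next
    case True
    then obtain S where S: "S \<subseteq> idx" "\<phi> S < M" by blast
    define \<psi> where "\<psi> = \<phi>(S := Suc (\<phi> S))"
    have fin: "finite (Pow idx)" "S \<in> Pow idx" using S by simp_all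
    have sum: "(\<Sum>S\<in>Pow idx. \<psi> S) = Suc (\<Sum>S\<in>Pow idx. \<phi> S)"
      unfolding sum.remove[OF fin] by (simp add: \<psi>_def)
    have "(\<Sum>S\<in>Pow idx. M - \<psi> S) < (\<Sum>S\<in>Pow idx. M - \<phi> S)"
      unfolding sum.remove[OF fin] using S(2) by (simp add: \<psi>_def)
    moreover have "\<psi> T \<le> M" if "T \<subseteq> idx" for T
      using less.prems that S(2) by (simp add: \<psi>_def)
    ultimately have IH: "has_lattice_det (emb ` mob_dvd \<psi>) (\<nu> ^ 4 ^ m * 4 ^ (\<Sum>S\<in>Pow idx. \<psi> S))"
      by (rule less.hyps)
    define f :: "'f \<Rightarrow> int" where "f v = 2 ^ \<phi> S * mon S v" for v
    have mob_f: "mob f T = 2 ^ \<phi> S * of_bool (T = S)" if "T \<subseteq> idx" for T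
      unfolding f_def using that S by (simp add: mob_smult mob_mon)
    have "f \<notin> mob_dvd \<psi>"
    proof
      assume "f \<in> mob_dvd \<psi>"
      then have "2 ^ Suc (\<phi> S) dvd (2 ^ \<phi> S :: int)"
        using S(1) mob_f[OF S(1)] by (auto simp: mob_dvd_def \<psi>_def)
      then show False by (simp add: power_dvd_imp_le)
    qed
    moreover have "(\<lambda>v. 2 * f v) \<in> mob_dvd \<psi>"
      by (auto simp: mob_dvd_def mob_smult mob_f \<psi>_def)
    then have "2 *\<^sub>R emb f \<in> emb ` mob_dvd \<psi>"
      using emb_smult[of 2 f] by (metis imageI of_int_numeral)
    ultimately have "has_lattice_det {y + of_int k *\<^sub>R emb f | y k. y \<in> emb ` mob_dvd \<psi>}
        (\<nu> ^ 4 ^ m * 4 ^ (\<Sum>S\<in>Pow idx. \<psi> S) / 4)"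
      using IH by (intro has_lattice_det_insert) auto
    also have "{y + of_int k *\<^sub>R emb f | y k. y \<in> emb ` mob_dvd \<psi>} = emb ` mob_dvd \<phi>"
    proof (intro equalityI subsetI)
      fix y assume "y \<in> {y + of_int k *\<^sub>R emb f | y k. y \<in> emb ` mob_dvd \<psi>}"
      then obtain a k where a: "a \<in> mob_dvd \<psi>" "y = emb (\<lambda>v. a v + k * f v)"
        by (auto simp: emb_add emb_smult)
      have "2 ^ \<phi> T dvd mob a T" if "T \<subseteq> idx" for T
      proof (rule dvd_trans)
        show "2 ^ \<psi> T dvd mob a T" using a(1) that by (simp add: mob_dvd_def)
        show "(2 :: int) ^ \<phi> T dvd 2 ^ \<psi> T" by (simp add: \<psi>_def le_imp_power_dvd)
      qed
      then have "(\<lambda>v. a v + k * f v) \<in> mob_dvd \<phi>"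
        by (auto simp: mob_dvd_def mob_add mob_smult mob_f)
      then show "y \<in> emb ` mob_dvd \<phi>" using a(2) by simp
    next
      fix y assume "y \<in> emb ` mob_dvd \<phi>"
      then obtain a where a: "a \<in> mob_dvd \<phi>" "y = emb a" by blast
      obtain k where k: "mob a S = 2 ^ \<phi> S * k"
        using a(1) S(1) unfolding mob_dvd_def dvd_def by blast
      have "2 ^ \<psi> T dvd mob (\<lambda>v. a v - k * f v) T" if "T \<subseteq> idx" for T
        using a(1) that k by (auto simp: mob_dvd_def mob_diff mob_smult mob_f \<psi>_def)
      then have "(\<lambda>v. a v - k * f v) \<in> mob_dvd \<psi>" by (simp add: mob_dvd_def)
      moreover have "y = emb (\<lambda>v. a v - k * f v) + of_int k *\<^sub>R emb f"
        by (simp add: a(2) emb_diff emb_smult)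
      ultimately show "y \<in> {y + of_int k *\<^sub>R emb f | y k. y \<in> emb ` mob_dvd \<psi>}" by blast
    qed
    finally show ?thesis by (simp add: sum)
  qed
qed

lemma idx_nonempty: "idx \<noteq> {}"
  using m by (simp add: idx_def)

text \<open>Up to sign, the sum is the coefficient at \<open>S\<close> of the constant function
  1.\<close>

lemma alternating_sum_Pow:
  assumes "S \<subseteq> idx"
  shows "(\<Sum>T\<in>Pow S. (-1) ^ card T) = (of_bool (S = {}) :: int)"
proof -
  have fin: "finite S" using assms finite_subset[OF _ finite_idx] by blast
  have "(\<Sum>T\<in>Pow S. (-1) ^ card T) = (\<Sum>T\<in>Pow S. (-1) ^ card S * (-1) ^ card (S - T) :: int)"
  proof (rule sum.cong[OF refl])
    fix T assume "T \<in> Pow S"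
    then have "card S = card T + card (S - T)"
      using fin by (simp add: card_Diff_subset card_mono finite_subset)
    then show "(-1 :: int) ^ card T = (-1) ^ card S * (-1) ^ card (S - T)"
      by (simp add: power_add mult.assoc flip: power_mult_distrib)
  qed
  also have "\<dots> = (-1) ^ card S * mob (\<lambda>v. 1) S"
    by (simp add: mob_def sum_distrib_left)
  also have "mob (\<lambda>v. 1) S = (mob (mon {}) S :: int)"
    by (simp add: mon_def[abs_def])
  finally show ?thesis using assms by (simp add: mob_mon)
qed

text \<open>Each set is paired with its complement.\<close>

lemma sum_card_Pow: "(\<Sum>S\<in>Pow idx. card S) = m * 4 ^ m"
proof -
  have "(\<Sum>S\<in>Pow idx. card S) = (\<Sum>S\<in>Pow idx. card (idx - S))"
    by (rule sum.reindex_bij_witness[of _ "\<lambda>S. idx - S" "\<lambda>S. idx - S"]) (auto simp: double_diff)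
  then have "2 * (\<Sum>S\<in>Pow idx. card S) = (\<Sum>S\<in>Pow idx. card S + card (idx - S))"
    by (simp add: sum.distrib)
  also have "\<dots> = (\<Sum>S\<in>Pow idx. 2 * m)"
  proof (rule sum.cong[OF refl])
    fix S assume "S \<in> Pow idx"
    then show "card S + card (idx - S) = 2 * m"
      using card_mono[of idx S] finite_subset[of S idx] by (simp add: card_Diff_subset)
  qed
  also have "\<dots> = 2 * (m * 4 ^ m)"
    by (simp add: card_Pow power_mult)
  finally show ?thesis by simp
qed

lemma sum_odd_card_Pow: "(\<Sum>S\<in>Pow idx. of_bool (odd (card S))) = (2 ^ (2 * m - 1) :: nat)"
proof -
  have "(\<Sum>S\<in>Pow idx. 1 - (-1) ^ card S) = (2 ^ (2 * m) :: int)"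
    using alternating_sum_Pow[OF order_refl] idx_nonempty by (simp add: sum_subtractf card_Pow)
  moreover have "(\<Sum>S\<in>Pow idx. 1 - (-1) ^ card S) = (\<Sum>S\<in>Pow idx. 2 * of_bool (odd (card S)) :: int)"
    by (rule sum.cong) auto
  ultimately have "2 * (\<Sum>S\<in>Pow idx. of_bool (odd (card S))) = (2 ^ (2 * m) :: int)"
    by (simp add: sum_distrib_left)
  also have "\<dots> = 2 * 2 ^ (2 * m - 1)"
    using m by (cases m) simp_all
  finally have "int (\<Sum>S\<in>Pow idx. of_bool (odd (card S))) = int (2 ^ (2 * m - 1))"
    by simp
  then show ?thesis by (simp only: of_nat_eq_iff)
qed

lemma sum_exponents:
  "2 * (\<Sum>S\<in>Pow idx. (card S + 1) div 2) = m * 4 ^ m + 2 ^ (2 * m - 1)"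
  "2 * (\<Sum>S\<in>Pow idx. card S div 2) + 2 ^ (2 * m - 1) = m * 4 ^ m"
proof -
  have "2 * (\<Sum>S\<in>Pow idx. (card S + 1) div 2) = (\<Sum>S\<in>Pow idx. card S + of_bool (odd (card S)))"
    unfolding sum_distrib_left by (rule sum.cong) (auto elim: oddE)
  then show "2 * (\<Sum>S\<in>Pow idx. (card S + 1) div 2) = m * 4 ^ m + 2 ^ (2 * m - 1)"
    by (simp add: sum.distrib sum_card_Pow sum_odd_card_Pow)
  have "2 * (\<Sum>S\<in>Pow idx. card S div 2) + (\<Sum>S\<in>Pow idx. of_bool (odd (card S))) = (\<Sum>S\<in>Pow idx. card S)"
    unfolding sum_distrib_left sum.distrib[symmetric] by (rule sum.cong) (auto elim: oddE)
  then show "2 * (\<Sum>S\<in>Pow idx. card S div 2) + 2 ^ (2 * m - 1) = m * 4 ^ m"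
    by (simp add: sum_card_Pow sum_odd_card_Pow)
qed

section \<open>Coordinate subspaces and the Barnes--Wall lattice\<close>

definition down :: "nat set \<Rightarrow> 'f \<Rightarrow> int" where "down S v = of_bool (supp v \<subseteq> S)"

lemma down_eq_prod:
  assumes "S \<subseteq> idx"
  shows "down S v = (\<Prod>i\<in>idx - S. 1 - mon {i} v)"
proof (cases "supp v \<subseteq> S")
  case True
  then have "(\<Prod>i\<in>idx - S. 1 - mon {i} v) = (\<Prod>i\<in>idx - S. 1 :: int)"
    by (intro prod.cong) (auto simp: mon_def)
  then show ?thesis using True by (simp add: down_def)
next
  case False
  then obtain i where "i \<in> supp v" "i \<notin> S" by blast
  then have "(\<Prod>i\<in>idx - S. 1 - mon {i} v) = (0 :: int)"
    using supp_subset by (intro prod_zero bexI[of _ i]) (auto simp: mon_def)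
  then show ?thesis using False by (simp add: down_def)
qed

text \<open>The coordinate subspace of \<open>S\<close> is cut out by the vanishing of the other
  \<open>2 * m - card S\<close> coordinates.\<close>

lemma down_in_deg_le:
  assumes "S \<subseteq> idx"
  shows "down S \<in> deg_le (2 * m - card S)"
proof -
  have "(\<lambda>v. \<Prod>i\<in>idx - S. 1 - mon {i} v :: int) \<in> deg_le (\<Sum>i\<in>idx - S. 1)"
    using one_minus_mon_in_deg_le by (intro deg_le_prod) auto
  moreover have "(\<Sum>i\<in>idx - S. 1) = 2 * m - card S"
    using assms finite_subset[OF assms] by (simp add: card_Diff_subset)
  moreover have "down S = (\<lambda>v. \<Prod>i\<in>idx - S. 1 - mon {i} v)"
    using down_eq_prod[OF assms] by blast
  ultimately show ?thesis by metis
qed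

text \<open>Expansion of the product of the coordinates x in \<open>S\<close>, each written as 1 -
  (1 - x); the product of 1 - x over \<open>T\<close> is the indicator of the subspace of
  \<open>idx - T\<close>.\<close>

lemma mon_eq_sum_down:
  assumes S: "S \<subseteq> idx"
  shows "mon S v = (\<Sum>T\<in>Pow S. (-1) ^ card T * down (idx - T) v)"
proof -
  have fin: "finite S" using S finite_subset[OF _ finite_idx] by blast
  have "(\<Sum>T\<in>Pow S. (-1) ^ card T * down (idx - T) v) = (\<Sum>T\<in>Pow (S - supp v). (-1) ^ card T)"
    using fin supp_subset[of v] by (intro sum.mono_neutral_cong_right) (auto simp: down_def)
  also have "\<dots> = of_bool (S - supp v = {})"
    using S by (intro alternating_sum_Pow) auto
  also have "\<dots> = mon S v" by (simp add: mon_def)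
  finally show ?thesis by simp
qed

lemma coordinate_subspaces_eq: "coordinate_subspaces m B r = {pt ` Pow S | S. S \<subseteq> idx \<and> card S = r}"
  unfolding coordinate_subspaces_def idx_def[symmetric] using span_f2_scale_image by metis

lemma sum_b_subspace:
  assumes "S \<subseteq> idx"
  shows "(\<Sum>v\<in>pt ` Pow S. b v) = emb (down S)"
proof -
  have "v \<in> pt ` Pow S \<longleftrightarrow> supp v \<subseteq> S" for v
  proof
    assume "supp v \<subseteq> S"
    then have "pt (supp v) \<in> pt ` Pow S" by blast
    then show "v \<in> pt ` Pow S" by simp
  qed (use assms in auto)
  then have "pt ` Pow S = {v. supp v \<subseteq> S}" by blast
  then show ?thesis
    by (simp add: emb_def down_def of_bool_def if_distrib[of "\<lambda>c. of_int c *\<^sub>R _"] sum.If_cases cong: if_cong)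
qed

text \<open>A subspace of dimension r has an indicator of degree 2m - r, and its prescribed factor
  is the one that \<open>Lam 1\<close> asks for in that degree. Conversely a monomial expands into
  indicators of at most its own degree, whose factors are no larger.\<close>

lemma barnes_wall_eq: "barnes_wall m B b = emb ` Lam 1"
proof -
  define G where "G = {2 ^ ((2 * m - r + 1) div 2) *\<^sub>R (\<Sum>v\<in>U. b v) | r U. r \<le> 2 * m \<and> U \<in> coordinate_subspaces m B r}"
  have sub: "Z.subspace (emb ` Lam 1)"
    unfolding Lam_eq_mob_dvd by (rule subspace_mob_dvd)
  have "Z.span G \<subseteq> emb ` Lam 1"
  proof (rule Z.span_minimal[OF _ sub], rule subsetI)
    fix x assume "x \<in> G"
    then obtain S where S: "S \<subseteq> idx" "x = 2 ^ ((2 * m - card S + 1) div 2) *\<^sub>R emb (down S)"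
      by (auto simp: G_def coordinate_subspaces_eq sum_b_subspace)
    have "x = emb (\<lambda>v. 2 ^ ((2 * m - card S + 1) div 2) * down S v)"
      unfolding S(2) emb_smult by simp
    moreover have "(\<lambda>v. 2 ^ ((2 * m - card S + 1) div 2) * down S v) \<in> Lam 1"
      by (rule Lam_deg_le[OF down_in_deg_le[OF S(1)]]) simp
    ultimately show "x \<in> emb ` Lam 1" by simp
  qed
  moreover have "emb ` Lam 1 \<subseteq> Z.span G"
  proof
    fix x assume "x \<in> emb ` Lam 1"
    then obtain a where a: "a \<in> Lam 1" "x = emb a" by blast
    have sc: "of_int k *\<^sub>R y \<in> Z.span G" if "y \<in> Z.span G" for k y
      using Z.span_scale[OF that, of k] by (simp add: int_scale_def)
    have term_in: "emb (\<lambda>v. mob a S * mon S v) \<in> Z.span G" if S: "S \<subseteq> idx" for S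
    proof -
      obtain k where k: "mob a S = 2 ^ ((card S + 1) div 2) * k"
        using a(1) S unfolding Lam_def dvd_def by blast
      have "emb (\<lambda>v. c * down (idx - T) v) \<in> Z.span G"
        if T: "T \<subseteq> S" and c: "2 ^ ((card T + 1) div 2) dvd c" for c T
      proof -
        have T': "T \<subseteq> idx" "finite T" using T S finite_subset[OF _ finite_idx] by auto
        have card: "card (idx - T) = 2 * m - card T" "card T \<le> 2 * m"
          using T' card_mono[OF finite_idx T'(1)] by (simp_all add: card_Diff_subset)
        then have exp: "(2 * m - card (idx - T) + 1) div 2 = (card T + 1) div 2" by simp
        obtain d where d: "c = d * 2 ^ ((card T + 1) div 2)" using c by (auto elim: dvdE)
        have "2 ^ ((2 * m - card (idx - T) + 1) div 2) *\<^sub>R (\<Sum>v\<in>pt ` Pow (idx - T). b v) \<in> G"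
          unfolding G_def coordinate_subspaces_eq using card
          by (intro CollectI exI[of _ "card (idx - T)"] exI[of _ "pt ` Pow (idx - T)"]) auto
        then have "2 ^ ((card T + 1) div 2) *\<^sub>R emb (down (idx - T)) \<in> Z.span G"
          unfolding exp by (simp add: sum_b_subspace Z.span_base)
        from sc[OF this, of d] show ?thesis
          unfolding emb_smult d by simp
      qed
      moreover have "2 ^ ((card T + 1) div 2) dvd mob a S * (-1) ^ card T" if "T \<subseteq> S" for T
      proof -
        have "card T \<le> card S" using that S by (meson card_mono finite_idx finite_subset)
        then have "(2::int) ^ ((card T + 1) div 2) dvd 2 ^ ((card S + 1) div 2)"
          by (intro le_imp_power_dvd div_le_mono) simp
        then show ?thesis unfolding k by (intro dvd_mult2)
      qed
      ultimately have "emb (\<lambda>v. \<Sum>T\<in>Pow S. (mob a S * (-1) ^ card T) * down (idx - T) v) \<in> Z.span G"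
        unfolding emb_sum by (intro Z.span_sum) auto
      then show ?thesis
        unfolding mon_eq_sum_down[OF S] by (simp add: sum_distrib_left mult.assoc)
    qed
    have "x = emb (\<lambda>v. \<Sum>S\<in>Pow idx. mob a S * mon S v)"
      unfolding a(2) by (simp flip: function_eq_sum_mon)
    also have "\<dots> \<in> Z.span G"
      unfolding emb_sum using term_in by (intro Z.span_sum) auto
    finally show "x \<in> Z.span G" .
  qed
  ultimately show ?thesis
    unfolding barnes_wall_def G_def[symmetric] by blast
qed

text \<open>With basis vectors of norm 2^(-m) this is integrality of inner products. The two
  coefficients bring at least half the size of \<open>S \<union> T\<close>, rounded down, and the
  sum of its monomial brings the rest of the exponent \<open>m\<close>.\<close>

lemma Lam_mult_dvd:
  assumes "a \<in> Lam 0" "c \<in> Lam 1"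
  shows "2 ^ m dvd (\<Sum>v\<in>UNIV. a v * c v)"
proof -
  have "(\<Sum>v\<in>UNIV. a v * c v) =
      (\<Sum>v\<in>UNIV. \<Sum>S\<in>Pow idx. \<Sum>T\<in>Pow idx. mob a S * mob c T * mon (S \<union> T) v)"
    by (subst function_eq_sum_mon[of a], subst function_eq_sum_mon[of c])
      (simp add: sum_product mult_ac flip: mon_mult)
  also have "\<dots> = (\<Sum>S\<in>Pow idx. \<Sum>T\<in>Pow idx. \<Sum>v\<in>UNIV. mob a S * mob c T * mon (S \<union> T) v)"
    by (subst sum.swap, rule sum.cong[OF refl], subst sum.swap, rule refl)
  also have "2 ^ m dvd \<dots>"
  proof (rule dvd_sum, rule dvd_sum)
    fix S T assume "S \<in> Pow idx" "T \<in> Pow idx"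
    then have S: "S \<subseteq> idx" and T: "T \<subseteq> idx" by auto
    have "card (S \<union> T) \<le> card S + card T" by (rule card_Un_le)
    moreover have "card (S \<union> T) \<le> 2 * m" using card_mono[of idx "S \<union> T"] S T by simp
    ultimately have "m \<le> card S div 2 + (card T + 1) div 2 + (2 * m - card (S \<union> T))" by linarith
    then have "(2::int) ^ m dvd 2 ^ (card S div 2) * 2 ^ ((card T + 1) div 2) * 2 ^ (2 * m - card (S \<union> T))"
      unfolding power_add[symmetric] by (rule le_imp_power_dvd)
    also have "\<dots> dvd mob a S * mob c T * 2 ^ (2 * m - card (S \<union> T))"
      using assms S T by (intro mult_dvd_mono) (auto simp: Lam_def)
    also have "\<dots> = (\<Sum>v\<in>UNIV. mob a S * mob c T * mon (S \<union> T) v)"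
      using S T by (simp add: sum_mon flip: sum_distrib_left)
    finally show "2 ^ m dvd (\<Sum>v\<in>UNIV. mob a S * mob c T * mon (S \<union> T) v)" .
  qed
  finally show ?thesis .
qed

text \<open>The functional \<open>\<lambda>f. mob f S\<close>, up to normalization, is the inner product with this function.\<close>

definition mob_dual :: "nat set \<Rightarrow> 'f \<Rightarrow> int" where
  "mob_dual S v = of_bool (supp v \<subseteq> S) * (-1) ^ card (S - supp v)"

text \<open>On the subspace of \<open>S\<close> the sign is the product of 2 x - 1 over the
  coordinates x in \<open>S\<close>, of degree 0; the degree comes from the indicator of the
  subspace.\<close>

lemma mob_dual_in_deg_le:
  assumes S: "S \<subseteq> idx"
  shows "mob_dual S \<in> deg_le (2 * m - card S)"
proof -
  have fin: "finite S" using S finite_subset[OF _ finite_idx] by blast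
  have eq: "mob_dual S v = (\<Prod>i\<in>S. 2 * mon {i} v - 1) * down S v" for v
  proof (cases "supp v \<subseteq> S")
    case True
    have "(\<Prod>i\<in>S. 2 * mon {i} v - 1 :: int) = (\<Prod>i\<in>S - supp v. - 1)"
      using fin by (intro prod.mono_neutral_cong_right) (auto simp: mon_def)
    then show ?thesis using True by (simp add: mob_dual_def down_def)
  qed (simp add: mob_dual_def down_def)
  have "(\<lambda>v. 2 * mon {i} v - 1 :: int) \<in> deg_le 0" if "i \<in> S" for i
    using mon_in_deg_le[of "{i}"] that S by (intro deg_le_diff const_in_deg_le deg_le_smult_shift) auto
  then have "(\<lambda>v. \<Prod>i\<in>S. 2 * mon {i} v - 1 :: int) \<in> deg_le (\<Sum>i\<in>S. 0)"
    using fin by (intro deg_le_prod)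
  from deg_le_mult[OF this down_in_deg_le[OF S]] show ?thesis
    by (simp flip: eq)
qed

lemma sum_mob_dual:
  fixes f :: "'f \<Rightarrow> real"
  assumes S: "S \<subseteq> idx"
  shows "(\<Sum>v\<in>UNIV. f v * of_int (mob_dual S v)) = mob f S"
proof -
  have "(\<Sum>v\<in>UNIV. f v * of_int (mob_dual S v)) = (\<Sum>T\<in>Pow idx. f (pt T) * of_int (mob_dual S (pt T)))"
    by (rule sum_over_pt)
  also have "\<dots> = (\<Sum>T\<in>Pow S. (-1) ^ card (S - T) * f (pt T))"
    using S by (intro sum.mono_neutral_cong_right) (auto simp: mob_dual_def)
  finally show ?thesis by (simp add: mob_def)
qed

text \<open>One inclusion is \<open>Lam_mult_dvd\<close>. For the other, pairing with a multiple of
  \<open>mob_dual S\<close> reads off the coefficient at \<open>S\<close>, and integrality becomes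
  its divisibility.\<close>

lemma dual_lattice_Lam:
  assumes nu_eq: "\<nu> = 1 / 2 ^ m"
  shows "dual_lattice (emb ` Lam 1) = emb ` Lam 0"
proof -
  have "Real_Vector_Spaces.span (emb ` Lam 1) = UNIV"
  proof -
    have "b v \<in> Real_Vector_Spaces.span (emb ` Lam 1)" for v
    proof -
      have "(\<lambda>w. 2 ^ m * delta v w) \<in> Lam 1" by (rule Lam_dvd) simp_all
      then have "emb (\<lambda>w. 2 ^ m * delta v w) \<in> emb ` Lam 1" by simp
      then have "(1 / 2 ^ m) *\<^sub>R emb (\<lambda>w. 2 ^ m * delta v w) \<in> Real_Vector_Spaces.span (emb ` Lam 1)"
        by (intro Real_Vector_Spaces.span_scale Real_Vector_Spaces.span_base)
      moreover have "emb (delta v) = b v"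
      proof -
        have "emb (delta v) = (\<Sum>w\<in>UNIV. if w = v then b v else 0)"
          unfolding emb_def by (rule sum.cong) (auto simp: delta_def)
        then show ?thesis by simp
      qed
      ultimately show ?thesis by (simp add: emb_smult)
    qed
    then have "Real_Vector_Spaces.span (range b) \<subseteq> Real_Vector_Spaces.span (emb ` Lam 1)"
      by (intro Real_Vector_Spaces.span_minimal) auto
    then show ?thesis using span_b by blast
  qed
  then have dual: "dual_lattice (emb ` Lam 1) = {x. \<forall>c\<in>Lam 1. x \<bullet> emb c \<in> \<int>}"
    by (auto simp: dual_lattice_def)
  show ?thesis
    unfolding dual
  proof (intro equalityI subsetI)
    fix x assume "x \<in> emb ` Lam 0"
    then obtain a where a: "a \<in> Lam 0" "x = emb a" by blast
    have "x \<bullet> emb c \<in> \<int>" if c: "c \<in> Lam 1" for c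
    proof -
      obtain k where "(\<Sum>v\<in>UNIV. a v * c v) = 2 ^ m * k"
        using Lam_mult_dvd[OF a(1) c] by (auto elim: dvdE)
      then have "x \<bullet> emb c = \<nu> * of_int (2 ^ m * k)"
        unfolding a(2) inner_emb by (simp only:)
      then show ?thesis by (simp add: nu_eq)
    qed
    then show "x \<in> {x. \<forall>c\<in>Lam 1. x \<bullet> emb c \<in> \<int>}" by blast
  next
    fix x assume "x \<in> {x. \<forall>c\<in>Lam 1. x \<bullet> emb c \<in> \<int>}"
    then have x: "x \<bullet> emb c \<in> \<int>" if "c \<in> Lam 1" for c using that by blast
    define f where "f v = (x \<bullet> b v) / \<nu>" for v
    have mob: "\<exists>k. mob f S = 2 ^ (card S div 2) * of_int k" if S: "S \<subseteq> idx" for S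
    proof -
      have card: "card S \<le> 2 * m" using card_mono[OF finite_idx S] by simp
      \<comment> \<open>The exponent that puts \<open>2 ^ e * mob_dual S\<close>, of degree
        \<open>2 * m - card S\<close> before scaling, into \<open>Lam 1\<close>. Against the norm
        \<open>1 / 2 ^ m\<close> it leaves the factor \<open>2 ^ (card S div 2)\<close>.\<close>
      define e where "e = m - card S div 2"
      have e: "(2 * m - card S + 1) div 2 = e" "m = e + card S div 2"
        using card by (simp_all add: e_def)
      have "(\<lambda>v. 2 ^ e * mob_dual S v) \<in> Lam 1"
        by (rule Lam_deg_le[OF mob_dual_in_deg_le[OF S]]) (simp only: e(1) dvd_refl)
      then have "x \<bullet> emb (\<lambda>v. 2 ^ e * mob_dual S v) \<in> \<int>" by (rule x)
      then obtain k where k: "x \<bullet> emb (\<lambda>v. 2 ^ e * mob_dual S v) = of_int k" by (auto elim: Ints_cases)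
      have "x \<bullet> emb (mob_dual S) = (\<Sum>v\<in>UNIV. of_int (mob_dual S v) * (x \<bullet> b v))"
        by (simp add: emb_def inner_sum_right)
      also have "\<dots> = \<nu> * (\<Sum>v\<in>UNIV. f v * of_int (mob_dual S v))"
        unfolding sum_distrib_left using nu by (intro sum.cong) (auto simp: f_def)
      finally have "2 ^ e * (\<nu> * mob f S) = of_int k"
        using k unfolding emb_smult sum_mob_dual[OF S] by simp
      then have "mob f S = 2 ^ (card S div 2) * of_int k"
      proof -
        have "(2 :: real) ^ m = 2 ^ e * 2 ^ (card S div 2)"
          using e(2) by (metis power_add)
        then show ?thesis
          using \<open>2 ^ e * (\<nu> * mob f S) = of_int k\<close> by (simp add: nu_eq field_simps)
      qed
      then show ?thesis by blast
    qed
    have "f v \<in> \<int>" for v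
    proof -
      have "f v = (\<Sum>S\<in>Pow idx. mob f S * mon S v)" by (rule function_eq_sum_mon)
      also have "\<dots> \<in> \<int>"
      proof (intro Ints_sum Ints_mult)
        fix S assume "S \<in> Pow idx"
        then show "mob f S \<in> \<int>" using mob[of S] by auto
        show "mon S v \<in> (\<int> :: real set)" by (simp add: mon_def)
      qed
      finally show ?thesis .
    qed
    then have "\<forall>v. \<exists>k. f v = of_int k" by (auto elim: Ints_cases)
    then obtain a where a: "\<And>v. f v = of_int (a v)" by metis
    have "a \<in> Lam 0"
      unfolding Lam_def mem_Collect_eq
    proof (intro allI impI)
      fix S assume S: "S \<subseteq> idx"
      obtain k where "mob f S = 2 ^ (card S div 2) * of_int k" using mob[OF S] by blast
      moreover have "mob f S = of_int (mob a S)"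
        using mob_of_int[of a S, where 'a = real] by (simp add: a[abs_def])
      ultimately have "real_of_int (mob a S) = of_int (2 ^ (card S div 2) * k)" by simp
      then have "mob a S = 2 ^ (card S div 2) * k" by (simp only: of_int_eq_iff)
      then show "2 ^ ((card S + 0) div 2) dvd mob a S" by simp
    qed
    moreover have "x = emb a"
    proof -
      have "x = (\<Sum>v\<in>UNIV. f v *\<^sub>R b v)" unfolding f_def by (rule expand_b)
      then show ?thesis by (simp add: a emb_def)
    qed
    ultimately show "x \<in> emb ` Lam 0" by blast
  qed
qed

end

section \<open>Exponent sets and the minimum\<close>

lemma bij_bits: "bij_betw (\<lambda>u::nat. {i. i < k \<and> bit u i}) {..<2 ^ k} (Pow {..<k})"
proof -
  have inj: "inj_on (\<lambda>u::nat. {i. i < k \<and> bit u i}) {..<2 ^ k}"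
    by (rule inj_onI) (metis lessThan_iff sum_bits)
  have "(\<lambda>u::nat. {i. i < k \<and> bit u i}) ` {..<2 ^ k} = Pow {..<k}"
    by (rule card_subset_eq) (auto simp: card_image[OF inj] card_Pow)
  then show ?thesis using inj by (simp add: bij_betw_def)
qed

lemma bij_betw_Collect_restrict:
  assumes "bij_betw f A B"
  shows "bij_betw f {x \<in> A. P (f x)} {y \<in> B. P y}"
proof -
  have "inj_on f {x \<in> A. P (f x)}" using assms by (auto simp: bij_betw_def intro: inj_on_subset)
  moreover have "f ` {x \<in> A. P (f x)} = {y \<in> B. P y}" using assms by (auto simp: bij_betw_def)
  ultimately show ?thesis by (simp add: bij_betw_def)
qed

lemma card_even_subsets:
  assumes "finite U" "U \<noteq> {}"
  shows "2 * card {A. A \<subseteq> U \<and> even (card A)} = 2 ^ card U"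
proof -
  have "card {A. A \<subseteq> U \<and> even (card A)} = card {A. A \<subseteq> U \<and> odd (card A)}"
    using card_subsupersets_even_odd[of U "{}"] assms by (simp add: psubset_eq)
  moreover have "card (Pow U) = card {A. A \<subseteq> U \<and> even (card A)} + card {A. A \<subseteq> U \<and> odd (card A)}"
    using assms(1) by (subst card_Un_disjoint[symmetric]) (auto intro: arg_cong[of _ _ card])
  ultimately show ?thesis using assms(1) by (simp add: card_Pow)
qed

lemma bit_range_sum:
  fixes y :: "'a \<Rightarrow> int"
  assumes "finite A"
  shows "int (card {v \<in> A. odd (y v)}) \<le> (\<Sum>v\<in>A. (y v)\<^sup>2)"
proof -
  have "int (card {v \<in> A. odd (y v)}) = (\<Sum>v\<in>A. of_bool (odd (y v)))"
    using assms by (simp add: of_bool_def sum.If_cases Int_def)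
  also have "\<dots> \<le> (\<Sum>v\<in>A. (y v)\<^sup>2)"
  proof (rule sum_mono)
    fix v
    show "of_bool (odd (y v)) \<le> (y v)\<^sup>2"
      by (cases "y v = 0") (auto simp: of_bool_def int_one_le_iff_zero_less)
  qed
  finally show ?thesis .
qed

lemma even_card_odd:
  fixes y :: "'a \<Rightarrow> int"
  assumes "finite A"
  shows "even (card {v \<in> A. odd (y v)}) \<longleftrightarrow> even (\<Sum>v\<in>A. y v)"
  using assms
proof (induction A rule: finite_induct)
  case (insert x A)
  have "{v \<in> insert x A. odd (y v)} = (if odd (y x) then insert x {v \<in> A. odd (y v)} else {v \<in> A. odd (y v)})"
    by auto
  then show ?case using insert by simp
qed simp

lemma split_two_power:
  fixes a :: "'a \<Rightarrow> int"
  assumes "a v \<noteq> 0"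
  shows "\<exists>j y w. a = (\<lambda>v. 2 ^ j * y v) \<and> odd (y w)"
  using assms
proof (induction "nat \<bar>a v\<bar>" arbitrary: a rule: less_induct)
  case less
  show ?case
  proof (cases "\<exists>w. odd (a w)")
    case True
    then show ?thesis by (intro exI[of _ 0] exI[of _ a]) simp
  next
    case False
    define c where "c w = a w div 2" for w
    have c: "a = (\<lambda>w. 2 * c w)" using False by (simp add: c_def fun_eq_iff)
    then have "nat \<bar>c v\<bar> < nat \<bar>a v\<bar>" "c v \<noteq> 0" using less.prems by auto
    then obtain j y w where "c = (\<lambda>v. 2 ^ j * y v)" "odd (y w)" using less.hyps by blast
    then show ?thesis using c by (intro exI[of _ "Suc j"] exI[of _ y] exI[of _ w]) (simp add: mult.assoc)
  qed
qed

context bw_field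
begin

text \<open>Membership in a set \<open>Theta\<close> with index in \<open>K\<close>, expressed by
  exponents because 0 and \<open>n\<close> denote the same element.\<close>

definition hits :: "nat set \<Rightarrow> nat \<Rightarrow> bool" where
  "hits K u \<longleftrightarrow> (\<exists>k\<in>K. odd_even_diff u = int m - int k)"

text \<open>The exponents of the zeros of the code with parameters \<open>r\<close> and \<open>K\<close>. The exponent \<open>n\<close>, of
  weight \<open>2 * m\<close>, could only matter for \<open>r = 0\<close>, which occurs only with \<open>m \<in> K\<close>; then it is
  removed.\<close>

definition zset :: "nat \<Rightarrow> nat set \<Rightarrow> nat set" where
  "zset r K = {u \<in> {0<..<n}. wt u + r \<le> 2 * m \<and> \<not> (wt u + r = 2 * m \<and> hits K u)}"

definition hitset :: "nat set \<Rightarrow> nat set" where "hitset K = {u \<in> {0<..<n}. hits K u}"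

section \<open>Zero sets of the codes in terms of exponents\<close>

lemma closed_zset: "closed (zset r K)"
  unfolding zset_def hits_def
  by (rule closed_weights[where Q = "\<lambda>a d. a + r \<le> 2 * m \<and> \<not> (a + r = 2 * m \<and> (\<exists>k\<in>K. d = int m - int k))"])

lemma n_less: "n < 2 ^ (2 * m)"
  using Suc_n by (simp add: power_mult)

lemma bit_n: "i < 2 * m \<Longrightarrow> bit n i"
proof -
  assume "i < 2 * m"
  have "n = mask (2 * m)" by (simp add: mask_eq_exp_minus_1 n_def power_mult)
  then show ?thesis using \<open>i < 2 * m\<close> by (simp add: bit_mask_iff)
qed

lemma weights_n: "wt n = 2 * m" "odd_even_diff n = 0" and weights_0: "wt 0 = 0" "odd_even_diff 0 = 0"
proof -
  have *: "odd_ones m n = m" "even_ones m n = m"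
    unfolding odd_ones_def even_ones_def using bit_n by (simp_all cong: conj_cong)
  show "wt n = 2 * m" "odd_even_diff n = 0"
    by (simp_all add: wt2_eq_odd_even odd_even_diff_def *)
  show "wt 0 = 0" "odd_even_diff 0 = 0"
    by (simp_all add: wt2_eq_odd_even odd_even_diff_def odd_ones_def even_ones_def)
qed

lemma wt_pos: "0 < u \<Longrightarrow> u < n \<Longrightarrow> 0 < wt u" and wt_less: "u < n \<Longrightarrow> wt u < 2 * m"
proof -
  have bits: "(\<Sum>i | i < 2 * m \<and> bit u i. 2 ^ i) = u" if "u < n"
    using that n_less by (intro sum_bits) simp
  show "0 < wt u" if "0 < u" "u < n"
  proof (rule ccontr)
    assume "\<not> 0 < wt u"
    then have "{i. i < 2 * m \<and> bit u i} = {}" by (simp add: wt_eq_card)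
    from bits[OF that(2), unfolded this] show False using that(1) by simp
  qed
  show "wt u < 2 * m" if "u < n"
  proof (rule ccontr)
    assume "\<not> wt u < 2 * m"
    then have "card {i. i < 2 * m \<and> bit u i} \<ge> card {..<2 * m}" by (simp add: wt_eq_card)
    then have "{i. i < 2 * m \<and> bit u i} = {..<2 * m}" by (intro card_seteq) auto
    then show False using bits[OF that] bits_n that by simp
  qed
qed

text \<open>Sum and difference of the two digit counts have the same parity, so the index
  \<open>k\<close> determines the parity of the weight.\<close>

lemma parity_hits:
  assumes "odd_even_diff u = int m - int k" "k \<le> m"
  shows "even (wt u) \<longleftrightarrow> even (m - k)"
proof -
  have "even (wt u) \<longleftrightarrow> even (int (odd_ones m u) - int (even_ones m u))"
    by (simp add: wt2_eq_odd_even)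
  also have "\<dots> \<longleftrightarrow> even (odd_even_diff u)"
    by (auto simp: odd_even_diff_def abs_if)
  also have "odd_even_diff u = int (m - k)"
    using assms by (simp add: of_nat_diff)
  finally show ?thesis by simp
qed

lemma eq_if_power_eq: "\<zeta> ^ u = \<zeta> ^ v \<Longrightarrow> u < n \<Longrightarrow> v < n \<Longrightarrow> u = v"
  using inj_onD[OF inj_zeta] by simp

lemma zero_set_eq:
  assumes r: "r \<le> 2 * m" and 0: "r = 0 \<Longrightarrow> m \<in> K"
  shows "Z_pred m \<zeta> r - (\<Union>k\<in>K. Theta_wt m \<zeta> r k) = zeros (zset r K)"
proof (intro equalityI subsetI)
  have Theta: "x \<in> (\<Union>k\<in>K. Theta_wt m \<zeta> r k) \<longleftrightarrow> (\<exists>u\<le>n. x = \<zeta> ^ u \<and> hits K u \<and> wt u + r = 2 * m)" for x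
  proof -
    have "wt u = 2 * m - r \<longleftrightarrow> wt u + r = 2 * m" for u using r by linarith
    then show ?thesis
      unfolding Theta_wt_def hits_def odd_even_diff_def n_def[symmetric] by auto
  qed
  have Zp: "x \<in> Z_pred m \<zeta> r \<longleftrightarrow> (\<exists>u. 0 < u \<and> u \<le> n \<and> x = \<zeta> ^ u \<and> wt u + r \<le> 2 * m)" for x
    unfolding Z_pred_def n_def[symmetric] using r by (auto simp: le_diff_conv2)
  {
    fix x assume x: "x \<in> Z_pred m \<zeta> r - (\<Union>k\<in>K. Theta_wt m \<zeta> r k)"
    from x have "x \<notin> (\<Union>k\<in>K. Theta_wt m \<zeta> r k)" unfolding Diff_iff by (rule conjunct2)
    then have no: "\<not> (\<exists>u\<le>n. x = \<zeta> ^ u \<and> hits K u \<and> wt u + r = 2 * m)"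
      by (rule contrapos_nn) (rule Theta[THEN iffD2])
    from x[THEN DiffD1] obtain u where u: "0 < u" "u \<le> n" "x = \<zeta> ^ u" "wt u + r \<le> 2 * m"
      unfolding Zp by (elim exE conjE)
    \<comment> \<open>Weight \<open>2 * m\<close> forces \<open>r = 0\<close>; then
      \<open>m \<in> K\<close>, and \<open>n\<close>, whose digits are balanced, is among the
      removed exponents.\<close>
    have "u \<noteq> n"
    proof
      assume "u = n"
      then have "r = 0" using u(4) by (simp add: weights_n)
      then have "hits K n" unfolding hits_def weights_n using 0 by (intro bexI[of _ m]) auto
      then have "n \<le> n \<and> x = \<zeta> ^ n \<and> hits K n \<and> wt n + r = 2 * m"
        using u(3) \<open>u = n\<close> \<open>r = 0\<close> by (simp add: weights_n)
      then show False using no by blast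
    qed
    moreover have "\<not> (wt u + r = 2 * m \<and> hits K u)" using no u(2,3) by blast
    ultimately have "u \<in> zset r K" using u(1,2,4) by (simp add: zset_def)
    then show "x \<in> zeros (zset r K)" using u(3) by (auto simp: zeros_def)
  next
    fix x assume "x \<in> zeros (zset r K)"
    then obtain u where u: "u \<in> zset r K" "x = \<zeta> ^ u" by (auto simp: zeros_def)
    then have u': "0 < u" "u < n" "wt u + r \<le> 2 * m" by (auto simp: zset_def)
    have "\<not> (hits K w \<and> wt w + r = 2 * m)" if w: "w \<le> n" "x = \<zeta> ^ w" for w
    proof (cases "w = n")
      case True
      then have "\<zeta> ^ u = \<zeta> ^ 0" using u(2) w(2) zeta_order by simp
      then show ?thesis using eq_if_power_eq[of u 0] u' by simp
    next
      case False
      then have "w = u" using eq_if_power_eq[of w u] u u' w by simp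
      then show ?thesis using u(1) by (auto simp: zset_def)
    qed
    then show "x \<in> Z_pred m \<zeta> r - (\<Union>k\<in>K. Theta_wt m \<zeta> r k)"
      unfolding Diff_iff Theta Zp using u(2) u' less_imp_le[OF u'(2)] by blast
  }
qed

lemma bw_code_eq:
  assumes r: "r \<le> 2 * m" and 0: "r = 0 \<Longrightarrow> m \<in> K" and 1: "r = 2 * m \<Longrightarrow> m \<notin> K"
  shows "bw_code m \<zeta> r K = extended_code (cyclic_code m \<zeta> (zeros (zset r K)))"
proof (cases "r = 2 * m")
  case False
  then show ?thesis using r zero_set_eq[OF r 0] by (simp add: bw_code_def)
next
  case True
  \<comment> \<open>Exponents strictly between 0 and \<open>n\<close> have positive weight, so the
    zero set is empty and the even-weight code is the extension of the full space.\<close>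
  have "u \<notin> zset (2 * m) K" for u using wt_pos[of u] by (auto simp: zset_def)
  then have "zset (2 * m) K = {}" by blast
  then have "cyclic_code m \<zeta> (zeros (zset r K)) = UNIV" using True by (simp add: cyclic_code_def zeros_def)
  moreover have "even (card {v. c v \<noteq> 0}) \<longleftrightarrow> c 0 = - (\<Sum>v | v \<noteq> 0. c v)" for c :: "'f \<Rightarrow> bit"
  proof -
    have "{v. v \<noteq> 0} = UNIV - {0::'f}" by auto
    then have "(\<Sum>v\<in>UNIV. c v) = c 0 + (\<Sum>v | v \<noteq> 0. c v)"
      by (simp add: sum.remove[of UNIV "0::'f"])
    moreover have "(\<Sum>v\<in>UNIV. c v) = of_nat (card {v. c v \<noteq> 0})"
    proof -
      have "(\<Sum>v\<in>UNIV. c v) = (\<Sum>v\<in>UNIV. if c v \<noteq> 0 then 1 else 0)"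
        by (rule sum.cong) auto
      then show ?thesis by (simp add: sum.If_cases)
    qed
    moreover have "(of_nat k :: bit) = 0 \<longleftrightarrow> even k" for k
      using of_int_bit_eq_0_iff[of "int k"] by simp
    ultimately show ?thesis by (metis add_eq_0_iff2)
  qed
  ultimately show ?thesis
    using True 1 by (auto simp: bw_code_def extended_code_def)
qed

text \<open>The code at level \<open>j\<close> has r = 2 j + t, with t = 1 for
  \<open>chain_minus\<close> and t = 0 or t = 2 for \<open>chain_plus\<close>, as
  \<open>m \<in> J\<close> or not. Only the top weight 2m - r is affected by \<open>K\<close>, which
  gives the interlacing.\<close>

lemma bw_chain_zset: "t \<le> 2 \<Longrightarrow> bw_chain m B \<zeta> (\<lambda>j. zset (2 * j + t) K) (\<lambda>j. low_wt (2 * j + t))"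
proof
  show "closed (zset (2 * j + t) K)" "closed (low_wt (2 * j + t))" for j
    by (rule closed_zset) (rule closed_low_wt)
  show "low_wt (2 * j + t) \<subseteq> {0<..<n}" "zset (2 * j + t) K \<subseteq> low_wt (2 * j + t)" for j
    by (auto simp: low_wt_def zset_def)
  show "low_wt (2 * j + t) \<subseteq> zset (2 * i + t) K" if "i < j" for i j
    using that by (auto simp: low_wt_def zset_def)
qed

text \<open>Level \<open>j\<close> removes exponents of weight exactly 2m - 2j - t. The parity
  condition on \<open>K\<close> places every exponent that hits \<open>K\<close> at one of these
  weights.\<close>

lemma chain_T:
  assumes t: "t \<le> 2" and K: "\<And>k. k \<in> K \<Longrightarrow> k \<le> m \<and> (even (m - k) \<longleftrightarrow> even t)"
  shows "bw_chain.T m (\<lambda>j. zset (2 * j + t) K) (\<lambda>j. low_wt (2 * j + t)) = hitset K"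
proof -
  interpret bw_chain m B \<zeta> "\<lambda>j. zset (2 * j + t) K" "\<lambda>j. low_wt (2 * j + t)"
    by (rule bw_chain_zset[OF t])
  show ?thesis
  proof (intro equalityI subsetI)
    fix u assume "u \<in> T"
    then show "u \<in> hitset K" unfolding T_def S_def by (auto simp: low_wt_def zset_def hitset_def)
  next
    fix u assume u: "u \<in> hitset K"
    then obtain k where k: "k \<in> K" "odd_even_diff u = int m - int k" by (auto simp: hitset_def hits_def)
    have un: "0 < u" "u < n" using u by (auto simp: hitset_def)
    have par: "even (wt u) \<longleftrightarrow> even t" using parity_hits[OF k(2)] K[OF k(1)] by blast
    then have "even (wt u + t)" by simp
    then obtain c where c: "wt u + t = 2 * c" by (rule evenE)
    define j where "j = m - c"
    have "wt u < 2 * m" "0 < wt u" using wt_less wt_pos un by auto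
    then have "c \<le> m" "0 < c" using c t by linarith+
    then have "wt u + (2 * j + t) = 2 * m" "j < m"
      using c by (simp_all add: j_def)
    then have "u \<in> S j" unfolding S_def using u by (auto simp: low_wt_def zset_def hitset_def)
    then show "u \<in> T" unfolding T_def using \<open>j < m\<close> by blast
  qed
qed

text \<open>The exponents 0 and \<open>n\<close> have balanced digits and both denote 1, which
  therefore occurs exactly for \<open>m \<in> K\<close>.\<close>

lemma Theta_UN_eq:
  "(\<Union>k\<in>K. Theta m \<zeta> k) = (if m \<in> K then insert 1 (zeros (hitset K)) else zeros (hitset K))"
proof -
  have Theta: "x \<in> (\<Union>k\<in>K. Theta m \<zeta> k) \<longleftrightarrow> (\<exists>u\<le>n. x = \<zeta> ^ u \<and> hits K u)" for x
    unfolding Theta_def hits_def odd_even_diff_def n_def[symmetric] by auto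
  have ends: "hits K 0 \<longleftrightarrow> m \<in> K" "hits K n \<longleftrightarrow> m \<in> K"
    by (auto simp: hits_def weights_n weights_0)
  have "(\<exists>u\<le>n. x = \<zeta> ^ u \<and> hits K u) \<longleftrightarrow> x \<in> zeros (hitset K) \<or> (x = 1 \<and> m \<in> K)" for x
  proof
    assume "\<exists>u\<le>n. x = \<zeta> ^ u \<and> hits K u"
    then obtain u where u: "u \<le> n" "x = \<zeta> ^ u" "hits K u" by blast
    consider "u = 0" | "u = n" | "0 < u" "u < n" using u(1) by linarith
    then show "x \<in> zeros (hitset K) \<or> (x = 1 \<and> m \<in> K)"
      using u ends zeta_order by cases (auto simp: zeros_def hitset_def)
  next
    assume "x \<in> zeros (hitset K) \<or> (x = 1 \<and> m \<in> K)"
    then show "\<exists>u\<le>n. x = \<zeta> ^ u \<and> hits K u"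
      using ends(1) by (auto simp: zeros_def hitset_def intro: less_imp_le exI[of _ 0])
  qed
  then show ?thesis using Theta by auto
qed

text \<open>Complementing the digits at even places turns the condition into having exactly
  \<open>s\<close> digits 1.\<close>

lemma card_balance: "card {u. u < 2 ^ (2 * m) \<and> odd_ones m u + (m - even_ones m u) = s} = (2 * m) choose s"
proof -
  define F where "F u = sym_diff {i. i < 2 * m \<and> bit u i} {i. i < 2 * m \<and> even i}" for u :: nat
  have "bij_betw (\<lambda>A. sym_diff A {i. i < 2 * m \<and> even i}) (Pow {..<2 * m}) (Pow {..<2 * m})"
    by (rule bij_betwI[where g = "\<lambda>A. sym_diff A {i. i < 2 * m \<and> even i}"]) auto
  from bij_betw_trans[OF bij_bits this] have F: "bij_betw F {..<2 ^ (2 * m)} (Pow {..<2 * m})"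
    by (simp add: F_def[abs_def] o_def)
  have cardF: "card (F u) = odd_ones m u + (m - even_ones m u)" for u
  proof -
    have cnt: "(\<Sum>i<k. of_bool (P i)) = card {i. i < k \<and> P i}" for P and k :: nat
      by (simp add: of_bool_def sum.If_cases Int_def)
    have "F u = {i. i < 2 * m \<and> (bit u i \<longleftrightarrow> odd i)}" by (auto simp: F_def)
    then have "card (F u) = (\<Sum>i<2 * m. of_bool (bit u i \<longleftrightarrow> odd i))" by (simp add: cnt)
    also have "\<dots> = card {i. i < m \<and> \<not> bit u (2 * i)} + odd_ones m u"
      unfolding sum_odd_even by (simp add: cnt odd_ones_def del: sum_of_bool_eq)
    also have "card {i. i < m \<and> \<not> bit u (2 * i)} = m - even_ones m u"
    proof -
      have "{i. i < m \<and> \<not> bit u (2 * i)} = {..<m} - {i. i < m \<and> bit u (2 * i)}" by auto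
      then show ?thesis by (simp add: card_Diff_subset even_ones_def subset_iff)
    qed
    finally show ?thesis by simp
  qed
  have "bij_betw F {u \<in> {..<2 ^ (2 * m)}. card (F u) = s} {A \<in> Pow {..<2 * m}. card A = s}"
    by (rule bij_betw_Collect_restrict[OF F])
  from bij_betw_same_card[OF this] show ?thesis
    by (simp add: cardF n_subsets)
qed

text \<open>The absolute value leaves the two balances k and 2m - k, with equal binomial
  coefficients; they coincide for \<open>k = m\<close>.\<close>

lemma card_hits_single:
  assumes k: "k \<le> m"
  shows "card {u. u < 2 ^ (2 * m) \<and> odd_even_diff u = int m - int k} =
     (if k = m then (2 * m) choose m else 2 * ((2 * m) choose k))"
proof -
  have E: "even_ones m u \<le> m" for u
    unfolding even_ones_def using card_mono[of "{..<m}" "{i. i < m \<and> bit u (2 * i)}"] by auto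
  have iff: "odd_even_diff u = int m - int k \<longleftrightarrow>
      odd_ones m u + (m - even_ones m u) = k \<or> odd_ones m u + (m - even_ones m u) = 2 * m - k" for u
    using E[of u] k unfolding odd_even_diff_def by linarith
  have "{u. u < 2 ^ (2 * m) \<and> odd_even_diff u = int m - int k} =
      {u. u < 2 ^ (2 * m) \<and> odd_ones m u + (m - even_ones m u) = k} \<union>
      {u. u < 2 ^ (2 * m) \<and> odd_ones m u + (m - even_ones m u) = 2 * m - k}" (is "_ = ?A \<union> ?B")
    unfolding iff by blast
  moreover have "card ?B = card ?A"
    unfolding card_balance using k binomial_symmetric[of k "2 * m"] by simp
  moreover have "?A \<inter> ?B = {}" if "k \<noteq> m" using that k by auto
  moreover have "2 * m - m = m" by simp
  ultimately show ?thesis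
    by (cases "k = m") (simp_all add: card_Un_disjoint card_balance)
qed

text \<open>The count over all digit patterns includes the exponents 0 and \<open>n\<close>, which
  \<open>hitset\<close> leaves out and which hit \<open>K\<close> exactly if
  \<open>m \<in> K\<close>.\<close>

lemma card_hitset:
  assumes K: "K \<subseteq> {..m}"
  shows "card (hitset K) + (if m \<in> K then 2 else 0) =
     (\<Sum>k\<in>K. if k = m then (2 * m) choose m else 2 * ((2 * m) choose k))"
proof -
  have fin: "finite K" using K finite_subset by blast
  define A where "A = {u. u < 2 ^ (2 * m) \<and> hits K u}"
  have "A = (\<Union>k\<in>K. {u. u < 2 ^ (2 * m) \<and> odd_even_diff u = int m - int k})"
    by (auto simp: A_def hits_def)
  then have "card A = (\<Sum>k\<in>K. card {u. u < 2 ^ (2 * m) \<and> odd_even_diff u = int m - int k})"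
    using fin by (simp only:) (rule card_UN_disjoint, auto)
  also have "\<dots> = (\<Sum>k\<in>K. if k = m then (2 * m) choose m else 2 * ((2 * m) choose k))"
    using K by (intro sum.cong[OF refl] card_hits_single) auto
  also have "card A = card (hitset K) + (if m \<in> K then 2 else 0)"
  proof -
    have lt: "u < 2 ^ (2 * m) \<longleftrightarrow> u \<le> n" for u
      using Suc_n by (auto simp: power_mult)
    have ends: "hits K 0 \<longleftrightarrow> m \<in> K" "hits K n \<longleftrightarrow> m \<in> K"
      by (auto simp: hits_def weights_n weights_0)
    have "A = hitset K \<union> (if m \<in> K then {0, n} else {})"
      using ends by (auto simp: A_def hitset_def lt) (metis le_neq_implies_less neq0_conv)+
    moreover have "finite (hitset K)" "0 \<notin> hitset K" "n \<notin> hitset K"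
      by (auto simp: hitset_def)
    ultimately show ?thesis using n_ge_3 by (auto simp: card_insert_if)
  qed
  finally show ?thesis by simp
qed

text \<open>Every even weight hits \<open>M_plus m\<close>, and half of all digit sets have even
  size.\<close>

lemma card_hitset_M_plus: "card (hitset (M_plus m)) + 2 = 2 ^ (2 * m - 1)"
proof -
  have "hits (M_plus m) u \<longleftrightarrow> even (wt u)" for u
  proof
    assume "hits (M_plus m) u"
    then show "even (wt u)" using parity_hits by (auto simp: hits_def M_plus_def)
  next
    assume ev: "even (wt u)"
    define d where "d = nat (odd_even_diff u)"
    have "odd_ones m u \<le> m" "even_ones m u \<le> m"
      unfolding odd_ones_def even_ones_def
      using card_mono[of "{..<m}" "{i. i < m \<and> bit u (2 * i + 1)}"] card_mono[of "{..<m}" "{i. i < m \<and> bit u (2 * i)}"]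
      by auto
    then have d: "odd_even_diff u = int d" "d \<le> m" by (auto simp: d_def odd_even_diff_def)
    then have k: "odd_even_diff u = int m - int (m - d)" by simp
    then have "even d" using parity_hits[OF k] ev d(2) by simp
    then have "m - d \<in> M_plus m" using d by (simp add: M_plus_def)
    then show "hits (M_plus m) u" using k unfolding hits_def by blast
  qed
  then have hs: "hitset (M_plus m) = {u \<in> {0<..<n}. even (wt u)}"
    by (simp add: hitset_def)
  define A where "A = {u \<in> {..<2 ^ (2 * m)}. even (wt u)}"
  have "bij_betw (\<lambda>u. {i. i < 2 * m \<and> bit u i}) A {S \<in> Pow {..<2 * m}. even (card S)}"
    unfolding A_def wt_eq_card by (rule bij_betw_Collect_restrict[OF bij_bits])
  from bij_betw_same_card[OF this] have "2 * card A = 2 ^ (2 * m)"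
    using card_even_subsets[of "{..<2 * m}"] m by (auto simp: lessThan_empty_iff)
  also have "\<dots> = 2 * 2 ^ (2 * m - 1)" using m by (cases m) simp_all
  finally have "card A = 2 ^ (2 * m - 1)" by simp
  moreover have "A = insert 0 (insert n (hitset (M_plus m)))"
  proof -
    have lt: "u < 2 ^ (2 * m) \<longleftrightarrow> u \<le> n" for u
      using Suc_n by (auto simp: power_mult)
    show ?thesis
      unfolding A_def hs by (auto simp: weights_n weights_0 lt)
  qed
  moreover have "0 \<notin> hitset (M_plus m)" "n \<notin> hitset (M_plus m)" "finite (hitset (M_plus m))"
    by (auto simp: hitset_def)
  ultimately show ?thesis using n_ge_3 by simp
qed

text \<open>If there were fewer than \<open>D\<close> odd values, a polynomial without constant term
  and of degree below \<open>D\<close> could vanish at all their positions except \<open>v0\<close>.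
  Its pairing with \<open>y\<close> is a combination of vanishing transforms, yet only
  \<open>v0\<close> contributes.\<close>

lemma bch_bound:
  assumes y: "\<And>u. 0 < u \<Longrightarrow> u < D \<Longrightarrow> ft y u = 0" and v0: "v0 \<noteq> 0" "odd (y v0)"
  shows "D \<le> card {v. v \<noteq> 0 \<and> odd (y v)}"
proof (rule ccontr)
  define R where "R = {v. v \<noteq> 0 \<and> odd (y v)}"
  assume "\<not> D \<le> card {v. v \<noteq> 0 \<and> odd (y v)}"
  then have D: "card R < D" by (simp add: R_def)
  have R: "finite R" "v0 \<in> R" using v0 by (simp_all add: R_def)
  \<comment> \<open>The factor X removes the constant term, since nothing is assumed about the
    transform at 0.\<close>
  define q where "q = [:0, 1:] * (\<Prod>v\<in>R - {v0}. [:- v, 1:])"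
  have "Polynomial.degree (\<Prod>v\<in>R - {v0}. [:- v, 1:]) \<le> (\<Sum>v\<in>R - {v0}. 1)"
    by (rule order.trans[OF degree_prod_sum_le]) (simp_all add: R)
  also have "\<dots> = card R - 1" using R by simp
  finally have "Polynomial.degree q \<le> 1 + (card R - 1)"
    unfolding q_def by (intro order.trans[OF degree_mult_le] add_mono) simp_all
  moreover have "card R > 0" using R by (auto simp: card_gt_0_iff)
  ultimately have deg: "Polynomial.degree q < D" using D by simp
  have q: "poly q v = v * (\<Prod>w\<in>R - {v0}. w + v)" for v
    by (simp add: q_def poly_prod)
  have "(\<Sum>v\<in>UNIV - {0}. of_int (y v) * poly q v) =
      (\<Sum>i\<le>Polynomial.degree q. Polynomial.coeff q i * ft y i)"
    unfolding poly_altdef ft_def sum_distrib_left by (subst sum.swap) (simp add: mult_ac)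
  also have "\<dots> = 0"
  proof (rule sum.neutral, rule ballI)
    fix i assume "i \<in> {..Polynomial.degree q}"
    moreover have "Polynomial.coeff q 0 = 0" by (simp add: q_def)
    ultimately show "Polynomial.coeff q i * ft y i = 0"
      using y[of i] deg by (cases "i = 0") auto
  qed
  finally have "(\<Sum>v\<in>UNIV - {0}. of_int (y v) * poly q v) = 0" .
  moreover have "(\<Sum>v\<in>UNIV - {0}. of_int (y v) * poly q v) = (\<Sum>v\<in>{v0}. of_int (y v) * poly q v)"
  proof (rule sum.mono_neutral_right)
    show "\<forall>v\<in>UNIV - {0} - {v0}. of_int (y v) * poly q v = 0"
    proof
      fix v assume v: "v \<in> UNIV - {0} - {v0}"
      show "of_int (y v) * poly q v = 0"
      proof (cases "v \<in> R")
        case True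
        then have "(\<Prod>w\<in>R - {v0}. w + v) = 0" using v R by (intro prod_zero bexI[of _ v]) auto
        then show ?thesis by (simp add: q)
      next
        case False
        then have "of_int (y v) = (0::'f)" using v by (simp add: of_int_eq_0_iff_even R_def)
        then show ?thesis by simp
      qed
    qed
  qed (use v0 in auto)
  moreover have "of_int (y v0) \<noteq> (0::'f)" using v0 by (simp add: of_int_eq_0_iff_even)
  moreover have "w + v0 \<noteq> 0" if "w \<noteq> v0" for w
    using that by (simp add: add_eq_0_iff2)
  then have "poly q v0 \<noteq> 0" using v0 R by (simp add: q)
  ultimately show False by simp
qed

text \<open>The exponents below \<open>2 ^ L - 1\<close> of weight \<open>L - 1\<close> have a single zero among their \<open>L\<close>
  lowest bits, so that the numbers of odd and of even bits nearly balance.\<close>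

lemma low_exponents_in_zset:
  assumes r: "1 \<le> r" "r \<le> 2 * m" and u: "0 < u" "u < 2 ^ (2 * m - r + 1) - 1"
    and odd_r: "odd r \<Longrightarrow> m - 1 \<notin> K" and even_r: "even r \<Longrightarrow> m \<notin> K \<and> (2 \<le> m \<longrightarrow> m - 2 \<notin> K)"
  shows "u \<in> zset r K"
proof -
  define L where "L = 2 * m - r + 1"
  have L: "L \<le> 2 * m" "1 \<le> L" using r by (auto simp: L_def)
  have uL: "u < 2 ^ L" using u by (simp add: L_def)
  have "(2::nat) ^ L \<le> 2 ^ (2 * m)" using L by (intro power_increasing) auto
  then have un: "u < n" using u Suc_n unfolding L_def[symmetric] by (simp add: power_mult)
  define A where "A = {i. i < 2 * m \<and> bit u i}"
  have high: "\<not> bit u i" if "i \<ge> L" for i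
  proof -
    have "u < 2 ^ i" using uL that by (meson less_le_trans one_le_numeral power_increasing)
    then show ?thesis by (simp add: bit_iff_odd)
  qed
  then have A: "A \<subseteq> {..<L}" by (auto simp: A_def) (meson not_le)
  have A_eq: "A = {i. i < L \<and> bit u i}" using high L by (auto simp: A_def) (meson not_le)+
  have "A \<noteq> {..<L}"
  proof
    assume "A = {..<L}"
    then have "u = (\<Sum>i<L. 2 ^ i)" using sum_bits[OF uL] by (simp add: A_eq[symmetric])
    also have "\<dots> = 2 ^ L - 1" using sum_power2[of L] by (simp add: atLeast0LessThan)
    finally show False using u(2) by (simp add: L_def)
  qed
  then have "A \<subset> {..<L}" using A by blast
  then have cA: "card A < L" using psubset_card_mono[of "{..<L}" A] by simp
  have wt: "wt u = card A" by (simp add: wt_eq_card A_def)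
  have "wt u + r \<le> 2 * m" using cA r by (simp add: wt L_def)
  moreover have "\<not> hits K u" if eq: "wt u + r = 2 * m"
  proof -
    have "card ({..<L} - A) = 1"
      using card_Diff_subset[of A "{..<L}"] A finite_subset[OF A] eq r by (simp add: wt L_def)
    then obtain i0 where i0: "{..<L} - A = {i0}" by (auto simp: card_1_singleton_iff)
    then have bits: "bit u i \<longleftrightarrow> i < L \<and> i \<noteq> i0" for i
    proof -
      have "A = {..<L} - {i0}" using A i0 by blast
      then have "i \<in> A \<longleftrightarrow> i < L \<and> i \<noteq> i0" by simp
      then show ?thesis using high[of i] by (cases "i < L") (simp_all add: A_eq)
    qed
    have i0L: "i0 < L" using i0 by blast
    have odd_set: "{i. i < m \<and> bit u (2 * i + 1)} = {..<L div 2} - {i. 2 * i + 1 = i0}"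
      using L by (auto simp: bits)
    have even_set: "{i. i < m \<and> bit u (2 * i)} = {..<(L + 1) div 2} - {i. 2 * i = i0}"
      using L by (auto simp: bits)
    \<comment> \<open>For even \<open>L\<close> the odd and even positions below \<open>L\<close>
      are equally many, and the single digit 0 makes the difference 1. For odd \<open>L\<close>
      there is one more even position, and the difference is 0 or 2.\<close>
    have vals: "odd_even_diff u \<in> (if even L then {1} else {0, 2})"
    proof (cases "even i0")
      case True
      then obtain k where k: "i0 = 2 * k" by (auto elim: evenE)
      have "{i. 2 * i + 1 = i0} = {}" "{i. 2 * i = i0} = {k}" "k < (L + 1) div 2"
        using k i0L by (auto, presburger)
      then have "odd_ones m u = L div 2" "even_ones m u = (L + 1) div 2 - 1" "0 < (L + 1) div 2"
        unfolding odd_ones_def even_ones_def odd_set even_set by simp_all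
      then show ?thesis unfolding odd_even_diff_def by (cases "even L") (auto elim!: evenE oddE)
    next
      case False
      then obtain k where k: "i0 = 2 * k + 1" by (auto elim: oddE)
      have "{i. 2 * i + 1 = i0} = {k}" "{i. 2 * i = i0} = {}" "k < L div 2"
        using k i0L by (auto, presburger)
      then have "odd_ones m u = L div 2 - 1" "even_ones m u = (L + 1) div 2" "0 < L div 2"
        unfolding odd_ones_def even_ones_def odd_set even_set by simp_all
      then show ?thesis unfolding odd_even_diff_def by (cases "even L") (auto elim!: evenE oddE)
    qed
    show "\<not> hits K u"
    proof
      assume "hits K u"
      then obtain k where k: "k \<in> K" "odd_even_diff u = int m - int k" by (auto simp: hits_def)
      show False
      proof (cases "even L")
        case True
        then have "odd r" using r by (auto simp: L_def)
        moreover have "k = m - 1" using vals k(2) True m by auto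
        ultimately show False using odd_r k(1) by simp
      next
        case False
        then have "even r" using r by (auto simp: L_def)
        moreover have "k = m \<or> (2 \<le> m \<and> k = m - 2)" using vals k(2) False by auto
        ultimately show False using even_r k(1) by auto
      qed
    qed
  qed
  ultimately show ?thesis using u(1) un by (auto simp: zset_def)
qed

text \<open>After division by the exact power 2^j, the condition of level \<open>j\<close> makes the
  parities a codeword with zeros at the exponents 1 up to 2^L - 2. The BCH bound and the even total
  give at least 2^L odd coordinates, and 4^j 2^L is independent of \<open>j\<close>.\<close>

lemma crit_min:
  assumes t: "t = 1 \<or> t = 2" and a: "a \<in> crit (\<lambda>j. zset (2 * j + t) K)" and nz: "a v \<noteq> 0"
    and t1: "t = 1 \<Longrightarrow> m - 1 \<notin> K" and t2: "t = 2 \<Longrightarrow> m \<notin> K \<and> (2 \<le> m \<longrightarrow> m - 2 \<notin> K)"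
  shows "2 ^ (2 * m + 1 - t) \<le> (\<Sum>v\<in>UNIV. (a v)\<^sup>2)"
proof -
  obtain j y w where ay: "a = (\<lambda>v. 2 ^ j * y v)" and w: "odd (y w)" 
    using split_two_power[of a v, OF nz] by blast
  have sq: "(\<Sum>v\<in>UNIV. (a v)\<^sup>2) = 4 ^ j * (\<Sum>v\<in>UNIV. (y v)\<^sup>2)"
  proof -
    have "((2::int) ^ j)\<^sup>2 = 4 ^ j" by (simp add: power2_eq_square flip: power_mult_distrib)
    then show ?thesis by (simp add: ay power_mult_distrib sum_distrib_left)
  qed
  define R where "R = {v \<in> UNIV. odd (y v)}"
  have R: "int (card R) \<le> (\<Sum>v\<in>UNIV. (y v)\<^sup>2)"
    unfolding R_def by (rule bit_range_sum) simp
  have "2 ^ (2 * m + 1 - t) \<le> 4 ^ j * int (card R)"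
  proof (cases "m \<le> j")
    \<comment> \<open>A single odd coordinate is enough here, because
      \<open>t \<ge> 1\<close>.\<close>
    case True
    have "w \<in> R" using w by (simp add: R_def)
    then have "1 \<le> int (card R)" by (metis card_gt_0_iff finite int_one_le_iff_zero_less of_nat_0_less_iff empty_iff)
    moreover have "(2::int) ^ (2 * m + 1 - t) \<le> 2 ^ (2 * j)"
      using True t by (intro power_increasing) auto
    then have "(2::int) ^ (2 * m + 1 - t) \<le> 4 ^ j" by (simp add: power_mult)
    ultimately show ?thesis
      using mult_mono[of "2 ^ (2 * m + 1 - t)" "4 ^ j" 1 "int (card R)"] by simp
  next
    case False
    then have j: "j < m" by simp
    define r where "r = 2 * j + t"
    have r: "1 \<le> r" "r \<le> 2 * m" using j t by (auto simp: r_def)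
    define L where "L = 2 * m - r + 1"
    have "2 ^ m dvd 2 ^ j * (\<Sum>v\<in>UNIV. y v)"
      using a unfolding crit_def ay by (simp add: sum_distrib_left)
    moreover have "(2::int) ^ Suc j dvd 2 ^ m" using j by (intro le_imp_power_dvd) simp
    ultimately have "2 ^ Suc j dvd 2 ^ j * (\<Sum>v\<in>UNIV. y v)" by (rule dvd_trans[rotated])
    then have sum_even: "even (\<Sum>v\<in>UNIV. y v)" by simp
    then have card_even: "even (card R)" unfolding R_def by (subst even_card_odd) simp_all
    have ft0: "ft y u = 0" if u: "u \<in> zset r K" for u
    proof -
      have "2 ^ Suc j dvd act (idem (zset r K)) a v" for v
        using a j by (simp add: crit_def r_def)
      then have "even (act (idem (zset r K)) y v)" for v
        unfolding ay act_smult_right by simp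
      then have "ft (act (idem (zset r K)) y) u = 0"
        by (simp add: ft_def flip: of_int_eq_0_iff_even)
      moreover have "u < n" using u by (simp add: zset_def)
      ultimately show ?thesis using u by (simp add: ft_act_idem closed_zset)
    qed
    have "\<exists>v0. v0 \<noteq> 0 \<and> odd (y v0)"
    proof (rule ccontr)
      assume "\<not> ?thesis"
      then have "R \<subseteq> {0}" by (auto simp: R_def)
      moreover have "w \<in> R" using w by (simp add: R_def)
      ultimately have "R = {0}" by blast
      then show False using card_even by simp
    qed
    then obtain v0 where v0: "v0 \<noteq> 0" "odd (y v0)" by blast
    have "2 ^ L - 1 \<le> card {v. v \<noteq> 0 \<and> odd (y v)}"
    proof (rule bch_bound[of _ y v0, OF _ v0])
      fix u :: nat assume "0 < u" "u < 2 ^ L - 1"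
      then have "u \<in> zset r K"
        using r t t1 t2 by (intro low_exponents_in_zset) (auto simp: L_def r_def)
      then show "ft y u = 0" by (rule ft0)
    qed
    also have "\<dots> \<le> card R" by (intro card_mono) (auto simp: R_def)
    finally have "2 ^ L - 1 \<le> card R" .
    \<comment> \<open>The gain from extension: the number of odd coordinates is even, so it exceeds
      the odd BCH bound.\<close>
    moreover have "even (2 ^ L :: nat)" by (simp add: L_def)
    then have "card R \<noteq> 2 ^ L - 1" using card_even by auto
    ultimately have "2 ^ L \<le> card R" by linarith
    then have "4 ^ j * 2 ^ L \<le> 4 ^ j * int (card R)"
      by (intro mult_left_mono) (metis of_nat_le_iff of_nat_numeral of_nat_power, simp)
    moreover have "4 ^ j * 2 ^ L = (2 :: int) ^ (2 * m + 1 - t)"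
    proof -
      have e: "2 * j + L = 2 * m + 1 - t" using r by (simp add: L_def r_def)
      show ?thesis unfolding e[symmetric] by (simp add: power_mult power_add)
    qed
    ultimately show ?thesis by simp
  qed
  also have "\<dots> \<le> 4 ^ j * (\<Sum>v\<in>UNIV. (y v)\<^sup>2)" using R by (intro mult_left_mono) auto
  finally show ?thesis by (simp add: sq)
qed

lemma crit_zset_mono:
  assumes "\<And>j. j < m \<Longrightarrow> closed (N j)" "\<And>j. j < m \<Longrightarrow> closed (N' j)" "\<And>j. j < m \<Longrightarrow> N j \<subseteq> N' j"
  shows "crit N' \<subseteq> crit N"
proof
  fix a assume "a \<in> crit N'"
  then have "2 ^ m dvd (\<Sum>v\<in>UNIV. a v)" "cond N' a" by (simp_all add: crit_def cond_def)
  with cond_mono[OF assms this(2)] show "a \<in> crit N" by (simp add: crit_def cond_def)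
qed

text \<open>Level 0 concerns all nontrivial exponents, so with the parity at 0 it makes all values
  even. After halving, level j + 1 becomes level j of \<open>Lam 0\<close>, whose last level has no
  exponents.\<close>

lemma even_crit_eq_double:
  "{a. even (a 0) \<and> even (\<Sum>v\<in>UNIV - {0}. a v) \<and> 2 ^ Suc m dvd (\<Sum>v\<in>UNIV. a v) \<and> cond (\<lambda>j. low_wt (2 * j)) a}
     = (\<lambda>a v. 2 * a v) ` Lam 0"
proof (intro equalityI subsetI)
  fix a assume a: "a \<in> {a. even (a 0) \<and> even (\<Sum>v\<in>UNIV - {0}. a v) \<and> 2 ^ Suc m dvd (\<Sum>v\<in>UNIV. a v) \<and>
     cond (\<lambda>j. low_wt (2 * j)) a}"
  have c: "2 ^ Suc j dvd act (idem (low_wt (2 * j))) a v" if "j < m" for j v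
    using a that unfolding cond_def by blast
  have sum: "2 ^ Suc m dvd (\<Sum>v\<in>UNIV. a v)" using a by blast
  have "low_wt 0 = {0<..<n}" using wt_le by (auto simp: low_wt_def)
  then have e1: "even (act (idem {0<..<n}) a v)" for v using c[of 0 v] m by simp
  have "even (a v)" for v
  proof -
    have "2 ^ m dvd (\<Sum>v\<in>UNIV. a v)" using sum by (rule dvd_trans[rotated]) simp
    from function_mod[OF this, of v] have "even (a v - (a 0 + act (idem {0<..<n}) a v))"
      by (rule dvd_trans[rotated]) (use m in simp)
    then show ?thesis using e1[of v] a by simp
  qed
  then have "\<exists>y. a v = 2 * y" for v by (auto elim: evenE)
  then obtain y where y: "\<And>v. a v = 2 * y v" by metis
  then have ay: "a = (\<lambda>v. 2 * y v)" by blast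
  have "y \<in> crit (\<lambda>j. low_wt (2 * j + 2 - 0))"
    unfolding crit_def mem_Collect_eq
  proof (intro conjI allI impI)
    show "2 ^ m dvd (\<Sum>v\<in>UNIV. y v)"
      using sum unfolding ay by (simp flip: sum_distrib_left)
    fix j v assume j: "j < m"
    show "2 ^ Suc j dvd act (idem (low_wt (2 * j + 2 - 0))) y v"
    proof (cases "Suc j < m")
      case True
      then have "2 * 2 ^ Suc j dvd 2 * act (idem (low_wt (2 * j + 2 - 0))) y v"
        using c[OF True, of v] by (simp add: ay act_smult_right)
      then show ?thesis unfolding dvd_mult_cancel_left by simp
    next
      case False
      then have "2 * j + 2 = 2 * m" using j by simp
      moreover have "u \<notin> low_wt (2 * m)" for u
        using wt_pos[of u] unfolding low_wt_def by (cases "u = 0") simp_all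
      ultimately have "low_wt (2 * j + 2 - 0) = {}" by auto
      then show ?thesis by (simp add: idem_empty)
    qed
  qed
  then have "y \<in> Lam 0" by (simp add: Lam_eq_crit)
  then show "a \<in> (\<lambda>a v. 2 * a v) ` Lam 0" using ay by blast
next
  fix a assume "a \<in> (\<lambda>a v. 2 * a v) ` Lam 0"
  then obtain y where y: "y \<in> Lam 0" "a = (\<lambda>v. 2 * y v)" by blast
  then have yc: "y \<in> crit (\<lambda>j. low_wt (2 * j + 2))" by (simp add: Lam_eq_crit)
  have "2 ^ Suc j dvd act (idem (low_wt (2 * j))) a v" if "j < m" for j v
  proof (cases j)
    case (Suc i)
    then have "2 ^ Suc i dvd act (idem (low_wt (2 * i + 2))) y v" using yc that by (simp add: crit_def)
    then have "2 * 2 ^ Suc i dvd 2 * act (idem (low_wt (2 * i + 2))) y v" by (rule mult_dvd_mono[OF dvd_refl])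
    then show ?thesis unfolding y(2) act_smult_right using Suc by simp
  qed (simp add: y(2) act_smult_right)
  moreover have "2 ^ m dvd (\<Sum>v\<in>UNIV. y v)" using yc by (simp add: crit_def)
  ultimately show "a \<in> {a. even (a 0) \<and> even (\<Sum>v\<in>UNIV - {0}. a v) \<and> 2 ^ Suc m dvd (\<Sum>v\<in>UNIV. a v) \<and>
     cond (\<lambda>j. low_wt (2 * j)) a}"
    by (simp add: y(2) cond_def flip: sum_distrib_left)
qed

end

section \<open>The lattices of the lifted codes\<close>

lemma lattice_min_eqI:
  fixes L :: "'a::real_inner set" and x :: 'a
  assumes "x \<in> L" "x \<noteq> 0" "x \<bullet> x = t" "\<And>y :: 'a. y \<in> L \<Longrightarrow> y \<noteq> 0 \<Longrightarrow> t \<le> y \<bullet> y"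
  shows "lattice_min L = t"
  unfolding lattice_min_def by (rule Least_equality) (use assms in auto)

lemma log_lattice_det:
  assumes "has_lattice_det L ((1 / 2 ^ m) ^ 4 ^ m * 4 ^ s / 4 ^ k)"
  shows "log 2 (lattice_det L) = 2 * real s - real (m * 4 ^ m) - 2 * real k"
proof -
  have four: "(4::real) ^ i = 2 ^ (2 * i)" for i by (simp add: power_mult)
  have "(1 / 2 ^ m :: real) ^ 4 ^ m = 1 / 2 ^ (m * 4 ^ m)" by (simp add: power_divide power_mult)
  then show ?thesis
    unfolding lattice_det_eq[OF assms] four by (simp add: log_mult log_divide log_nat_power)
qed

context embedded
begin

lemma code_lattice_lifted:
  assumes card_r: "CARD('r::nontriv) = 2 ^ m" and t: "t \<le> 2" "t = 0 \<Longrightarrow> m \<in> K" "t = 2 \<Longrightarrow> m \<notin> K"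
    and C: "\<And>j. j < m \<Longrightarrow> C j = bw_code m \<zeta> (2 * j + t) K"
  shows "code_lattice b (lifted_code m \<zeta> C :: ('f \<Rightarrow> 'r mod_ring) set) = emb ` crit (\<lambda>j. zset (2 * j + t) K)"
proof -
  have "(\<lambda>v. of_int (a v)) \<in> (lifted_code m \<zeta> C :: ('f \<Rightarrow> 'r mod_ring) set) \<longleftrightarrow>
      a \<in> crit (\<lambda>j. zset (2 * j + t) K)" for a
  proof (rule lifted_code_iff_crit[OF card_r])
    fix i j :: nat assume "i \<le> j"
    then show "zset (2 * j + t) K \<subseteq> zset (2 * i + t) K" by (cases "i = j") (auto simp: zset_def)
  next
    fix j assume j: "j < m"
    show "C j = extended_code (cyclic_code m \<zeta> (zeros (zset (2 * j + t) K)))"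
      unfolding C[OF j] by (rule bw_code_eq) (use j t in auto)
  next
    show "closed (zset (2 * j + t) K)" for j by (rule closed_zset)
    show "0 \<notin> zset (2 * j + t) K" for j by (simp add: zset_def)
  qed
  then show ?thesis unfolding code_lattice_def emb_def by auto
qed

text \<open>Serves all three cases. The sublattice is the Barnes--Wall lattice for t = 1, its dual
  for t = 2, which is applied in doubled coordinates, and twice the dual, as
  \<open>even_crit\<close>, for t = 0.\<close>

lemma quotient_zset:
  assumes t: "t \<le> 2" and K: "\<And>k. k \<in> K \<Longrightarrow> k \<le> m \<and> (even (m - k) \<longleftrightarrow> even t)"
  defines "\<Gamma> \<equiv> emb ` crit (\<lambda>j. zset (2 * j + t) K)"
    and "\<Delta> \<equiv> emb ` crit (\<lambda>j. low_wt (2 * j + t))"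
    and "\<Delta>' \<equiv> emb ` even_crit (\<lambda>j. low_wt (2 * j + t))"
  shows "quotient_eigenvalues \<sigma> \<Gamma> \<Delta> = to_ac ` zeros (hitset K)"
    and "eigenvalue_multiplicity \<sigma> \<Gamma> \<Delta> 1 = 0"
    and "has_lattice_det \<Delta> d \<Longrightarrow> has_lattice_det \<Gamma> (d / 4 ^ card (hitset K))"
    and "quotient_eigenvalues \<sigma> \<Gamma> \<Delta>' = insert 1 (to_ac ` zeros (hitset K))"
    and "eigenvalue_multiplicity \<sigma> \<Gamma> \<Delta>' 1 = 2"
    and "has_lattice_det \<Delta>' d \<Longrightarrow> has_lattice_det \<Gamma> (d / 4 ^ (card (hitset K) + 2))"
    and "\<Delta>' \<subseteq> \<Gamma>"
proof -
  interpret C: embedded_chain m B \<zeta> b \<nu> \<sigma> "\<lambda>j. zset (2 * j + t) K" "\<lambda>j. low_wt (2 * j + t)"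
    by (intro embedded_chain.intro embedded_axioms bw_chain_zset t)
  have T: "C.T = hitset K" by (rule chain_T[OF t K])
  note q = C.quotient_crit[folded \<Gamma>_def \<Delta>_def, unfolded T]
  note q' = C.quotient_even_crit[folded \<Gamma>_def \<Delta>'_def, unfolded T]
  show "quotient_eigenvalues \<sigma> \<Gamma> \<Delta> = to_ac ` zeros (hitset K)" by (rule q(3))
  show "eigenvalue_multiplicity \<sigma> \<Gamma> \<Delta> 1 = 0" by (rule q(4))
  show "quotient_eigenvalues \<sigma> \<Gamma> \<Delta>' = insert 1 (to_ac ` zeros (hitset K))" by (rule q'(3))
  show "eigenvalue_multiplicity \<sigma> \<Gamma> \<Delta>' 1 = 2" by (rule q'(4))
  from q(2) obtain xs where xs: "quotient_basis \<Gamma> \<Delta> xs" "length xs = card (hitset K)"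
    by (elim exE conjE)
  show "has_lattice_det \<Gamma> (d / 4 ^ card (hitset K))" if "has_lattice_det \<Delta> d"
    using has_lattice_det_elementary_quotient[OF q(1) xs(1) that] unfolding xs(2) .
  from q'(2) obtain ys where ys: "quotient_basis \<Gamma> \<Delta>' ys" "length ys = card (hitset K) + 2"
    by (elim exE conjE)
  show "has_lattice_det \<Gamma> (d / 4 ^ (card (hitset K) + 2))" if "has_lattice_det \<Delta>' d"
    using has_lattice_det_elementary_quotient[OF q'(1) ys(1) that] unfolding ys(2) .
  show "\<Delta>' \<subseteq> \<Gamma>" using ys(1) unfolding quotient_basis_def by (rule conjunct1)
qed

text \<open>\<open>zset r K\<close> differs from \<open>low_wt r\<close> in the top weight only, so
  it contains \<open>low_wt (r + 1)\<close>.\<close>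

lemma Lam_subset_crit:
  "Lam 1 \<subseteq> crit (\<lambda>j. zset (2 * j + 1) K)" "Lam 0 \<subseteq> crit (\<lambda>j. zset (2 * j + 2) K)"
  and crit_subset_Lam: "crit (\<lambda>j. zset (2 * j + 1) K) \<subseteq> Lam 0" "crit (\<lambda>j. zset (2 * j) K) \<subseteq> Lam 1"
proof -
  have Lam: "Lam 1 = crit (\<lambda>j. low_wt (2 * j + 1))" "Lam 0 = crit (\<lambda>j. low_wt (2 * j + 2))"
    by (simp_all add: Lam_eq_crit)
  have "zset r K \<subseteq> low_wt r" "low_wt (r + 1) \<subseteq> zset r K" for r
    by (auto simp: zset_def low_wt_def)
  note sub = this this(2)[of "2 * j + 1" for j, simplified]
  show "Lam 1 \<subseteq> crit (\<lambda>j. zset (2 * j + 1) K)" "Lam 0 \<subseteq> crit (\<lambda>j. zset (2 * j + 2) K)"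
    unfolding Lam by (rule crit_zset_mono[OF closed_zset closed_low_wt], rule sub)+
  show "crit (\<lambda>j. zset (2 * j + 1) K) \<subseteq> Lam 0" "crit (\<lambda>j. zset (2 * j) K) \<subseteq> Lam 1"
    unfolding Lam by (rule crit_zset_mono[OF closed_low_wt closed_zset], use sub in simp)+
qed

text \<open>Doubling moves the conditions up by one level, where \<open>low_wt (2 * i + 3)\<close>
  is the set of \<open>Lam 1\<close> at level i + 1; level 0 asks for evenness only.\<close>

lemma double_crit_in_Lam:
  assumes "a \<in> crit (\<lambda>j. zset (2 * j + 2) K)"
  shows "(\<lambda>v. 2 * a v) \<in> Lam 1"
proof -
  have "crit (\<lambda>j. zset (2 * j + 2) K) \<subseteq> crit (\<lambda>j. low_wt (2 * j + 3))"
    by (rule crit_zset_mono[OF closed_low_wt closed_zset]) (auto simp: zset_def low_wt_def)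
  then have a: "a \<in> crit (\<lambda>j. low_wt (2 * j + 3))" using assms by blast
  have "2 ^ Suc j dvd act (idem (low_wt (2 * j + 1))) (\<lambda>v. 2 * a v) v" if "j < m" for j v
  proof (cases j)
    case (Suc i)
    then have "2 ^ Suc i dvd act (idem (low_wt (2 * i + 3))) a v" using a that by (simp add: crit_def)
    then have "2 * 2 ^ Suc i dvd 2 * act (idem (low_wt (2 * i + 3))) a v" by (rule mult_dvd_mono[OF dvd_refl])
    then show ?thesis unfolding act_smult_right using Suc by (simp add: numeral_3_eq_3)
  qed (simp add: act_smult_right)
  moreover have "2 ^ m dvd (\<Sum>v\<in>UNIV. 2 * a v)"
    using a by (simp add: crit_def flip: sum_distrib_left)
  ultimately show ?thesis by (simp add: Lam_eq_crit crit_def)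
qed

lemma const_in_Lam: "(\<lambda>v. 1) \<in> Lam 1"
  using Lam_deg_le[OF const_in_deg_le[of 1 0], of 1] by simp

lemma even_crit_low_wt: "even_crit (\<lambda>j. low_wt (2 * j)) = (\<lambda>a v. 2 * a v) ` Lam 0"
  unfolding even_crit_def by (rule even_crit_eq_double)

lemma emb_double: "emb ` (\<lambda>a v. 2 * a v) ` A = (*\<^sub>R) 2 ` emb ` A"
  unfolding image_image using emb_smult[of 2] by simp

lemma double_Lam_eq_mob_dvd: "(\<lambda>a v. 2 * a v) ` Lam 0 = mob_dvd (\<lambda>S. card S div 2 + 1)"
proof (intro equalityI subsetI)
  fix a assume "a \<in> mob_dvd (\<lambda>S. card S div 2 + 1)"
  then have a: "2 * 2 ^ (card S div 2) dvd mob a S" if "S \<subseteq> idx" for S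
    using that by (simp add: mob_dvd_def)
  have "even (a v)" for v
    unfolding function_eq_sum_mon[of a v]
    by (intro dvd_sum dvd_mult2 dvd_mult_left[OF a]) simp
  then obtain y where y: "\<And>v. a v = 2 * y v" by (atomize_elim, intro choice allI) (auto elim: evenE)
  then have ay: "a = (\<lambda>v. 2 * y v)" by blast
  have "y \<in> Lam 0"
    unfolding Lam_def mem_Collect_eq
  proof (intro allI impI)
    fix S assume "S \<subseteq> idx"
    from a[OF this] show "2 ^ ((card S + 0) div 2) dvd mob y S"
      unfolding ay mob_smult dvd_mult_cancel_left by simp
  qed
  then show "a \<in> (\<lambda>a v. 2 * a v) ` Lam 0" using ay by blast
qed (auto simp: mob_dvd_def Lam_def mob_smult)

end

locale barnes_wall_setting = embedded m B \<zeta> b "1 / 2 ^ m" \<sigma>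
  for m :: nat and B :: "nat \<Rightarrow> 'f::{field,finite}" and \<zeta> :: 'f
    and b :: "'f \<Rightarrow> 'f euclid" and \<sigma> :: "'f euclid \<Rightarrow> 'f euclid"
begin

section \<open>Determinants, eigenvalues and minima in the three cases\<close>

abbreviation "BW \<equiv> barnes_wall m B b"
abbreviation "BW2 \<equiv> (*\<^sub>R) 2 ` dual_lattice BW"

lemma BW_eq: "BW = emb ` Lam 1" and dual_BW: "dual_lattice BW = emb ` Lam 0"
  and BW2_eq: "BW2 = emb ` (\<lambda>a v. 2 * a v) ` Lam 0"
  unfolding barnes_wall_eq dual_lattice_Lam[OF refl] emb_double by (rule refl)+

lemma det_BW: "has_lattice_det BW ((1 / 2 ^ m) ^ 4 ^ m * 4 ^ (\<Sum>S\<in>Pow idx. (card S + 1) div 2))"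
  unfolding BW_eq Lam_eq_mob_dvd
  by (rule has_lattice_det_mob_dvd[where M = "2 * m + 1"])
    (use card_mono[OF finite_idx] in \<open>fastforce intro: le_trans[OF div_le_dividend]\<close>)

lemma det_BW2: "has_lattice_det BW2 ((1 / 2 ^ m) ^ 4 ^ m * 4 ^ (\<Sum>S\<in>Pow idx. card S div 2 + 1))"
  unfolding BW2_eq double_Lam_eq_mob_dvd
  by (rule has_lattice_det_mob_dvd[where M = "2 * m + 1"])
    (use card_mono[OF finite_idx] in \<open>fastforce intro: le_trans[OF div_le_dividend]\<close>)

lemma emb_eq_0_iff: "emb a = 0 \<longleftrightarrow> (\<forall>v. a v = 0)"
  using emb_eq_iff[of a "\<lambda>v. 0"] by (simp add: fun_eq_iff)

lemma norm_emb: "emb a \<bullet> emb a = of_int (\<Sum>v\<in>UNIV. (a v)\<^sup>2) / 2 ^ m"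
  by (simp add: inner_emb power2_eq_square)

lemma zeros_Theta: "m \<notin> K \<Longrightarrow> to_ac ` zeros (hitset K) = to_ac ` (\<Union>k\<in>K. Theta m \<zeta> k)"
  "m \<in> K \<Longrightarrow> insert 1 (to_ac ` zeros (hitset K)) = to_ac ` (\<Union>k\<in>K. Theta m \<zeta> k)"
  by (simp_all add: Theta_UN_eq)

lemma two_power_half: "(2::real) ^ (2 * m - 1) * 2 = 2 ^ m * 2 ^ m"
proof -
  have "Suc (2 * m - 1) = m + m" using m by simp
  then show ?thesis unfolding power_add[symmetric] power_Suc2[symmetric] by (rule arg_cong)
qed

lemma lattice_minus:
  assumes card_r: "CARD('r::nontriv) = 2 ^ m" and I: "I \<subseteq> M_minus m"
  defines "L \<equiv> code_lattice b (lifted_code m \<zeta> (chain_minus m \<zeta> I) :: ('f \<Rightarrow> 'r mod_ring) set)"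
  shows "L \<in> L_minus \<sigma> BW"
    and "quotient_eigenvalues \<sigma> L BW = to_ac ` (\<Union>k\<in>I. Theta m \<zeta> k)"
    and "log 2 (lattice_det L) = 2 ^ (2 * m - 1) - 4 * (\<Sum>k\<in>I. real ((2 * m) choose k))"
    and "m - 1 \<notin> I \<Longrightarrow> lattice_min L = lattice_min BW"
    and "m - 1 \<notin> I \<Longrightarrow> lattice_min BW = 2 ^ m"
proof -
  have mI: "m \<notin> I" and K: "\<And>k. k \<in> I \<Longrightarrow> k \<le> m \<and> (even (m - k) \<longleftrightarrow> even (1::nat))"
    using I by (auto simp: M_minus_def)
  have L: "L = emb ` crit (\<lambda>j. zset (2 * j + 1) I)"
    unfolding L_def by (rule code_lattice_lifted[OF card_r]) (simp_all add: chain_minus_def)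
  have BW: "BW = emb ` crit (\<lambda>j. low_wt (2 * j + 1))"
    unfolding BW_eq by (simp add: Lam_eq_crit)
  note q = quotient_zset[of 1 I, OF _ K, folded L BW]
  have sub: "BW \<subseteq> L" "L \<subseteq> dual_lattice BW"
    unfolding L BW_eq[symmetric] dual_BW unfolding BW_eq
    by (intro image_mono Lam_subset_crit crit_subset_Lam)+
  show "L \<in> L_minus \<sigma> BW"
    unfolding L_minus_def using sub subspace_crit sigma_crit unfolding L by blast
  show "quotient_eigenvalues \<sigma> L BW = to_ac ` (\<Union>k\<in>I. Theta m \<zeta> k)"
    using q(1) zeros_Theta(1)[OF mI] by simp
  have cH: "card (hitset I) = (\<Sum>k\<in>I. 2 * ((2 * m) choose k))"
  proof -
    have "(\<Sum>k\<in>I. if k = m then (2 * m) choose m else 2 * ((2 * m) choose k)) = (\<Sum>k\<in>I. 2 * ((2 * m) choose k))"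
      by (rule sum.cong) (use mI in auto)
    then show ?thesis using card_hitset[of I] K mI by auto
  qed
  have "log 2 (lattice_det L) = 2 * real (\<Sum>S\<in>Pow idx. (card S + 1) div 2) - real (m * 4 ^ m) - 2 * real (card (hitset I))"
    by (rule log_lattice_det) (use q(3)[OF _ _ det_BW] in simp)
  also have "2 * real (\<Sum>S\<in>Pow idx. (card S + 1) div 2) = real (m * 4 ^ m) + 2 ^ (2 * m - 1)"
    using arg_cong[OF sum_exponents(1), of real] by simp
  finally show "log 2 (lattice_det L) = 2 ^ (2 * m - 1) - 4 * (\<Sum>k\<in>I. real ((2 * m) choose k))"
    by (simp add: cH sum_distrib_left mult.assoc)
  assume m1: "m - 1 \<notin> I"
  \<comment> \<open>The constant function 1 attains the minimum, with norm
    \<open>4 ^ m / 2 ^ m\<close>.\<close>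
  have one: "emb (\<lambda>v. 1) \<in> BW" "emb (\<lambda>v. 1) \<noteq> 0" "emb (\<lambda>v. 1) \<bullet> emb (\<lambda>v. 1) = 2 ^ m"
  proof -
    have "(4::real) ^ m = 2 ^ m * 2 ^ m" by (simp flip: power_mult_distrib)
    then show "emb (\<lambda>v. 1) \<bullet> emb (\<lambda>v. 1) = 2 ^ m" by (simp add: norm_emb card_f)
    show "emb (\<lambda>v. 1) \<in> BW" unfolding BW_eq by (rule imageI[OF const_in_Lam])
  qed (simp add: emb_eq_0_iff)
  have bound: "2 ^ m \<le> y \<bullet> y" if y: "y \<in> L" "y \<noteq> 0" for y :: "'f euclid"
  proof -
    obtain a where a: "a \<in> crit (\<lambda>j. zset (2 * j + 1) I)" "y = emb a" using y(1) unfolding L by blast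
    then obtain v where "a v \<noteq> 0" using y(2) by (auto simp: emb_eq_0_iff)
    from crit_min[of 1 a I v, OF _ a(1) this m1]
    have "2 ^ (2 * m) \<le> (\<Sum>v\<in>UNIV. (a v)\<^sup>2)" by simp
    then have "real_of_int (2 ^ (2 * m)) \<le> of_int (\<Sum>v\<in>UNIV. (a v)\<^sup>2)"
      unfolding of_int_le_iff .
    then have "(2::real) ^ (2 * m) \<le> of_int (\<Sum>v\<in>UNIV. (a v)\<^sup>2)" by simp
    then have "(2::real) ^ (2 * m) / 2 ^ m \<le> y \<bullet> y" unfolding a(2) norm_emb by (rule divide_right_mono) simp
    moreover have "(2::real) ^ (2 * m) / 2 ^ m = 2 ^ m" by (simp add: mult_2 power_add)
    ultimately show ?thesis by simp
  qed
  have "lattice_min L = 2 ^ m"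
    by (rule lattice_min_eqI[OF _ one(2,3) bound]) (use one(1) sub(1) in auto)
  moreover show BWm: "lattice_min BW = 2 ^ m"
    by (rule lattice_min_eqI[OF one bound]) (use sub(1) in auto)
  ultimately show "lattice_min L = lattice_min BW" by simp
qed

text \<open>The dual lattice contributes -2^(2m-1), and doubling in dimension 4^m adds 2 * 4^m,
  which is four times 2^(2m-1).\<close>

lemma log_det_BW2_index:
  assumes "has_lattice_det L ((1 / 2 ^ m) ^ 4 ^ m * 4 ^ (\<Sum>S\<in>Pow idx. card S div 2 + 1) / 4 ^ k)"
  shows "log 2 (lattice_det L) = 3 * 2 ^ (2 * m - 1) - 2 * real k"
proof -
  have "(\<Sum>S\<in>Pow idx. card S div 2 + 1) = (\<Sum>S\<in>Pow idx. card S div 2) + 4 ^ m"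
    unfolding sum.distrib by (simp add: card_Pow power_mult)
  moreover have "real (4 ^ m) = 2 * 2 ^ (2 * m - 1)"
    using m by (cases m) (simp_all add: power_mult)
  moreover have "2 * real (\<Sum>S\<in>Pow idx. card S div 2) + 2 ^ (2 * m - 1) = real (m * 4 ^ m)"
    using arg_cong[OF sum_exponents(2), of real] by simp
  ultimately show ?thesis
    using log_lattice_det[OF assms] by simp
qed

text \<open>The determinant formulas sum over the complement of \<open>J\<close>. All of
  \<open>M_plus m\<close> accounts for the 2^(2m-1) digit patterns of even weight; the index
  \<open>m\<close> is set apart because its patterns are counted once, not twice.\<close>

lemma card_hitset_compl:
  assumes J: "J \<subseteq> M_plus m"
  shows "real (card (hitset J) + (if m \<in> J then 2 else 0)) =
    2 ^ (2 * m - 1) - (2 * (\<Sum>k\<in>M_plus m - J - {m}. real ((2 * m) choose k)) +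
      (if m \<in> J then 0 else real ((2 * m) choose m)))"
proof -
  define g where "g k = real (if k = m then (2 * m) choose m else 2 * ((2 * m) choose k))" for k
  have fin: "finite (M_plus m)" by (rule finite_subset[of _ "{..m}"]) (auto simp: M_plus_def)
  have M: "M_plus m \<subseteq> {..m}" "m \<in> M_plus m" by (auto simp: M_plus_def)
  have "real (card (hitset K) + (if m \<in> K then 2 else 0)) = (\<Sum>k\<in>K. g k)" if "K \<subseteq> {..m}" for K
    unfolding card_hitset[OF that] g_def by simp
  note g = this[of J] this[of "M_plus m"]
  have "(\<Sum>k\<in>M_plus m. g k) = (\<Sum>k\<in>M_plus m - J. g k) + (\<Sum>k\<in>J. g k)"
    using sum.subset_diff[OF J fin, of g] by simp
  moreover have "(\<Sum>k\<in>M_plus m. g k) = 2 ^ (2 * m - 1)"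
    using g(2)[OF M(1)] M(2) arg_cong[OF card_hitset_M_plus, of real] by simp
  moreover have "(\<Sum>k\<in>M_plus m - J. g k) = 2 * (\<Sum>k\<in>M_plus m - J - {m}. real ((2 * m) choose k)) +
      (if m \<in> J then 0 else real ((2 * m) choose m))"
  proof -
    have "(\<Sum>k\<in>M_plus m - J - {m}. g k) = 2 * (\<Sum>k\<in>M_plus m - J - {m}. real ((2 * m) choose k))"
      unfolding sum_distrib_left by (rule sum.cong) (auto simp: g_def)
    moreover have "(\<Sum>k\<in>M_plus m - J. g k) = (\<Sum>k\<in>M_plus m - J - {m}. g k) + (if m \<in> J then 0 else g m)"
      using M(2) fin by (simp add: sum.remove[of "M_plus m - J" m])
    ultimately show ?thesis by (simp add: g_def)
  qed
  ultimately show ?thesis using g(1) J M(1) by (simp add: subset_trans[OF J M(1)])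
qed

lemma lattice_plus:
  assumes card_r: "CARD('r::nontriv) = 2 ^ m" and J: "J \<subseteq> M_plus m" and mJ: "m \<in> J"
  defines "L \<equiv> code_lattice b (lifted_code m \<zeta> (chain_plus m \<zeta> J) :: ('f \<Rightarrow> 'r mod_ring) set)"
  shows "L \<in> L_plus \<sigma> BW"
    and "quotient_eigenvalues \<sigma> L BW2 = to_ac ` (\<Union>k\<in>J. Theta m \<zeta> k)"
    and "log 2 (lattice_det L) = 2 ^ (2 * m - 1) + 4 * (\<Sum>k\<in>M_plus m - J. real ((2 * m) choose k))"
proof -
  have K: "\<And>k. k \<in> J \<Longrightarrow> k \<le> m \<and> (even (m - k) \<longleftrightarrow> even (0::nat))"
    using J by (auto simp: M_plus_def)
  have L: "L = emb ` crit (\<lambda>j. zset (2 * j + 0) J)"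
    unfolding L_def by (rule code_lattice_lifted[OF card_r]) (use mJ in \<open>simp_all add: chain_plus_def\<close>)
  have B2: "BW2 = emb ` even_crit (\<lambda>j. low_wt (2 * j + 0))"
    unfolding BW2_eq by (simp add: even_crit_low_wt)
  note q = quotient_zset[of 0 J, OF _ K, folded L B2]
  have "BW2 \<subseteq> L" using q(7) by simp
  moreover have "L \<subseteq> BW"
    unfolding L BW_eq using crit_subset_Lam(2)[of J] by (intro image_mono) simp
  ultimately show "L \<in> L_plus \<sigma> BW"
    unfolding L_plus_def using q(5) subspace_crit sigma_crit unfolding L by simp
  show "quotient_eigenvalues \<sigma> L BW2 = to_ac ` (\<Union>k\<in>J. Theta m \<zeta> k)"
    using q(4) zeros_Theta(2)[OF mJ] by simp
  have "log 2 (lattice_det L) = 3 * 2 ^ (2 * m - 1) - 2 * real (card (hitset J) + 2)"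
    by (rule log_det_BW2_index) (use q(6)[OF _ _ det_BW2] in simp)
  moreover have "M_plus m - J - {m} = M_plus m - J" using mJ by blast
  ultimately show "log 2 (lattice_det L) = 2 ^ (2 * m - 1) + 4 * (\<Sum>k\<in>M_plus m - J. real ((2 * m) choose k))"
    using card_hitset_compl[OF J] mJ by simp
qed

text \<open>In the basis \<open>2 *\<^sub>R b\<close> the doubled lattice and twice the dual are the
  coordinate lattices of the chain with t = 2 and of \<open>Lam 0\<close>, so the general quotient
  statement applies there.\<close>

lemma lattice_plus_double:
  assumes card_r: "CARD('r::nontriv) = 2 ^ m" and J: "J \<subseteq> M_plus m" and mJ: "m \<notin> J"
  defines "L \<equiv> (*\<^sub>R) 2 ` code_lattice b (lifted_code m \<zeta> (chain_plus m \<zeta> J) :: ('f \<Rightarrow> 'r mod_ring) set)"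
  shows "L \<in> L_plus \<sigma> BW"
    and "quotient_eigenvalues \<sigma> L BW2 = to_ac ` (\<Union>k\<in>J. Theta m \<zeta> k)"
    and "log 2 (lattice_det L) = 2 ^ (2 * m - 1) +
      4 * (\<Sum>k\<in>M_plus m - J - {m}. real ((2 * m) choose k)) + 2 * real ((2 * m) choose m)"
    and "m - 2 \<notin> J \<Longrightarrow> lattice_min L = lattice_min BW2"
    and "m - 2 \<notin> J \<Longrightarrow> lattice_min BW2 = 2 ^ (m + 1)"
proof -
  interpret E: embedded m B \<zeta> "\<lambda>v. 2 *\<^sub>R b v" "2\<^sup>2 * (1 / 2 ^ m)" \<sigma>
    by (rule embedded_scale) simp
  have Eemb: "E.emb a = 2 *\<^sub>R emb a" for a by (rule emb_scale) simp
  have Eimg: "E.emb ` A = (*\<^sub>R) 2 ` emb ` A" for A by (simp add: image_image Eemb)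
  have K: "\<And>k. k \<in> J \<Longrightarrow> k \<le> m \<and> (even (m - k) \<longleftrightarrow> even (2::nat))"
    using J by (auto simp: M_plus_def)
  have "code_lattice b (lifted_code m \<zeta> (chain_plus m \<zeta> J) :: ('f \<Rightarrow> 'r mod_ring) set) =
      emb ` crit (\<lambda>j. zset (2 * j + 2) J)"
    by (rule code_lattice_lifted[OF card_r]) (use mJ in \<open>simp_all add: chain_plus_def\<close>)
  then have L: "L = E.emb ` crit (\<lambda>j. zset (2 * j + 2) J)" unfolding L_def Eimg by simp
  have B2': "BW2 = E.emb ` Lam 0" unfolding dual_BW Eimg ..
  then have B2: "BW2 = E.emb ` crit (\<lambda>j. low_wt (2 * j + 2))" by (simp add: Lam_eq_crit)
  note q = E.quotient_zset[of 2 J, OF _ K, folded L B2]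
  have sub: "BW2 \<subseteq> L" unfolding L B2' by (intro image_mono Lam_subset_crit)
  have "L \<subseteq> BW"
  proof
    fix x assume "x \<in> L"
    then obtain a where a: "a \<in> crit (\<lambda>j. zset (2 * j + 2) J)" "x = 2 *\<^sub>R emb a" unfolding L Eemb by blast
    then have "x = emb (\<lambda>v. 2 * a v)" using emb_smult[of 2 a] by simp
    then show "x \<in> BW" unfolding BW_eq using double_crit_in_Lam[OF a(1)] by blast
  qed
  with sub show "L \<in> L_plus \<sigma> BW"
    unfolding L_plus_def using q(2) E.subspace_crit E.sigma_crit unfolding L by simp
  show "quotient_eigenvalues \<sigma> L BW2 = to_ac ` (\<Union>k\<in>J. Theta m \<zeta> k)"
    using q(1) zeros_Theta(1)[OF mJ] by simp
  have "log 2 (lattice_det L) = 3 * 2 ^ (2 * m - 1) - 2 * real (card (hitset J))"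
    by (rule log_det_BW2_index) (use q(3)[OF _ _ det_BW2] in simp)
  then show "log 2 (lattice_det L) = 2 ^ (2 * m - 1) +
      4 * (\<Sum>k\<in>M_plus m - J - {m}. real ((2 * m) choose k)) + 2 * real ((2 * m) choose m)"
    using card_hitset_compl[OF J] mJ by simp
  assume m2: "m - 2 \<notin> J"
  have "finite idx" "idx \<noteq> {}" using idx_nonempty by simp_all
  then obtain i where i: "i \<in> idx" by blast
  \<comment> \<open>The indicator of a coordinate hyperplane, of degree 1 and therefore in
    \<open>Lam 0\<close>; its \<open>2 ^ (2 * m - 1)\<close> coordinates 1 attain the
    minimum.\<close>
  define d where "d = down (idx - {i})"
  have card_d: "card (idx - {i}) = 2 * m - 1" using i by simp
  have dd: "(\<Sum>v\<in>UNIV. (d v)\<^sup>2) = 2 ^ (2 * m - 1)"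
  proof -
    have "(\<Sum>v\<in>UNIV. (d v)\<^sup>2) = (\<Sum>S\<in>Pow idx. of_bool (S \<subseteq> idx - {i}))"
      unfolding sum_over_pt by (rule sum.cong) (auto simp: d_def down_def)
    also have "\<dots> = int (card (Pow (idx - {i})))"
    proof -
      have "Pow idx \<inter> {S. S \<subseteq> idx - {i}} = Pow (idx - {i})" by auto
      then show ?thesis by simp
    qed
    finally show ?thesis by (simp add: card_Pow card_d del: card_Diff_insert)
  qed
  have dL: "d \<in> Lam 0"
    using Lam_deg_le[OF down_in_deg_le[of "idx - {i}"], of 0 1] m card_d by (simp add: d_def)
  have wit: "E.emb d \<in> BW2" "E.emb d \<noteq> 0" "E.emb d \<bullet> E.emb d = 2 ^ (m + 1)"
  proof -
    have two: "(2::real) ^ (2 * m - 1) * 2 = 2 ^ m * 2 ^ m"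
      by (rule two_power_half)
    have "E.emb d \<bullet> E.emb d = 4 * (2 ^ (2 * m - 1) / 2 ^ m)"
      using arg_cong[OF dd, of real_of_int] unfolding Eemb by (simp add: norm_emb)
    also have "\<dots> = 2 ^ (m + 1)" using two by (simp add: field_simps)
    finally show e: "E.emb d \<bullet> E.emb d = 2 ^ (m + 1)" .
    then show "E.emb d \<noteq> 0" by auto
    show "E.emb d \<in> BW2" unfolding B2' using dL by blast
  qed
  have bound: "2 ^ (m + 1) \<le> y \<bullet> y" if y: "y \<in> L" "y \<noteq> 0" for y :: "'f euclid"
  proof -
    obtain a where a: "a \<in> crit (\<lambda>j. zset (2 * j + 2) J)" "y = 2 *\<^sub>R emb a" using y(1) unfolding L Eemb by blast
    then obtain v where "a v \<noteq> 0" using y(2) by (auto simp: emb_eq_0_iff)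
    from crit_min[of 2 a J v, OF _ a(1) this] mJ m2
    have "2 ^ (2 * m - 1) \<le> (\<Sum>v\<in>UNIV. (a v)\<^sup>2)" by simp
    then have "real_of_int (2 ^ (2 * m - 1)) \<le> of_int (\<Sum>v\<in>UNIV. (a v)\<^sup>2)"
      unfolding of_int_le_iff .
    then have "(2::real) ^ (2 * m - 1) \<le> of_int (\<Sum>v\<in>UNIV. (a v)\<^sup>2)" by simp
    then have "(2::real) ^ (2 * m - 1) / 2 ^ m \<le> emb a \<bullet> emb a"
      unfolding norm_emb by (rule divide_right_mono) simp
    moreover have "4 * ((2::real) ^ (2 * m - 1) / 2 ^ m) = 2 ^ (m + 1)"
    proof -
      have "(2::real) ^ (2 * m - 1) * 2 = 2 ^ m * 2 ^ m"
        by (rule two_power_half)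
      then show ?thesis by (simp add: field_simps)
    qed
    moreover have "y \<bullet> y = 4 * (emb a \<bullet> emb a)" by (simp add: a(2))
    ultimately show ?thesis by linarith
  qed
  have "lattice_min L = 2 ^ (m + 1)"
    by (rule lattice_min_eqI[OF _ wit(2,3) bound]) (use wit(1) sub in auto)
  moreover show "lattice_min BW2 = 2 ^ (m + 1)"
    by (rule lattice_min_eqI[OF wit bound]) (use sub in auto)
  ultimately show "lattice_min L = lattice_min BW2" by simp
qed

end

theorem theorem5p8:
  fixes m :: nat
    and \<zeta> :: "'f::{field,finite}"
    and B :: "nat \<Rightarrow> 'f"
    and b :: "'f \<Rightarrow> 'f euclid"
    and \<sigma> :: "'f euclid \<Rightarrow> 'f euclid"
  assumes m: "m \<ge> 1"
    and card_f: "CARD('f) = 4 ^ m"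
    and card_r: "CARD('r::nontriv) = 2 ^ m"
    and zeta: "primitive_element \<zeta>"
    and B: "f2_basis (2 * m) B"
    and b: "\<And>v w. b v \<bullet> b w = (if v = w then 1 / 2 ^ m else 0)"
    and sigma: "linear \<sigma>" "\<And>v. \<sigma> (b v) = b (\<zeta> * v)"
  shows
    "let BW = barnes_wall m B b;
         BW2 = (*\<^sub>R) 2 ` dual_lattice BW;
         LI = (\<lambda>I. code_lattice b (lifted_code m \<zeta> (chain_minus m \<zeta> I) :: ('f \<Rightarrow> 'r mod_ring) set));
         LJ = (\<lambda>J. code_lattice b (lifted_code m \<zeta> (chain_plus m \<zeta> J) :: ('f \<Rightarrow> 'r mod_ring) set))
     in
     (\<forall>I. I \<noteq> {} \<and> I \<subset> M_minus m \<longrightarrow>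
        LI I \<in> L_minus \<sigma> BW \<and>
        quotient_eigenvalues \<sigma> (LI I) BW = to_ac ` (\<Union>k\<in>I. Theta m \<zeta> k) \<and>
        log 2 (lattice_det (LI I)) = 2 ^ (2 * m - 1) - 4 * (\<Sum>k\<in>I. real ((2 * m) choose k)) \<and>
        (m - 1 \<notin> I \<longrightarrow> lattice_min (LI I) = lattice_min BW \<and> lattice_min BW = 2 ^ m)) \<and>
     (\<forall>J. J \<noteq> {} \<and> J \<subset> M_plus m \<and> m \<in> J \<longrightarrow>
        LJ J \<in> L_plus \<sigma> BW \<and>
        quotient_eigenvalues \<sigma> (LJ J) BW2 = to_ac ` (\<Union>k\<in>J. Theta m \<zeta> k) \<and>
        log 2 (lattice_det (LJ J)) =
          2 ^ (2 * m - 1) + 4 * (\<Sum>k\<in>M_plus m - J. real ((2 * m) choose k))) \<and>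
     (\<forall>J. J \<noteq> {} \<and> J \<subset> M_plus m \<and> m \<notin> J \<longrightarrow>
        (*\<^sub>R) 2 ` LJ J \<in> L_plus \<sigma> BW \<and>
        quotient_eigenvalues \<sigma> ((*\<^sub>R) 2 ` LJ J) BW2 = to_ac ` (\<Union>k\<in>J. Theta m \<zeta> k) \<and>
        log 2 (lattice_det ((*\<^sub>R) 2 ` LJ J)) =
          2 ^ (2 * m - 1) + 4 * (\<Sum>k\<in>M_plus m - J - {m}. real ((2 * m) choose k))
            + 2 * real ((2 * m) choose m) \<and>
        (m - 2 \<notin> J \<longrightarrow>
          lattice_min ((*\<^sub>R) 2 ` LJ J) = lattice_min BW2 \<and> lattice_min BW2 = 2 ^ (m + 1)))"
proof -
  interpret barnes_wall_setting m B \<zeta> b \<sigma>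
    by (intro barnes_wall_setting.intro embedded.intro embedded_axioms.intro bw_field.intro
        bw_field_axioms.intro f2_coordinates.intro m card_f zeta B b sigma) simp
  note lattices = lattice_minus[OF card_r] lattice_plus[OF card_r] lattice_plus_double[OF card_r]
  show ?thesis
    unfolding Let_def
    by (intro conjI allI impI; elim conjE; drule psubset_imp_subset; rule lattices; assumption)
qed

end
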